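(* Consider the Poisson multigraph model on the vertex set $[n]$: for each unordered pair $\{i,j\}$ of distinct vertices there are infinitely many parallel edges between $i$ and $j$, whose costs are the points of a Poisson process of intensity $1$ on $(0,\infty)$, these processes being independent for different pairs. Let $T_1$ be the minimum-cost spanning tree of this multigraph and, for $k\ge 2$, let $T_k$ be the minimum-cost spanning tree of the multigraph obtained by deleting the edges of $T_1,\dots,T_{k-1}$; let $w(T_k)$ be the total cost of the edges of $T_k$. Then for each $k\ge1$, $w(T_k)\to\gamma_k$ in probability as $n\to\infty$, where $\gamma_k$ is the same constant that is the limit in probability of the cost of the $k$-th greedily chosen edge-disjoint minimum spanning tree in the complete graph $K_n$ with i.i.d. uniform $(0,1)$ (or exponential mean $1$) edge costs.
   Context: In the simple-graph models: $K_n$ has i.i.d. edge costs, uniform on $(0,1)$ or exponential with mean 1; $T_1$ is the minimum spanning tree and $T_k$ is the minimum spanning tree of $K_n$ minus the edges of $T_1,\dots,T_{k-1}$ (with $w(T_k):=\infty$ if it does not exist); in those models $w(T_k)$ converges in probability to a constant $\gamma_k$ (the same for both distributions). *)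

theory Defs
  imports "HOL-Probability.Probability"
begin

text \<open>Multigraphs on the vertex set {..<n}: an edge type 'e, an endpoint map
  ends (each edge joins two distinct vertices), costs c, available edge set A.\<close>

definition spanning_tree :: "nat \<Rightarrow> ('e \<Rightarrow> nat set) \<Rightarrow> 'e set \<Rightarrow> bool" where
  "spanning_tree n ends F \<longleftrightarrow>
     finite F \<and> card F = n - 1 \<and>
     (\<forall>e\<in>F. ends e \<subseteq> {..<n} \<and> card (ends e) = 2) \<and>
     (\<forall>u<n. \<forall>v<n. (\<lambda>x y. \<exists>e\<in>F. ends e = {x, y})\<^sup>*\<^sup>* u v)"

definition is_MST :: "nat \<Rightarrow> ('e \<Rightarrow> nat set) \<Rightarrow> ('e \<Rightarrow> real) \<Rightarrow> 'e set \<Rightarrow> 'e set \<Rightarrow> bool" where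
  "is_MST n ends c A F \<longleftrightarrow>
     F \<subseteq> A \<and> spanning_tree n ends F \<and>
     (\<forall>G. G \<subseteq> A \<and> spanning_tree n ends G \<longrightarrow> sum c F \<le> sum c G)"

definition next_MST :: "nat \<Rightarrow> ('e \<Rightarrow> nat set) \<Rightarrow> ('e \<Rightarrow> real) \<Rightarrow> 'e set \<Rightarrow> 'e set option" where
  "next_MST n ends c A =
     (if \<exists>F. is_MST n ends c A F then Some (SOME F. is_MST n ends c A F) else None)"

fun used_edges :: "nat \<Rightarrow> ('e \<Rightarrow> nat set) \<Rightarrow> ('e \<Rightarrow> real) \<Rightarrow> 'e set \<Rightarrow> nat \<Rightarrow> 'e set option" where
  "used_edges n ends c E 0 = Some {}"
| "used_edges n ends c E (Suc k) =
     (case used_edges n ends c E k of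
        None \<Rightarrow> None
      | Some U \<Rightarrow> (case next_MST n ends c (E - U) of
                    None \<Rightarrow> None
                  | Some T \<Rightarrow> Some (U \<union> T)))"

definition kth_tree :: "nat \<Rightarrow> ('e \<Rightarrow> nat set) \<Rightarrow> ('e \<Rightarrow> real) \<Rightarrow> 'e set \<Rightarrow> nat \<Rightarrow> 'e set option" where
  "kth_tree n ends c E k =
     (case used_edges n ends c E (k - 1) of
        None \<Rightarrow> None
      | Some U \<Rightarrow> next_MST n ends c (E - U))"

definition wT :: "nat \<Rightarrow> ('e \<Rightarrow> nat set) \<Rightarrow> ('e \<Rightarrow> real) \<Rightarrow> 'e set \<Rightarrow> nat \<Rightarrow> ereal" where
  "wT n ends c E k =
     (case kth_tree n ends c E k of None \<Rightarrow> \<infinity> | Some T \<Rightarrow> ereal (sum c T))"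

definition Kn_edges :: "nat \<Rightarrow> (nat \<times> nat) set" where
  "Kn_edges n = {(i, j). i < j \<and> j < n}"

definition Kn_ends :: "nat \<times> nat \<Rightarrow> nat set" where
  "Kn_ends p = {fst p, snd p}"

definition Kn_uniform_space :: "nat \<Rightarrow> (nat \<times> nat \<Rightarrow> real) measure" where
  "Kn_uniform_space n = PiM (Kn_edges n) (\<lambda>_. uniform_measure lborel {0<..<1::real})"

text \<open>Poisson multigraph: edge ((i,j),m) is the (m+1)-th parallel edge between i and j;
  its cost is the (m+1)-th point of a rate-1 Poisson process on (0,\<infinity>), realised as the
  partial sum of i.i.d. Exp(1) inter-arrival times; independent over pairs.\<close>
definition PM_edges :: "nat \<Rightarrow> ((nat \<times> nat) \<times> nat) set" where
  "PM_edges n = Kn_edges n \<times> UNIV"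

definition PM_ends :: "(nat \<times> nat) \<times> nat \<Rightarrow> nat set" where
  "PM_ends e = Kn_ends (fst e)"

definition PM_space :: "nat \<Rightarrow> ((nat \<times> nat) \<times> nat \<Rightarrow> real) measure" where
  "PM_space n = PiM (PM_edges n) (\<lambda>_. density lborel (exponential_density 1))"

definition PM_cost :: "((nat \<times> nat) \<times> nat \<Rightarrow> real) \<Rightarrow> (nat \<times> nat) \<times> nat \<Rightarrow> real" where
  "PM_cost \<omega> e = (\<Sum>l\<le>snd e. \<omega> (fst e, l))"

text \<open>Convergence in (outer) probability of extended-real random variables X n on M n to a
  real constant g (an infinite value counts as far from g).\<close>
definition conv_in_prob :: "(nat \<Rightarrow> 'a measure) \<Rightarrow> (nat \<Rightarrow> 'a \<Rightarrow> ereal) \<Rightarrow> real \<Rightarrow> bool" where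
  "conv_in_prob M X g \<longleftrightarrow>
     (\<forall>\<epsilon>>0. \<forall>\<delta>>0. eventually (\<lambda>n. \<exists>A\<in>sets (M n).
        {\<omega>\<in>space (M n). \<not> (\<bar>X n \<omega> - ereal g\<bar> \<le> ereal \<epsilon>)} \<subseteq> A \<and> measure (M n) A < \<delta>)
       sequentially)"

end

theory Submission
  imports Defs "HOL-Library.Sublist" "HOL-Real_Asymp.Real_Asymp"
begin

text \<open>Scan the edges in the order of their costs. By the exchange argument of Kruskal's algorithm \<open>T\<^sub>1\<close>
  consists of the edges that join two components of what was scanned before; the edges rejected by
  this rule, scanned again, produce \<open>T\<^sub>2\<close>, and so on. Hence \<open>w(T\<^sub>k)\<close> is the integral over \<open>s\<close> of the
  number of components minus one of the graph formed by the edges of cost at most \<open>s\<close> that were rejected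
  \<open>k - 1\<close> times. It therefore suffices to show that at \<open>s = t / n\<close> this number, divided by \<open>n\<close>, converges
  in probability to a deterministic function of \<open>t\<close>, and to bound the tail of the integral.

  For the first point replace the ordered edges by an i.i.d. sequence of uniform edges (the ordered edges
  are a uniform injective sequence, which is contiguous to it on the relevant scale). The numbers of
  vertices in components of given size change boundedly when an edge is inserted or deleted, so they
  concentrate, and their means satisfy an approximate difference equation whose coefficients come from the
  previous level; a Gronwall argument gives convergence, by induction on the level. The equation closes
  because two vertices in large components are, up to few pairs, in the same component: after \<open>\<epsilon> n\<close>
  further edges no cut between unions of large components survives.

  For the second point a vertex \<open>v\<close> fails to be attached to the giant component of the graph without
  \<open>v\<close> by \<open>k\<close> disjoint windows of costs with probability exponentially small in \<open>t\<close>, as the costs at \<open>v\<close>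
  are independent of that component.

  In the Poisson multigraph the first points of the processes are i.i.d. exponential, and
  the further points of cost at most \<open>t / n\<close> are \<open>o(n)\<close> in number, so the same limit function arises; the
  extra edges only help the tail.\<close>

subsection \<open>Greedy forests of an edge list\<close>

text \<open>The graph of level j + 1 has no independence of its own: whether an edge reaches it
  depends on the whole past. What replaces independence is that an inserted edge changes the
  relation of every level by at most one merge, which yields bounded differences and monotonicity on
  all levels at once. The drift is of Smoluchowski type, but it runs on the vertices in the giant
  class of the level below, and a giant is not definable at finite n. It is approximated by the
  classes of size at least a constant K chosen from the wanted accuracy; so every accuracy has its
  own coefficients, and no limiting equation is ever solved. Limits come from the Cauchy criterion,
  both for the densities and for \<gamma>. That large classes are rarely distinct is proved only on
  average over time, which is all a summed Gronwall error requires. Both models share one value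
  because the approximants are built from the same function \<open>rhol\<close> of i.i.d. words.
  Exceptional sets are enclosed in measurable ones throughout, as in \<open>conv_in_prob\<close>, so
  \<open>wT\<close> never has to be shown measurable.\<close>

text \<open>The closure that occurs in \<open>spanning_tree\<close>. It is an equivalence on all
  natural numbers, so no carrier set has to be tracked.\<close>

definition conn :: "('e \<Rightarrow> nat set) \<Rightarrow> 'e set \<Rightarrow> nat \<Rightarrow> nat \<Rightarrow> bool" where
  "conn en S = (\<lambda>x y. \<exists>e\<in>S. en e = {x, y})\<^sup>*\<^sup>*"

text \<open>For an equivalence \<open>R\<close> this is the equivalence generated by
  \<open>R\<close> and the pair \<open>a\<close>, \<open>b\<close>, written out so that the exchange
  laws below become first-order facts.\<close>

definition merge :: "(nat \<Rightarrow> nat \<Rightarrow> bool) \<Rightarrow> nat \<Rightarrow> nat \<Rightarrow> nat \<Rightarrow> nat \<Rightarrow> bool" where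
  "merge R a b u v \<longleftrightarrow> R u v \<or> R u a \<and> R b v \<or> R u b \<and> R a v"

lemma equivp_conn: "equivp (conn en S)"
proof (rule equivpI)
  show "reflp (conn en S)" by (simp add: conn_def reflp_def)
  show "symp (conn en S)"
    unfolding conn_def by (rule symp_rtranclp) (auto simp: symp_def insert_commute)
  show "transp (conn en S)" by (auto simp: conn_def transp_def)
qed

lemma conn_empty: "conn en {} = (=)"
  by (auto simp: conn_def fun_eq_iff elim: rtranclp_induct)

lemma conn_mono: "S \<subseteq> S' \<Longrightarrow> conn en S u v \<Longrightarrow> conn en S' u v"
  unfolding conn_def by (erule mono_rtranclp[rule_format, rotated]) blast

lemma conn_edge: "e \<in> S \<Longrightarrow> en e = {a, b} \<Longrightarrow> conn en S a b"
  unfolding conn_def by (rule r_into_rtranclp) blast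

lemma equivp_merge:
  assumes "equivp R"
  shows "equivp (merge R a b)"
proof -
  have r: "R x x" and s: "R x y \<Longrightarrow> R y x" and t: "R x y \<Longrightarrow> R y z \<Longrightarrow> R x z" for x y z
    using assms by (auto elim: equivpE dest: reflpD sympD transpD)
  show ?thesis
  proof (rule equivpI)
    show "reflp (merge R a b)" using r by (simp add: reflp_def merge_def)
    show "symp (merge R a b)" using s unfolding symp_def merge_def by blast
    show "transp (merge R a b)" using s t unfolding transp_def merge_def by meson
  qed
qed

lemma merge_same: "equivp R \<Longrightarrow> R a b \<Longrightarrow> merge R a b = R"
  unfolding merge_def fun_eq_iff by (meson equivp_symp equivp_transp)

lemma merge_refl: "equivp R \<Longrightarrow> merge R a a = R"
  by (rule merge_same) (auto simp: equivp_reflp)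

lemma merge_ge: "R u v \<Longrightarrow> merge R a b u v"
  by (simp add: merge_def)

lemma merge_join: "equivp R \<Longrightarrow> merge R a b a b"
  by (simp add: merge_def equivp_reflp)

text \<open>Both sides are the equivalence generated by \<open>R\<close> and the same two
  pairs.\<close>

lemma merge_swap: "merge (merge R a b) c d = merge (merge R c d) a b" if "equivp R"
  unfolding merge_def fun_eq_iff using that by (meson equivp_symp equivp_transp)

text \<open>Matroid exchange in rank one: if adding the pair \<open>a\<close>, \<open>b\<close>
  joins the distinct classes of \<open>c\<close> and \<open>d\<close>, then these two classes are
  those of \<open>a\<close> and \<open>b\<close>.\<close>

lemma merge_exchange:
  "equivp R \<Longrightarrow> \<not> R c d \<Longrightarrow> merge R a b c d \<Longrightarrow> merge R c d = merge R a b"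
  unfolding merge_def fun_eq_iff by (meson equivp_symp equivp_transp)

text \<open>The bridge from graphs to the algebra of \<open>merge\<close>: a path through the new
  edge is cut at that edge.\<close>

lemma conn_insert:
  assumes "en e = {a, b}"
  shows "conn en (insert e S) = merge (conn en S) a b"
proof (intro ext iffI)
  fix u v
  have eq: "equivp (merge (conn en S) a b)" by (rule equivp_merge[OF equivp_conn])
  assume "conn en (insert e S) u v"
  then show "merge (conn en S) a b u v"
    unfolding conn_def[of _ "insert e S"]
  proof (induction rule: rtranclp_induct)
    case base show ?case using eq by (simp add: equivp_reflp)
  next
    case (step y z)
    have "merge (conn en S) a b y z"
    proof -
      from step(2) obtain f where f: "f \<in> insert e S" "en f = {y, z}" by blast
      show ?thesis
      proof (cases "f \<in> S")
        case True then show ?thesis using f(2) by (intro merge_ge) (rule conn_edge)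
      next
        case False
        with f assms have "{y, z} = {a, b}" by auto
        then have "y = a \<and> z = b \<or> y = b \<and> z = a" by (auto simp: doubleton_eq_iff)
        then show ?thesis
          using merge_join[OF equivp_conn] equivp_symp[OF eq] by metis
      qed
    qed
    then show ?case using step(3) equivp_transp[OF eq] by blast
  qed
next
  fix u v
  have eq: "equivp (conn en (insert e S))" by (rule equivp_conn)
  have ab: "conn en (insert e S) a b" by (rule conn_edge[of e]) (use assms in auto)
  assume "merge (conn en S) a b u v"
  then show "conn en (insert e S) u v"
    unfolding merge_def using conn_mono[of S "insert e S" en] ab
    by (meson eq equivp_symp equivp_transp subset_insertI)
qed

lemma conn_image: "conn (\<lambda>e. en (f e)) S = conn en (f ` S)"
  by (simp add: conn_def)

section \<open>Scanning a list: rejected edges, levels and insertions\<close>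

text \<open>The edge closes a cycle with \<open>S\<close>. Quantifying over the ends avoids fixing
  an orientation; \<open>cyc_iff\<close> shows that any orientation may be used.\<close>

definition cyc :: "('e \<Rightarrow> nat set) \<Rightarrow> 'e set \<Rightarrow> 'e \<Rightarrow> bool" where
  "cyc en S e \<longleftrightarrow> (\<exists>u v. en e = {u, v} \<and> conn en S u v)"

lemma cyc_iff: "en e = {a, b} \<Longrightarrow> cyc en S e \<longleftrightarrow> conn en S a b"
  unfolding cyc_def using equivp_symp[OF equivp_conn[of en S]]
  by (auto simp: doubleton_eq_iff)

text \<open>\<open>rel en (Suc j) l\<close> is connectedness through the edges of \<open>l\<close> rejected by the first \<open>j\<close> forests. With the
  total relation at level \<open>0\<close>, an appended edge changes \<open>rel en (Suc j)\<close> only if \<open>rel en j\<close> joins its ends,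
  for every \<open>j\<close>.\<close>

fun rejA :: "('e \<Rightarrow> nat set) \<Rightarrow> 'e set \<Rightarrow> 'e list \<Rightarrow> 'e list" where
  "rejA en S [] = []"
| "rejA en S (e # l) = (if cyc en S e then [e] else []) @ rejA en (insert e S) l"

definition rej :: "('e \<Rightarrow> nat set) \<Rightarrow> 'e list \<Rightarrow> 'e list" where
  "rej en l = rejA en {} l"

definition lev :: "('e \<Rightarrow> nat set) \<Rightarrow> nat \<Rightarrow> 'e list \<Rightarrow> 'e list" where
  "lev en j = (rej en) ^^ j"

primrec rel :: "('e \<Rightarrow> nat set) \<Rightarrow> nat \<Rightarrow> 'e list \<Rightarrow> nat \<Rightarrow> nat \<Rightarrow> bool" where
  "rel en 0 l = (\<lambda>_ _. True)"
| "rel en (Suc j) l = conn en (set (lev en j l))"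

lemma lev_0 [simp]: "lev en 0 l = l"
  and lev_Suc: "lev en (Suc j) l = rej en (lev en j l)"
  and lev_Nil [simp]: "lev en j [] = []"
  by (simp_all add: lev_def) (induction j, auto simp: rej_def)

lemma equivp_rel: "equivp (rel en j l)"
  by (cases j) (auto simp: equivp_conn intro!: equivpI simp: reflp_def symp_def transp_def)

lemma rejA_append: "rejA en S (a @ b) = rejA en S a @ rejA en (S \<union> set a) b"
  by (induction a arbitrary: S) auto

lemma rej_append: "rej en (a @ b) = rej en a @ rejA en (set a) b"
  by (simp add: rej_def rejA_append)

lemma set_rejA: "set (rejA en S l) \<subseteq> set l"
  by (induction l arbitrary: S) auto

lemma set_rej: "set (rej en l) \<subseteq> set l"
  by (simp add: rej_def set_rejA)

lemma set_lev: "set (lev en j l) \<subseteq> set l"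
  by (induction j) (use set_rej in \<open>force simp: lev_Suc\<close>)+

text \<open>Each rejection passes on a subset of the edges, so the relations decrease in the level,
  starting from the total relation.\<close>

lemma rel_Suc_le: "rel en (Suc j) l u v \<Longrightarrow> rel en j l u v"
  by (cases j) (auto simp: lev_Suc intro: conn_mono[OF set_rej])

definition good :: "nat \<Rightarrow> ('e \<Rightarrow> nat set) \<Rightarrow> 'e \<Rightarrow> bool" where
  "good n en e \<longleftrightarrow> (\<exists>a<n. \<exists>b<n. a \<noteq> b \<and> en e = {a, b})"

text \<open>The elementary perturbation of a word; replacing a letter is one deletion followed by
  one insertion.\<close>

definition ins :: "'e list \<Rightarrow> 'e list \<Rightarrow> bool" where
  "ins l l' \<longleftrightarrow> (\<exists>x e y. l = x @ y \<and> l' = x @ e # y)"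

lemma ins_Cons: "ins l l' \<Longrightarrow> ins (e # l) (e # l')"
  unfolding ins_def by (metis append_Cons)

text \<open>The scan consults \<open>S\<close> only through connectivity. Hence it does no harm that
  \<open>rejA\<close> also adds the rejected edges to \<open>S\<close>, which keeps \<open>S\<close>
  equal to the set of scanned letters.\<close>

lemma rejA_cong:
  assumes "\<forall>e\<in>set l. good n en e" "conn en S = conn en S'"
  shows "rejA en S l = rejA en S' l"
  using assms
proof (induction l arbitrary: S S')
  case (Cons e l)
  then obtain a b where ab: "en e = {a, b}" by (auto simp: good_def)
  have "conn en (insert e S) = conn en (insert e S')"
    using Cons.prems(2) by (simp add: conn_insert[of en e, OF ab])
  then have "rejA en (insert e S) l = rejA en (insert e S') l"
    by (intro Cons.IH) (use Cons.prems(1) in auto)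
  then show ?case using Cons.prems(2) by (simp add: cyc_def)
qed simp

text \<open>Run the scan from two states that differ by one merge. The states keep differing by that
  merge until an edge is rejected by the larger state only; by \<open>merge_exchange\<close> the
  states agree after this edge. So the outputs differ by at most that one letter.\<close>

lemma rejA_merge:
  assumes "\<forall>e\<in>set l. good n en e" "conn en S' = merge (conn en S) a b"
  shows "rejA en S' l = rejA en S l \<or> ins (rejA en S l) (rejA en S' l)"
  using assms
proof (induction l arbitrary: S S')
  case (Cons e l)
  then obtain c d where cd: "en e = {c, d}" by (auto simp: good_def)
  have gl: "\<forall>e\<in>set l. good n en e" using Cons.prems by auto
  note [simp] = cyc_iff[of en e, OF cd]
  have eq: "equivp (conn en S)" by (rule equivp_conn)
  have 1: "conn en (insert e S') = merge (conn en S') c d"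
    and 2: "conn en (insert e S) = merge (conn en S) c d"
    using conn_insert[of en e, OF cd] by auto
  have 3: "conn en (insert e S') = merge (conn en (insert e S)) a b"
    unfolding 1 2 Cons.prems(2) by (rule merge_swap[OF eq])
  show ?case
  proof (cases "conn en S c d")
    case True
    then have "conn en S' c d" using Cons.prems(2) by (simp add: merge_ge)
    then show ?thesis using True Cons.IH[OF gl 3] by (auto intro: ins_Cons)
  next
    case False
    show ?thesis
    proof (cases "conn en S' c d")
      case True
      have "conn en (insert e S') = conn en S'"
        unfolding 1 using True by (rule merge_same[OF equivp_conn])
      moreover have "conn en (insert e S) = conn en S'"
        unfolding 2 Cons.prems(2) using True False
        by (intro merge_exchange) (auto simp: eq Cons.prems(2))
      ultimately have "rejA en (insert e S') l = rejA en (insert e S) l"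
        by (intro rejA_cong[OF gl]) simp
      then show ?thesis using True False by (force simp: ins_def)
    next
      case F2: False
      then show ?thesis using False Cons.IH[OF gl 3] by auto
    qed
  qed
qed simp

text \<open>If the inserted edge is rejected, it appears in the output and leaves the state
  unchanged. If it is accepted, at most one later edge is rejected in its place.\<close>

lemma rej_ins:
  assumes "ins l l'" "\<forall>e\<in>set l'. good n en e"
  shows "rej en l' = rej en l \<or> ins (rej en l) (rej en l')"
proof -
  obtain x e y where l: "l = x @ y" "l' = x @ e # y" using assms(1) by (auto simp: ins_def)
  obtain a b where ab: "en e = {a, b}" using assms(2) l by (auto simp: good_def)
  have gy: "\<forall>e\<in>set y. good n en e" using assms(2) l by auto
  have c: "conn en (insert e (set x)) = merge (conn en (set x)) a b" by (rule conn_insert[of en e, OF ab])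
  have r: "rej en l = rej en x @ rejA en (set x) y"
    "rej en l' = rej en x @ (if cyc en (set x) e then [e] else []) @ rejA en (insert e (set x)) y"
    by (simp_all add: l rej_append)
  show ?thesis
  proof (cases "cyc en (set x) e")
    case True
    then have "conn en (set x) a b" by (simp add: cyc_iff[of en e, OF ab])
    then have "conn en (insert e (set x)) = conn en (set x)"
      unfolding c by (rule merge_same[OF equivp_conn])
    then have "rejA en (insert e (set x)) y = rejA en (set x) y" by (rule rejA_cong[OF gy])
    then show ?thesis using True r by (auto simp: ins_def)
  next
    case False
    show ?thesis using rejA_merge[OF gy c] False r
      unfolding ins_def by (auto; metis append_assoc)
  qed
qed

lemma lev_ins:
  assumes "ins l l'" "\<forall>e\<in>set l'. good n en e"
  shows "lev en j l' = lev en j l \<or> ins (lev en j l) (lev en j l')"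
proof (induction j)
  case (Suc j)
  have "\<forall>e\<in>set (lev en j l'). good n en e" using set_lev[of en j l'] assms(2) by auto
  then show ?case using Suc rej_ins[of "lev en j l" "lev en j l'" n en] by (auto simp: lev_Suc)
qed (use assms in simp)

text \<open>Iterating \<open>rej_ins\<close>, one insertion at the bottom remains at most one
  insertion at every level, hence at most one merge. This is the source of all Lipschitz
  bounds.\<close>

lemma rel_ins:
  assumes "ins l l'" "\<forall>e\<in>set l'. good n en e"
  shows "\<exists>a<n. \<exists>b<n. rel en j l' = merge (rel en j l) a b"
proof -
  have n0: "0 < n" using assms by (auto simp: ins_def good_def)
  show ?thesis
  proof (cases j)
    case 0
    then show ?thesis using n0 by (auto simp: merge_def fun_eq_iff)
  next
    case (Suc i)
    \<comment> \<open>An unchanged relation is presented as the merge of vertex 0 with itself; 0 is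
      a vertex because a good edge exists.\<close>
    have triv: "\<exists>a<n. \<exists>b<n. conn en S = merge (conn en S) a b" for S
      using n0 merge_refl[OF equivp_conn, of en S 0] by metis
    from lev_ins[OF assms, of i] show ?thesis
    proof
      assume "lev en i l' = lev en i l"
      then show ?thesis using triv Suc by simp
    next
      assume "ins (lev en i l) (lev en i l')"
      then obtain x e y where l: "lev en i l = x @ y" "lev en i l' = x @ e # y" by (auto simp: ins_def)
      then have "e \<in> set l'" using set_lev[of en i l'] by auto
      then obtain a b where ab: "a < n" "b < n" "en e = {a, b}" using assms(2) by (auto simp: good_def)
      have "conn en (set (lev en i l')) = merge (conn en (set (lev en i l))) a b"
        using conn_insert[of en e, OF ab(3), of "set x \<union> set y"] l by simp
      then show ?thesis using ab Suc by auto
    qed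
  qed
qed

text \<open>The last letter cannot influence the earlier ones. It survives \<open>j\<close>
  rejections iff its ends are joined at the levels up to \<open>j\<close>, and by
  \<open>rel_Suc_le\<close> level \<open>j\<close> decides.\<close>

lemma lev_snoc:
  assumes "en e = {a, b}"
  shows "lev en j (l @ [e]) = lev en j l @ (if rel en j l a b then [e] else [])"
proof (induction j)
  case (Suc j)
  then show ?case
    using rel_Suc_le[of en j l a b] cyc_iff[of en e, OF assms]
    by (auto simp: lev_Suc rej_append)
qed simp

lemma rel_Suc_snoc:
  assumes "en e = {a, b}"
  shows "rel en (Suc j) (l @ [e]) = (if rel en j l a b then merge (rel en (Suc j) l) a b else rel en (Suc j) l)"
  using conn_insert[of en e, OF assms, of "set (lev en j l)"]
  by (simp add: lev_snoc[of en e, OF assms])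

lemma rel_snoc_ge: "rel en j l u v \<Longrightarrow> en e = {a, b} \<Longrightarrow> rel en j (l @ [e]) u v"
  by (cases j) (auto simp: rel_Suc_snoc merge_ge simp del: rel.simps(2))

section \<open>Class sizes and additive functionals of a partition\<close>

definition csz :: "nat \<Rightarrow> (nat \<Rightarrow> nat \<Rightarrow> bool) \<Rightarrow> nat \<Rightarrow> nat" where
  "csz n R u = card {v. v < n \<and> R u v}"

text \<open>For \<open>g x = 1 / x\<close> this counts the classes of \<open>R\<close>.\<close>

definition Phi :: "nat \<Rightarrow> (nat \<Rightarrow> real) \<Rightarrow> (nat \<Rightarrow> nat \<Rightarrow> bool) \<Rightarrow> real" where
  "Phi n g R = (\<Sum>u<n. g (csz n R u))"

lemma csz_cong: "equivp R \<Longrightarrow> R u v \<Longrightarrow> csz n R u = csz n R v"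
  unfolding csz_def by (rule arg_cong[where f = card]) (auto dest: equivp_symp equivp_transp)

lemma csz_mono: "(\<And>v. R u v \<Longrightarrow> R' u v) \<Longrightarrow> csz n R u \<le> csz n R' u"
  unfolding csz_def by (intro card_mono) auto

lemma csz_pos: "equivp R \<Longrightarrow> u < n \<Longrightarrow> 0 < csz n R u"
  unfolding csz_def by (subst card_gt_0_iff) (auto intro: equivp_reflp)

lemma csz_le: "csz n R u \<le> n"
proof -
  have "csz n R u \<le> card {..<n}" unfolding csz_def by (intro card_mono) auto
  then show ?thesis by simp
qed

lemma csz_merge:
  assumes "equivp R" "\<not> R a b" "a < n" "b < n"
  shows "csz n (merge R a b) u = (if R u a \<or> R u b then csz n R a + csz n R b else csz n R u)"
proof (cases "R u a \<or> R u b")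
  case True
  have "{v. v < n \<and> merge R a b u v} = {v. v < n \<and> R a v} \<union> {v. v < n \<and> R b v}"
    using True assms(1) unfolding merge_def by (auto dest: equivp_symp equivp_transp)
  moreover have "{v. v < n \<and> R a v} \<inter> {v. v < n \<and> R b v} = {}"
    using assms(1,2) by (auto dest: equivp_symp equivp_transp)
  ultimately show ?thesis using True unfolding csz_def by (simp add: card_Un_disjoint)
next
  case False
  then show ?thesis unfolding csz_def merge_def by simp
qed

text \<open>A class of size x contributes x times g x in total, and a merge replaces two such
  contributions by one.\<close>

lemma Phi_merge:
  assumes "equivp R" "\<not> R a b" "a < n" "b < n"
  defines "\<alpha> \<equiv> csz n R a" and "\<beta> \<equiv> csz n R b"
  shows "Phi n g (merge R a b) = Phi n g R + real (\<alpha> + \<beta>) * g (\<alpha> + \<beta>) - real \<alpha> * g \<alpha> - real \<beta> * g \<beta>"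
proof -
  define A B C where "A = {v. v < n \<and> R a v}" and "B = {v. v < n \<and> R b v}"
    and "C = {..<n} - (A \<union> B)"
  have AB: "A \<inter> B = {}" unfolding A_def B_def using assms(1,2) by (auto dest: equivp_symp equivp_transp)
  have fin: "finite A" "finite B" "finite C" by (auto simp: A_def B_def C_def)
  have U: "{..<n} = (A \<union> B) \<union> C" by (auto simp: A_def B_def C_def)
  have split: "(\<Sum>u<n. h u) = sum h A + sum h B + sum h C" for h :: "nat \<Rightarrow> real"
    unfolding U using AB fin by (subst sum.union_disjoint) (auto simp: sum.union_disjoint C_def)
  have cA: "card A = \<alpha>" "card B = \<beta>" by (simp_all add: A_def B_def assms csz_def)
  have m: "csz n (merge R a b) u = (if u \<in> A \<union> B then \<alpha> + \<beta> else csz n R u)" if "u < n" for u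
    unfolding csz_merge[OF assms(1-4)] A_def B_def \<alpha>_def \<beta>_def using that assms(1)
    by (auto dest: equivp_symp)
  have "Phi n g (merge R a b) = real (\<alpha> + \<beta>) * g (\<alpha> + \<beta>) + (\<Sum>u\<in>C. g (csz n R u))"
  proof -
    have "(\<Sum>u\<in>A. g (csz n (merge R a b) u)) = real \<alpha> * g (\<alpha> + \<beta>)"
      using m cA by (simp add: A_def)
    moreover have "(\<Sum>u\<in>B. g (csz n (merge R a b) u)) = real \<beta> * g (\<alpha> + \<beta>)"
      using m cA by (simp add: B_def)
    moreover have "(\<Sum>u\<in>C. g (csz n (merge R a b) u)) = (\<Sum>u\<in>C. g (csz n R u))"
      by (rule sum.cong) (auto simp: m C_def)
    ultimately show ?thesis unfolding Phi_def split by (simp add: algebra_simps)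
  qed
  moreover have "Phi n g R = real \<alpha> * g \<alpha> + real \<beta> * g \<beta> + (\<Sum>u\<in>C. g (csz n R u))"
  proof -
    have "(\<Sum>u\<in>A. g (csz n R u)) = (\<Sum>u\<in>A. g \<alpha>)"
    proof (rule sum.cong[OF refl])
      fix u assume "u \<in> A"
      then have "csz n R u = \<alpha>" unfolding A_def \<alpha>_def using csz_cong[OF assms(1), of a u n] by simp
      then show "g (csz n R u) = g \<alpha>" by simp
    qed
    moreover have "(\<Sum>u\<in>B. g (csz n R u)) = (\<Sum>u\<in>B. g \<beta>)"
    proof (rule sum.cong[OF refl])
      fix u assume "u \<in> B"
      then have "csz n R u = \<beta>" unfolding B_def \<beta>_def using csz_cong[OF assms(1), of b u n] by simp
      then show "g (csz n R u) = g \<beta>" by simp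
    qed
    ultimately show ?thesis unfolding Phi_def split by (simp add: cA)
  qed
  ultimately show ?thesis by simp
qed

text \<open>Bounds the jump of \<open>Phi\<close> computed in \<open>Phi_merge\<close>; the
  condition on the sign of \<open>c\<close> covers the trivial merges.\<close>

definition mbound :: "(nat \<Rightarrow> real) \<Rightarrow> real \<Rightarrow> bool" where
  "mbound g c \<longleftrightarrow> 0 \<le> c \<and> (\<forall>a b. 0 < a \<longrightarrow> 0 < b \<longrightarrow>
     \<bar>real (a + b) * g (a + b) - real a * g a - real b * g b\<bar> \<le> c)"

lemma Phi_ins:
  assumes "mbound g c" "ins l l'" "\<forall>e\<in>set l'. good n en e"
  shows "\<bar>Phi n g (rel en j l') - Phi n g (rel en j l)\<bar> \<le> c"
proof -
  obtain a b where ab: "a < n" "b < n" "rel en j l' = merge (rel en j l) a b"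
    using rel_ins[OF assms(2,3)] by blast
  show ?thesis
  proof (cases "rel en j l a b")
    case True
    then show ?thesis using ab merge_same[OF equivp_rel True] assms(1) by (simp add: mbound_def)
  next
    case False
    have "0 < csz n (rel en j l) a" "0 < csz n (rel en j l) b"
      using ab by (auto intro: csz_pos[OF equivp_rel])
    then have "\<bar>real (csz n (rel en j l) a + csz n (rel en j l) b) * g (csz n (rel en j l) a + csz n (rel en j l) b)
        - real (csz n (rel en j l) a) * g (csz n (rel en j l) a)
        - real (csz n (rel en j l) b) * g (csz n (rel en j l) b)\<bar> \<le> c"
      using assms(1) unfolding mbound_def by blast
    then show ?thesis
      unfolding ab(3) Phi_merge[OF equivp_rel False ab(1,2), of g] by linarith
  qed
qed

text \<open>Letters common to both words are moved into the prefix \<open>p\<close>, so that every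
  other induction step is a single insertion right after the prefix.\<close>

lemma ins_Lipschitz_subseq:
  fixes F :: "'e list \<Rightarrow> real"
  assumes "\<And>l l'. ins l l' \<Longrightarrow> set l' \<subseteq> A \<Longrightarrow> \<bar>F l' - F l\<bar> \<le> c"
    and "subseq l l'" "set l' \<subseteq> A" "set p \<subseteq> A"
  shows "\<bar>F (p @ l') - F (p @ l)\<bar> \<le> c * (real (length l') - real (length l))"
  using assms(2-4)
proof (induction arbitrary: p rule: list_emb.induct)
  case (list_emb_Nil ys)
  then show ?case
  proof (induction ys)
    case (Cons y ys)
    have "\<bar>F (p @ y # ys) - F (p @ ys)\<bar> \<le> c"
      by (rule assms(1)) (use Cons.prems in \<open>auto simp: ins_def\<close>)
    then show ?case using Cons by (auto simp: algebra_simps)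
  qed simp
next
  case (list_emb_Cons xs ys y)
  have "\<bar>F (p @ y # ys) - F (p @ ys)\<bar> \<le> c"
    by (rule assms(1)) (use list_emb_Cons.prems in \<open>auto simp: ins_def\<close>)
  then show ?case using list_emb_Cons.IH[of p] list_emb_Cons.prems by (auto simp: algebra_simps)
next
  case (list_emb_Cons2 x y xs ys)
  then show ?case using list_emb_Cons2.IH[of "p @ [x]"] by auto
qed

lemma Phi_subseq:
  assumes "mbound g c" "subseq l l'" "\<forall>e\<in>set l'. good n en e"
  shows "\<bar>Phi n g (rel en j l') - Phi n g (rel en j l)\<bar> \<le> c * (real (length l') - real (length l))"
  using ins_Lipschitz_subseq[of "{e. good n en e}" "\<lambda>l. Phi n g (rel en j l)" c l l' "[]",
      OF Phi_ins[OF assms(1)]] assms(2,3) by auto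

text \<open>Not evident from the scan, since a new edge may displace others from the forests; but by
  \<open>rel_ins\<close> each insertion only merges classes.\<close>

lemma rel_mono_subseq:
  assumes "subseq l l'" "\<forall>e\<in>set l'. good n en e" "rel en j l u v"
  shows "rel en j l' u v"
proof -
  have step: "rel en j l u v \<Longrightarrow> rel en j l' u v" if "ins l l'" "\<forall>e\<in>set l'. good n en e" for l l'
    using rel_ins[OF that, of j] by (auto simp: merge_ge)
  have "rel en j (p @ l) u v \<Longrightarrow> \<forall>e\<in>set (p @ l'). good n en e \<Longrightarrow> rel en j (p @ l') u v" for p
    using assms(1)
  proof (induction arbitrary: p rule: list_emb.induct)
    case (list_emb_Nil ys)
    then show ?case
    proof (induction ys arbitrary: p)
      case (Cons y ys)
      then have "rel en j (p @ ys) u v" by auto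
      then show ?case by (rule step[rotated -1]) (use Cons.prems in \<open>auto simp: ins_def\<close>)
    qed simp
  next
    case (list_emb_Cons xs ys y)
    then have "rel en j (p @ ys) u v" by auto
    then show ?case by (rule step[rotated -1]) (use list_emb_Cons.prems in \<open>auto simp: ins_def\<close>)
  next
    case (list_emb_Cons2 x y xs ys)
    then show ?case using list_emb_Cons2.IH[of "p @ [x]"] by auto
  qed
  from this[of "[]"] show ?thesis using assms by simp
qed

text \<open>Weights that make \<open>Phi\<close> count the vertices in classes of size
  \<open>s\<close>, the vertices in classes smaller than \<open>K\<close>, and the classes
  themselves.\<close>

definition gsz :: "nat \<Rightarrow> nat \<Rightarrow> real" where "gsz s x = (if x = s then 1 else 0)"
definition gsm :: "nat \<Rightarrow> nat \<Rightarrow> real" where "gsm K x = (if x < K then 1 else 0)"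
definition ginv :: "nat \<Rightarrow> real" where "ginv x = 1 / real x"

text \<open>The extreme case is the union of two classes of size \<open>s\<close>.\<close>

lemma mbound_gsz: "mbound (gsz s) (2 * real s)"
  unfolding mbound_def gsz_def by auto

text \<open>The extreme case is two classes below \<open>K\<close> whose union is not.\<close>

lemma mbound_gsm: "mbound (gsm K) (2 * real K)"
  unfolding mbound_def gsm_def by auto

lemma mbound_ginv: "mbound ginv 1"
  unfolding mbound_def ginv_def by auto

subsection \<open>Averages over words\<close>

text \<open>Expectation over a uniformly random word of length \<open>m\<close>, as an iterated
  mean. Finite sums replace measure theory until the word model is compared with random costs;
  averaging the last letter innermost fits processes that grow by appending.\<close>

primrec av :: "'a set \<Rightarrow> nat \<Rightarrow> ('a list \<Rightarrow> real) \<Rightarrow> real" where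
  "av E 0 f = f []"
| "av E (Suc m) f = av E m (\<lambda>l. (\<Sum>e\<in>E. f (l @ [e])) / real (card E))"

lemma av_mono:
  assumes "\<And>l. set l \<subseteq> E \<Longrightarrow> length l = m \<Longrightarrow> f l \<le> g l"
  shows "av E m f \<le> av E m g"
  using assms
proof (induction m arbitrary: f g)
  case (Suc m)
  show ?case unfolding av.simps
    by (intro Suc.IH divide_right_mono sum_mono Suc.prems) auto
qed simp

lemma av_cong:
  assumes "\<And>l. set l \<subseteq> E \<Longrightarrow> length l = m \<Longrightarrow> f l = g l"
  shows "av E m f = av E m g"
  by (intro antisym av_mono) (auto simp: assms)

lemma av_add: "av E m (\<lambda>l. f l + g l) = av E m f + av E m g"
  by (induction m arbitrary: f g) (simp_all add: sum.distrib add_divide_distrib)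

lemma av_cmult: "av E m (\<lambda>l. c * f l) = c * av E m f"
proof (induction m arbitrary: f)
  case (Suc m)
  show ?case using Suc[of "\<lambda>l. (\<Sum>e\<in>E. f (l @ [e])) / real (card E)"]
    by (simp add: sum_distrib_left[symmetric])
qed simp

lemma av_diff: "av E m (\<lambda>l. f l - g l) = av E m f - av E m g"
  using av_add[of E m f "\<lambda>l. -1 * g l"] av_cmult[of E m "-1" g] by simp

lemma av_sum: "av E m (\<lambda>l. \<Sum>i\<in>I. f i l) = (\<Sum>i\<in>I. av E m (f i))"
proof (induction I rule: infinite_finite_induct)
  case (insert x F)
  then show ?case by (simp add: av_add)
qed (use av_cmult[of E m 0] in auto)

context
  fixes E :: "'a set"
  assumes fin: "finite E" and ne: "E \<noteq> {}"
begin

lemma cardE: "0 < real (card E)"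
  using fin ne by (simp add: card_gt_0_iff)

lemma av_const: "av E m (\<lambda>_. c) = c"
  by (induction m) (use cardE in auto)

lemma av_nonneg: "(\<And>l. set l \<subseteq> E \<Longrightarrow> length l = m \<Longrightarrow> 0 \<le> f l) \<Longrightarrow> 0 \<le> av E m f"
  using av_mono[of E m "\<lambda>_. 0" f] by (simp add: av_const)

lemma av_le: "(\<And>l. set l \<subseteq> E \<Longrightarrow> length l = m \<Longrightarrow> f l \<le> c) \<Longrightarrow> av E m f \<le> c"
  using av_mono[of E m f "\<lambda>_. c"] by (simp add: av_const)

lemma av_abs: "\<bar>av E m f\<bar> \<le> av E m (\<lambda>l. \<bar>f l\<bar>)"
  using av_mono[of E m f "\<lambda>l. \<bar>f l\<bar>"] av_mono[of E m "\<lambda>l. -1 * f l" "\<lambda>l. \<bar>f l\<bar>"]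
  by (simp only: av_cmult) linarith

lemma av_abs_le: "(\<And>l. set l \<subseteq> E \<Longrightarrow> length l = m \<Longrightarrow> \<bar>f l\<bar> \<le> c) \<Longrightarrow> \<bar>av E m f\<bar> \<le> c"
  by (rule order_trans[OF av_abs av_le])

lemma av_append: "av E (m + r) f = av E m (\<lambda>l. av E r (\<lambda>l'. f (l @ l')))"
proof (induction r arbitrary: f)
  case (Suc r)
  then show ?case by simp
qed simp

lemma av_Cons: "av E (Suc m) f = (\<Sum>e\<in>E. av E m (\<lambda>l. f (e # l))) / real (card E)"
  using av_append[of 1 m f] by simp

lemma av_card: "av E m f = (\<Sum>l | set l \<subseteq> E \<and> length l = m. f l) / real (card E) ^ m"
proof (induction m arbitrary: f)
  case 0
  have "{l. set l \<subseteq> E \<and> length l = 0} = {[]}" by auto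
  then show ?case by simp
next
  case (Suc m)
  have S: "{l. set l \<subseteq> E \<and> length l = Suc m} = (\<lambda>(e, l). e # l) ` (E \<times> {l. set l \<subseteq> E \<and> length l = m})"
    by (auto simp: length_Suc_conv image_iff)
  have "(\<Sum>l | set l \<subseteq> E \<and> length l = Suc m. f l) = (\<Sum>e\<in>E. \<Sum>l | set l \<subseteq> E \<and> length l = m. f (e # l))"
    unfolding S by (subst sum.reindex) (auto simp: inj_on_def sum.cartesian_product case_prod_unfold)
  then show ?case unfolding av_Cons Suc
    by (simp add: sum_divide_distrib[symmetric] mult.commute)
qed

text \<open>Condition on the first letter: the variance splits into the mean conditional variance,
  at most \<open>m\<close> times c squared by induction, and the variance of the conditional means
  \<open>g e\<close>, which differ pairwise by at most \<open>c\<close>.\<close>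

lemma av_variance:
  assumes "\<And>x e e' y. set x \<subseteq> E \<Longrightarrow> set y \<subseteq> E \<Longrightarrow> e \<in> E \<Longrightarrow> e' \<in> E \<Longrightarrow>
      \<bar>f (x @ e # y) - f (x @ e' # y)\<bar> \<le> c"
  shows "av E m (\<lambda>l. (f l - av E m f)\<^sup>2) \<le> real m * c\<^sup>2"
  using assms
proof (induction m arbitrary: f)
  case (Suc m)
  define g where "g e = av E m (\<lambda>l. f (e # l))" for e
  define a where "a = av E (Suc m) f"
  have a: "a = (\<Sum>e\<in>E. g e) / card E" unfolding a_def g_def av_Cons ..
  have c0: "0 \<le> c"
  proof -
    obtain e where "e \<in> E" using ne by auto
    then show ?thesis using Suc.prems[of "[]" "[]" e e] by simp
  qed
  have gg: "\<bar>g e - g e'\<bar> \<le> c" if "e \<in> E" "e' \<in> E" for e e'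
    unfolding g_def av_diff[symmetric]
    using Suc.prems[of "[]" _ e e'] that by (intro av_abs_le) auto
  have ga: "\<bar>g e - a\<bar> \<le> c" if "e \<in> E" for e
  proof -
    have "g e - a = (\<Sum>e'\<in>E. g e - g e') / card E"
      unfolding a using cardE by (simp add: sum_subtractf diff_divide_distrib)
    also have "\<bar>\<dots>\<bar> \<le> (\<Sum>e'\<in>E. c) / card E"
      unfolding abs_divide using gg that
      by (auto intro!: divide_right_mono order_trans[OF sum_abs] sum_mono simp del: sum_constant)
    finally show ?thesis using cardE by simp
  qed
  have "av E m (\<lambda>l. (f (e # l) - a)\<^sup>2) \<le> real m * c\<^sup>2 + c\<^sup>2" if e: "e \<in> E" for e
  proof -
    \<comment> \<open>Expansion around the conditional mean; after averaging, the remaining terms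
      collapse to the square of \<open>g e - a\<close>.\<close>
    have "(f (e # l) - a)\<^sup>2 = (f (e # l) - g e)\<^sup>2 + (2 * (g e - a) * f (e # l) + (a\<^sup>2 - (g e)\<^sup>2))" for l
      by (simp add: power2_eq_square algebra_simps)
    then have "av E m (\<lambda>l. (f (e # l) - a)\<^sup>2)
       = av E m (\<lambda>l. (f (e # l) - g e)\<^sup>2) + (2 * (g e - a) * g e + (a\<^sup>2 - (g e)\<^sup>2))"
      by (simp only: av_add av_cmult av_const g_def[symmetric])
    also have "2 * (g e - a) * g e + (a\<^sup>2 - (g e)\<^sup>2) = (g e - a)\<^sup>2"
      by (simp add: power2_eq_square algebra_simps)
    also have "(g e - a)\<^sup>2 \<le> c\<^sup>2" using ga[OF e] c0 by (metis abs_le_square_iff abs_of_nonneg)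
    also have "av E m (\<lambda>l. (f (e # l) - g e)\<^sup>2) \<le> real m * c\<^sup>2"
      unfolding g_def using Suc.prems[of "e # _"] e by (intro Suc.IH) (auto simp flip: append_Cons)
    finally show ?thesis by simp
  qed
  then have "(\<Sum>e\<in>E. av E m (\<lambda>l. (f (e # l) - a)\<^sup>2)) / card E \<le> (\<Sum>e\<in>E. real m * c\<^sup>2 + c\<^sup>2) / card E"
    by (intro divide_right_mono sum_mono) auto
  also have "\<dots> = real (Suc m) * c\<^sup>2" using cardE by (simp add: field_simps)
  finally show ?case unfolding a_def[symmetric] unfolding av_Cons .
qed simp

text \<open>The pointwise bound of |xy| by half of the sum of squares serves in place of the
  Cauchy-Schwarz inequality; nothing is lost because both variances have the same bound.\<close>

lemma av_covariance:
  assumes "av E m (\<lambda>l. (f l - av E m f)\<^sup>2) \<le> v" "av E m (\<lambda>l. (g l - av E m g)\<^sup>2) \<le> v"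
  shows "\<bar>av E m (\<lambda>l. f l * g l) - av E m f * av E m g\<bar> \<le> v"
proof -
  define a b where "a = av E m f" and "b = av E m g"
  have "av E m (\<lambda>l. (f l - a) * (g l - b)) = av E m (\<lambda>l. f l * g l + (-b) * f l + (-a) * g l + a * b)"
    by (simp add: algebra_simps)
  also have "\<dots> = av E m (\<lambda>l. f l * g l) - a * b"
    by (simp only: av_add av_cmult av_const a_def[symmetric] b_def[symmetric]) simp
  finally have 1: "av E m (\<lambda>l. f l * g l) - a * b = av E m (\<lambda>l. (f l - a) * (g l - b))" by simp
  have "\<bar>x * y\<bar> \<le> (1/2) * (x\<^sup>2 + y\<^sup>2)" for x y :: real
    using sum_squares_bound[of x y] sum_squares_bound[of x "-y"] by (auto simp: abs_le_iff)
  then have "\<bar>av E m (\<lambda>l. (f l - a) * (g l - b))\<bar> \<le> av E m (\<lambda>l. (1/2) * ((f l - a)\<^sup>2 + (g l - b)\<^sup>2))"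
    by (intro order_trans[OF av_abs] av_mono)
  also have "\<dots> \<le> v" using assms unfolding av_cmult av_add a_def b_def by simp
  finally show ?thesis unfolding 1[unfolded a_def b_def] a_def b_def .
qed

lemma av_Markov:
  assumes "\<And>l. set l \<subseteq> E \<Longrightarrow> length l = m \<Longrightarrow> 0 \<le> f l" "0 < c"
  shows "av E m (\<lambda>l. if c \<le> f l then 1 else 0) \<le> av E m f / c"
proof -
  have "av E m (\<lambda>l. if c \<le> f l then 1 else 0) \<le> av E m (\<lambda>l. (1 / c) * f l)"
    using assms by (intro av_mono) (auto simp: field_simps)
  then show ?thesis by (simp only: av_cmult) simp
qed

lemma av_avoid:
  assumes "F \<subseteq> E"
  shows "av E r (\<lambda>l. if set l \<inter> F = {} then 1 else 0) = (1 - card F / card E) ^ r"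
proof (induction r)
  case (Suc r)
  have "(\<Sum>e\<in>E. if set (l @ [e]) \<inter> F = {} then 1 else 0) / real (card E)
      = (1 - card F / card E) * (if set l \<inter> F = {} then 1 else (0::real))" for l
  proof (cases "set l \<inter> F = {}")
    case True
    have "(\<Sum>e\<in>E. if set (l @ [e]) \<inter> F = {} then 1 else 0) = (\<Sum>e\<in>E. if e \<notin> F then 1 else (0::real))"
      using True by (intro sum.cong) auto
    also have "\<dots> = real (card (E - F))" using fin by (simp add: sum.If_cases Diff_eq Compl_eq)
    also have "\<dots> = real (card E) - real (card F)"
      using assms fin by (simp add: card_Diff_subset finite_subset of_nat_diff card_mono)
    finally show ?thesis using True cardE by (simp add: diff_divide_distrib)
  qed auto
  then show ?case using Suc by (simp only: av.simps av_cmult) simp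
qed simp

end

lemma Phi_variance:
  assumes "finite E" "E \<noteq> {}" "\<forall>e\<in>E. good n en e" "mbound g c"
  shows "av E m (\<lambda>l. (Phi n g (rel en j l) - av E m (\<lambda>l. Phi n g (rel en j l)))\<^sup>2) \<le> real m * (2 * c)\<^sup>2"
proof (rule av_variance[OF assms(1,2)])
  fix x y e e' assume *: "set x \<subseteq> E" "set y \<subseteq> E" "e \<in> E" "e' \<in> E"
  have "\<bar>Phi n g (rel en j (x @ d # y)) - Phi n g (rel en j (x @ y))\<bar> \<le> c" if "d \<in> E" for d
    using * that assms(3) by (intro Phi_ins[OF assms(4)]) (auto simp: ins_def)
  from this[OF *(3)] this[OF *(4)]
  show "\<bar>Phi n g (rel en j (x @ e # y)) - Phi n g (rel en j (x @ e' # y))\<bar> \<le> 2 * c" by linarith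
qed

subsection \<open>Large classes merge after few further edges\<close>

lemma finite_Kn: "finite (Kn_edges n)"
  by (rule finite_subset[of _ "{..<n} \<times> {..<n}"]) (auto simp: Kn_edges_def)

lemma Kn_ne: "2 \<le> n \<Longrightarrow> Kn_edges n \<noteq> {}"
proof -
  assume "2 \<le> n"
  then have "(0, 1) \<in> Kn_edges n" by (simp add: Kn_edges_def)
  then show ?thesis by blast
qed

lemma good_Kn: "e \<in> Kn_edges n \<Longrightarrow> good n Kn_ends e"
  unfolding Kn_edges_def good_def Kn_ends_def
  by (intro exI[of _ "fst e"] exI[of _ "snd e"] conjI) auto

lemma Kn_ends_pair: "Kn_ends e = {fst e, snd e}"
  by (simp add: Kn_ends_def)

text \<open>Passes from edges to ordered pairs, where counts determined by class sizes
  factorize.\<close>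

lemma sum_Kn_sym:
  fixes h :: "nat \<Rightarrow> nat \<Rightarrow> real"
  assumes "\<And>u v. h u v = h v u"
  shows "(\<Sum>(u, v) | u < n \<and> v < n \<and> u \<noteq> v. h u v) = 2 * (\<Sum>e\<in>Kn_edges n. h (fst e) (snd e))"
proof -
  let ?E = "Kn_edges n"
  have S: "{(u, v). u < n \<and> v < n \<and> u \<noteq> v} = ?E \<union> prod.swap ` ?E"
    by (auto simp: Kn_edges_def image_iff)
  have "(\<Sum>(u, v) | u < n \<and> v < n \<and> u \<noteq> v. h u v)
      = (\<Sum>(u, v)\<in>?E. h u v) + (\<Sum>(u, v)\<in>prod.swap ` ?E. h u v)"
    unfolding S
  proof (rule sum.union_disjoint)
    show "?E \<inter> prod.swap ` ?E = {}" by (auto simp: Kn_edges_def)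
  qed (simp_all add: finite_Kn)
  also have "(\<Sum>(u, v)\<in>prod.swap ` ?E. h u v) = (\<Sum>e\<in>?E. h (snd e) (fst e))"
    by (subst sum.reindex) (auto simp: inj_on_def case_prod_unfold)
  finally show ?thesis using assms by (simp add: case_prod_unfold)
qed

lemma card_Kn: "real (card (Kn_edges n)) = real n * (real n - 1) / 2"
proof -
  have "{(u, v). u < n \<and> v < n \<and> u \<noteq> v} = (SIGMA u:{..<n}. {..<n} - {u})" by auto
  then have "card {(u, v). u < n \<and> v < n \<and> u \<noteq> v} = n * (n - 1)" by simp
  then have "real (card {(u, v). u < n \<and> v < n \<and> u \<noteq> v}) = real n * (real n - 1)"
    by (cases n) (simp_all add: algebra_simps)
  then show ?thesis using sum_Kn_sym[of "\<lambda>_ _. 1" n] by (simp add: case_prod_unfold)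
qed

text \<open>A cut of \<open>Q\<close> that \<open>R\<close> does not cross.\<close>

definition closed_in :: "(nat \<Rightarrow> nat \<Rightarrow> bool) \<Rightarrow> nat set \<Rightarrow> nat set \<Rightarrow> bool" where
  "closed_in R Q W \<longleftrightarrow> W \<subseteq> Q \<and> (\<forall>u\<in>W. \<forall>v\<in>Q. R u v \<longrightarrow> v \<in> W)"

text \<open>Take the closed \<open>W\<close> that maximizes the product of the two sides. Moving one
  class of \<open>W\<close> across cannot increase the product, so each vertex of \<open>W\<close>
  has at most \<open>card (Q - W)\<close> strangers inside \<open>W\<close>. The complement is
  equally optimal, so the same holds there. Unrelated pairs inside each side and the crossing pairs
  in both orders give four times the product.\<close>

lemma cut_exists:
  assumes R: "equivp R" and Q: "finite Q"
  shows "\<exists>W. closed_in R Q W \<and> card {(u, v). u \<in> Q \<and> v \<in> Q \<and> \<not> R u v} \<le> 4 * (card W * card (Q - W))"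
proof -
  define f where "f W = card W * card (Q - W)" for W
  have "finite {W. closed_in R Q W}"
    by (rule finite_subset[of _ "Pow Q"]) (auto simp: closed_in_def Q)
  moreover have "{} \<in> {W. closed_in R Q W}" by (simp add: closed_in_def)
  ultimately obtain W where W: "closed_in R Q W" and max: "\<And>V. closed_in R Q V \<Longrightarrow> f V \<le> f W"
    using Max_in[of "f ` {W. closed_in R Q W}"] Max_ge[of "f ` {W. closed_in R Q W}"]
    by (smt (verit) empty_iff finite_imageI image_iff image_is_empty mem_Collect_eq)
  define V where "V = Q - W"
  have sym: "R x y \<Longrightarrow> R y x" for x y using R by (rule equivp_symp)
  have trans: "R x y \<Longrightarrow> R y z \<Longrightarrow> R x z" for x y z using R by (rule equivp_transp)
  have VW: "Q - V = W" "V \<subseteq> Q" "W \<subseteq> Q" using W by (auto simp: V_def closed_in_def)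
  have V: "closed_in R Q V" using W sym unfolding V_def closed_in_def by blast
  have fVW: "f V = f W" unfolding f_def VW by (simp add: V_def mult.commute)
  have half: "card {(u, v). u \<in> X \<and> v \<in> X \<and> \<not> R u v} \<le> card X * card (Q - X)"
    if X: "closed_in R Q X" and fX: "f X = f W" for X
  proof -
    have XQ: "X \<subseteq> Q" "finite X" using X Q by (auto simp: closed_in_def intro: finite_subset)
    have each: "card {v \<in> X. \<not> R u v} \<le> card (Q - X)" if u: "u \<in> X" for u
    proof -
      define C where "C = {v \<in> Q. R u v}"
      have CX: "C \<subseteq> X" using X u by (auto simp: C_def closed_in_def)
      have "u \<in> C" using u XQ R by (auto simp: C_def equivp_reflp)
      then have c: "0 < card C" using CX XQ by (auto simp: card_gt_0_iff intro: finite_subset)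
      have "closed_in R Q (X - C)" using X sym trans unfolding closed_in_def C_def by blast
      then have "f (X - C) \<le> f X" using max fX by simp
      moreover have "card X = card (X - C) + card C"
        using CX XQ by (metis card_Diff_subset card_mono finite_subset le_add_diff_inverse2)
      moreover have "card (Q - (X - C)) = card (Q - X) + card C"
      proof -
        have "Q - (X - C) = (Q - X) \<union> C" using CX XQ by auto
        then show ?thesis using CX Q finite_subset[OF CX XQ(2)] card_Un_disjoint[of "Q - X" C] by (auto simp: disjoint_iff)
      qed
      ultimately have "card (X - C) * card C \<le> card C * card (Q - X)"
        unfolding f_def by (simp add: algebra_simps)
      then have "card (X - C) \<le> card (Q - X)" using c by (simp add: mult.commute)
      moreover have "{v \<in> X. \<not> R u v} = X - C" using XQ by (auto simp: C_def)
      ultimately show ?thesis by simp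
    qed
    have "{(u, v). u \<in> X \<and> v \<in> X \<and> \<not> R u v} = (SIGMA u:X. {v \<in> X. \<not> R u v})" by auto
    then have "card {(u, v). u \<in> X \<and> v \<in> X \<and> \<not> R u v} = (\<Sum>u\<in>X. card {v \<in> X. \<not> R u v})"
      using XQ by simp
    also have "\<dots> \<le> (\<Sum>u\<in>X. card (Q - X))" by (intro sum_mono each)
    finally show ?thesis by simp
  qed
  have "{(u, v). u \<in> Q \<and> v \<in> Q \<and> \<not> R u v} \<subseteq>
      ({(u, v). u \<in> W \<and> v \<in> W \<and> \<not> R u v} \<union> {(u, v). u \<in> V \<and> v \<in> V \<and> \<not> R u v}) \<union> (W \<times> V \<union> V \<times> W)"
    using VW by (auto simp: V_def)
  moreover have fin: "finite W" "finite V" using VW Q by (auto intro: finite_subset)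
  have fin2: "finite {(u, v). u \<in> X \<and> v \<in> X \<and> \<not> R u v}" if "finite X" for X
    by (rule finite_subset[of _ "X \<times> X"]) (use that in auto)
  ultimately have "card {(u, v). u \<in> Q \<and> v \<in> Q \<and> \<not> R u v} \<le>
     card (({(u, v). u \<in> W \<and> v \<in> W \<and> \<not> R u v} \<union> {(u, v). u \<in> V \<and> v \<in> V \<and> \<not> R u v}) \<union> (W \<times> V \<union> V \<times> W))"
    using fin by (intro card_mono) (auto intro!: finite_UnI fin2)
  also have "\<dots> \<le> card {(u, v). u \<in> W \<and> v \<in> W \<and> \<not> R u v} + card {(u, v). u \<in> V \<and> v \<in> V \<and> \<not> R u v}
      + (card (W \<times> V) + card (V \<times> W))"
    by (intro order_trans[OF card_Un_le] add_mono card_Un_le)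
  also have "\<dots> \<le> card W * card V + card V * card W + (card W * card V + card V * card W)"
    using half[OF W refl] half[OF V fVW] unfolding VW V_def[symmetric]
    by (intro add_mono) (simp_all add: card_cartesian_product)
  finally show ?thesis using W unfolding V_def by (intro exI[of _ W]) (simp add: algebra_simps)
qed

text \<open>There are at most n / K classes of size at least \<open>K\<close>, and a closed set is
  determined by the classes it contains.\<close>

lemma card_closed_in:
  assumes R: "equivp R" and "0 < K"
  shows "card {W. closed_in R {u. u < n \<and> K \<le> csz n R u} W} \<le> 2 ^ (n div K)"
proof -
  define Q where "Q = {u. u < n \<and> K \<le> csz n R u}"
  \<comment> \<open>The least vertex of each large class serves as its representative.\<close>
  define P where "P = {u \<in> Q. \<forall>v<n. R u v \<longrightarrow> u \<le> v}"
  define C where "C u = {v. v < n \<and> R u v}" for u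
  have fin: "finite P" "finite Q" by (auto simp: P_def Q_def)
  have sym: "R x y \<Longrightarrow> R y x" for x y using R by (rule equivp_symp)
  have trans: "R x y \<Longrightarrow> R y z \<Longrightarrow> R x z" for x y z using R by (rule equivp_transp)
  have disj: "C u \<inter> C v = {}" if "u \<in> P" "v \<in> P" "u \<noteq> v" for u v
  proof (rule ccontr)
    assume "C u \<inter> C v \<noteq> {}"
    then obtain w where "R u w" "R v w" by (auto simp: C_def)
    then have "R u v" "R v u" by (blast intro: sym trans)+
    then show False using that by (auto simp: P_def Q_def dest: order.antisym)
  qed
  have "card P * K \<le> (\<Sum>u\<in>P. card (C u))"
    using sum_bounded_below[of P K "\<lambda>u. card (C u)"] by (simp add: P_def Q_def C_def csz_def)
  also have "\<dots> = card (\<Union>u\<in>P. C u)"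
    using fin disj by (intro card_UN_disjoint[symmetric]) (auto simp: C_def)
  also have "\<dots> \<le> card {..<n}" by (intro card_mono) (auto simp: C_def)
  finally have "card P \<le> n div K" using assms(2) by (simp add: less_eq_div_iff_mult_less_eq)
  moreover have "inj_on (\<lambda>W. W \<inter> P) {W. closed_in R Q W}"
  proof (rule inj_onI)
    have half: "W \<subseteq> W'" if "closed_in R Q W" "closed_in R Q W'" "W \<inter> P = W' \<inter> P" for W W'
    proof
      fix u assume u: "u \<in> W"
      then have uQ: "u \<in> Q" using that by (auto simp: closed_in_def)
      define r where "r = (LEAST v. v < n \<and> R u v)"
      have "u < n \<and> R u u" using uQ R by (auto simp: Q_def equivp_reflp)
      then have r: "r < n \<and> R u r" unfolding r_def by (rule LeastI)
      have "r \<le> v" if "v < n" "R r v" for v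
        unfolding r_def using that r trans by (intro Least_le) blast
      moreover have rQ: "r \<in> Q" using uQ r csz_cong[OF R, of u r n] by (auto simp: Q_def)
      ultimately have "r \<in> P" by (simp add: P_def)
      moreover have "r \<in> W" using that(1) u r rQ by (auto simp: closed_in_def)
      ultimately have "r \<in> W'" using that(3) by blast
      then show "u \<in> W'" using that(2) uQ r sym by (auto simp: closed_in_def)
    qed
    fix W W' assume "W \<in> {W. closed_in R Q W}" "W' \<in> {W. closed_in R Q W}" "W \<inter> P = W' \<inter> P"
    then show "W = W'" using half[of W W'] half[of W' W] by auto
  qed
  then have "card {W. closed_in R Q W} \<le> card (Pow P)"
    using fin by (intro card_inj_on_le) auto
  ultimately show ?thesis unfolding Q_def[symmetric]
    using fin by (simp add: card_Pow) (meson order_trans one_le_numeral power_increasing)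
qed

text \<open>Ordered pairs of vertices in large classes of \<open>R\<close> that \<open>R'\<close>
  leaves apart. Two relations occur because largeness is judged at an earlier time, or on a higher
  level, than being joined.\<close>

definition unc :: "nat \<Rightarrow> nat \<Rightarrow> (nat \<Rightarrow> nat \<Rightarrow> bool) \<Rightarrow> (nat \<Rightarrow> nat \<Rightarrow> bool) \<Rightarrow> real" where
  "unc n K R R' = real (card {(u, v). u < n \<and> v < n \<and> K \<le> csz n R u \<and> K \<le> csz n R v \<and> \<not> R' u v})"

lemma finite_pairs: "finite {(u, v). u < n \<and> v < n \<and> P u v}" for n :: nat
  by (rule finite_subset[of _ "{..<n} \<times> {..<n}"]) auto

lemma unc_nonneg: "0 \<le> unc n K R R'"
  by (simp add: unc_def)

lemma unc_le: "unc n K R R' \<le> (real n)\<^sup>2"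
proof -
  have "card {(u, v). u < n \<and> v < n \<and> K \<le> csz n R u \<and> K \<le> csz n R v \<and> \<not> R' u v} \<le> card ({..<n} \<times> {..<n})"
    by (intro card_mono) auto
  then show ?thesis unfolding unc_def by (simp add: power2_eq_square flip: of_nat_mult)
qed

text \<open>An edge whose ends are joined at level \<open>j\<close> has been rejected
  \<open>j\<close> times when it is scanned, so it is offered to level \<open>j + 1\<close>;
  monotonicity covers the letters before and after it.\<close>

lemma rel_join:
  assumes "\<forall>e\<in>set (L @ l). good n Kn_ends e" "e \<in> set l" "rel Kn_ends j L (fst e) (snd e)"
  shows "rel Kn_ends (Suc j) (L @ l) (fst e) (snd e)"
proof -
  obtain x y where l: "l = x @ e # y" using assms(2) by (metis split_list)
  have "rel Kn_ends j (L @ x) (fst e) (snd e)"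
    by (rule rel_mono_subseq[OF _ _ assms(3)]) (use assms(1) l in auto)
  then have "rel Kn_ends (Suc j) ((L @ x) @ [e]) (fst e) (snd e)"
    unfolding rel_Suc_snoc[of Kn_ends e, OF Kn_ends_pair] by (simp add: merge_join[OF equivp_conn])
  then show ?thesis
    by (rule rel_mono_subseq[rotated 2]) (use assms(1) l in auto)
qed

text \<open>Union bound over cuts. If many pairs stay apart at level \<open>j + 1\<close>,
  \<open>cut_exists\<close> yields a balanced cut that the final relation, hence also the earlier
  \<open>R\<close>, does not cross. By \<open>bad\<close> most pairs across it are joined at level
  \<open>j\<close>, so each of the corresponding edges would have destroyed the cut. They form a
  fraction of at least \<delta> / 8 of all edges, and there are at most \<open>2 ^ (n div K)\<close>
  cuts.\<close>

lemma sprinkle_step: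
  assumes n: "2 \<le> n" and K: "0 < K" and \<delta>: "0 < \<delta>" "\<delta> \<le> 1"
    and l: "set l \<subseteq> Kn_edges n" "subseq l L" "set L \<subseteq> Kn_edges n"
    and bad: "unc n K (rel Kn_ends (Suc j) l) (rel Kn_ends j L) \<le> \<delta> * (real n)\<^sup>2 / 16"
  shows "av (Kn_edges n) r (\<lambda>l'. unc n K (rel Kn_ends (Suc j) l) (rel Kn_ends (Suc j) (L @ l')))
     \<le> \<delta> / 2 * (real n)\<^sup>2 + (real n)\<^sup>2 * (2 ^ (n div K) * exp (- \<delta> * real r / 8))"
proof -
  let ?E = "Kn_edges n"
  define R where "R = rel Kn_ends (Suc j) l"
  define Q where "Q = {u. u < n \<and> K \<le> csz n R u}"
  define H where "H W = {(u, v). u \<in> W \<and> v \<in> Q - W \<and> rel Kn_ends j L u v}" for W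
  define F where "F W = {e \<in> ?E. e \<in> H W \<or> prod.swap e \<in> H W}" for W
  \<comment> \<open>The threshold is \<delta> / 2 divided by the factor 4 of
    \<open>cut_exists\<close>.\<close>
  define WW where "WW = {W. closed_in R Q W \<and> \<delta> * (real n)\<^sup>2 / 8 \<le> real (card W * card (Q - W))}"
  have R: "equivp R" unfolding R_def by (rule equivp_rel)
  have finQ: "finite Q" by (simp add: Q_def)
  have finWW: "finite {W. closed_in R Q W}"
    by (rule finite_subset[of _ "Pow Q"]) (auto simp: closed_in_def finQ)
  have cardWW: "real (card WW) \<le> 2 ^ (n div K)"
  proof -
    have "card WW \<le> card {W. closed_in R Q W}" unfolding WW_def by (intro card_mono finWW) auto
    also have "\<dots> \<le> 2 ^ (n div K)" unfolding Q_def by (rule card_closed_in[OF R K])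
    finally show ?thesis using of_nat_le_iff[where 'a = real, of "card WW" "2 ^ (n div K)"] by simp
  qed
  have cE: "real (card ?E) \<le> (real n)\<^sup>2 / 2"
    unfolding card_Kn by (simp add: power2_eq_square algebra_simps)
  have cardE0: "0 < real (card ?E)" by (rule cardE[OF finite_Kn Kn_ne[OF n]])
  have cardF: "\<delta> * (real n)\<^sup>2 / 16 \<le> real (card (F W))" if W: "W \<in> WW" for W
  proof -
    have WQ: "W \<subseteq> Q" using W by (auto simp: WW_def closed_in_def)
    have "H W \<subseteq> Q \<times> Q" using WQ by (auto simp: H_def)
    then have finH: "finite (H W)" using finQ by (auto intro: finite_subset)
    have "W \<times> (Q - W) \<subseteq> H W \<union> {(u, v). u < n \<and> v < n \<and> K \<le> csz n R u \<and> K \<le> csz n R v \<and> \<not> rel Kn_ends j L u v}"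
      using WQ by (auto simp: H_def Q_def)
    then have "card (W \<times> (Q - W)) \<le> card (H W \<union> {(u, v). u < n \<and> v < n \<and> K \<le> csz n R u \<and> K \<le> csz n R v \<and> \<not> rel Kn_ends j L u v})"
      by (rule card_mono[rotated]) (auto simp: finH finite_pairs)
    also have "\<dots> \<le> card (H W) + card {(u, v). u < n \<and> v < n \<and> K \<le> csz n R u \<and> K \<le> csz n R v \<and> \<not> rel Kn_ends j L u v}"
      by (rule card_Un_le)
    finally have "real (card (W \<times> (Q - W))) \<le> real (card (H W) + card {(u, v). u < n \<and> v < n \<and> K \<le> csz n R u \<and> K \<le> csz n R v \<and> \<not> rel Kn_ends j L u v})"
      by (rule of_nat_mono)
    then have "real (card W * card (Q - W)) \<le> card (H W) + unc n K R (rel Kn_ends j L)"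
      unfolding unc_def by (simp add: card_cartesian_product)
    moreover have "card (H W) = card (F W)"
    proof -
      define h where "h = (\<lambda>(u, v). if u < v then (u, v) else (v, u :: nat))"
      have "F W = h ` H W"
      proof (intro set_eqI iffI)
        fix e assume "e \<in> F W"
        then show "e \<in> h ` H W"
          by (cases e) (auto simp: F_def h_def Kn_edges_def image_iff intro: bexI[of _ e] bexI[of _ "prod.swap e"])
      next
        fix e assume "e \<in> h ` H W"
        then obtain u v where uv: "(u, v) \<in> H W" "e = h (u, v)" by auto
        then have "u < n" "v < n" "u \<noteq> v" using WQ by (auto simp: H_def Q_def)
        then show "e \<in> F W" using uv by (auto simp: F_def h_def Kn_edges_def)
      qed
      \<comment> \<open>The orientation of a pair can be recovered: its first vertex lies in
        \<open>W\<close>, its second does not.\<close>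
      moreover have "inj_on h (H W)" by (auto simp: inj_on_def h_def H_def split: if_splits)
      ultimately show ?thesis by (simp add: card_image)
    qed
    ultimately show ?thesis using W bad by (simp add: WW_def R_def)
  qed
  have pointwise: "unc n K R (rel Kn_ends (Suc j) (L @ l'))
      \<le> \<delta> / 2 * (real n)\<^sup>2 + (real n)\<^sup>2 * (\<Sum>W\<in>WW. if set l' \<inter> F W = {} then 1 else 0)"
    if l': "set l' \<subseteq> ?E" for l'
  proof (cases "unc n K R (rel Kn_ends (Suc j) (L @ l')) \<le> \<delta> / 2 * (real n)\<^sup>2")
    case True
    then show ?thesis
      by (smt (verit, best) mult_nonneg_nonneg sum_nonneg zero_le_power2)
  next
    case False
    let ?R' = "rel Kn_ends (Suc j) (L @ l')"
    have good: "\<forall>e\<in>set (L @ l'). good n Kn_ends e" using l l' good_Kn by fastforce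
    have RR': "?R' u v" if "R u v" for u v
      using that unfolding R_def
      by (rule rel_mono_subseq[rotated 2]) (use good l in \<open>auto intro: subseq_order.trans[of l L]\<close>)
    obtain W where W: "closed_in ?R' Q W"
      "card {(u, v). u \<in> Q \<and> v \<in> Q \<and> \<not> ?R' u v} \<le> 4 * (card W * card (Q - W))"
      using cut_exists[OF equivp_rel finQ] by blast
    have "unc n K R ?R' = real (card {(u, v). u \<in> Q \<and> v \<in> Q \<and> \<not> ?R' u v})"
      unfolding unc_def Q_def by (intro arg_cong[where f = "\<lambda>x. real (card x)"]) auto
    also have "\<dots> \<le> 4 * real (card W * card (Q - W))"
      using of_nat_mono[OF W(2), where 'a = real] by simp
    finally have "\<delta> * (real n)\<^sup>2 / 8 \<le> real (card W * card (Q - W))" using False by simp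
    moreover have "closed_in R Q W" using W(1) RR' by (auto simp: closed_in_def)
    ultimately have WW: "W \<in> WW" by (simp add: WW_def)
    have "set l' \<inter> F W = {}"
    proof (rule ccontr)
      assume "set l' \<inter> F W \<noteq> {}"
      then obtain e where e: "e \<in> set l'" "e \<in> F W" by auto
      then have "rel Kn_ends j L (fst e) (snd e)"
        using equivp_symp[OF equivp_rel] by (cases e) (auto simp: F_def H_def)
      then have "?R' (fst e) (snd e)" by (rule rel_join[OF good e(1)])
      moreover have "?R' (snd e) (fst e)" using calculation by (rule equivp_symp[OF equivp_rel])
      ultimately show False using e(2) W(1) by (cases e) (auto simp: F_def H_def closed_in_def)
    qed
    then have "1 \<le> (\<Sum>W\<in>WW. if set l' \<inter> F W = {} then 1 else (0::real))"
      using member_le_sum[of W WW "\<lambda>W. if set l' \<inter> F W = {} then 1 else (0::real)"] WW finWW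
      by (auto simp: WW_def)
    then have "(real n)\<^sup>2 * 1 \<le> (real n)\<^sup>2 * (\<Sum>W\<in>WW. if set l' \<inter> F W = {} then 1 else 0)"
      by (intro mult_left_mono) auto
    moreover have "0 \<le> \<delta> / 2 * (real n)\<^sup>2" using \<delta> by simp
    ultimately show ?thesis using unc_le[of n K R ?R'] by linarith
  qed
  have "av ?E r (\<lambda>l'. unc n K R (rel Kn_ends (Suc j) (L @ l')))
      \<le> av ?E r (\<lambda>l'. \<delta> / 2 * (real n)\<^sup>2 + (real n)\<^sup>2 * (\<Sum>W\<in>WW. if set l' \<inter> F W = {} then 1 else 0))"
    by (intro av_mono pointwise)
  also have "\<dots> = \<delta> / 2 * (real n)\<^sup>2 + (real n)\<^sup>2 * (\<Sum>W\<in>WW. (1 - card (F W) / card ?E) ^ r)"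
    unfolding av_add av_const[OF finite_Kn Kn_ne[OF n]] av_cmult av_sum
    by (subst av_avoid[OF finite_Kn Kn_ne[OF n]]) (auto simp: F_def)
  also have "(\<Sum>W\<in>WW. (1 - card (F W) / card ?E) ^ r) \<le> (\<Sum>W\<in>WW. exp (- \<delta> * real r / 8))"
  proof (rule sum_mono)
    fix W assume W: "W \<in> WW"
    have "card (F W) \<le> card ?E" by (intro card_mono finite_Kn) (auto simp: F_def)
    then have 0: "0 \<le> 1 - card (F W) / card ?E" using cardE0 by (simp add: divide_le_eq)
    have "\<delta> / 8 = (\<delta> * (real n)\<^sup>2 / 16) / ((real n)\<^sup>2 / 2)" using n by (simp add: field_simps)
    also have "\<dots> \<le> card (F W) / card ?E"
      using cardF[OF W] cE cardE0 \<delta> by (intro frac_le) auto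
    finally have "1 - card (F W) / card ?E \<le> 1 + (- \<delta> / 8)" by simp
    also have "\<dots> \<le> exp (- \<delta> / 8)" by (rule exp_ge_add_one_self)
    finally have "(1 - card (F W) / card ?E) ^ r \<le> exp (- \<delta> / 8) ^ r"
      using 0 by (intro power_mono) auto
    then show "(1 - card (F W) / card ?E) ^ r \<le> exp (- \<delta> * real r / 8)"
      by (simp add: exp_of_nat_mult[symmetric] algebra_simps)
  qed
  also have "\<dots> \<le> 2 ^ (n div K) * exp (- \<delta> * real r / 8)"
    using cardWW by (simp add: mult_right_mono)
  finally show ?thesis unfolding R_def by (simp add: mult_left_mono)
qed

lemma unc_antimono:
  assumes "K' \<le> K" "\<And>u v. R u v \<Longrightarrow> S u v"
  shows "unc n K R R' \<le> unc n K' S R'"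
proof -
  have "csz n R u \<le> csz n S u" for u using assms(2) by (rule csz_mono)
  then have "{(u, v). u < n \<and> v < n \<and> K \<le> csz n R u \<and> K \<le> csz n R v \<and> \<not> R' u v}
    \<subseteq> {(u, v). u < n \<and> v < n \<and> K' \<le> csz n S u \<and> K' \<le> csz n S v \<and> \<not> R' u v}"
    using assms(1) by (auto intro: order_trans)
  then show ?thesis unfolding unc_def by (simp add: card_mono finite_pairs)
qed

text \<open>Half of the new letters are spent on level \<open>j\<close>. By induction and the Markov
  inequality the hypothesis \<open>bad\<close> of \<open>sprinkle_step\<close> then fails with
  probability at most \<delta> / 4, the quotient of \<delta>\<cdot>\<delta> / 64 and \<delta> / 16.
  The other half is spent on level \<open>j + 1\<close>, at a further cost of \<delta> / 2 and
  \<delta> / 4. Level 0 is total, which starts the induction.\<close>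

lemma sprinkle:
  assumes "0 < \<epsilon>" "0 < \<delta>" "\<delta> \<le> 1"
  shows "\<exists>K>0. \<forall>\<^sub>F n in sequentially. \<forall>m r. \<epsilon> * real n \<le> real r \<longrightarrow>
    av (Kn_edges n) (m + r) (\<lambda>L. unc n K (rel Kn_ends j (take m L)) (rel Kn_ends j L)) \<le> \<delta> * (real n)\<^sup>2"
  using assms
proof (induction j arbitrary: \<epsilon> \<delta>)
  case 0
  have "av (Kn_edges n) (m + r) (\<lambda>L. 0) \<le> \<delta> * (real n)\<^sup>2" for n m r
    using av_cmult[of "Kn_edges n" "m + r" 0 "\<lambda>_. 0"] 0 by simp
  then show ?case by (intro exI[of _ 1]) (simp add: unc_def)
next
  case (Suc j)
  note \<epsilon> = Suc.prems(1) and \<delta> = Suc.prems(2,3)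
  have "\<exists>K>0. \<forall>\<^sub>F n in sequentially. \<forall>m r. \<epsilon> / 4 * real n \<le> real r \<longrightarrow>
    av (Kn_edges n) (m + r) (\<lambda>L. unc n K (rel Kn_ends j (take m L)) (rel Kn_ends j L)) \<le> (\<delta>\<^sup>2 / 64) * (real n)\<^sup>2"
    using \<epsilon> \<delta> power_le_one[of \<delta> 2] by (intro Suc.IH) auto
  then obtain K' where K': "0 < K'" and ev: "\<forall>\<^sub>F n in sequentially. \<forall>m r. \<epsilon> / 4 * real n \<le> real r \<longrightarrow>
    av (Kn_edges n) (m + r) (\<lambda>L. unc n K' (rel Kn_ends j (take m L)) (rel Kn_ends j L)) \<le> (\<delta>\<^sup>2 / 64) * (real n)\<^sup>2"
    by blast
  \<comment> \<open>The second half of the letters gives a decay rate of at least \<delta>\<epsilon>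
    / 16 = 2 c per vertex; with K at least 1 / c the number of cuts grows at rate at most c, which
    leaves a factor exp (- c n).\<close>
  define c where "c = \<delta> * \<epsilon> / 32"
  have c: "0 < c" using \<epsilon> \<delta> by (simp add: c_def)
  define K where "K = max K' (nat \<lceil>1 / c\<rceil>)"
  have K: "K' \<le> K" "0 < K" "1 / c \<le> real K" using K' by (auto simp: K_def) linarith
  have "((\<lambda>n. exp (- c * real n)) \<longlongrightarrow> 0) sequentially"
    using c by real_asymp
  then have ev2: "\<forall>\<^sub>F n in sequentially. exp (- c * real n) < \<delta> / 4"
    using \<delta> by (intro order_tendstoD) auto
  have "filterlim (\<lambda>n. \<epsilon> * real n) at_top sequentially"
    using \<epsilon> by real_asymp
  then have ev3: "\<forall>\<^sub>F n in sequentially. 2 \<le> \<epsilon> * real n" by (simp add: filterlim_at_top)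
  have "\<forall>\<^sub>F n in sequentially. \<forall>m r. \<epsilon> * real n \<le> real r \<longrightarrow>
    av (Kn_edges n) (m + r) (\<lambda>L. unc n K (rel Kn_ends (Suc j) (take m L)) (rel Kn_ends (Suc j) L)) \<le> \<delta> * (real n)\<^sup>2"
    using ev ev2 ev3 eventually_ge_at_top[of 2]
  proof eventually_elim
    case (elim n)
    show ?case
    proof (intro allI impI)
      fix m r :: nat assume r: "\<epsilon> * real n \<le> real r"
      let ?E = "Kn_edges n"
      note fin = finite_Kn[of n] and ne = Kn_ne[OF elim(4)]
      define r1 r2 where "r1 = r div 2" and "r2 = r - r div 2"
      have "real r \<le> 2 * real r1 + 1" "real r \<le> 2 * real r2" unfolding r1_def r2_def by linarith+
      then have r1: "\<epsilon> / 4 * real n \<le> real r1" and r2: "\<epsilon> * real n / 2 \<le> real r2"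
        using r elim(3) by linarith+
      have rr: "r = r1 + r2" by (simp add: r1_def r2_def)
      let ?u = "\<lambda>L. unc n K' (rel Kn_ends j (take m L)) (rel Kn_ends j L)"
      let ?b = "\<delta> * (real n)\<^sup>2 / 16"
      have tail: "2 ^ (n div K) * exp (- \<delta> * real r2 / 8) \<le> \<delta> / 4"
      proof -
        have "(2::real) ^ (n div K) \<le> exp 1 ^ (n div K)"
          using exp_ge_add_one_self[of 1] by (intro power_mono) auto
        also have "\<dots> = exp (real (n div K))" by (simp add: exp_of_nat_mult[symmetric])
        also have "real (n div K) \<le> real n / real K" by (rule of_nat_div_le_of_nat)
        also have "\<dots> \<le> real n / (1 / c)" using K c by (intro divide_left_mono) auto
        finally have "(2::real) ^ (n div K) \<le> exp (c * real n)" by (simp add: mult.commute)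
        moreover have "\<delta> * (\<epsilon> * real n / 2) \<le> \<delta> * real r2" using r2 \<delta> by (intro mult_left_mono) auto
        then have "exp (- \<delta> * real r2 / 8) \<le> exp (- 2 * c * real n)" by (simp add: c_def)
        ultimately have "2 ^ (n div K) * exp (- \<delta> * real r2 / 8) \<le> exp (c * real n) * exp (- 2 * c * real n)"
          by (intro mult_mono) auto
        also have "\<dots> = exp (- c * real n)" by (simp flip: exp_add)
        finally show ?thesis using elim(2) by linarith
      qed
      have inner: "av ?E r2 (\<lambda>l'. unc n K (rel Kn_ends (Suc j) (take m (L @ l'))) (rel Kn_ends (Suc j) (L @ l')))
         \<le> 3 * \<delta> / 4 * (real n)\<^sup>2 + (real n)\<^sup>2 * (if ?b \<le> ?u L then 1 else 0)"
        if L: "set L \<subseteq> ?E" "length L = m + r1" for L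
      proof (cases "?b \<le> ?u L")
        case True
        have "av ?E r2 (\<lambda>l'. unc n K (rel Kn_ends (Suc j) (take m (L @ l'))) (rel Kn_ends (Suc j) (L @ l'))) \<le> (real n)\<^sup>2"
          by (intro av_le fin ne unc_le)
        moreover have "0 \<le> 3 * \<delta> / 4 * (real n)\<^sup>2" using \<delta> by simp
        ultimately show ?thesis unfolding if_P[OF True] by linarith
      next
        case False
        have tk: "take m (L @ l') = take m L" for l' using L(2) by (simp only: take_append) simp
        have X: "\<delta> / 2 * X + X * (\<delta> / 4) = 3 * \<delta> / 4 * X" for X :: real by (simp add: field_simps)
        have "unc n K (rel Kn_ends (Suc j) (take m L)) (rel Kn_ends j L) \<le> ?u L"
          by (rule unc_antimono[OF K(1)]) (rule rel_Suc_le)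
        then have "unc n K (rel Kn_ends (Suc j) (take m L)) (rel Kn_ends j L) \<le> ?b" using False by linarith
        then have "av ?E r2 (\<lambda>l'. unc n K (rel Kn_ends (Suc j) (take m L)) (rel Kn_ends (Suc j) (L @ l')))
          \<le> \<delta> / 2 * (real n)\<^sup>2 + (real n)\<^sup>2 * (2 ^ (n div K) * exp (- \<delta> * real r2 / 8))"
          using L set_take_subset[of m L]
          by (intro sprinkle_step elim K \<delta>) (auto intro: prefix_imp_subseq take_is_prefix)
        also have "\<dots> \<le> \<delta> / 2 * (real n)\<^sup>2 + (real n)\<^sup>2 * (\<delta> / 4)"
          by (intro add_left_mono mult_left_mono tail) simp
        finally show ?thesis unfolding if_not_P[OF False] tk X by linarith
      qed
      have "av ?E (m + r) (\<lambda>L. unc n K (rel Kn_ends (Suc j) (take m L)) (rel Kn_ends (Suc j) L))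
         \<le> av ?E (m + r1) (\<lambda>L. 3 * \<delta> / 4 * (real n)\<^sup>2 + (real n)\<^sup>2 * (if ?b \<le> ?u L then 1 else 0))"
        unfolding rr add.assoc[symmetric] av_append[OF fin ne, of "m + r1"] by (intro av_mono inner)
      also have "\<dots> = 3 * \<delta> / 4 * (real n)\<^sup>2 + (real n)\<^sup>2 * av ?E (m + r1) (\<lambda>L. if ?b \<le> ?u L then 1 else 0)"
        by (simp only: av_add av_cmult av_const[OF fin ne])
      also have "av ?E (m + r1) (\<lambda>L. if ?b \<le> ?u L then 1 else 0) \<le> av ?E (m + r1) ?u / ?b"
        using elim \<delta> by (intro av_Markov fin ne unc_nonneg) auto
      also have "av ?E (m + r1) ?u / ?b \<le> (\<delta>\<^sup>2 / 64) * (real n)\<^sup>2 / ?b"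
        using elim(1) r1 \<delta> by (intro divide_right_mono) auto
      also have "\<dots> = \<delta> / 4" using elim(4) \<delta> by (simp add: field_simps power2_eq_square)
      finally have "av ?E (m + r) (\<lambda>L. unc n K (rel Kn_ends (Suc j) (take m L)) (rel Kn_ends (Suc j) L))
         \<le> 3 * \<delta> / 4 * (real n)\<^sup>2 + (real n)\<^sup>2 * (\<delta> / 4)"
        by (simp only: mult_left_mono add_left_mono zero_le_power2)
      also have "\<dots> = \<delta> * (real n)\<^sup>2" by (simp add: field_simps)
      finally show "av ?E (m + r) (\<lambda>L. unc n K (rel Kn_ends (Suc j) (take m L)) (rel Kn_ends (Suc j) L)) \<le> \<delta> * (real n)\<^sup>2" .
    qed
  qed
  then show ?case using K(2) by blast
qed

subsection \<open>The drift of the class size counts\<close>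

lemma card_diff_le:
  assumes "finite A" "finite B" "finite X" "A \<subseteq> B \<union> X" "B \<subseteq> A \<union> X"
  shows "\<bar>real (card A) - real (card B)\<bar> \<le> real (card X)"
proof -
  have "card A \<le> card B + card X" "card B \<le> card A + card X"
    using card_mono[OF _ assms(4)] card_mono[OF _ assms(5)] card_Un_le[of B X] card_Un_le[of A X] assms
    by (meson finite_UnI order_trans)+
  then show ?thesis by linarith
qed

lemma card_small_pairs:
  "card {(u, v). u < n \<and> v < n \<and> (R u v \<and> csz n R u \<le> s)} \<le> n * s"
proof -
  have "{(u, v). u < n \<and> v < n \<and> (R u v \<and> csz n R u \<le> s)}
      = (SIGMA u:{u. u < n \<and> csz n R u \<le> s}. {v. v < n \<and> R u v})" by auto
  then have "card {(u, v). u < n \<and> v < n \<and> (R u v \<and> csz n R u \<le> s)}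
      = (\<Sum>u\<in>{u. u < n \<and> csz n R u \<le> s}. csz n R u)"
    by (simp add: csz_def)
  also have "\<dots> \<le> (\<Sum>u\<in>{u. u < n \<and> csz n R u \<le> s}. s)" by (intro sum_mono) auto
  also have "\<dots> \<le> n * s"
  proof -
    have "card {u. u < n \<and> csz n R u \<le> s} \<le> card {..<n}" by (intro card_mono) auto
    then show ?thesis by simp
  qed
  finally show ?thesis .
qed

text \<open>If level \<open>j\<close> had one class containing exactly the vertices of
  \<open>B\<close>, the two counts would differ only by pairs already joined one level up. The error
  terms count pairs of \<open>B\<close> that \<open>R0\<close> keeps apart, pairs inside small
  classes of \<open>R0\<close>, and pairs joined by \<open>R1\<close>, whose classes are small by
  \<open>P\<close>.\<close>

lemma pairs_approx:
  fixes n K :: nat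
  assumes R0: "equivp R0"
    and P: "\<And>u v. u < n \<Longrightarrow> v < n \<Longrightarrow> P u v \<Longrightarrow> csz n R1 u \<le> s"
  defines "B \<equiv> {u. u < n \<and> K \<le> csz n R0 u}"
  shows "\<bar>real (card {(u, v). u < n \<and> v < n \<and> R0 u v \<and> \<not> R1 u v \<and> P u v})
     - real (card {(u, v). u \<in> B \<and> v \<in> B \<and> P u v})\<bar>
    \<le> unc n K R0 R0 + real n * real K + real n * real s"
proof -
  define X1 where "X1 = {(u, v). u < n \<and> v < n \<and> K \<le> csz n R0 u \<and> K \<le> csz n R0 v \<and> \<not> R0 u v}"
  define X2 where "X2 = {(u, v). u < n \<and> v < n \<and> (R0 u v \<and> csz n R0 u \<le> K)}"
  define X3 where "X3 = {(u, v). u < n \<and> v < n \<and> (R1 u v \<and> csz n R1 u \<le> s)}"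
  have fin: "finite X1" "finite X2" "finite X3" unfolding X1_def X2_def X3_def by (rule finite_pairs)+
  have same: "csz n R0 u = csz n R0 v" if "R0 u v" for u v using csz_cong[OF R0 that] .
  have "\<bar>real (card {(u, v). u < n \<and> v < n \<and> R0 u v \<and> \<not> R1 u v \<and> P u v})
     - real (card {(u, v). u \<in> B \<and> v \<in> B \<and> P u v})\<bar> \<le> real (card (X1 \<union> (X2 \<union> X3)))"
  proof (rule card_diff_le)
    show "finite {(u, v). u < n \<and> v < n \<and> R0 u v \<and> \<not> R1 u v \<and> P u v}" by (rule finite_pairs)
    show "finite {(u, v). u \<in> B \<and> v \<in> B \<and> P u v}"
      by (rule finite_subset[of _ "B \<times> B"]) (auto simp: B_def)
    show "finite (X1 \<union> (X2 \<union> X3))" using fin by simp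
    show "{(u, v). u < n \<and> v < n \<and> R0 u v \<and> \<not> R1 u v \<and> P u v}
       \<subseteq> {(u, v). u \<in> B \<and> v \<in> B \<and> P u v} \<union> (X1 \<union> (X2 \<union> X3))"
    proof
      fix x assume "x \<in> {(u, v). u < n \<and> v < n \<and> R0 u v \<and> \<not> R1 u v \<and> P u v}"
      then obtain u v where *: "x = (u, v)" "u < n" "v < n" "R0 u v" "P u v" by auto
      show "x \<in> {(u, v). u \<in> B \<and> v \<in> B \<and> P u v} \<union> (X1 \<union> (X2 \<union> X3))"
        using * same[of u v] by (cases "csz n R0 u \<le> K") (auto simp: X2_def B_def)
    qed
    show "{(u, v). u \<in> B \<and> v \<in> B \<and> P u v}
       \<subseteq> {(u, v). u < n \<and> v < n \<and> R0 u v \<and> \<not> R1 u v \<and> P u v} \<union> (X1 \<union> (X2 \<union> X3))"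
      using P by (auto simp: X1_def X3_def B_def)
  qed
  also have "card (X1 \<union> (X2 \<union> X3)) \<le> card X1 + (card X2 + card X3)"
    by (intro order_trans[OF card_Un_le] add_left_mono card_Un_le)
  then have "real (card (X1 \<union> (X2 \<union> X3))) \<le> real (card X1) + (real (card X2) + real (card X3))" by linarith
  also have "\<dots> \<le> unc n K R0 R0 + (real (n * K) + real (n * s))"
    unfolding X1_def X2_def X3_def unc_def
    by (intro add_mono of_nat_mono card_small_pairs order_refl)
  finally show ?thesis by simp
qed

section \<open>Size counts on the complete graph and their one-step change\<close>

definition rl :: "nat \<Rightarrow> (nat \<times> nat) list \<Rightarrow> nat \<Rightarrow> nat \<Rightarrow> bool" where
  "rl j l = rel Kn_ends j l"

lemma equivp_rl: "equivp (rl j l)"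
  unfolding rl_def by (rule equivp_rel)

lemma rl_Suc_snoc:
  "rl (Suc j) (l @ [e]) = (if rl j l (fst e) (snd e) then merge (rl (Suc j) l) (fst e) (snd e) else rl (Suc j) l)"
  unfolding rl_def by (rule rel_Suc_snoc[of Kn_ends e, OF Kn_ends_pair])

definition Ns :: "nat \<Rightarrow> nat \<Rightarrow> nat \<Rightarrow> (nat \<times> nat) list \<Rightarrow> real" where
  "Ns n j s l = Phi n (gsz s) (rl j l)"

definition Sm :: "nat \<Rightarrow> nat \<Rightarrow> nat \<Rightarrow> (nat \<times> nat) list \<Rightarrow> real" where
  "Sm n K j l = Phi n (gsm K) (rl j l)"

text \<open>Up to \<open>Dk\<close>, this is the number of vertices in a class of size \<open>a\<close> at level \<open>j + 1\<close> that lie in a large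
  class at level \<open>j\<close>; only these can be met by an edge reaching level \<open>j + 1\<close>.\<close>

definition Vt :: "nat \<Rightarrow> nat \<Rightarrow> nat \<Rightarrow> nat \<Rightarrow> (nat \<times> nat) list \<Rightarrow> real" where
  "Vt n K j a l = Ns n (Suc j) a l - (if a = 1 then Sm n K j l else 0)"

text \<open>The exceptional vertices: in a small class at level \<open>j\<close>, yet not isolated
  at level \<open>j + 1\<close>. Apart from them all vertices of small classes are singletons one
  level up, which is why \<open>Vt\<close> subtracts \<open>Sm\<close> at size 1 only.\<close>

definition Dk :: "nat \<Rightarrow> nat \<Rightarrow> nat \<Rightarrow> (nat \<times> nat) list \<Rightarrow> real" where
  "Dk n K j l = real (card {u. u < n \<and> csz n (rl j l) u < K \<and> 2 \<le> csz n (rl (Suc j) l) u})"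

lemma Ns_card: "Ns n j s l = real (card {u. u < n \<and> csz n (rl j l) u = s})"
proof -
  have "Ns n j s l = (\<Sum>u\<in>{u \<in> {..<n}. csz n (rl j l) u = s}. 1)"
    unfolding Ns_def Phi_def gsz_def by (rule sum.inter_filter[symmetric]) simp
  then show ?thesis by simp
qed

lemma Sm_card: "Sm n K j l = real (card {u. u < n \<and> csz n (rl j l) u < K})"
proof -
  have "Sm n K j l = (\<Sum>u\<in>{u \<in> {..<n}. csz n (rl j l) u < K}. 1)"
    unfolding Sm_def Phi_def gsm_def by (rule sum.inter_filter[symmetric]) simp
  then show ?thesis by simp
qed

lemma card_le_n: "card {u. u < n \<and> P u} \<le> n" for n :: nat
proof -
  have "card {u. u < n \<and> P u} \<le> card {..<n}" by (intro card_mono) auto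
  then show ?thesis by simp
qed

lemma Ns_bounds: "0 \<le> Ns n j s l" "Ns n j s l \<le> real n"
  unfolding Ns_card by (simp_all add: card_le_n)

lemma Sm_bounds: "0 \<le> Sm n K j l" "Sm n K j l \<le> real n"
  unfolding Sm_card by (simp_all add: card_le_n)

lemma Vt_bound: "\<bar>Vt n K j a l\<bar> \<le> real n"
  using Ns_bounds[of n "Suc j" a l] Sm_bounds[of n K j l] by (auto simp: Vt_def abs_le_iff)

lemma Dk_bounds: "0 \<le> Dk n K j l" "Dk n K j l \<le> real n"
  unfolding Dk_def by (simp_all add: card_le_n)

text \<open>The purpose of a threshold \<open>K\<close> that does not grow with \<open>n\<close>:
  the fraction of small vertices is a finite sum of size densities and inherits their
  convergence.\<close>

lemma Sm_sum: "Sm n K j l = (\<Sum>s\<in>{..<K}. Ns n j s l)"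
proof -
  have "(\<Sum>s\<in>{..<K}. Ns n j s l) = (\<Sum>u<n. \<Sum>s\<in>{..<K}. gsz s (csz n (rl j l) u))"
    unfolding Ns_def Phi_def by (rule sum.swap)
  also have "\<dots> = Sm n K j l"
    unfolding Sm_def Phi_def gsz_def gsm_def by (intro sum.cong refl) (simp add: sum.delta')
  finally show ?thesis ..
qed

lemma Ns_step:
  fixes n j :: nat and l :: "(nat \<times> nat) list"
  assumes "e \<in> Kn_edges n"
  defines "a \<equiv> csz n (rl (Suc j) l)"
  shows "Ns n (Suc j) s (l @ [e]) - Ns n (Suc j) s l =
    (if rl j l (fst e) (snd e) \<and> \<not> rl (Suc j) l (fst e) (snd e)
     then real s * (of_bool (a (fst e) + a (snd e) = s) - of_bool (a (fst e) = s) - of_bool (a (snd e) = s)) else 0)"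
proof -
  have n: "fst e < n" "snd e < n" using assms by (auto simp: Kn_edges_def)
  show ?thesis
  proof (cases "rl j l (fst e) (snd e) \<and> \<not> rl (Suc j) l (fst e) (snd e)")
    case True
    then show ?thesis
      using Phi_merge[OF equivp_rl, of "Suc j" l "fst e" "snd e" n "gsz s"] n
      unfolding Ns_def rl_Suc_snoc a_def by (auto simp: gsz_def algebra_simps)
  next
    case False
    then show ?thesis unfolding Ns_def rl_Suc_snoc by (auto simp: merge_same[OF equivp_rl])
  qed
qed

lemma card_cmult_sum: "(\<Sum>x\<in>{(u, v). P u v}. of_bool (Q (fst x) (snd x))) = real (card {(u, v). P u v \<and> Q u v})"
  if "finite {(u, v). P u v}"
proof -
  have "(\<Sum>x\<in>{(u, v). P u v}. of_bool (Q (fst x) (snd x))) = (\<Sum>x\<in>{x \<in> {(u, v). P u v}. Q (fst x) (snd x)}. (1::real))"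
    unfolding of_bool_def by (rule sum.inter_filter[symmetric, OF that])
  also have "{x \<in> {(u, v). P u v}. Q (fst x) (snd x)} = {(u, v). P u v \<and> Q u v}" by auto
  finally show ?thesis by simp
qed

text \<open>Coagulation: a pair of large vertices with class sizes a and s - a creates a class of s
  vertices, and a large vertex of class size s destroys one by meeting any large vertex. The factor
  s counts vertices per class, the factor 1 / 2 passes from ordered pairs to edges. The errors are
  those of \<open>pairs_approx\<close> and the replacement of exact counts by
  \<open>Vt\<close>.\<close>

lemma step_det:
  fixes n K j s :: nat
  assumes s: "1 \<le> s"
  defines "T \<equiv> \<lambda>l. (\<Sum>a\<in>{1..<s}. Vt n K j a l * Vt n K j (s - a) l) - 2 * (Vt n K j s l * (real n - Sm n K j l))"
  shows "\<bar>(\<Sum>e\<in>Kn_edges n. Ns n (Suc j) s (l @ [e]) - Ns n (Suc j) s l) - real s / 2 * T l\<bar>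
    \<le> 3 * (real s)\<^sup>2 * (unc n K (rl j l) (rl j l) + real n * real K + real n * real s + real n * Dk n K j l)"
proof -
  define R0 R1 where "R0 = rl j l" and "R1 = rl (Suc j) l"
  define a where "a = csz n R1"
  define B where "B = {u. u < n \<and> K \<le> csz n R0 u}"
  define V where "V i = {u \<in> B. a u = i}" for i
  define err where "err = unc n K R0 R0 + real n * real K + real n * real s"
  have R0: "equivp R0" and R1: "equivp R1" unfolding R0_def R1_def by (rule equivp_rl)+
  have finB: "finite B" "finite (V i)" for i by (auto simp: B_def V_def)
  define G where "G = real (card {(u, v). u < n \<and> v < n \<and> R0 u v \<and> \<not> R1 u v \<and> a u + a v = s})"
  define L where "L = real (card {(u, v). u < n \<and> v < n \<and> R0 u v \<and> \<not> R1 u v \<and> a u = s})"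
  define h where "h u v = (if R0 u v \<and> \<not> R1 u v
     then real s * (of_bool (a u + a v = s) - of_bool (a u = s) - of_bool (a v = s)) else 0)" for u v
  have sym0: "R0 u v \<longleftrightarrow> R0 v u" and sym1: "R1 u v \<longleftrightarrow> R1 v u" for u v
    using equivp_symp[OF R0] equivp_symp[OF R1] by blast+
  have hsym: "h u v = h v u" for u v
    unfolding h_def using sym0[of u v] sym1[of u v] by (auto simp: add.commute)
  have "(\<Sum>e\<in>Kn_edges n. Ns n (Suc j) s (l @ [e]) - Ns n (Suc j) s l) = (\<Sum>e\<in>Kn_edges n. h (fst e) (snd e))"
    by (intro sum.cong refl) (simp add: Ns_step h_def R0_def R1_def a_def)
  also have "\<dots> = (\<Sum>(u, v) | u < n \<and> v < n \<and> u \<noteq> v. h u v) / 2"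
    using sum_Kn_sym[of h n] hsym by simp
  also have "(\<Sum>(u, v) | u < n \<and> v < n \<and> u \<noteq> v. h u v)
      = (\<Sum>(u, v) | u < n \<and> v < n \<and> R0 u v \<and> \<not> R1 u v. h u v)"
    by (rule sum.mono_neutral_right) (auto simp: finite_pairs h_def equivp_reflp[OF R1] split: if_splits)
  also have "\<dots> = (\<Sum>x | case x of (u, v) \<Rightarrow> u < n \<and> v < n \<and> R0 u v \<and> \<not> R1 u v.
      real s * (of_bool (a (fst x) + a (snd x) = s) - of_bool (a (fst x) = s) - of_bool (a (snd x) = s)))"
    by (rule sum.cong) (auto simp: h_def)
  also have "\<dots> = real s * (G - L - real (card {(u, v). (u < n \<and> v < n \<and> R0 u v \<and> \<not> R1 u v) \<and> a v = s}))"
    unfolding sum_distrib_left[symmetric] sum_subtractf G_def L_def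
    by (subst (1 2 3) card_cmult_sum) (auto simp: finite_pairs)
  also have "card {(u, v). (u < n \<and> v < n \<and> R0 u v \<and> \<not> R1 u v) \<and> a v = s}
      = card (prod.swap ` {(u, v). u < n \<and> v < n \<and> R0 u v \<and> \<not> R1 u v \<and> a u = s})"
    using sym0 sym1 by (intro arg_cong[where f = card]) (auto simp: image_iff)
  also have "\<dots> = card {(u, v). u < n \<and> v < n \<and> R0 u v \<and> \<not> R1 u v \<and> a u = s}"
    by (rule card_image) simp
  finally have main: "(\<Sum>e\<in>Kn_edges n. Ns n (Suc j) s (l @ [e]) - Ns n (Suc j) s l) = real s / 2 * (G - 2 * L)"
    unfolding L_def[symmetric] by simp
  have apos: "0 < a u" if "u < n" for u unfolding a_def using csz_pos[OF R1 that] .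
  \<comment> \<open>\<open>G\<close> and \<open>L\<close> are the gain and loss pairs; both
    conditions bound the class size of the first vertex by \<open>s\<close>, as
    \<open>pairs_approx\<close> demands.\<close>
  have G1: "\<bar>G - real (card {(u, v). u \<in> B \<and> v \<in> B \<and> a u + a v = s})\<bar> \<le> err"
    unfolding G_def err_def B_def by (rule pairs_approx[OF R0]) (auto simp: a_def)
  have L1: "\<bar>L - real (card {(u, v). u \<in> B \<and> v \<in> B \<and> a u = s})\<bar> \<le> err"
    unfolding L_def err_def B_def by (rule pairs_approx[OF R0]) (auto simp: a_def)
  have "{(u, v). u \<in> B \<and> v \<in> B \<and> a u = s} = V s \<times> B" by (auto simp: V_def)
  then have L2: "real (card {(u, v). u \<in> B \<and> v \<in> B \<and> a u = s}) = real (card (V s)) * real (card B)"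
    by (simp add: card_cartesian_product)
  have "{(u, v). u \<in> B \<and> v \<in> B \<and> a u + a v = s} = (\<Union>i\<in>{1..<s}. V i \<times> V (s - i))"
  proof (intro set_eqI iffI)
    fix x assume "x \<in> {(u, v). u \<in> B \<and> v \<in> B \<and> a u + a v = s}"
    then obtain u v where x: "x = (u, v)" "u \<in> B" "v \<in> B" "a u + a v = s" by auto
    then have "0 < a u" "0 < a v" using apos by (auto simp: B_def)
    then show "x \<in> (\<Union>i\<in>{1..<s}. V i \<times> V (s - i))" using x by (auto simp: V_def intro!: bexI[of _ "a u"])
  qed (auto simp: V_def)
  then have G2: "real (card {(u, v). u \<in> B \<and> v \<in> B \<and> a u + a v = s})
      = (\<Sum>i\<in>{1..<s}. real (card (V i)) * real (card (V (s - i))))"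
    by (simp only:) (subst card_UN_disjoint, auto simp: finB V_def card_cartesian_product)
  have B: "real (card B) = real n - Sm n K j l"
  proof -
    have "B = {..<n} - {u. u < n \<and> csz n R0 u < K}" by (auto simp: B_def)
    then have "card B = n - card {u. u < n \<and> csz n R0 u < K}"
      by (simp add: card_Diff_subset Collect_mono subset_iff)
    then show ?thesis unfolding Sm_card R0_def by (simp add: of_nat_diff card_le_n)
  qed
  \<comment> \<open>For i > 1 the vertices outside \<open>B\<close> that are counted by
    \<open>Ns\<close> are exceptional. For i = 1 the subtraction of \<open>Sm\<close> removes them
    all, including exceptional ones that \<open>Ns\<close> did not count. Either way the discrepancy
    is at most \<open>Dk\<close>.\<close>
  have VV: "\<bar>real (card (V i)) - Vt n K j i l\<bar> \<le> Dk n K j l" if i: "1 \<le> i" for i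
  proof -
    have N: "{u. u < n \<and> csz n R1 u = i} = V i \<union> {u. u < n \<and> csz n R0 u < K \<and> a u = i}"
      by (auto simp: V_def B_def a_def)
    have "Ns n (Suc j) i l = real (card (V i)) + real (card {u. u < n \<and> csz n R0 u < K \<and> a u = i})"
      unfolding Ns_card R1_def[symmetric] N by (subst card_Un_disjoint) (auto simp: V_def B_def)
    then have N': "real (card (V i)) = Ns n (Suc j) i l - real (card {u. u < n \<and> csz n R0 u < K \<and> a u = i})" by simp
    show ?thesis
    proof (cases "i = 1")
      case False
      have "card {u. u < n \<and> csz n R0 u < K \<and> a u = i} \<le> card {u. u < n \<and> csz n R0 u < K \<and> 2 \<le> a u}"
        using i False by (intro card_mono) auto
      then show ?thesis using False unfolding N' Vt_def Dk_def R0_def R1_def a_def by simp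
    next
      case True
      have S: "{u. u < n \<and> csz n R0 u < K}
         = {u. u < n \<and> csz n R0 u < K \<and> a u = i} \<union> {u. u < n \<and> csz n R0 u < K \<and> 2 \<le> a u}"
        using apos True by (auto simp: numeral_2_eq_2 Suc_le_eq) (metis Suc_lessI)
      have "Sm n K j l = real (card {u. u < n \<and> csz n R0 u < K \<and> a u = i}) + Dk n K j l"
        unfolding Sm_card Dk_def R0_def[symmetric] R1_def[symmetric] a_def[symmetric] S
        using True by (subst card_Un_disjoint) auto
      then show ?thesis using True Dk_bounds(1)[of n K j l] unfolding N' Vt_def by simp
    qed
  qed
  have cV: "\<bar>real (card (V i))\<bar> \<le> real n" for i
    using card_mono[of "{..<n}" "V i"] by (auto simp: V_def B_def)
  have cB: "\<bar>real (card B)\<bar> \<le> real n"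
    using card_mono[of "{..<n}" B] by (auto simp: B_def)
  have prod: "\<bar>x * y - x' * y'\<bar> \<le> 2 * real n * d"
    if "\<bar>x - x'\<bar> \<le> d" "\<bar>y - y'\<bar> \<le> d" "\<bar>x\<bar> \<le> real n" "\<bar>y'\<bar> \<le> real n" for x y x' y' d
  proof -
    have "x * y - x' * y' = x * (y - y') + (x - x') * y'" by (simp add: algebra_simps)
    also have "\<bar>\<dots>\<bar> \<le> \<bar>x\<bar> * \<bar>y - y'\<bar> + \<bar>x - x'\<bar> * \<bar>y'\<bar>" by (metis abs_mult abs_triangle_ineq)
    also have "\<dots> \<le> real n * d + d * real n" using that by (intro add_mono mult_mono) auto
    finally show ?thesis by (simp add: algebra_simps)
  qed
  have G3: "\<bar>(\<Sum>i\<in>{1..<s}. real (card (V i)) * real (card (V (s - i)))) - (\<Sum>i\<in>{1..<s}. Vt n K j i l * Vt n K j (s - i) l)\<bar>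
      \<le> real s * (2 * real n * Dk n K j l)"
  proof -
    have "\<bar>(\<Sum>i\<in>{1..<s}. real (card (V i)) * real (card (V (s - i)))) - (\<Sum>i\<in>{1..<s}. Vt n K j i l * Vt n K j (s - i) l)\<bar>
       \<le> (\<Sum>i\<in>{1..<s}. 2 * real n * Dk n K j l)"
      unfolding sum_subtractf[symmetric]
      by (intro order_trans[OF sum_abs] sum_mono prod VV cV Vt_bound) auto
    also have "\<dots> \<le> real s * (2 * real n * Dk n K j l)"
      using Dk_bounds(1)[of n K j l] by (simp add: mult_right_mono)
    finally show ?thesis .
  qed
  have L3: "\<bar>real (card (V s)) * real (card B) - Vt n K j s l * (real n - Sm n K j l)\<bar> \<le> 2 * real n * Dk n K j l"
    unfolding B[symmetric] using Dk_bounds(1)[of n K j l]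
    by (intro prod VV s cV cB) simp
  have err0: "0 \<le> err" unfolding err_def by (simp add: unc_nonneg)
  have D0: "0 \<le> real n * Dk n K j l" using Dk_bounds(1) by simp
  have "\<bar>(G - 2 * L) - T l\<bar> \<le> 3 * err + (2 * real s + 4) * (real n * Dk n K j l)"
    using G1 L1 G3 L3 unfolding G2 L2 T_def by (simp add: algebra_simps abs_le_iff)
  then have "real s / 2 * \<bar>(G - 2 * L) - T l\<bar> \<le> real s / 2 * (3 * err + (2 * real s + 4) * (real n * Dk n K j l))"
    by (intro mult_left_mono) auto
  also have "\<dots> \<le> real s / 2 * (4 * real s * err + 4 * real s * (real n * Dk n K j l) + 2 * real s * (real n * Dk n K j l))"
  proof (intro mult_left_mono)
    have "3 * err \<le> 4 * real s * err" "(2 * real s + 4) * (real n * Dk n K j l) \<le> (6 * real s) * (real n * Dk n K j l)"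
      using s err0 D0 by (intro mult_right_mono; simp)+
    then show "3 * err + (2 * real s + 4) * (real n * Dk n K j l)
       \<le> 4 * real s * err + 4 * real s * (real n * Dk n K j l) + 2 * real s * (real n * Dk n K j l)"
      by (simp add: algebra_simps)
  qed simp
  also have "\<dots> = 2 * (real s)\<^sup>2 * err + 3 * (real s)\<^sup>2 * (real n * Dk n K j l)"
    by (simp add: power2_eq_square algebra_simps)
  finally have "\<bar>real s / 2 * (G - 2 * L) - real s / 2 * T l\<bar> \<le> 2 * (real s)\<^sup>2 * err + 3 * (real s)\<^sup>2 * (real n * Dk n K j l)"
    unfolding right_diff_distrib[symmetric] abs_mult by simp
  also have "\<dots> \<le> 3 * (real s)\<^sup>2 * err + 3 * (real s)\<^sup>2 * (real n * Dk n K j l)"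
    using err0 by (intro add_right_mono mult_right_mono) auto
  finally show ?thesis unfolding main err_def R0_def by (simp add: algebra_simps)
qed

lemma rl_snoc_ge: "rl j l u v \<Longrightarrow> rl j (l @ [e]) u v"
  unfolding rl_def by (rule rel_snoc_ge[of _ _ _ _ _ e, OF _ Kn_ends_pair])

lemma csz_one: "equivp R \<Longrightarrow> u < n \<Longrightarrow> v < n \<Longrightarrow> R u v \<Longrightarrow> csz n R u \<le> 1 \<Longrightarrow> v = u"
proof (rule ccontr)
  assume R: "equivp R" and uv: "u < n" "v < n" "R u v" "csz n R u \<le> 1" and ne: "v \<noteq> u"
  have "{u, v} \<subseteq> {w. w < n \<and> R u w}" using R uv by (auto simp: equivp_reflp)
  then have "card {u, v} \<le> csz n R u" unfolding csz_def by (intro card_mono) auto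
  then show False using ne uv by simp
qed

text \<open>Classes never shrink, so a newly exceptional vertex was small before and was isolated
  one level up. It must therefore be an end of the new edge, and this edge lies inside a small class
  of level \<open>j\<close>.\<close>

lemma Dk_step:
  assumes e: "e \<in> Kn_edges n"
  shows "Dk n K j (l @ [e]) \<le> Dk n K j l +
    2 * of_bool (rl j l (fst e) (snd e) \<and> csz n (rl j l) (fst e) \<le> K)"
proof -
  let ?C = "rl j l (fst e) (snd e) \<and> csz n (rl j l) (fst e) \<le> K"
  define X where "X = (if ?C then {fst e, snd e} else {})"
  have n: "fst e < n" "snd e < n" using e by (auto simp: Kn_edges_def)
  have "{u. u < n \<and> csz n (rl j (l @ [e])) u < K \<and> 2 \<le> csz n (rl (Suc j) (l @ [e])) u}
    \<subseteq> {u. u < n \<and> csz n (rl j l) u < K \<and> 2 \<le> csz n (rl (Suc j) l) u} \<union> X"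
  proof
    fix u assume "u \<in> {u. u < n \<and> csz n (rl j (l @ [e])) u < K \<and> 2 \<le> csz n (rl (Suc j) (l @ [e])) u}"
    then have u: "u < n" "csz n (rl j (l @ [e])) u < K" "2 \<le> csz n (rl (Suc j) (l @ [e])) u" by auto
    have "csz n (rl j l) u \<le> csz n (rl j (l @ [e])) u" by (rule csz_mono) (rule rl_snoc_ge)
    then have K: "csz n (rl j l) u < K" using u by simp
    show "u \<in> {u. u < n \<and> csz n (rl j l) u < K \<and> 2 \<le> csz n (rl (Suc j) l) u} \<union> X"
    proof (cases "2 \<le> csz n (rl (Suc j) l) u")
      case False
      then have 1: "csz n (rl (Suc j) l) u \<le> 1" by simp
      have ne: "rl (Suc j) (l @ [e]) \<noteq> rl (Suc j) l" using u(3) False by auto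
      then have j: "rl j l (fst e) (snd e)" by (auto simp: rl_Suc_snoc split: if_splits)
      then have m: "rl (Suc j) (l @ [e]) = merge (rl (Suc j) l) (fst e) (snd e)" by (simp add: rl_Suc_snoc)
      then have "\<not> rl (Suc j) l (fst e) (snd e)" using ne merge_same[OF equivp_rl] by metis
      then have "rl (Suc j) l u (fst e) \<or> rl (Suc j) l u (snd e)"
        using u(3) False csz_merge[OF equivp_rl _ n] unfolding m by metis
      then have "u = fst e \<or> u = snd e"
        using csz_one[OF equivp_rl u(1) n(1) _ 1] csz_one[OF equivp_rl u(1) n(2) _ 1] by metis
      moreover have "csz n (rl j l) (fst e) = csz n (rl j l) (snd e)" by (rule csz_cong[OF equivp_rl j])
      ultimately show ?thesis using j K by (auto simp: X_def)
    qed (use u K in auto)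
  qed
  then have "card {u. u < n \<and> csz n (rl j (l @ [e])) u < K \<and> 2 \<le> csz n (rl (Suc j) (l @ [e])) u}
    \<le> card ({u. u < n \<and> csz n (rl j l) u < K \<and> 2 \<le> csz n (rl (Suc j) l) u} \<union> X)"
    by (rule card_mono[rotated]) (auto simp: X_def)
  also have "\<dots> \<le> card {u. u < n \<and> csz n (rl j l) u < K \<and> 2 \<le> csz n (rl (Suc j) l) u} + card X"
    by (rule card_Un_le)
  also have "card X \<le> 2 * of_bool ?C" unfolding X_def by (auto simp: card_insert_if)
  finally have "card {u. u < n \<and> csz n (rl j (l @ [e])) u < K \<and> 2 \<le> csz n (rl (Suc j) (l @ [e])) u}
    \<le> card {u. u < n \<and> csz n (rl j l) u < K \<and> 2 \<le> csz n (rl (Suc j) l) u} + 2 * of_bool ?C" by simp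
  from of_nat_mono[OF this, where 'a = real] show ?thesis unfolding Dk_def by simp
qed

text \<open>At most \<open>n * K\<close> edges lie inside small classes, so a random edge creates
  O(K / n) exceptional vertices on average; over O(n) steps their number stays bounded.\<close>

lemma Dk_av:
  assumes n: "2 \<le> n"
  shows "av (Kn_edges n) m (Dk n K j) \<le> 4 * real K * real m / (real n - 1)"
proof (induction m)
  case 0
  have "Dk n K j [] = 0"
  proof -
    have r: "rl (Suc j) [] = (=)" by (simp add: rl_def conn_empty)
    have "csz n (rl (Suc j) []) u \<le> 1" for u
    proof -
      have "csz n (rl (Suc j) []) u \<le> card {u}" unfolding csz_def r by (intro card_mono) auto
      then show ?thesis by simp
    qed
    then have "\<not> 2 \<le> csz n (rl (Suc j) []) u" for u by (metis Suc_1 not_less_eq_eq)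
    then show ?thesis unfolding Dk_def by simp
  qed
  then show ?case by simp
next
  case (Suc m)
  let ?E = "Kn_edges n"
  note fin = finite_Kn[of n] and ne = Kn_ne[OF n]
  have cE0: "0 < real (card ?E)" by (rule cardE[OF fin ne])
  have "(\<Sum>e\<in>?E. Dk n K j (l @ [e])) / card ?E \<le> Dk n K j l + 4 * real K / (real n - 1)" for l
  proof -
    have "(\<Sum>e\<in>?E. Dk n K j (l @ [e])) \<le> (\<Sum>e\<in>?E. Dk n K j l + 2 * of_bool (rl j l (fst e) (snd e) \<and> csz n (rl j l) (fst e) \<le> K))"
      by (intro sum_mono Dk_step)
    also have "\<dots> = card ?E * Dk n K j l + 2 * (\<Sum>e\<in>?E. of_bool (rl j l (fst e) (snd e) \<and> csz n (rl j l) (fst e) \<le> K))"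
      by (simp add: sum.distrib sum_distrib_left)
    also have "(\<Sum>e\<in>?E. of_bool (rl j l (fst e) (snd e) \<and> csz n (rl j l) (fst e) \<le> K))
       = real (card {e \<in> ?E. rl j l (fst e) (snd e) \<and> csz n (rl j l) (fst e) \<le> K})"
      unfolding of_bool_def by (subst sum.inter_filter[OF fin, symmetric]) simp
    also have "card {e \<in> ?E. rl j l (fst e) (snd e) \<and> csz n (rl j l) (fst e) \<le> K}
       \<le> card {(u, v). u < n \<and> v < n \<and> (rl j l u v \<and> csz n (rl j l) u \<le> K)}"
      by (rule card_mono[OF finite_pairs]) (auto simp: Kn_edges_def)
    also have "\<dots> \<le> n * K" by (rule card_small_pairs)
    finally have "(\<Sum>e\<in>?E. Dk n K j (l @ [e])) \<le> card ?E * Dk n K j l + 2 * real (n * K)" by simp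
    then have "(\<Sum>e\<in>?E. Dk n K j (l @ [e])) / card ?E \<le> (card ?E * Dk n K j l + 2 * real (n * K)) / card ?E"
      using cE0 by (intro divide_right_mono) auto
    also have "\<dots> = Dk n K j l + 2 * real (n * K) / card ?E" using cE0 by (simp add: add_divide_distrib)
    also have "2 * real (n * K) / card ?E = 4 * real K / (real n - 1)"
      unfolding card_Kn using n by (simp add: field_simps)
    finally show ?thesis .
  qed
  then have "av ?E (Suc m) (Dk n K j) \<le> av ?E m (\<lambda>l. Dk n K j l + 4 * real K / (real n - 1))"
    unfolding av.simps by (rule av_mono)
  also have "\<dots> = av ?E m (Dk n K j) + 4 * real K / (real n - 1)"
    by (simp only: av_add av_const[OF fin ne])
  finally show ?case using Suc by (simp add: algebra_simps add_divide_distrib)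
qed

lemma ins_mid: "ins (x @ y) (x @ d # y)"
  unfolding ins_def by blast

lemma Phi_replace:
  assumes "\<forall>e\<in>E. good n Kn_ends e" "mbound g c" "set x \<subseteq> E" "set y \<subseteq> E" "e \<in> E" "e' \<in> E"
  shows "\<bar>Phi n g (rl j (x @ e # y)) - Phi n g (rl j (x @ e' # y))\<bar> \<le> 2 * c"
proof -
  have "\<bar>Phi n g (rl j (x @ d # y)) - Phi n g (rl j (x @ y))\<bar> \<le> c" if "d \<in> E" for d
    unfolding rl_def using assms that by (intro Phi_ins[OF assms(2) ins_mid]) auto
  from this[OF assms(5)] this[OF assms(6)] show ?thesis by linarith
qed

section \<open>Normalized means and their approximate difference equation\<close>

text \<open>The length of the word acts as discrete time, with n steps per unit.\<close>

definition zz :: "nat \<Rightarrow> nat \<Rightarrow> nat \<Rightarrow> nat \<Rightarrow> real" where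
  "zz n j s m = av (Kn_edges n) m (Ns n j s) / real n"

definition sm :: "nat \<Rightarrow> nat \<Rightarrow> nat \<Rightarrow> nat \<Rightarrow> real" where
  "sm n K j m = av (Kn_edges n) m (Sm n K j) / real n"

definition vt :: "nat \<Rightarrow> nat \<Rightarrow> nat \<Rightarrow> nat \<Rightarrow> nat \<Rightarrow> real" where
  "vt n K j a m = zz n (Suc j) a m - (if a = 1 then sm n K j m else 0)"

definition uu :: "nat \<Rightarrow> nat \<Rightarrow> nat \<Rightarrow> nat \<Rightarrow> real" where
  "uu n K j m = av (Kn_edges n) m (\<lambda>l. unc n K (rl j l) (rl j l)) / (real n)\<^sup>2"

lemma vt_av: "av (Kn_edges n) m (Vt n K j a) = real n * vt n K j a m" if "0 < n"
proof -
  have V: "Vt n K j a = (\<lambda>l. Ns n (Suc j) a l - (if a = 1 then 1 else 0) * Sm n K j l)"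
    by (auto simp: Vt_def fun_eq_iff)
  show ?thesis unfolding V vt_def zz_def sm_def av_diff av_cmult using that by (simp add: algebra_simps)
qed

text \<open>\<open>step_det\<close> averaged. The quadratic terms close because \<open>Vt\<close>
  and \<open>Sm\<close> have bounded differences, hence variance O(m), so that means of products are
  products of means up to O(m) against a main term of order n squared. Dividing the factor s / 2 by
  the number of edges gives the coefficient s at leading order.\<close>

lemma step_av:
  fixes n j s K m :: nat
  assumes n: "2 \<le> n" and s: "1 \<le> s"
  defines "C \<equiv> 12 * (real s)\<^sup>2 * (real K + real s) + 48 * (real s)\<^sup>2 * real K + real s * (real s + 2)
     + real s * (real s + 2) * (4 * real s + 4 * real K)\<^sup>2"
  shows "\<bar>zz n (Suc j) s (Suc m) - zz n (Suc j) s m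
     - (1 / real n) * (real s * ((\<Sum>a\<in>{1..<s}. vt n K j a m * vt n K j (s - a) m) - 2 * (vt n K j s m * (1 - sm n K j m))))\<bar>
   \<le> (1 / real n) * (12 * (real s)\<^sup>2 * uu n K j m + C * (1 + real m / real n) / (real n - 1))"
proof -
  let ?E = "Kn_edges n"
  let ?N = "real (card ?E)"
  note fin = finite_Kn[of n] and ne = Kn_ne[OF n]
  have cE0: "0 < ?N" by (rule cardE[OF fin ne])
  have N: "?N = real n * (real n - 1) / 2" by (rule card_Kn)
  have n1: "1 \<le> real n - 1" "0 < real n" using n by auto
  define T where "T l = (\<Sum>a\<in>{1..<s}. Vt n K j a l * Vt n K j (s - a) l) - 2 * (Vt n K j s l * (real n - Sm n K j l))" for l
  define \<tau> where "\<tau> = (\<Sum>a\<in>{1..<s}. vt n K j a m * vt n K j (s - a) m) - 2 * (vt n K j s m * (1 - sm n K j m))"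
  define D where "D l = (\<Sum>e\<in>?E. Ns n (Suc j) s (l @ [e]) - Ns n (Suc j) s l)" for l
  define err where "err l = 3 * (real s)\<^sup>2 * (unc n K (rl j l) (rl j l) + (real n * real K + real n * real s) + real n * Dk n K j l)" for l
  have D: "\<bar>D l - real s / 2 * T l\<bar> \<le> err l" for l
    using step_det[OF s, of n j l K] unfolding D_def T_def err_def by (simp add: algebra_simps)
  have "av ?E (Suc m) (Ns n (Suc j) s) = av ?E m (\<lambda>l. Ns n (Suc j) s l + (1 / ?N) * D l)"
    unfolding av.simps D_def using cE0 by (intro av_cong) (simp add: sum_subtractf field_simps)
  then have 1: "av ?E (Suc m) (Ns n (Suc j) s) - av ?E m (Ns n (Suc j) s) = (1 / ?N) * av ?E m D"
    by (simp only: av_add av_cmult)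
  have "\<bar>av ?E m D - real s / 2 * av ?E m T\<bar> = \<bar>av ?E m (\<lambda>l. D l - real s / 2 * T l)\<bar>"
    by (simp only: av_diff av_cmult)
  also have "\<dots> \<le> av ?E m err" by (intro order_trans[OF av_abs[OF fin ne]] av_mono D)
  also have "\<dots> = 3 * (real s)\<^sup>2 * ((real n)\<^sup>2 * uu n K j m + (real n * real K + real n * real s) + real n * av ?E m (Dk n K j))"
    unfolding err_def av_cmult av_add av_const[OF fin ne] uu_def using n1 by simp
  also have "\<dots> \<le> 3 * (real s)\<^sup>2 * ((real n)\<^sup>2 * uu n K j m + (real n * real K + real n * real s) + real n * (4 * real K * real m / (real n - 1)))"
    by (intro mult_left_mono add_left_mono Dk_av n) auto
  finally have 2: "\<bar>av ?E m D - real s / 2 * av ?E m T\<bar> \<le> 3 * (real s)\<^sup>2 * ((real n)\<^sup>2 * uu n K j m + (real n * real K + real n * real s) + real n * (4 * real K * real m / (real n - 1)))" .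
  define c where "c = 4 * real s + 4 * real K"
  have vV: "av ?E m (\<lambda>l. (Vt n K j a l - av ?E m (Vt n K j a))\<^sup>2) \<le> real m * c\<^sup>2" if a: "a \<le> s" for a
  proof (rule av_variance[OF fin ne])
    fix x y e e' assume *: "set x \<subseteq> ?E" "set y \<subseteq> ?E" "e \<in> ?E" "e' \<in> ?E"
    have "\<bar>Ns n (Suc j) a (x @ e # y) - Ns n (Suc j) a (x @ e' # y)\<bar> \<le> 2 * (2 * real a)"
      unfolding Ns_def by (rule Phi_replace[OF _ mbound_gsz *]) (simp add: good_Kn)
    moreover have "\<bar>Sm n K j (x @ e # y) - Sm n K j (x @ e' # y)\<bar> \<le> 2 * (2 * real K)"
      unfolding Sm_def by (rule Phi_replace[OF _ mbound_gsm *]) (simp add: good_Kn)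
    ultimately show "\<bar>Vt n K j a (x @ e # y) - Vt n K j a (x @ e' # y)\<bar> \<le> c"
      using a unfolding Vt_def c_def by (auto simp: abs_le_iff)
  qed
  have vS: "av ?E m (\<lambda>l. ((real n - Sm n K j l) - av ?E m (\<lambda>l. real n - Sm n K j l))\<^sup>2) \<le> real m * c\<^sup>2"
  proof (rule av_variance[OF fin ne])
    fix x y e e' assume *: "set x \<subseteq> ?E" "set y \<subseteq> ?E" "e \<in> ?E" "e' \<in> ?E"
    have "\<bar>Sm n K j (x @ e # y) - Sm n K j (x @ e' # y)\<bar> \<le> 2 * (2 * real K)"
      unfolding Sm_def by (rule Phi_replace[OF _ mbound_gsm *]) (simp add: good_Kn)
    then show "\<bar>(real n - Sm n K j (x @ e # y)) - (real n - Sm n K j (x @ e' # y))\<bar> \<le> c"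
      unfolding c_def by (auto simp: abs_le_iff)
  qed
  have aS: "av ?E m (\<lambda>l. real n - Sm n K j l) = real n * (1 - sm n K j m)"
    unfolding av_diff av_const[OF fin ne] sm_def using n1 by (simp add: algebra_simps)
  have aV: "av ?E m (Vt n K j a) = real n * vt n K j a m" for a using vt_av n by simp
  have T1: "\<bar>av ?E m T - (real n)\<^sup>2 * \<tau>\<bar> \<le> (real s + 2) * (real m * c\<^sup>2)"
  proof -
    have p1: "\<bar>av ?E m (\<lambda>l. Vt n K j a l * Vt n K j (s - a) l) - (real n)\<^sup>2 * (vt n K j a m * vt n K j (s - a) m)\<bar> \<le> real m * c\<^sup>2"
      if "a \<in> {1..<s}" for a
      using av_covariance[OF fin ne vV[of a] vV[of "s - a"]] that unfolding aV
      by (simp add: power2_eq_square algebra_simps)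
    have p2: "\<bar>av ?E m (\<lambda>l. Vt n K j s l * (real n - Sm n K j l)) - (real n)\<^sup>2 * (vt n K j s m * (1 - sm n K j m))\<bar> \<le> real m * c\<^sup>2"
      using av_covariance[OF fin ne vV[of s] vS] unfolding aV aS
      by (simp add: power2_eq_square algebra_simps)
    define p where "p = (\<Sum>a\<in>{1..<s}. av ?E m (\<lambda>l. Vt n K j a l * Vt n K j (s - a) l) - (real n)\<^sup>2 * (vt n K j a m * vt n K j (s - a) m))"
    define q where "q = av ?E m (\<lambda>l. Vt n K j s l * (real n - Sm n K j l)) - (real n)\<^sup>2 * (vt n K j s m * (1 - sm n K j m))"
    have p: "\<bar>p\<bar> \<le> (\<Sum>a\<in>{1..<s}. real m * c\<^sup>2)"
      unfolding p_def by (intro order_trans[OF sum_abs] sum_mono p1)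
    have q: "\<bar>q\<bar> \<le> real m * c\<^sup>2" unfolding q_def by (rule p2)
    have "av ?E m T = (\<Sum>a\<in>{1..<s}. av ?E m (\<lambda>l. Vt n K j a l * Vt n K j (s - a) l)) - 2 * av ?E m (\<lambda>l. Vt n K j s l * (real n - Sm n K j l))"
      unfolding T_def av_diff av_sum av_cmult ..
    then have "av ?E m T - (real n)\<^sup>2 * \<tau> = p - 2 * q"
      unfolding \<tau>_def p_def q_def sum_subtractf by (simp add: sum_distrib_left algebra_simps)
    also have "\<bar>p - 2 * q\<bar> \<le> \<bar>p\<bar> + 2 * \<bar>q\<bar>" by linarith
    also have "\<dots> \<le> (\<Sum>a\<in>{1..<s}. real m * c\<^sup>2) + 2 * (real m * c\<^sup>2)"
      using p q by linarith
    also have "\<dots> \<le> (real s + 2) * (real m * c\<^sup>2)" using s by (simp add: algebra_simps of_nat_diff)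
    finally show ?thesis .
  qed
  have T2: "\<bar>av ?E m T\<bar> \<le> (real s + 2) * (real n)\<^sup>2"
  proof (rule av_abs_le[OF fin ne])
    fix l
    have V: "\<bar>Vt n K j a l\<bar> \<le> real n" for a by (rule Vt_bound)
    have S: "\<bar>real n - Sm n K j l\<bar> \<le> real n" using Sm_bounds[of n K j l] by simp
    have p1: "\<bar>Vt n K j a l * Vt n K j (s - a) l\<bar> \<le> (real n)\<^sup>2" for a
      unfolding abs_mult power2_eq_square by (intro mult_mono V) auto
    have p2: "\<bar>Vt n K j s l * (real n - Sm n K j l)\<bar> \<le> (real n)\<^sup>2"
      unfolding abs_mult power2_eq_square by (intro mult_mono V S) auto
    have "\<bar>T l\<bar> \<le> \<bar>\<Sum>a\<in>{1..<s}. Vt n K j a l * Vt n K j (s - a) l\<bar> + 2 * \<bar>Vt n K j s l * (real n - Sm n K j l)\<bar>"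
      unfolding T_def by linarith
    also have "\<dots> \<le> (\<Sum>a\<in>{1..<s}. (real n)\<^sup>2) + 2 * (real n)\<^sup>2"
      by (intro add_mono order_trans[OF sum_abs] sum_mono p1 mult_left_mono p2) auto
    also have "\<dots> \<le> (real s + 2) * (real n)\<^sup>2" using s by (simp add: algebra_simps of_nat_diff)
    finally show "\<bar>T l\<bar> \<le> (real s + 2) * (real n)\<^sup>2" .
  qed
  \<comment> \<open>\<open>a1\<close> is the error of \<open>step_det\<close>, \<open>a2\<close>
    comes from replacing n (n - 1) by n squared, and \<open>a3\<close> collects the
    covariances.\<close>
  define a1 where "a1 = (1 / ?N) * (av ?E m D - real s / 2 * av ?E m T)"
  define a2 where "a2 = (real s / (2 * ?N) - real s / (real n)\<^sup>2) * av ?E m T"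
  define a3 where "a3 = real s / (real n)\<^sup>2 * (av ?E m T - (real n)\<^sup>2 * \<tau>)"
  have dec: "(1 / ?N) * av ?E m D - real s * \<tau> = a1 + a2 + a3"
  proof -
    have "real s / (real n)\<^sup>2 * ((real n)\<^sup>2 * \<tau>) = real s * \<tau>" using n1 by simp
    moreover have "(1 / ?N) * (real s / 2 * av ?E m T) = real s / (2 * ?N) * av ?E m T" by simp
    ultimately show ?thesis
      unfolding a1_def a2_def a3_def right_diff_distrib left_diff_distrib by linarith
  qed
  have fourN: "1 / ?N \<le> 4 / (real n)\<^sup>2"
  proof -
    have "(real n)\<^sup>2 / 4 \<le> ?N" unfolding N using n by (simp add: power2_eq_square field_simps)
    then have "1 / ?N \<le> 1 / ((real n)\<^sup>2 / 4)" using n1 cE0 by (intro divide_left_mono mult_pos_pos) auto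
    then show ?thesis by simp
  qed
  have uu0: "0 \<le> uu n K j m" unfolding uu_def
    by (intro divide_nonneg_nonneg av_nonneg[OF fin ne] unc_nonneg) auto
  have b1: "\<bar>a1\<bar> \<le> 12 * (real s)\<^sup>2 * uu n K j m + 12 * (real s)\<^sup>2 * (real K + real s) / (real n - 1)
      + 48 * (real s)\<^sup>2 * real K * (real m / real n) / (real n - 1)"
  proof -
    have "\<bar>a1\<bar> \<le> (4 / (real n)\<^sup>2) * (3 * (real s)\<^sup>2 * ((real n)\<^sup>2 * uu n K j m + (real n * real K + real n * real s) + real n * (4 * real K * real m / (real n - 1))))"
      unfolding a1_def abs_mult using 2 fourN by (intro mult_mono) auto
    also have "\<dots> = 12 * (real s)\<^sup>2 * uu n K j m + 12 * (real s)\<^sup>2 * (real K + real s) / real n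
      + 48 * (real s)\<^sup>2 * real K * (real m / real n) / (real n - 1)"
      using n1 by (simp add: field_simps power2_eq_square)
    also have "12 * (real s)\<^sup>2 * (real K + real s) / real n \<le> 12 * (real s)\<^sup>2 * (real K + real s) / (real n - 1)"
      using n1 by (intro divide_left_mono) auto
    finally show ?thesis by simp
  qed
  have b2: "\<bar>a2\<bar> \<le> real s * (real s + 2) / (real n - 1)"
  proof -
    have "real s / (2 * ?N) - real s / (real n)\<^sup>2 = real s / ((real n)\<^sup>2 * (real n - 1))"
      unfolding N using n1 by (simp add: field_simps power2_eq_square)
    then have "\<bar>a2\<bar> \<le> real s / ((real n)\<^sup>2 * (real n - 1)) * ((real s + 2) * (real n)\<^sup>2)"
      unfolding a2_def abs_mult using n1 T2 by (intro mult_mono) auto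
    also have "\<dots> = real s * (real s + 2) / (real n - 1)" using n1 by (simp add: field_simps)
    finally show ?thesis .
  qed
  have b3: "\<bar>a3\<bar> \<le> real s * (real s + 2) * c\<^sup>2 * (real m / real n) / (real n - 1)"
  proof -
    have "\<bar>a3\<bar> \<le> real s / (real n)\<^sup>2 * ((real s + 2) * (real m * c\<^sup>2))"
      unfolding a3_def abs_mult using T1 by (intro mult_mono) auto
    also have "\<dots> = real s * (real s + 2) * c\<^sup>2 * (real m / real n) / real n"
      by (simp add: power2_eq_square)
    also have "\<dots> \<le> real s * (real s + 2) * c\<^sup>2 * (real m / real n) / (real n - 1)"
      using n1 by (intro divide_left_mono) auto
    finally show ?thesis .
  qed
  define x where "x = real m / real n"
  define y where "y = 1 / (real n - 1)"
  have xy: "0 \<le> x" "0 \<le> y" using n1 by (auto simp: x_def y_def)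
  have "\<bar>(1 / ?N) * av ?E m D - real s * \<tau>\<bar> \<le> 12 * (real s)\<^sup>2 * uu n K j m + C * (1 + real m / real n) / (real n - 1)"
  proof -
    define p q r t where "p = 12 * (real s)\<^sup>2 * (real K + real s)" and "q = 48 * (real s)\<^sup>2 * real K"
      and "r = real s * (real s + 2)" and "t = real s * (real s + 2) * c\<^sup>2"
    have nn: "0 \<le> p" "0 \<le> q" "0 \<le> r" "0 \<le> t" by (auto simp: p_def q_def r_def t_def)
    have "\<bar>(1 / ?N) * av ?E m D - real s * \<tau>\<bar> \<le> 12 * (real s)\<^sup>2 * uu n K j m + (p * y + q * x * y + r * y + t * x * y)"
      unfolding dec p_def q_def r_def t_def using b1 b2 b3 by (simp add: x_def y_def)
    also have "p * y + q * x * y + r * y + t * x * y \<le> (p + q + r + t) * (1 + x) * y"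
    proof -
      have "0 \<le> q * y + t * y + (p + r) * (x * y)" using nn xy by simp
      then show ?thesis by (simp add: algebra_simps)
    qed
    also have "(p + q + r + t) * (1 + x) * y = C * (1 + real m / real n) / (real n - 1)"
      unfolding p_def q_def r_def t_def C_def c_def x_def y_def by simp
    finally show ?thesis by simp
  qed
  then have "(1 / real n) * \<bar>(1 / ?N) * av ?E m D - real s * \<tau>\<bar>
     \<le> (1 / real n) * (12 * (real s)\<^sup>2 * uu n K j m + C * (1 + real m / real n) / (real n - 1))"
    by (intro mult_left_mono) auto
  moreover have "zz n (Suc j) s (Suc m) - zz n (Suc j) s m - (1 / real n) * (real s * \<tau>)
     = (1 / real n) * ((1 / ?N) * av ?E m D - real s * \<tau>)"
    unfolding zz_def diff_divide_distrib[symmetric] 1 by (simp add: right_diff_distrib)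
  ultimately show ?thesis unfolding \<tau>_def[symmetric] by (simp add: abs_mult)
qed

section \<open>Unjoined pairs of large vertices are few on average over time\<close>

text \<open>Vertices that are large for \<open>S\<close> but not for \<open>R\<close> are as many as
  the drop of the number of small vertices, and each of them lies in at most 2 n ordered
  pairs.\<close>

lemma unc_shift:
  assumes "\<And>u v. R u v \<Longrightarrow> S u v"
  shows "unc n K S S \<le> unc n K R S + 2 * real n * (Phi n (gsm K) R - Phi n (gsm K) S)"
proof -
  define A B where "A = {u. u < n \<and> K \<le> csz n R u}" and "B = {u. u < n \<and> K \<le> csz n S u}"
  have sub: "A \<subseteq> B" using csz_mono[OF assms] unfolding A_def B_def by (auto intro: order_trans)
  have fin: "finite A" "finite B" by (auto simp: A_def B_def)
  have Phi: "Phi n (gsm K) Q = real n - real (card {u. u < n \<and> K \<le> csz n Q u})" for Q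
  proof -
    have "Phi n (gsm K) Q = (\<Sum>u<n. 1 - (if K \<le> csz n Q u then 1 else 0))"
      unfolding Phi_def gsm_def by (intro sum.cong) auto
    also have "\<dots> = real n - (\<Sum>u\<in>{u \<in> {..<n}. K \<le> csz n Q u}. 1)"
      by (subst sum.inter_filter) (auto simp: sum_subtractf)
    finally show ?thesis by simp
  qed
  have D: "Phi n (gsm K) R - Phi n (gsm K) S = real (card (B - A))"
    unfolding Phi A_def[symmetric] B_def[symmetric] using fin sub
    by (simp add: card_Diff_subset of_nat_diff card_mono)
  have "{(u, v). u < n \<and> v < n \<and> K \<le> csz n S u \<and> K \<le> csz n S v \<and> \<not> S u v}
     \<subseteq> {(u, v). u < n \<and> v < n \<and> K \<le> csz n R u \<and> K \<le> csz n R v \<and> \<not> S u v}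
       \<union> ((B - A) \<times> {..<n} \<union> {..<n} \<times> (B - A))"
    by (auto simp: A_def B_def)
  then have "card {(u, v). u < n \<and> v < n \<and> K \<le> csz n S u \<and> K \<le> csz n S v \<and> \<not> S u v}
     \<le> card ({(u, v). u < n \<and> v < n \<and> K \<le> csz n R u \<and> K \<le> csz n R v \<and> \<not> S u v}
       \<union> ((B - A) \<times> {..<n} \<union> {..<n} \<times> (B - A)))"
    by (rule card_mono[rotated]) (auto simp: finite_pairs fin)
  also have "\<dots> \<le> card {(u, v). u < n \<and> v < n \<and> K \<le> csz n R u \<and> K \<le> csz n R v \<and> \<not> S u v}
     + (card ((B - A) \<times> {..<n}) + card ({..<n} \<times> (B - A)))"
    by (intro order_trans[OF card_Un_le] add_left_mono card_Un_le)
  also have "\<dots> = card {(u, v). u < n \<and> v < n \<and> K \<le> csz n R u \<and> K \<le> csz n R v \<and> \<not> S u v}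
     + 2 * n * card (B - A)" unfolding card_cartesian_product by simp
  finally have "card {(u, v). u < n \<and> v < n \<and> K \<le> csz n S u \<and> K \<le> csz n S v \<and> \<not> S u v}
     \<le> card {(u, v). u < n \<and> v < n \<and> K \<le> csz n R u \<and> K \<le> csz n R v \<and> \<not> S u v} + 2 * n * card (B - A)" .
  from of_nat_mono[OF this, where 'a = real] show ?thesis unfolding unc_def D by simp
qed

lemma av_take:
  assumes "finite E" "E \<noteq> {}" "k \<le> m"
  shows "av E m (\<lambda>l. f (take k l)) = av E k f"
proof -
  have "av E (k + (m - k)) (\<lambda>l. f (take k l)) = av E k (\<lambda>l. av E (m - k) (\<lambda>l'. f l))"
    unfolding av_append[OF assms(1,2)] by (intro av_cong) simp
  then show ?thesis using assms(3) by (simp add: av_const[OF assms(1,2)])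
qed

lemma rl_take: "set l \<subseteq> Kn_edges n \<Longrightarrow> rl j (take k l) u v \<Longrightarrow> rl j l u v"
  unfolding rl_def
  by (rule rel_mono_subseq[of "take k l" l n]) (auto intro: prefix_imp_subseq take_is_prefix good_Kn)

lemma sm_bounds: "0 < n \<Longrightarrow> 2 \<le> n \<Longrightarrow> 0 \<le> sm n K j m \<and> sm n K j m \<le> 1"
  unfolding sm_def using av_nonneg[OF finite_Kn Kn_ne, of n m "Sm n K j"] av_le[OF finite_Kn Kn_ne, of n m "Sm n K j" "real n"]
  by (simp add: Sm_bounds)

lemma zz_bounds: "2 \<le> n \<Longrightarrow> 0 \<le> zz n j s m \<and> zz n j s m \<le> 1"
  unfolding zz_def using av_nonneg[OF finite_Kn Kn_ne, of n m "Ns n j s"] av_le[OF finite_Kn Kn_ne, of n m "Ns n j s" "real n"]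
  by (simp add: Ns_bounds)

lemma uu_le_1:
  assumes "2 \<le> n"
  shows "uu n K j m \<le> 1"
proof -
  have "av (Kn_edges n) m (\<lambda>l. unc n K (rl j l) (rl j l)) \<le> (real n)\<^sup>2"
    by (rule av_le[OF finite_Kn Kn_ne[OF assms]]) (rule unc_le)
  moreover have "0 < (real n)\<^sup>2" using assms by simp
  ultimately show ?thesis unfolding uu_def by (simp only: divide_le_eq_1_pos)
qed

text \<open>Sprinkling controls only vertices that were large \<open>r\<close> steps ago. The others
  are paid for by the decrease of \<open>sm\<close>, which telescopes when summed over time.\<close>

lemma uu_shift:
  assumes n: "2 \<le> n" and r: "r \<le> m"
  shows "uu n K j m \<le> av (Kn_edges n) m (\<lambda>l. unc n K (rl j (take (m - r) l)) (rl j l)) / (real n)\<^sup>2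
     + 2 * (sm n K j (m - r) - sm n K j m)"
proof -
  let ?E = "Kn_edges n"
  note fin = finite_Kn[of n] and ne = Kn_ne[OF n]
  have "av ?E m (\<lambda>l. unc n K (rl j l) (rl j l))
     \<le> av ?E m (\<lambda>l. unc n K (rl j (take (m - r) l)) (rl j l) + 2 * real n * (Sm n K j (take (m - r) l) - Sm n K j l))"
    unfolding Sm_def by (rule av_mono, rule unc_shift, rule rl_take)
  also have "\<dots> = av ?E m (\<lambda>l. unc n K (rl j (take (m - r) l)) (rl j l))
     + 2 * real n * (av ?E (m - r) (Sm n K j) - av ?E m (Sm n K j))"
    unfolding av_add av_cmult av_diff by (subst av_take[OF fin ne]) auto
  finally have "uu n K j m \<le> (av ?E m (\<lambda>l. unc n K (rl j (take (m - r) l)) (rl j l))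
     + 2 * real n * (av ?E (m - r) (Sm n K j) - av ?E m (Sm n K j))) / (real n)\<^sup>2"
    unfolding uu_def by (intro divide_right_mono) auto
  also have "\<dots> = av ?E m (\<lambda>l. unc n K (rl j (take (m - r) l)) (rl j l)) / (real n)\<^sup>2
     + 2 * (sm n K j (m - r) - sm n K j m)"
    unfolding sm_def using n by (simp add: field_simps power2_eq_square)
  finally show ?thesis .
qed

text \<open>The shifted and the unshifted sum overlap except for r terms at the start and r at the
  end; the latter enter with a favourable sign.\<close>

lemma telescope_shift:
  fixes f :: "nat \<Rightarrow> real"
  assumes "\<And>m. 0 \<le> f m \<and> f m \<le> 1"
  shows "(\<Sum>m<M. if r \<le> m then f (m - r) - f m else 0) \<le> real r"
proof (cases "r \<le> M")
  case True
  have "(\<Sum>m<M. if r \<le> m then f (m - r) - f m else 0) = (\<Sum>m\<in>{r..<M}. f (m - r) - f m)"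
    by (rule sum.mono_neutral_cong_right) auto
  also have "\<dots> = (\<Sum>m\<in>{r..<M}. f (m - r)) - (\<Sum>m\<in>{r..<M}. f m)" by (rule sum_subtractf)
  also have "(\<Sum>m\<in>{r..<M}. f (m - r)) = (\<Sum>m\<in>{0..<M - r}. f m)"
    by (rule sum.reindex_bij_witness[of _ "\<lambda>m. m + r" "\<lambda>m. m - r"]) (use True in auto)
  also have "\<dots> \<le> (\<Sum>m\<in>{0..<M}. f m)" by (intro sum_mono2) (use assms in auto)
  also have "\<dots> = (\<Sum>m\<in>{0..<r}. f m) + (\<Sum>m\<in>{r..<M}. f m)"
    using True by (intro sum.atLeastLessThan_concat[symmetric]) auto
  also have "(\<Sum>m\<in>{0..<r}. f m) \<le> (\<Sum>m\<in>{0..<r}. 1)" by (intro sum_mono) (use assms in auto)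
  finally show ?thesis by simp
next
  case False
  then have "(\<Sum>m<M. if r \<le> m then f (m - r) - f m else 0) = 0" by (intro sum.neutral) auto
  then show ?thesis by simp
qed

text \<open>A single time might carry a burst of vertices turning large; the total of such bursts is
  bounded, so the time average is small.\<close>

lemma uu_average:
  assumes "0 < \<eta>" "0 \<le> T"
  shows "\<exists>K>0. \<forall>\<^sub>F n in sequentially. (1 / real n) * (\<Sum>m<nat \<lfloor>T * real n\<rfloor>. uu n K j m) \<le> \<eta>"
proof -
  \<comment> \<open>The first r terms and twice the telescoped sum cost 3 r, at most 6\<epsilon> n =
    \<eta> n / 2. The other half of \<eta> pays \<delta> for each of at most T n steps.\<close>
  define \<epsilon> where "\<epsilon> = \<eta> / 12"
  define \<delta> where "\<delta> = min 1 (\<eta> / (2 * (T + 1)))"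
  have pos: "0 < \<epsilon>" "0 < \<delta>" "\<delta> \<le> 1" using assms by (auto simp: \<epsilon>_def \<delta>_def)
  obtain K where K: "0 < K" and ev: "\<forall>\<^sub>F n in sequentially. \<forall>m r. \<epsilon> * real n \<le> real r \<longrightarrow>
    av (Kn_edges n) (m + r) (\<lambda>L. unc n K (rel Kn_ends j (take m L)) (rel Kn_ends j L)) \<le> \<delta> * (real n)\<^sup>2"
    using sprinkle[OF pos, of j] by blast
  have "filterlim (\<lambda>n. \<epsilon> * real n) at_top sequentially" using pos by real_asymp
  then have ev3: "\<forall>\<^sub>F n in sequentially. 1 \<le> \<epsilon> * real n" by (simp add: filterlim_at_top)
  have "\<forall>\<^sub>F n in sequentially. (1 / real n) * (\<Sum>m<nat \<lfloor>T * real n\<rfloor>. uu n K j m) \<le> \<eta>"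
    using ev ev3 eventually_ge_at_top[of 2]
  proof eventually_elim
    case (elim n)
    define r where "r = nat \<lceil>\<epsilon> * real n\<rceil>"
    define M where "M = nat \<lfloor>T * real n\<rfloor>"
    have r: "\<epsilon> * real n \<le> real r" "real r \<le> 2 * \<epsilon> * real n"
      unfolding r_def using elim(2) by linarith+
    have M: "real M \<le> T * real n" unfolding M_def using assms by simp
    have each: "uu n K j m \<le> (if m < r then 1 else 0) + (\<delta> + 2 * (if r \<le> m then sm n K j (m - r) - sm n K j m else 0))" for m
    proof (cases "m < r")
      case True
      then show ?thesis using uu_le_1[OF elim(3), of K j m] pos by simp
    next
      case False
      then have "av (Kn_edges n) ((m - r) + r) (\<lambda>L. unc n K (rel Kn_ends j (take (m - r) L)) (rel Kn_ends j L)) \<le> \<delta> * (real n)\<^sup>2"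
        using elim(1) r by blast
      then have "av (Kn_edges n) m (\<lambda>l. unc n K (rl j (take (m - r) l)) (rl j l)) / (real n)\<^sup>2 \<le> \<delta>"
        unfolding rl_def using False elim(3) by (simp add: divide_le_eq)
      then show ?thesis using uu_shift[OF elim(3), of r m K j] False by simp
    qed
    have "(\<Sum>m<M. uu n K j m) \<le> (\<Sum>m<M. (if m < r then 1 else 0) + (\<delta> + 2 * (if r \<le> m then sm n K j (m - r) - sm n K j m else 0)))"
      by (intro sum_mono each)
    also have "\<dots> = (\<Sum>m<M. if m < r then 1 else 0) + (real M * \<delta> + 2 * (\<Sum>m<M. if r \<le> m then sm n K j (m - r) - sm n K j m else 0))"
      by (simp only: sum.distrib sum_distrib_left[symmetric] sum_constant card_lessThan)
    also have "\<dots> \<le> real r + (real M * \<delta> + 2 * real r)"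
    proof (intro add_mono mult_left_mono telescope_shift)
      have "(\<Sum>m<M. if m < r then 1 else (0::real)) = (\<Sum>m\<in>{m \<in> {..<M}. m < r}. 1)"
        by (rule sum.inter_filter[symmetric]) simp
      also have "\<dots> \<le> (\<Sum>m\<in>{..<r}. 1)" by (intro sum_mono2) auto
      finally show "(\<Sum>m<M. if m < r then 1 else (0::real)) \<le> real r" by simp
      show "0 \<le> sm n K j m \<and> sm n K j m \<le> 1" for m using sm_bounds[of n K j m] elim(3) by simp
    qed auto
    also have "\<dots> \<le> 6 * \<epsilon> * real n + (T * real n) * (\<eta> / (2 * (T + 1)))"
    proof -
      have "real M * \<delta> \<le> (T * real n) * (\<eta> / (2 * (T + 1)))"
        using M pos by (intro mult_mono) (auto simp: \<delta>_def intro: order_trans[of 0 "real M"])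
      then show ?thesis using r by simp
    qed
    also have "\<dots> \<le> real n * \<eta>"
    proof -
      have "T * (\<eta> / (2 * (T + 1))) \<le> \<eta> / 2" using assms by (simp add: field_simps)
      then have "real n * (T * (\<eta> / (2 * (T + 1)))) \<le> real n * (\<eta> / 2)" by (intro mult_left_mono) auto
      moreover have "6 * \<epsilon> * real n = real n * (\<eta> / 2)" by (simp add: \<epsilon>_def)
      moreover have "(T * real n) * (\<eta> / (2 * (T + 1))) = real n * (T * (\<eta> / (2 * (T + 1))))"
        by (simp only: mult_ac)
      ultimately show ?thesis by linarith
    qed
    finally have "(\<Sum>m<M. uu n K j m) \<le> real n * \<eta>" .
    then show ?case unfolding M_def[symmetric] using elim(3) by (simp add: divide_le_eq mult.commute)
  qed
  then show ?thesis using K by blast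
qed

subsection \<open>Convergence of Euler schemes\<close>

lemma convergent_approx:
  fixes z :: "nat \<Rightarrow> real"
  assumes "\<And>\<zeta>. 0 < \<zeta> \<Longrightarrow> \<exists>w. convergent w \<and> (\<forall>\<^sub>F n in sequentially. \<bar>z n - w n\<bar> \<le> \<zeta>)"
  shows "convergent z"
proof -
  have "Cauchy z"
  proof (rule metric_CauchyI)
    fix e :: real assume e: "0 < e"
    then obtain w where w: "convergent w" "\<forall>\<^sub>F n in sequentially. \<bar>z n - w n\<bar> \<le> e / 4"
      using assms[of "e / 4"] by auto
    obtain M1 where M1: "\<And>m n. m \<ge> M1 \<Longrightarrow> n \<ge> M1 \<Longrightarrow> dist (w m) (w n) < e / 4"
      using metric_CauchyD[OF convergent_Cauchy[OF w(1)], of "e / 4"] e by auto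
    obtain M2 where M2: "\<And>n. n \<ge> M2 \<Longrightarrow> \<bar>z n - w n\<bar> \<le> e / 4"
      using w(2) by (auto simp: eventually_sequentially)
    show "\<exists>M. \<forall>m\<ge>M. \<forall>n\<ge>M. dist (z m) (z n) < e"
    proof (intro exI[of _ "max M1 M2"] allI impI)
      fix m n assume "max M1 M2 \<le> m" "max M1 M2 \<le> n"
      then have "\<bar>w m - w n\<bar> < e / 4" "\<bar>z m - w m\<bar> \<le> e / 4" "\<bar>z n - w n\<bar> \<le> e / 4"
        using M1[of m n] M2[of m] M2[of n] unfolding dist_real_def by simp_all
      then show "dist (z m) (z n) < e" using e unfolding dist_real_def by linarith
    qed
  qed
  then show ?thesis by (rule Cauchy_convergent)
qed

lemma discrete_Gronwall:
  fixes d b :: "nat \<Rightarrow> real"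
  assumes "\<And>i. d (Suc i) \<le> (1 + a) * d i + b i" "d 0 \<le> 0" "0 \<le> a" "\<And>i. 0 \<le> b i"
  shows "d i \<le> (1 + a) ^ i * (\<Sum>k<i. b k)"
proof (induction i)
  case (Suc i)
  have "d (Suc i) \<le> (1 + a) * ((1 + a) ^ i * (\<Sum>k<i. b k)) + b i"
    using assms(1)[of i] Suc assms(3) by (smt (verit) mult_left_mono)
  also have "\<dots> \<le> (1 + a) ^ Suc i * (\<Sum>k<i. b k) + (1 + a) ^ Suc i * b i"
  proof -
    have "1 * b i \<le> (1 + a) ^ Suc i * b i"
      by (intro mult_right_mono one_le_power assms) (use assms in auto)
    then show ?thesis by simp
  qed
  finally show ?case by (simp add: algebra_simps)
qed (use assms in auto)

text \<open>\<open>z\<close> is compared with an explicit Euler scheme of fixed mesh. For a fixed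
  number of coarse steps the scheme is a polynomial in finitely many convergent values of
  \<open>P\<close>, \<open>Q\<close> and the initial value, so it converges; the distance to
  \<open>z\<close> is controlled by \<open>discrete_Gronwall\<close>. \<open>C\<close> bounds the
  coefficients for every accuracy, while \<open>P\<close>, \<open>Q\<close> and \<open>L\<close> may
  depend on \<eta>; hence \<eta> is fixed from \<open>C\<close> alone and the mesh is chosen after
  \<open>L\<close> is known.\<close>

lemma euler_limit:
  fixes z :: "nat \<Rightarrow> nat \<Rightarrow> real"
  assumes C: "1 \<le> C" and t: "0 < t"
    and zL: "\<And>n m. n0 \<le> n \<Longrightarrow> \<bar>z n (Suc m) - z n m\<bar> \<le> C / real n"
    and z1: "\<And>n m. n0 \<le> n \<Longrightarrow> \<bar>z n m\<bar> \<le> 1"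
    and z0: "convergent (\<lambda>n. z n 0)"
    and drift: "\<And>\<eta>. 0 < \<eta> \<Longrightarrow> \<exists>P Q L. 0 \<le> L \<and>
      (\<forall>t\<ge>0. convergent (\<lambda>n. P n (nat \<lfloor>t * real n\<rfloor>))) \<and> (\<forall>t\<ge>0. convergent (\<lambda>n. Q n (nat \<lfloor>t * real n\<rfloor>))) \<and>
      (\<forall>n\<ge>n0. \<forall>m. \<bar>P n (Suc m) - P n m\<bar> \<le> L / real n \<and> \<bar>Q n (Suc m) - Q n m\<bar> \<le> L / real n \<and> \<bar>P n m\<bar> \<le> C \<and> \<bar>Q n m\<bar> \<le> C) \<and>
      (\<forall>\<^sub>F n in sequentially. (\<Sum>m<nat \<lfloor>t * real n\<rfloor>. \<bar>z n (Suc m) - z n m - (1 / real n) * (P n m - Q n m * z n m)\<bar>) \<le> \<eta>)"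
  shows "convergent (\<lambda>n. z n (nat \<lfloor>t * real n\<rfloor>))"
proof (rule convergent_approx)
  fix \<zeta> :: real assume \<zeta>: "0 < \<zeta>"
  \<comment> \<open>The accumulated drift error is amplified by the Gronwall factor
    \<open>exp (t * C)\<close>; this leaves a third of \<zeta>.\<close>
  define \<eta> where "\<eta> = \<zeta> / (3 * exp (t * C))"
  have \<eta>: "0 < \<eta>" using \<zeta> by (simp add: \<eta>_def)
  obtain P Q L where L: "0 \<le> L"
    and Pc: "\<And>t. 0 \<le> t \<Longrightarrow> convergent (\<lambda>n. P n (nat \<lfloor>t * real n\<rfloor>))"
    and Qc: "\<And>t. 0 \<le> t \<Longrightarrow> convergent (\<lambda>n. Q n (nat \<lfloor>t * real n\<rfloor>))"
    and PQ: "\<And>n m. n0 \<le> n \<Longrightarrow> \<bar>P n (Suc m) - P n m\<bar> \<le> L / real n \<and> \<bar>Q n (Suc m) - Q n m\<bar> \<le> L / real n \<and> \<bar>P n m\<bar> \<le> C \<and> \<bar>Q n m\<bar> \<le> C"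
    and err: "\<forall>\<^sub>F n in sequentially. (\<Sum>m<nat \<lfloor>t * real n\<rfloor>. \<bar>z n (Suc m) - z n m - (1 / real n) * (P n m - Q n m * z n m)\<bar>) \<le> \<eta>"
    using drift[OF \<eta>] by blast
  define L' where "L' = 2 * L + C * C"
  have L': "0 \<le> L'" "1 \<le> C * C" using L C mult_mono[of 1 C 1 C] by (auto simp: L'_def)
  \<comment> \<open>With h = t / M the discretization error M h h L' equals t t L' / M; after
    amplification it is below another third of \<zeta>.\<close>
  obtain M :: nat where M: "0 < M" "t * t * L' * exp (t * C) * 3 / \<zeta> < real M"
  proof -
    obtain M where "t * t * L' * exp (t * C) * 3 / \<zeta> < real M" using reals_Archimedean2 by blast
    then show ?thesis using that[of "Suc M"] by auto
  qed
  define h where "h = t / real M"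
  have h: "0 < h" using t M by (simp add: h_def)
  define \<tau> where "\<tau> i = real i * h" for i :: nat
  \<comment> \<open>The scheme samples the coefficients at the coarse times only.\<close>
  define e where "e n = rec_nat (z n 0) (\<lambda>i x. x + h * (P n (nat \<lfloor>\<tau> i * real n\<rfloor>) - Q n (nat \<lfloor>\<tau> i * real n\<rfloor>) * x))" for n
  have e0: "e n 0 = z n 0" and eS: "e n (Suc i) = e n i + h * (P n (nat \<lfloor>\<tau> i * real n\<rfloor>) - Q n (nat \<lfloor>\<tau> i * real n\<rfloor>) * e n i)" for n i
    by (simp_all add: e_def)
  have \<tau>0: "0 \<le> \<tau> i" for i using h by (simp add: \<tau>_def)
  have ec: "convergent (\<lambda>n. e n i)" for i
  proof (induction i)
    case (Suc i)
    show ?case unfolding eS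
      by (intro convergent_add convergent_mult convergent_const convergent_diff Suc Pc Qc \<tau>0)
  qed (simp add: e0 z0)
  have bound: "\<bar>z n (nat \<lfloor>t * real n\<rfloor>) - e n M\<bar> \<le> exp (t * C) * (\<eta> + real M * ((h + 1 / real n)\<^sup>2 * L' + 2 * C / real n))"
    if n: "n0 \<le> n" "0 < n"
    and er: "(\<Sum>m<nat \<lfloor>t * real n\<rfloor>. \<bar>z n (Suc m) - z n m - (1 / real n) * (P n m - Q n m * z n m)\<bar>) \<le> \<eta>" for n
  proof -
    define \<mu> where "\<mu> i = nat \<lfloor>\<tau> i * real n\<rfloor>" for i
    define er where "er m = z n (Suc m) - z n m - (1 / real n) * (P n m - Q n m * z n m)" for m
    define G where "G m = P n m - Q n m * z n m" for m
    have \<mu>mono: "\<mu> i \<le> \<mu> k" if "i \<le> k" for i k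
      unfolding \<mu>_def \<tau>_def using that h by (intro nat_mono floor_mono mult_right_mono) auto
    have \<mu>0: "\<mu> 0 = 0" by (simp add: \<mu>_def \<tau>_def)
    have \<mu>M: "\<mu> M = nat \<lfloor>t * real n\<rfloor>" using M by (simp add: \<mu>_def \<tau>_def h_def)
    have \<mu>d: "\<bar>real (\<mu> (Suc i)) - real (\<mu> i) - h * real n\<bar> \<le> 1" for i
    proof -
      have "\<tau> (Suc i) * real n = \<tau> i * real n + h * real n" by (simp add: \<tau>_def algebra_simps)
      moreover have "0 \<le> \<tau> i * real n" "0 \<le> \<tau> (Suc i) * real n" using \<tau>0 by auto
      moreover have "0 \<le> h * real n" using h by simp
      ultimately show ?thesis unfolding \<mu>_def by linarith
    qed
    have G1: "\<bar>G (Suc m) - G m\<bar> \<le> L' / real n" for m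
    proof -
      have "G (Suc m) - G m = (P n (Suc m) - P n m) - ((Q n (Suc m) - Q n m) * z n (Suc m) + Q n m * (z n (Suc m) - z n m))"
        by (simp add: G_def algebra_simps)
      also have "\<bar>\<dots>\<bar> \<le> \<bar>P n (Suc m) - P n m\<bar> + (\<bar>Q n (Suc m) - Q n m\<bar> * \<bar>z n (Suc m)\<bar> + \<bar>Q n m\<bar> * \<bar>z n (Suc m) - z n m\<bar>)"
        unfolding abs_mult[symmetric] by linarith
      also have "\<dots> \<le> L / real n + (L / real n * 1 + C * (C / real n))"
        using PQ[OF n(1), of m] zL[OF n(1), of m] z1[OF n(1), of "Suc m"] C L
        by (intro add_mono mult_mono) auto
      also have "\<dots> = L' / real n" by (simp add: L'_def add_divide_distrib)
      finally show ?thesis .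
    qed
    have Gd: "\<bar>G (m + k) - G m\<bar> \<le> real k * (L' / real n)" for m k
    proof (induction k)
      case (Suc k)
      have "real (Suc k) * (L' / real n) = real k * (L' / real n) + L' / real n"
        by (simp add: distrib_right del: times_divide_eq_right)
      then show ?case using Suc G1[of "m + k"] unfolding add_Suc_right by linarith
    qed simp
    have Gb: "\<bar>G m\<bar> \<le> 2 * C" for m
    proof -
      have "\<bar>G m\<bar> \<le> \<bar>P n m\<bar> + \<bar>Q n m\<bar> * \<bar>z n m\<bar>"
        unfolding G_def abs_mult[symmetric] by (rule abs_triangle_ineq4)
      also have "\<dots> \<le> C + C * 1"
        using PQ[OF n(1), of m] z1[OF n(1), of m] C by (intro add_mono mult_mono) auto
      finally show ?thesis by simp
    qed
    define b where "b i = (\<Sum>m\<in>{\<mu> i..<\<mu> (Suc i)}. \<bar>er m\<bar>) + ((h + 1 / real n)\<^sup>2 * L' + 2 * C / real n)" for i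
    define d where "d i = \<bar>z n (\<mu> i) - e n i\<bar>" for i
    \<comment> \<open>Over one coarse step the drift is frozen at the left end. The three errors are
      the residuals of the difference equation, the variation of \<open>G\<close> inside the block,
      and the rounding of the block length to an integer.\<close>
    have stp: "\<bar>z n (\<mu> (Suc i)) - z n (\<mu> i) - h * G (\<mu> i)\<bar> \<le> b i" for i
    proof -
      let ?I = "{\<mu> i..<\<mu> (Suc i)}"
      have le: "\<mu> i \<le> \<mu> (Suc i)" by (rule \<mu>mono) simp
      have cI: "real (card ?I) = real (\<mu> (Suc i)) - real (\<mu> i)" using le by (simp add: of_nat_diff)
      have cI2: "real (card ?I) \<le> h * real n + 1" using \<mu>d[of i] cI by linarith
      have "z n (\<mu> (Suc i)) - z n (\<mu> i) = (\<Sum>m\<in>?I. z n (Suc m) - z n m)"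
        using le by (rule sum_Suc_diff'[symmetric])
      also have "\<dots> = (\<Sum>m\<in>?I. er m + (1 / real n) * (G m - G (\<mu> i)) + (1 / real n) * G (\<mu> i))"
        by (intro sum.cong refl) (simp add: er_def G_def algebra_simps)
      also have "\<dots> = (\<Sum>m\<in>?I. er m) + (1 / real n) * (\<Sum>m\<in>?I. G m - G (\<mu> i)) + (1 / real n) * (real (card ?I) * G (\<mu> i))"
        by (simp only: sum.distrib sum_distrib_left[symmetric] sum_constant)
      finally have eq: "z n (\<mu> (Suc i)) - z n (\<mu> i) - h * G (\<mu> i)
         = (\<Sum>m\<in>?I. er m) + (1 / real n) * (\<Sum>m\<in>?I. G m - G (\<mu> i)) + (real (card ?I) / real n - h) * G (\<mu> i)"
        by (simp add: algebra_simps)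
      have x1: "\<bar>\<Sum>m\<in>?I. er m\<bar> \<le> (\<Sum>m\<in>?I. \<bar>er m\<bar>)" by (rule sum_abs)
      have x2: "\<bar>(1 / real n) * (\<Sum>m\<in>?I. G m - G (\<mu> i))\<bar> \<le> (h + 1 / real n)\<^sup>2 * L'"
      proof -
        have "\<bar>\<Sum>m\<in>?I. G m - G (\<mu> i)\<bar> \<le> (\<Sum>m\<in>?I. (h * real n + 1) * (L' / real n))"
        proof (intro order_trans[OF sum_abs] sum_mono)
          fix m assume m: "m \<in> ?I"
          then have "\<bar>G (\<mu> i + (m - \<mu> i)) - G (\<mu> i)\<bar> \<le> real (m - \<mu> i) * (L' / real n)" by (intro Gd)
          also have "\<dots> \<le> (h * real n + 1) * (L' / real n)"
          proof (intro mult_right_mono)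
            have "real (m - \<mu> i) \<le> real (card ?I)" using m by simp
            then show "real (m - \<mu> i) \<le> h * real n + 1" using cI2 by linarith
          qed (use L' in auto)
          finally show "\<bar>G m - G (\<mu> i)\<bar> \<le> (h * real n + 1) * (L' / real n)" using m by simp
        qed
        also have "\<dots> = real (card ?I) * ((h * real n + 1) * (L' / real n))" by simp
        also have "\<dots> \<le> (h * real n + 1) * ((h * real n + 1) * (L' / real n))"
          using cI2 h L' by (intro mult_right_mono) auto
        finally have "(1 / real n) * \<bar>\<Sum>m\<in>?I. G m - G (\<mu> i)\<bar> \<le> (1 / real n) * ((h * real n + 1) * ((h * real n + 1) * (L' / real n)))"
          by (intro mult_left_mono) auto
        also have "\<dots> = (h + 1 / real n)\<^sup>2 * L'" using n by (simp add: field_simps power2_eq_square)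
        finally show ?thesis by (simp add: abs_mult)
      qed
      have x3: "\<bar>(real (card ?I) / real n - h) * G (\<mu> i)\<bar> \<le> 2 * C / real n"
      proof -
        have "real (card ?I) / real n - h = (real (card ?I) - h * real n) / real n" using n by (simp add: field_simps)
        also have "\<bar>\<dots>\<bar> \<le> 1 / real n" unfolding abs_divide using \<mu>d[of i] cI by (intro frac_le) (use n in auto)
        finally have "\<bar>(real (card ?I) / real n - h)\<bar> * \<bar>G (\<mu> i)\<bar> \<le> 1 / real n * (2 * C)"
          using Gb by (intro mult_mono) auto
        then show ?thesis by (simp add: abs_mult)
      qed
      show ?thesis unfolding eq b_def using x1 x2 x3 by linarith
    qed
    have "d M \<le> (1 + h * C) ^ M * (\<Sum>k<M. b k)"
    proof (rule discrete_Gronwall)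
      fix i
      have "z n (\<mu> (Suc i)) - e n (Suc i) = (z n (\<mu> (Suc i)) - z n (\<mu> i) - h * G (\<mu> i))
          + (1 - h * Q n (\<mu> i)) * (z n (\<mu> i) - e n i)"
        unfolding eS \<mu>_def[symmetric] G_def by (simp add: algebra_simps)
      also have "\<bar>\<dots>\<bar> \<le> b i + \<bar>1 - h * Q n (\<mu> i)\<bar> * d i"
        unfolding d_def abs_mult[symmetric] using stp[of i] by linarith
      also have "\<bar>1 - h * Q n (\<mu> i)\<bar> * d i \<le> (1 + h * C) * d i"
      proof (intro mult_right_mono)
        have "\<bar>h * Q n (\<mu> i)\<bar> \<le> h * C" unfolding abs_mult using PQ[OF n(1), of "\<mu> i"] h by (intro mult_mono) auto
        then show "\<bar>1 - h * Q n (\<mu> i)\<bar> \<le> 1 + h * C" by linarith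
      qed (simp add: d_def)
      finally show "d (Suc i) \<le> (1 + h * C) * d i + b i" by (simp add: d_def)
    next
      show "d 0 \<le> 0" by (simp add: d_def e0 \<mu>0)
      show "0 \<le> h * C" using h C by simp
      show "0 \<le> b i" for i unfolding b_def using L' C by (intro add_nonneg_nonneg sum_nonneg) auto
    qed
    also have "\<dots> \<le> exp (t * C) * (\<Sum>k<M. b k)"
    proof (intro mult_right_mono)
      have "(1 + h * C) ^ M \<le> exp (h * C) ^ M"
        using h C by (intro power_mono exp_ge_add_one_self) auto
      also have "\<dots> = exp (t * C)" using M by (simp add: exp_of_nat_mult[symmetric] h_def)
      finally show "(1 + h * C) ^ M \<le> exp (t * C)" .
      show "0 \<le> (\<Sum>k<M. b k)" unfolding b_def using L' C by (intro sum_nonneg add_nonneg_nonneg) auto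
    qed
    also have "(\<Sum>k<M. b k) = (\<Sum>m\<in>{\<mu> 0..<\<mu> M}. \<bar>er m\<bar>) + real M * ((h + 1 / real n)\<^sup>2 * L' + 2 * C / real n)"
    proof -
      have "(\<Sum>k<i. (\<Sum>m\<in>{\<mu> k..<\<mu> (Suc k)}. \<bar>er m\<bar>)) = (\<Sum>m\<in>{\<mu> 0..<\<mu> i}. \<bar>er m\<bar>)" for i
      proof (induction i)
        case (Suc i)
        then show ?case using \<mu>mono[of 0 i] \<mu>mono[of i "Suc i"] by (simp add: sum.atLeastLessThan_concat)
      qed simp
      then show ?thesis unfolding b_def sum.distrib by (simp add: distrib_left)
    qed
    also have "(\<Sum>m\<in>{\<mu> 0..<\<mu> M}. \<bar>er m\<bar>) \<le> \<eta>" using er unfolding \<mu>0 \<mu>M er_def lessThan_atLeast0 .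
    finally show ?thesis unfolding d_def \<mu>M by simp
  qed
  have lim: "((\<lambda>n. exp (t * C) * (\<eta> + real M * ((h + 1 / real n)\<^sup>2 * L' + 2 * C / real n))) \<longlongrightarrow>
     exp (t * C) * (\<eta> + real M * ((h + 0)\<^sup>2 * L' + 0))) sequentially"
    by (intro tendsto_intros lim_1_over_n lim_const_over_n)
  have "exp (t * C) * (\<eta> + real M * ((h + 0)\<^sup>2 * L' + 0)) < \<zeta>"
  proof -
    have "real M * (h\<^sup>2 * L') = t * t * L' / real M" using M by (simp add: h_def field_simps power2_eq_square)
    also have "exp (t * C) * (t * t * L' / real M) < \<zeta> / 3"
      using M \<zeta> by (simp add: field_simps)
    finally have "exp (t * C) * (real M * (h\<^sup>2 * L')) < \<zeta> / 3" .
    moreover have "exp (t * C) * \<eta> = \<zeta> / 3" by (simp add: \<eta>_def)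
    ultimately show ?thesis using \<zeta> by (simp add: distrib_left)
  qed
  from order_tendstoD(2)[OF lim this]
  have "\<forall>\<^sub>F n in sequentially. exp (t * C) * (\<eta> + real M * ((h + 1 / real n)\<^sup>2 * L' + 2 * C / real n)) < \<zeta>" .
  then have "\<forall>\<^sub>F n in sequentially. \<bar>z n (nat \<lfloor>t * real n\<rfloor>) - e n M\<bar> \<le> \<zeta>"
    using err eventually_ge_at_top[of n0] eventually_gt_at_top[of 0]
  proof eventually_elim
    case (elim n)
    then show ?case using bound[of n] by linarith
  qed
  then show "\<exists>w. convergent w \<and> (\<forall>\<^sub>F n in sequentially. \<bar>z n (nat \<lfloor>t * real n\<rfloor>) - w n\<bar> \<le> \<zeta>)"
    using ec by blast
qed

subsection \<open>Limits of the class densities\<close>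

text \<open>The regularity that \<open>euler_limit\<close> asks of the coefficients: bounded, with
  increments O(1 / n), uniformly in \<open>n\<close>. It is stable under ring operations.\<close>

definition slow :: "(nat \<Rightarrow> nat \<Rightarrow> real) \<Rightarrow> bool" where
  "slow f \<longleftrightarrow> (\<exists>L\<ge>0. \<forall>n\<ge>2. \<forall>m. \<bar>f n (Suc m) - f n m\<bar> \<le> L / real n \<and> \<bar>f n m\<bar> \<le> L)"

lemma slow_const: "slow (\<lambda>_ _. c)"
  unfolding slow_def by (intro exI[of _ "\<bar>c\<bar>"]) auto

lemma slow_add:
  assumes "slow f" "slow g"
  shows "slow (\<lambda>n m. f n m + g n m)"
proof -
  obtain L M where L: "0 \<le> L" "\<And>n m. 2 \<le> n \<Longrightarrow> \<bar>f n (Suc m) - f n m\<bar> \<le> L / real n \<and> \<bar>f n m\<bar> \<le> L"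
    and M: "0 \<le> M" "\<And>n m. 2 \<le> n \<Longrightarrow> \<bar>g n (Suc m) - g n m\<bar> \<le> M / real n \<and> \<bar>g n m\<bar> \<le> M"
    using assms unfolding slow_def by blast
  show ?thesis unfolding slow_def
  proof (intro exI[of _ "L + M"] conjI allI impI)
    fix n m :: nat assume n: "2 \<le> n"
    show "\<bar>f n (Suc m) + g n (Suc m) - (f n m + g n m)\<bar> \<le> (L + M) / real n"
      using L(2)[OF n, of m] M(2)[OF n, of m] unfolding add_divide_distrib by linarith
    show "\<bar>f n m + g n m\<bar> \<le> L + M"
      using L(2)[OF n, of m] M(2)[OF n, of m] by linarith
  qed (use L M in auto)
qed

lemma slow_mult:
  assumes "slow f" "slow g"
  shows "slow (\<lambda>n m. f n m * g n m)"
proof -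
  obtain L M where L: "0 \<le> L" "\<And>n m. 2 \<le> n \<Longrightarrow> \<bar>f n (Suc m) - f n m\<bar> \<le> L / real n \<and> \<bar>f n m\<bar> \<le> L"
    and M: "0 \<le> M" "\<And>n m. 2 \<le> n \<Longrightarrow> \<bar>g n (Suc m) - g n m\<bar> \<le> M / real n \<and> \<bar>g n m\<bar> \<le> M"
    using assms unfolding slow_def by blast
  have LM: "0 \<le> L * M" using L M by simp
  show ?thesis unfolding slow_def
  proof (intro exI[of _ "2 * (L * M)"] conjI allI impI)
    fix n m :: nat assume n: "2 \<le> n"
    have "f n (Suc m) * g n (Suc m) - f n m * g n m
       = (f n (Suc m) - f n m) * g n (Suc m) + f n m * (g n (Suc m) - g n m)" by (simp add: algebra_simps)
    also have "\<bar>\<dots>\<bar> \<le> \<bar>f n (Suc m) - f n m\<bar> * \<bar>g n (Suc m)\<bar> + \<bar>f n m\<bar> * \<bar>g n (Suc m) - g n m\<bar>"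
      unfolding abs_mult[symmetric] by (rule abs_triangle_ineq)
    also have "\<dots> \<le> L / real n * M + L * (M / real n)"
      using L(1) L(2)[OF n, of m] M(1) M(2)[OF n, of m] M(2)[OF n, of "Suc m"]
      by (intro add_mono mult_mono) auto
    finally show "\<bar>f n (Suc m) * g n (Suc m) - f n m * g n m\<bar> \<le> 2 * (L * M) / real n" by simp
    have "\<bar>f n m * g n m\<bar> \<le> L * M"
      unfolding abs_mult using L(1) L(2)[OF n, of m] M(2)[OF n, of m] by (intro mult_mono) auto
    then show "\<bar>f n m * g n m\<bar> \<le> 2 * (L * M)" using LM by linarith
  qed (use LM in auto)
qed

lemma slow_diff: "slow f \<Longrightarrow> slow g \<Longrightarrow> slow (\<lambda>n m. f n m - g n m)"
  using slow_add[of f "\<lambda>n m. -1 * g n m"] slow_mult[OF slow_const[of "-1"], of g] by simp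

lemma slow_sum: "(\<And>i. i \<in> I \<Longrightarrow> slow (f i)) \<Longrightarrow> slow (\<lambda>n m. \<Sum>i\<in>I. f i n m)"
proof (induction I rule: infinite_finite_induct)
  case (insert x F)
  then show ?case using slow_add[of "f x" "\<lambda>n m. \<Sum>i\<in>F. f i n m"] by simp
qed (use slow_const[of 0] in auto)

lemma zz_step:
  assumes n: "2 \<le> n"
  shows "\<bar>zz n j s (Suc m) - zz n j s m\<bar> \<le> 2 * real s / real n"
proof -
  let ?E = "Kn_edges n"
  note fin = finite_Kn[of n] and ne = Kn_ne[OF n]
  have c0: "0 < real (card ?E)" by (rule cardE[OF fin ne])
  have "av ?E (Suc m) (Ns n j s) - av ?E m (Ns n j s)
     = av ?E m (\<lambda>l. (\<Sum>e\<in>?E. Ns n j s (l @ [e]) - Ns n j s l) / real (card ?E))"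
    unfolding av.simps av_diff[symmetric] using c0 by (intro av_cong) (simp add: sum_subtractf field_simps)
  also have "\<bar>\<dots>\<bar> \<le> 2 * real s"
  proof (rule av_abs_le[OF fin ne])
    fix l assume l: "set l \<subseteq> ?E"
    have "\<bar>Ns n j s (l @ [e]) - Ns n j s l\<bar> \<le> 2 * real s" if "e \<in> ?E" for e
    proof -
      have "ins l (l @ [e])" using ins_mid[of l "[]" e] by simp
      moreover have "\<forall>e\<in>set (l @ [e]). good n Kn_ends e" using l that good_Kn by auto
      ultimately show ?thesis unfolding Ns_def rl_def by (intro Phi_ins[OF mbound_gsz])
    qed
    then have "\<bar>\<Sum>e\<in>?E. Ns n j s (l @ [e]) - Ns n j s l\<bar> \<le> (\<Sum>e\<in>?E. 2 * real s)"
      by (intro order_trans[OF sum_abs] sum_mono)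
    then show "\<bar>(\<Sum>e\<in>?E. Ns n j s (l @ [e]) - Ns n j s l) / real (card ?E)\<bar> \<le> 2 * real s"
      using c0 by (simp add: divide_le_eq mult.commute)
  qed
  finally have "\<bar>av ?E (Suc m) (Ns n j s) - av ?E m (Ns n j s)\<bar> \<le> 2 * real s" .
  then have "\<bar>av ?E (Suc m) (Ns n j s) - av ?E m (Ns n j s)\<bar> / real n \<le> 2 * real s / real n"
    by (intro divide_right_mono) auto
  then show ?thesis unfolding zz_def diff_divide_distrib[symmetric] by simp
qed

lemma slow_zz: "slow (\<lambda>n. zz n j s)"
  unfolding slow_def
proof (intro exI[of _ "2 * real s + 1"] conjI allI impI)
  fix n m :: nat assume n: "2 \<le> n"
  have "2 * real s / real n \<le> (2 * real s + 1) / real n" by (intro divide_right_mono) auto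
  then show "\<bar>zz n j s (Suc m) - zz n j s m\<bar> \<le> (2 * real s + 1) / real n"
    using zz_step[OF n, of j s m] by linarith
  show "\<bar>zz n j s m\<bar> \<le> 2 * real s + 1" using zz_bounds[OF n, of j s m] by simp
qed simp

lemma sm_sum: "sm n K j m = (\<Sum>s<K. zz n j s m)"
proof -
  have "Sm n K j = (\<lambda>l. \<Sum>s<K. Ns n j s l)" by (simp add: Sm_sum fun_eq_iff)
  then show ?thesis unfolding sm_def zz_def by (simp add: av_sum sum_divide_distrib)
qed

lemma slow_sm: "slow (\<lambda>n. sm n K j)"
  unfolding sm_sum by (rule slow_sum) (rule slow_zz)

lemma slow_vt: "slow (\<lambda>n. vt n K j a)"
  unfolding vt_def using slow_diff[OF slow_zz slow_sm] slow_diff[OF slow_zz slow_const[of 0]]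
  by (cases "a = 1") auto

lemma vt_bound: "2 \<le> n \<Longrightarrow> \<bar>vt n K j a m\<bar> \<le> 1"
  unfolding vt_def using zz_bounds[of n "Suc j" a m] sm_bounds[of n K j m] by auto

lemma convergent_vt:
  assumes "convergent (\<lambda>n. zz n (Suc j) a (f n))" "\<And>s. convergent (\<lambda>n. zz n j s (f n))"
  shows "convergent (\<lambda>n. vt n K j a (f n))"
proof -
  have "convergent (\<lambda>n. sm n K j (f n))" unfolding sm_sum by (intro convergent_sum assms(2))
  then show ?thesis unfolding vt_def using assms(1)
    by (cases "a = 1") (auto intro: convergent_diff)
qed

text \<open>Outer induction on the level, inner induction on the size. The drift of size
  \<open>s\<close> involves smaller sizes of the same level, finitely many sizes of the previous
  level through \<open>sm\<close>, and is affine in the unknown itself.\<close>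

lemma zz_convergent: "0 \<le> t \<Longrightarrow> convergent (\<lambda>n. zz n j s (nat \<lfloor>t * real n\<rfloor>))"
proof (induction j arbitrary: s t)
  \<comment> \<open>Level 0 has a single class, of size n, so no bounded size survives for large
    n.\<close>
  case 0
  have "\<forall>\<^sub>F n in sequentially. zz n 0 s (nat \<lfloor>t * real n\<rfloor>) = 0"
    using eventually_gt_at_top[of "max s 2"]
  proof eventually_elim
    case (elim n)
    then have n: "2 \<le> n" by simp
    have "Ns n 0 s l = 0" for l
      using elim unfolding Ns_def Phi_def rl_def csz_def gsz_def by simp
    then have "av (Kn_edges n) (nat \<lfloor>t * real n\<rfloor>) (Ns n 0 s) = av (Kn_edges n) (nat \<lfloor>t * real n\<rfloor>) (\<lambda>_. 0)"
      by (intro av_cong)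
    then show ?case unfolding zz_def av_const[OF finite_Kn Kn_ne[OF n]] by simp
  qed
  then have "((\<lambda>n. zz n 0 s (nat \<lfloor>t * real n\<rfloor>)) \<longlongrightarrow> 0) sequentially"
    by (rule tendsto_eventually)
  then show ?case by (rule convergentI)
next
  case (Suc j)
  show ?case using Suc.prems
  proof (induction s arbitrary: t rule: less_induct)
    case (less s)
    have init: "Ns n (Suc j) s [] = (if s = 1 then real n else 0)" for n
    proof -
      have r: "rl (Suc j) [] = (=)" by (simp add: rl_def conn_empty)
      have "csz n (=) u = 1" if "u < n" for u
      proof -
        have "{v. v < n \<and> u = v} = {u}" using that by auto
        then show ?thesis by (simp add: csz_def)
      qed
      then have "Ns n (Suc j) s [] = (\<Sum>u<n. if s = 1 then 1 else 0)"
        unfolding Ns_def Phi_def r gsz_def by (intro sum.cong) auto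
      then show ?thesis by simp
    qed
    have z0: "convergent (\<lambda>n. zz n (Suc j) s 0)"
    proof -
      have "\<forall>\<^sub>F n in sequentially. zz n (Suc j) s 0 = (if s = 1 then 1 else 0)"
        using eventually_gt_at_top[of 0] by eventually_elim (simp add: zz_def init)
      then show ?thesis by (intro convergentI[of _ "if s = 1 then 1 else 0"] tendsto_eventually)
    qed
    consider "s = 0" | "s \<noteq> 0" "t = 0" | "1 \<le> s" "0 < t" using less.prems by linarith
    then show ?case
    proof cases
      case 1
      have "Ns n (Suc j) 0 l = 0" for n l
        unfolding Ns_card using csz_pos[OF equivp_rl, of _ n "Suc j" l] by auto
      then have "Ns n (Suc j) 0 = (\<lambda>_. 0)" for n by (simp add: fun_eq_iff)
      then have "zz n (Suc j) s m = 0" for n m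
        using av_cmult[of "Kn_edges n" m 0 "\<lambda>_. 0"] unfolding zz_def 1 by simp
      then show ?thesis by (simp add: convergent_const)
    next
      case 2
      then show ?thesis using z0 by simp
    next
      case 3
      define C where "C = real s * real s + 2 * real s + 1"
      have C: "1 \<le> C" "2 * real s \<le> C" unfolding C_def using 3 by auto
      show ?thesis
      proof (rule euler_limit[where C = C and ?n0.0 = 2])
        show "1 \<le> C" "0 < t" by fact+
        show "\<bar>zz n (Suc j) s (Suc m) - zz n (Suc j) s m\<bar> \<le> C / real n" if "2 \<le> n" for n m
          using zz_step[OF that, of "Suc j" s m] divide_right_mono[OF C(2), of "real n"] by linarith
        show "\<bar>zz n (Suc j) s m\<bar> \<le> 1" if "2 \<le> n" for n m using zz_bounds[OF that, of "Suc j" s m] by simp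
        show "convergent (\<lambda>n. zz n (Suc j) s 0)" by (rule z0)
        fix \<eta> :: real assume \<eta>: "0 < \<eta>"
        \<comment> \<open>Chosen so that the coefficient 12 s s in \<open>step_av\<close> turns
          \<eta>' into \<eta> / 2.\<close>
        define \<eta>' where "\<eta>' = \<eta> / (24 * (real s)\<^sup>2)"
        have \<eta>': "0 < \<eta>'" using \<eta> 3 by (simp add: \<eta>'_def)
        obtain K where K: "\<forall>\<^sub>F n in sequentially. (1 / real n) * (\<Sum>m<nat \<lfloor>t * real n\<rfloor>. uu n K j m) \<le> \<eta>'"
          using uu_average[OF \<eta>', of t j] 3 by auto
        \<comment> \<open>For s = 1 the loss term contains \<open>vt = zz - sm\<close>; its part
          without \<open>zz\<close> is the inhomogeneity 2 sm (1 - sm).\<close>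
        define P where "P n m = real s * (\<Sum>a\<in>{1..<s}. vt n K j a m * vt n K j (s - a) m)
           + (if s = 1 then 2 else 0) * (sm n K j m * (1 - sm n K j m))" for n m
        define Q where "Q n m = 2 * real s * (1 - sm n K j m)" for n m
        have smc: "convergent (\<lambda>n. sm n K j (nat \<lfloor>t * real n\<rfloor>))" if "0 \<le> t" for t
          unfolding sm_sum by (intro convergent_sum Suc.IH that)
        have vtc: "convergent (\<lambda>n. vt n K j a (nat \<lfloor>t * real n\<rfloor>))" if "0 \<le> t" "a < s" for t a
          by (intro convergent_vt less.IH Suc.IH that)
        have Pc: "convergent (\<lambda>n. P n (nat \<lfloor>t * real n\<rfloor>))" if "0 \<le> t" for t
          unfolding P_def using that 3
          by (intro convergent_add convergent_mult convergent_const convergent_sum convergent_diff smc vtc) auto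
        have Qc: "convergent (\<lambda>n. Q n (nat \<lfloor>t * real n\<rfloor>))" if "0 \<le> t" for t
          unfolding Q_def using that by (intro convergent_mult convergent_const convergent_diff smc)
        have sP: "slow P" unfolding P_def
          by (intro slow_add slow_mult slow_const slow_sum slow_diff slow_sm slow_vt)
        have sQ: "slow Q" unfolding Q_def by (intro slow_mult slow_const slow_diff slow_sm)
        obtain LP LQ where LP: "0 \<le> LP" "\<forall>n\<ge>2. \<forall>m. \<bar>P n (Suc m) - P n m\<bar> \<le> LP / real n"
          and LQ: "0 \<le> LQ" "\<forall>n\<ge>2. \<forall>m. \<bar>Q n (Suc m) - Q n m\<bar> \<le> LQ / real n"
          using sP sQ unfolding slow_def by blast
        have Pb: "\<bar>P n m\<bar> \<le> C" if n: "2 \<le> n" for n m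
        proof -
          have "\<bar>vt n K j a m * vt n K j (s - a) m\<bar> \<le> 1" for a
            unfolding abs_mult using vt_bound[OF n, of K j a m] vt_bound[OF n, of K j "s - a" m]
            by (intro mult_le_one) auto
          then have "\<bar>\<Sum>a\<in>{1..<s}. vt n K j a m * vt n K j (s - a) m\<bar> \<le> (\<Sum>a\<in>{1..<s}. 1)"
            by (intro order_trans[OF sum_abs] sum_mono)
          then have "\<bar>\<Sum>a\<in>{1..<s}. vt n K j a m * vt n K j (s - a) m\<bar> \<le> real s" using 3 by simp
          then have 1: "\<bar>real s * (\<Sum>a\<in>{1..<s}. vt n K j a m * vt n K j (s - a) m)\<bar> \<le> real s * real s"
            unfolding abs_mult by (intro mult_mono) auto
          have x: "0 \<le> sm n K j m" "sm n K j m \<le> 1" using sm_bounds[of n K j m] n by auto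
          have "sm n K j m * (1 - sm n K j m) \<le> 1" using x by (intro mult_le_one) auto
          moreover have "0 \<le> sm n K j m * (1 - sm n K j m)" using x by simp
          ultimately have "\<bar>(if s = 1 then 2 else 0) * (sm n K j m * (1 - sm n K j m))\<bar> \<le> 2 * real s"
            using 3 by auto
          then show ?thesis using 1 unfolding P_def C_def by linarith
        qed
        have Qb: "\<bar>Q n m\<bar> \<le> C" if n: "2 \<le> n" for n m
        proof -
          have x: "0 \<le> sm n K j m" "sm n K j m \<le> 1" using sm_bounds[of n K j m] n by auto
          have "\<bar>Q n m\<bar> \<le> 2 * real s * 1" unfolding Q_def abs_mult using x by (intro mult_mono) auto
          then show ?thesis using C by simp
        qed
        define C1 where "C1 = 12 * (real s)\<^sup>2 * (real K + real s) + 48 * (real s)\<^sup>2 * real K + real s * (real s + 2)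
          + real s * (real s + 2) * (4 * real s + 4 * real K)\<^sup>2"
        have C1: "0 \<le> C1" by (simp add: C1_def)
        have each: "\<bar>zz n (Suc j) s (Suc m) - zz n (Suc j) s m - (1 / real n) * (P n m - Q n m * zz n (Suc j) s m)\<bar>
          \<le> (1 / real n) * (12 * (real s)\<^sup>2 * uu n K j m + C1 * (1 + real m / real n) / (real n - 1))"
          if n: "2 \<le> n" for n m
        proof -
          have "P n m - Q n m * zz n (Suc j) s m
            = real s * ((\<Sum>a\<in>{1..<s}. vt n K j a m * vt n K j (s - a) m) - 2 * (vt n K j s m * (1 - sm n K j m)))"
            unfolding P_def Q_def vt_def[of n K j s] by (auto simp: algebra_simps)
          then show ?thesis using step_av[OF n 3(1), of j m K] unfolding C1_def by simp
        qed
        have "((\<lambda>n. t * (C1 * (1 + t) / (real n - 1))) \<longlongrightarrow> 0) sequentially" by real_asymp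
        then have "\<forall>\<^sub>F n in sequentially. t * (C1 * (1 + t) / (real n - 1)) < \<eta> / 2"
          using \<eta> by (intro order_tendstoD) auto
        then have resid: "\<forall>\<^sub>F n in sequentially. (\<Sum>m<nat \<lfloor>t * real n\<rfloor>.
           \<bar>zz n (Suc j) s (Suc m) - zz n (Suc j) s m - (1 / real n) * (P n m - Q n m * zz n (Suc j) s m)\<bar>) \<le> \<eta>"
          using K eventually_ge_at_top[of 2]
        proof eventually_elim
          case (elim n)
          let ?M = "nat \<lfloor>t * real n\<rfloor>"
          have M: "real ?M \<le> t * real n" using 3 by simp
          have "(\<Sum>m<?M. \<bar>zz n (Suc j) s (Suc m) - zz n (Suc j) s m - (1 / real n) * (P n m - Q n m * zz n (Suc j) s m)\<bar>)
            \<le> (\<Sum>m<?M. 12 * (real s)\<^sup>2 * ((1 / real n) * uu n K j m) + (1 / real n) * (C1 * (1 + t) / (real n - 1)))"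
          proof (rule sum_mono)
            fix m assume m: "m \<in> {..<?M}"
            then have "real m \<le> t * real n" using M by simp
            then have "real m / real n \<le> t" using elim(3) by (simp add: divide_le_eq)
            then have "C1 * (1 + real m / real n) / (real n - 1) \<le> C1 * (1 + t) / (real n - 1)"
              using C1 elim(3) by (intro divide_right_mono mult_left_mono) auto
            then have "(1 / real n) * (12 * (real s)\<^sup>2 * uu n K j m + C1 * (1 + real m / real n) / (real n - 1))
              \<le> (1 / real n) * (12 * (real s)\<^sup>2 * uu n K j m + C1 * (1 + t) / (real n - 1))"
              by (intro mult_left_mono) auto
            then show "\<bar>zz n (Suc j) s (Suc m) - zz n (Suc j) s m - (1 / real n) * (P n m - Q n m * zz n (Suc j) s m)\<bar>
              \<le> 12 * (real s)\<^sup>2 * ((1 / real n) * uu n K j m) + (1 / real n) * (C1 * (1 + t) / (real n - 1))"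
              using each[OF elim(3), of m] by (simp add: distrib_left mult.assoc mult.left_commute)
          qed
          also have "\<dots> = 12 * (real s)\<^sup>2 * ((1 / real n) * (\<Sum>m<?M. uu n K j m)) + (1 / real n) * (real ?M * (C1 * (1 + t) / (real n - 1)))"
            by (simp only: sum.distrib sum_distrib_left[symmetric] sum_constant card_lessThan)
          also have "12 * (real s)\<^sup>2 * ((1 / real n) * (\<Sum>m<?M. uu n K j m)) \<le> 12 * (real s)\<^sup>2 * \<eta>'"
            using elim(2) by (intro mult_left_mono) auto
          also have "12 * (real s)\<^sup>2 * \<eta>' = \<eta> / 2" unfolding \<eta>'_def using 3 by simp
          also have "(1 / real n) * (real ?M * (C1 * (1 + t) / (real n - 1))) \<le> (1 / real n) * ((t * real n) * (C1 * (1 + t) / (real n - 1)))"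
            using M C1 elim(3) 3 by (intro mult_left_mono mult_right_mono) auto
          also have "\<dots> = t * (C1 * (1 + t) / (real n - 1))" using elim(3) by simp
          finally show ?case using elim(1) by linarith
        qed
        show "\<exists>P Q L. 0 \<le> L \<and>
          (\<forall>t\<ge>0. convergent (\<lambda>n. P n (nat \<lfloor>t * real n\<rfloor>))) \<and> (\<forall>t\<ge>0. convergent (\<lambda>n. Q n (nat \<lfloor>t * real n\<rfloor>))) \<and>
          (\<forall>n\<ge>2. \<forall>m. \<bar>P n (Suc m) - P n m\<bar> \<le> L / real n \<and> \<bar>Q n (Suc m) - Q n m\<bar> \<le> L / real n \<and> \<bar>P n m\<bar> \<le> C \<and> \<bar>Q n m\<bar> \<le> C) \<and>
          (\<forall>\<^sub>F n in sequentially. (\<Sum>m<nat \<lfloor>t * real n\<rfloor>. \<bar>zz n (Suc j) s (Suc m) - zz n (Suc j) s m - (1 / real n) * (P n m - Q n m * zz n (Suc j) s m)\<bar>) \<le> \<eta>)"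
        proof (rule exI[of _ P], rule exI[of _ Q], rule exI[of _ "LP + LQ"], intro conjI allI impI)
          fix n m :: nat assume n: "2 \<le> n"
          have "LP / real n \<le> (LP + LQ) / real n" "LQ / real n \<le> (LP + LQ) / real n"
            using LP(1) LQ(1) by (intro divide_right_mono; simp)+
          then show "\<bar>P n (Suc m) - P n m\<bar> \<le> (LP + LQ) / real n" "\<bar>Q n (Suc m) - Q n m\<bar> \<le> (LP + LQ) / real n"
            using LP(2) LQ(2) n by (meson order_trans)+
        qed (use LP(1) LQ(1) Pc Qc Pb Qb resid in auto)
      qed
    qed
  qed
qed

section \<open>Number of components: limit and concentration\<close>

definition rho :: "nat \<Rightarrow> nat \<Rightarrow> (nat \<times> nat) list \<Rightarrow> real" where
  "rho n j l = Phi n ginv (rl j l)"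

text \<open>There are at most n / S classes of size at least S.\<close>

lemma rho_truncate:
  assumes "0 < S"
  shows "\<bar>rho n j l - (\<Sum>s<S. Ns n j s l / real s)\<bar> \<le> real n / real S"
proof -
  have "(\<Sum>s<S. Ns n j s l / real s) = (\<Sum>u<n. \<Sum>s<S. gsz s (csz n (rl j l) u) / real s)"
    unfolding Ns_def Phi_def sum_divide_distrib by (rule sum.swap)
  also have "\<dots> = (\<Sum>u<n. if csz n (rl j l) u < S then ginv (csz n (rl j l) u) else 0)"
    unfolding gsz_def ginv_def by (intro sum.cong refl) (simp add: if_distrib[of "\<lambda>x. x / _"] sum.delta' cong: if_cong)
  finally have "rho n j l - (\<Sum>s<S. Ns n j s l / real s)
     = (\<Sum>u<n. if csz n (rl j l) u < S then 0 else ginv (csz n (rl j l) u))"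
    unfolding rho_def Phi_def by (simp add: sum_subtractf[symmetric] if_distrib cong: if_cong sum.cong)
  also have "\<bar>\<dots>\<bar> \<le> (\<Sum>u<n. 1 / real S)"
    using assms unfolding ginv_def
    by (intro order_trans[OF sum_abs] sum_mono) (auto intro: divide_left_mono)
  finally show ?thesis by simp
qed

lemma rho_convergent:
  assumes "0 \<le> t"
  shows "convergent (\<lambda>n. av (Kn_edges n) (nat \<lfloor>t * real n\<rfloor>) (rho n j) / real n)"
proof (rule convergent_approx)
  fix \<zeta> :: real assume \<zeta>: "0 < \<zeta>"
  obtain S :: nat where S: "1 / \<zeta> < real S" using reals_Archimedean2 by blast
  have S0: "0 < S" using S \<zeta> by (metis less_eq_real_def not_gr_zero of_nat_0 order_less_asym zero_less_divide_1_iff)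
  have S1: "1 / real S \<le> \<zeta>" using S \<zeta> S0 by (simp add: field_simps)
  let ?m = "\<lambda>n. nat \<lfloor>t * real n\<rfloor>"
  have c: "convergent (\<lambda>n. \<Sum>s<S. zz n j s (?m n) * (1 / real s))"
    by (intro convergent_sum convergent_mult convergent_const zz_convergent assms)
  have "\<forall>\<^sub>F n in sequentially. \<bar>av (Kn_edges n) (?m n) (rho n j) / real n - (\<Sum>s<S. zz n j s (?m n) * (1 / real s))\<bar> \<le> \<zeta>"
    using eventually_ge_at_top[of 2]
  proof eventually_elim
    case (elim n)
    note fin = finite_Kn[of n] and ne = Kn_ne[OF elim]
    have "av (Kn_edges n) (?m n) (\<lambda>l. \<Sum>s<S. Ns n j s l / real s) = (\<Sum>s<S. av (Kn_edges n) (?m n) (\<lambda>l. (1 / real s) * Ns n j s l))"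
      unfolding av_sum by simp
    also have "\<dots> = real n * (\<Sum>s<S. zz n j s (?m n) * (1 / real s))"
      unfolding av_cmult zz_def sum_distrib_left using elim by (intro sum.cong) auto
    finally have "av (Kn_edges n) (?m n) (rho n j) - real n * (\<Sum>s<S. zz n j s (?m n) * (1 / real s))
       = av (Kn_edges n) (?m n) (\<lambda>l. rho n j l - (\<Sum>s<S. Ns n j s l / real s))"
      by (simp add: av_diff)
    also have "\<bar>\<dots>\<bar> \<le> real n / real S" by (rule av_abs_le[OF fin ne]) (rule rho_truncate[OF S0])
    also have "\<dots> = real n * (1 / real S)" by simp
    also have "\<dots> \<le> real n * \<zeta>" using S1 by (intro mult_left_mono) auto
    finally have "\<bar>av (Kn_edges n) (?m n) (rho n j) - real n * (\<Sum>s<S. zz n j s (?m n) * (1 / real s))\<bar> / real n \<le> real n * \<zeta> / real n"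
      by (intro divide_right_mono) auto
    moreover have "av (Kn_edges n) (?m n) (rho n j) / real n - (\<Sum>s<S. zz n j s (?m n) * (1 / real s))
       = (av (Kn_edges n) (?m n) (rho n j) - real n * (\<Sum>s<S. zz n j s (?m n) * (1 / real s))) / real n"
      using elim by (simp add: field_simps)
    ultimately show ?case using elim by (simp add: abs_divide)
  qed
  then show "\<exists>w. convergent w \<and> (\<forall>\<^sub>F n in sequentially. \<bar>av (Kn_edges n) (?m n) (rho n j) / real n - w n\<bar> \<le> \<zeta>)"
    using c by blast
qed

text \<open>The time \<open>t\<close> is the number of scanned edges divided by \<open>n\<close>. On
  the cost scale t / n about t n / 2 edges have appeared, which explains the argument t / 2 in later
  statements.\<close>

definition rhol :: "nat \<Rightarrow> real \<Rightarrow> real" where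
  "rhol j t = lim (\<lambda>n. av (Kn_edges n) (nat \<lfloor>t * real n\<rfloor>) (rho n j) / real n)"

text \<open>Chebyshev: replacing a letter changes the number of classes by at most 2, so the
  variance is O(n), against squared deviations of order n squared.\<close>

lemma rho_concentrated:
  assumes t: "0 \<le> t" and \<epsilon>: "0 < \<epsilon>"
  shows "(\<lambda>n. av (Kn_edges n) (nat \<lfloor>t * real n\<rfloor>)
    (\<lambda>l. if \<epsilon> * real n \<le> \<bar>rho n j l - real n * rhol j t\<bar> then 1 else 0)) \<longlonglongrightarrow> 0"
proof -
  let ?m = "\<lambda>n. nat \<lfloor>t * real n\<rfloor>"
  let ?A = "\<lambda>n. av (Kn_edges n) (?m n)"
  have "(\<lambda>n. ?A n (rho n j) / real n) \<longlonglongrightarrow> rhol j t"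
    using rho_convergent[OF t, of j] unfolding rhol_def convergent_LIMSEQ_iff .
  then have ev: "\<forall>\<^sub>F n in sequentially. dist (?A n (rho n j) / real n) (rhol j t) < \<epsilon> / 2"
    using \<epsilon> by (intro tendstoD) auto
  have up: "\<forall>\<^sub>F n in sequentially. ?A n (\<lambda>l. if \<epsilon> * real n \<le> \<bar>rho n j l - real n * rhol j t\<bar> then 1 else 0)
     \<le> 16 * t / (\<epsilon>\<^sup>2 * real n)"
    using ev eventually_ge_at_top[of 2]
  proof eventually_elim
    case (elim n)
    note fin = finite_Kn[of n] and ne = Kn_ne[OF elim(2)]
    let ?a = "?A n (rho n j)"
    have "\<bar>?a / real n - rhol j t\<bar> < \<epsilon> / 2" using elim(1) by (simp add: dist_real_def)
    then have "real n * \<bar>?a / real n - rhol j t\<bar> < real n * (\<epsilon> / 2)" using elim(2) by (intro mult_strict_left_mono) auto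
    then have a: "\<bar>?a - real n * rhol j t\<bar> < \<epsilon> * real n / 2"
      using elim(2) by (simp add: abs_mult_pos' right_diff_distrib mult.commute)
    have c: "0 < (\<epsilon> * real n / 2)\<^sup>2" using \<epsilon> elim(2) by simp
    have "?A n (\<lambda>l. if \<epsilon> * real n \<le> \<bar>rho n j l - real n * rhol j t\<bar> then 1 else 0)
      \<le> ?A n (\<lambda>l. if (\<epsilon> * real n / 2)\<^sup>2 \<le> (rho n j l - ?a)\<^sup>2 then 1 else 0)"
    proof (rule av_mono)
      fix l
      have "(\<epsilon> * real n / 2)\<^sup>2 \<le> (rho n j l - ?a)\<^sup>2" if "\<epsilon> * real n \<le> \<bar>rho n j l - real n * rhol j t\<bar>"
      proof -
        have "\<bar>\<epsilon> * real n / 2\<bar> \<le> \<bar>rho n j l - ?a\<bar>" using that a mult_nonneg_nonneg[of \<epsilon> "real n"] \<epsilon> by linarith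
        then show ?thesis by (simp only: abs_le_square_iff)
      qed
      then show "(if \<epsilon> * real n \<le> \<bar>rho n j l - real n * rhol j t\<bar> then 1 else 0)
         \<le> (if (\<epsilon> * real n / 2)\<^sup>2 \<le> (rho n j l - ?a)\<^sup>2 then 1 else (0::real))" by auto
    qed
    also have "\<dots> \<le> ?A n (\<lambda>l. (rho n j l - ?a)\<^sup>2) / (\<epsilon> * real n / 2)\<^sup>2"
      by (rule av_Markov[OF fin ne _ c]) simp
    also have "\<dots> \<le> (real (?m n) * (2 * 1)\<^sup>2) / (\<epsilon> * real n / 2)\<^sup>2"
    proof (intro divide_right_mono)
      show "?A n (\<lambda>l. (rho n j l - ?a)\<^sup>2) \<le> real (?m n) * (2 * 1)\<^sup>2"
        using Phi_variance[OF fin ne _ mbound_ginv, of n Kn_ends "?m n" j] good_Kn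
        unfolding rho_def rl_def by auto
    qed simp
    also have "\<dots> \<le> ((t * real n) * (2 * 1)\<^sup>2) / (\<epsilon> * real n / 2)\<^sup>2"
      using t by (intro divide_right_mono mult_right_mono) auto
    also have "\<dots> = 16 * t / (\<epsilon>\<^sup>2 * real n)" using elim(2) \<epsilon> by (simp add: field_simps power2_eq_square)
    finally show ?case .
  qed
  have lo: "\<forall>\<^sub>F n in sequentially. 0 \<le> ?A n (\<lambda>l. if \<epsilon> * real n \<le> \<bar>rho n j l - real n * rhol j t\<bar> then 1 else 0)"
    using eventually_ge_at_top[of 2]
    by eventually_elim (intro av_nonneg finite_Kn Kn_ne, auto)
  have "(\<lambda>n. 16 * t / (\<epsilon>\<^sup>2 * real n)) \<longlonglongrightarrow> 0"
    using tendsto_mult_right_zero[OF lim_1_over_n, of "16 * t / \<epsilon>\<^sup>2"] by simp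
  then show ?thesis by (rule tendsto_sandwich[OF lo up tendsto_const])
qed

subsection \<open>Minimum spanning trees and greedy forests\<close>

text \<open>The number of components of the graph with edge set \<open>S\<close> on \<open>n\<close>
  vertices.\<close>

definition rhoE :: "nat \<Rightarrow> ('e \<Rightarrow> nat set) \<Rightarrow> 'e set \<Rightarrow> real" where
  "rhoE n en S = Phi n ginv (conn en S)"

lemma rhoE_empty: "rhoE n en {} = real n"
proof -
  have "csz n (=) u = 1" if "u < n" for u
  proof -
    have "{v. v < n \<and> u = v} = {u}" using that by auto
    then show ?thesis by (simp add: csz_def)
  qed
  then show ?thesis by (simp add: rhoE_def conn_empty Phi_def ginv_def)
qed

lemma rhoE_insert:
  assumes "good n en e"
  shows "rhoE n en (insert e S) = rhoE n en S - (if cyc en S e then 0 else 1)"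
proof -
  obtain a b where ab: "a < n" "b < n" "en e = {a, b}" using assms by (auto simp: good_def)
  have c: "cyc en S e = conn en S a b" by (rule cyc_iff[of en e, OF ab(3)])
  show ?thesis
  proof (cases "conn en S a b")
    case True
    then show ?thesis unfolding rhoE_def conn_insert[of en e, OF ab(3)] c
      by (simp add: merge_same[OF equivp_conn])
  next
    case False
    have "0 < csz n (conn en S) a" "0 < csz n (conn en S) b" using ab by (auto intro: csz_pos[OF equivp_conn])
    then show ?thesis
      unfolding rhoE_def conn_insert[of en e, OF ab(3)] c Phi_merge[OF equivp_conn False ab(1,2)] ginv_def
      using False by simp
  qed
qed

lemma rhoE_union:
  assumes "finite H" "\<forall>e\<in>H. good n en e"
  shows "rhoE n en (S \<union> H) \<le> rhoE n en S \<and> rhoE n en S - real (card H) \<le> rhoE n en (S \<union> H)"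
  using assms
proof (induction H rule: finite_induct)
  case (insert e H)
  then show ?case using rhoE_insert[of n en e "S \<union> H"] by auto
qed simp

lemma Phi_ginv_ge_1:
  assumes "equivp R" "0 < n"
  shows "1 \<le> Phi n ginv R"
proof -
  have "(\<Sum>u<n. 1 / real n) \<le> Phi n ginv R"
    unfolding Phi_def ginv_def using csz_le[of n R] csz_pos[OF assms(1)]
    by (intro sum_mono divide_left_mono) auto
  then show ?thesis using assms by simp
qed

lemma Phi_ginv_eq_1:
  assumes R: "equivp R" and n: "0 < n"
  shows "Phi n ginv R = 1 \<longleftrightarrow> (\<forall>u<n. \<forall>v<n. R u v)"
proof
  assume *: "\<forall>u<n. \<forall>v<n. R u v"
  have "csz n R u = n" if "u < n" for u
  proof -
    have "{v. v < n \<and> R u v} = {..<n}" using * that by auto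
    then show ?thesis by (simp add: csz_def)
  qed
  then show "Phi n ginv R = 1" unfolding Phi_def ginv_def using n by simp
next
  assume 1: "Phi n ginv R = 1"
  show "\<forall>u<n. \<forall>v<n. R u v"
  proof (rule ccontr)
    assume "\<not> ?thesis"
    then obtain u v where uv: "u < n" "v < n" "\<not> R u v" by auto
    have "{w. w < n \<and> R u w} \<subset> {..<n}" using uv by auto
    then have "csz n R u < n" unfolding csz_def using psubset_card_mono[of "{..<n}"] by auto
    then have s: "1 / real n < ginv (csz n R u)"
      unfolding ginv_def using csz_pos[OF R uv(1)] by (intro divide_strict_left_mono) auto
    have "(\<Sum>u<n. 1 / real n) < Phi n ginv R"
      unfolding Phi_def
    proof (rule sum_strict_mono_ex1)
      show "\<forall>x\<in>{..<n}. 1 / real n \<le> ginv (csz n R x)"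
        unfolding ginv_def using csz_le[of n R] csz_pos[OF R] by (auto intro: divide_left_mono)
      show "\<exists>a\<in>{..<n}. 1 / real n < ginv (csz n R a)" using s uv by auto
    qed simp
    then show False using 1 n by simp
  qed
qed

fun accA :: "('e \<Rightarrow> nat set) \<Rightarrow> 'e set \<Rightarrow> 'e list \<Rightarrow> 'e list" where
  "accA en S [] = []"
| "accA en S (e # l) = (if cyc en S e then [] else [e]) @ accA en (insert e S) l"

definition acc :: "('e \<Rightarrow> nat set) \<Rightarrow> 'e list \<Rightarrow> 'e list" where
  "acc en l = accA en {} l"

lemma set_accA: "set l = set (accA en S l) \<union> set (rejA en S l)"
  by (induction l arbitrary: S) auto

lemma disjoint_accA: "distinct l \<Longrightarrow> set (accA en S l) \<inter> set (rejA en S l) = {}"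
proof (induction l arbitrary: S)
  case (Cons e l)
  have "e \<notin> set (accA en (insert e S) l)" "e \<notin> set (rejA en (insert e S) l)"
    using Cons.prems set_accA[of l en "insert e S"] by auto
  then show ?case using Cons by auto
qed simp

lemma distinct_accA: "distinct l \<Longrightarrow> distinct (accA en S l)"
  by (induction l arbitrary: S) (use set_accA in \<open>fastforce+\<close>)

lemma length_accA:
  "\<forall>e\<in>set l. good n en e \<Longrightarrow> real (length (accA en S l)) = rhoE n en S - rhoE n en (S \<union> set l)"
proof (induction l arbitrary: S)
  case (Cons e l)
  then show ?case using rhoE_insert[of n en e S] by (auto simp: insert_commute)
qed simp

text \<open>\<open>S'\<close> receives accepted edges only, \<open>S\<close> all scanned ones; a
  rejected edge joins vertices that are already joined, so both connectivities stay equal.\<close>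

lemma conn_accA:
  assumes "\<forall>e\<in>set l. good n en e" "conn en S' = conn en S"
  shows "conn en (S' \<union> set (accA en S l)) = conn en (S \<union> set l)"
  using assms
proof (induction l arbitrary: S S')
  case (Cons e l)
  then obtain a b where ab: "en e = {a, b}" by (auto simp: good_def)
  have gl: "\<forall>e\<in>set l. good n en e" using Cons.prems by auto
  have i: "conn en (insert e T) = merge (conn en T) a b" for T by (rule conn_insert[of en e, OF ab])
  show ?case
  proof (cases "cyc en S e")
    case True
    then have "conn en S a b" by (simp add: cyc_iff[of en e, OF ab])
    then have "conn en S' = conn en (insert e S)" unfolding i by (simp add: merge_same[OF equivp_conn] Cons.prems)
    from Cons.IH[OF gl this] show ?thesis using True by simp
  next
    case False
    have "conn en (insert e S') = conn en (insert e S)" unfolding i by (simp add: Cons.prems)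
    from Cons.IH[OF gl this] show ?thesis using False by simp
  qed
qed simp

lemma accA_append: "accA en S (a @ b) = accA en S a @ accA en (S \<union> set a) b"
  by (induction a arbitrary: S) auto

section \<open>Optimality and uniqueness of the greedy tree through counting functions\<close>

definition ctr :: "('e \<Rightarrow> real) \<Rightarrow> 'e set \<Rightarrow> real \<Rightarrow> nat" where
  "ctr c G t = card {e \<in> G. c e \<le> t}"

lemma ctr_remove:
  assumes "finite G" "e \<in> G"
  shows "ctr c G t = ctr c (G - {e}) t + (if c e \<le> t then 1 else 0)"
proof (cases "c e \<le> t")
  case True
  then have "{e \<in> G. c e \<le> t} = insert e {x \<in> G - {e}. c x \<le> t}" using assms by auto
  then show ?thesis using assms True unfolding ctr_def by simp
next
  case False
  then have "{e \<in> G. c e \<le> t} = {x \<in> G - {e}. c x \<le> t}" using assms by auto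
  then show ?thesis using False unfolding ctr_def by simp
qed

lemma finite_maximizer:
  fixes c :: "'a \<Rightarrow> real"
  assumes "finite T" "T \<noteq> {}"
  obtains x where "x \<in> T" "\<And>e. e \<in> T \<Longrightarrow> c e \<le> c x"
proof -
  have "Max (c ` T) \<in> c ` T" using assms by (intro Max_in) auto
  then obtain x where "x \<in> T" "Max (c ` T) = c x" by auto
  moreover have "c e \<le> Max (c ` T)" if "e \<in> T" for e using that assms by (intro Max_ge) auto
  ultimately show thesis using that by simp
qed

text \<open>Optimality without edge swaps: if \<open>T\<close> has at least as many cheap elements
  as \<open>G\<close> at every threshold, then matching the costliest elements, the next ones, and
  so on, gives \<open>T\<close> the smaller sum, with equality only if all counts agree.\<close>

lemma ctr_sum_le:
  assumes "finite T" "finite G" "card T = card G" "\<And>t. ctr c G t \<le> ctr c T t"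
  shows "sum c T \<le> sum c G \<and> (sum c G \<le> sum c T \<longrightarrow> (\<forall>t. ctr c G t = ctr c T t))"
  using assms
proof (induction "card T" arbitrary: T G)
  case 0
  then show ?case by (simp add: ctr_def)
next
  case (Suc N)
  have ne: "T \<noteq> {}" "G \<noteq> {}" using Suc by auto
  obtain x where x: "x \<in> T" "\<And>e. e \<in> T \<Longrightarrow> c e \<le> c x"
    using finite_maximizer[OF Suc.prems(1) ne(1), of c] by metis
  obtain y where y: "y \<in> G" "\<And>e. e \<in> G \<Longrightarrow> c e \<le> c y"
    using finite_maximizer[OF Suc.prems(2) ne(2), of c] by metis
  \<comment> \<open>At the threshold \<open>c y\<close> all of \<open>G\<close> is counted, hence
    all of \<open>T\<close>.\<close>
  have xy: "c x \<le> c y"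
  proof -
    have "ctr c G (c y) = card G" unfolding ctr_def using y by (intro arg_cong[where f = card]) auto
    then have "card T \<le> card {e \<in> T. c e \<le> c y}" using Suc.prems(3) Suc.prems(4)[of "c y"] by (simp add: ctr_def)
    then have "{e \<in> T. c e \<le> c y} = T" using Suc.prems(1) by (intro card_seteq) auto
    then show ?thesis using x(1) by auto
  qed
  have rT: "ctr c T t = ctr c (T - {x}) t + (if c x \<le> t then 1 else 0)" for t
    by (rule ctr_remove) (use Suc.prems x in auto)
  have rG: "ctr c G t = ctr c (G - {y}) t + (if c y \<le> t then 1 else 0)" for t
    by (rule ctr_remove) (use Suc.prems y in auto)
  have cN: "card (T - {x}) = N" "card (G - {y}) = N"
    using Suc.hyps(2) Suc.prems x y by auto
  have le: "ctr c (G - {y}) t \<le> ctr c (T - {x}) t" for t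
  proof (cases "c x \<le> t")
    case True
    then have "ctr c (T - {x}) t = N"
      unfolding ctr_def cN(1)[symmetric] using x(2) by (intro arg_cong[where f = card]) (auto intro: order_trans)
    moreover have "ctr c (G - {y}) t \<le> N"
      unfolding ctr_def cN(2)[symmetric] using Suc.prems(2) by (intro card_mono) auto
    ultimately show ?thesis by simp
  next
    case False
    then show ?thesis using rT[of t] rG[of t] xy Suc.prems(4)[of t] by auto
  qed
  have IH: "sum c (T - {x}) \<le> sum c (G - {y}) \<and> (sum c (G - {y}) \<le> sum c (T - {x}) \<longrightarrow> (\<forall>t. ctr c (G - {y}) t = ctr c (T - {x}) t))"
    by (rule Suc.hyps(1)) (use cN Suc.prems le in auto)
  have s: "sum c T = c x + sum c (T - {x})" "sum c G = c y + sum c (G - {y})"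
    using Suc.prems x y by (simp_all add: sum.remove)
  show ?case
  proof (intro conjI impI)
    show "sum c T \<le> sum c G" using IH xy s by linarith
    assume "sum c G \<le> sum c T"
    then have "c x = c y" "sum c (G - {y}) \<le> sum c (T - {x})" using IH xy s by linarith+
    then show "\<forall>t. ctr c G t = ctr c T t" using IH rT rG by simp
  qed
qed

lemma ctr_eq_imp_eq:
  fixes X Y :: "real set"
  assumes fin: "finite X" "finite Y" and eq: "\<And>t. card {x \<in> X. x \<le> t} = card {x \<in> Y. x \<le> t}"
  shows "X = Y"
proof -
  have half: "x \<in> Y" if *: "finite X" "finite Y" "\<And>t. card {x \<in> X. x \<le> t} = card {x \<in> Y. x \<le> t}" "x \<in> X"
    "\<And>y. y < x \<Longrightarrow> y \<in> X \<longleftrightarrow> y \<in> Y" for X Y :: "real set" and x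
  proof (rule ccontr)
    assume n: "x \<notin> Y"
    have "{y \<in> X. y \<le> x} = insert x {y \<in> Y. y \<le> x}" using that n by (auto simp: le_less)
    then have "card {y \<in> X. y \<le> x} = Suc (card {y \<in> Y. y \<le> x})" using n *(2) by simp
    then show False using *(3)[of x] by simp
  qed
  show ?thesis
  proof (rule ccontr)
    assume ne: "X \<noteq> Y"
    define D where "D = (X - Y) \<union> (Y - X)"
    have D: "finite D" "D \<noteq> {}" using fin ne by (auto simp: D_def)
    define x where "x = Min D"
    have x: "x \<in> D" "\<And>y. y \<in> D \<Longrightarrow> x \<le> y" using D by (auto simp: x_def)
    have same: "y \<in> X \<longleftrightarrow> y \<in> Y" if "y < x" for y using x(2)[of y] that by (auto simp: D_def)
    show False
    proof (cases "x \<in> X")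
      case True
      then show ?thesis using half[OF fin eq, of x] same x(1) by (auto simp: D_def)
    next
      case False
      then show ?thesis using half[OF fin(2,1) eq[symmetric], of x] same x(1) by (auto simp: D_def)
    qed
  qed
qed

text \<open>The cutoff \<open>C\<close> leaves a finite list even when the edge set is infinite, as
  in the multigraph; strict sorting encodes that the listed costs are distinct.\<close>

definition enum :: "('e \<Rightarrow> real) \<Rightarrow> real \<Rightarrow> 'e set \<Rightarrow> 'e list \<Rightarrow> bool" where
  "enum c C A l \<longleftrightarrow> sorted_wrt (\<lambda>x y. c x < c y) l \<and> set l = {e \<in> A. c e \<le> C}"

lemma sorted_wrt_distinct: "sorted_wrt (\<lambda>x y. c x < (c y :: real)) l \<Longrightarrow> distinct l"
  by (induction l) auto

lemma sorted_wrt_inj: "sorted_wrt (\<lambda>x y. c x < (c y :: real)) l \<Longrightarrow> inj_on c (set l)"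
proof (induction l)
  case (Cons a l)
  then have "c a \<notin> c ` set l" by fastforce
  then show ?case using Cons by auto
qed simp

lemma sorted_split:
  fixes c :: "'e \<Rightarrow> real"
  assumes "sorted_wrt (\<lambda>x y. c x < c y) l"
  shows "l = filter (\<lambda>e. c e \<le> t) l @ filter (\<lambda>e. \<not> c e \<le> t) l"
  using assms
proof (induction l)
  case (Cons e l)
  then show ?case
  proof (cases "c e \<le> t")
    case False
    then have "filter (\<lambda>e. c e \<le> t) l = []" "filter (\<lambda>e. \<not> c e \<le> t) l = l"
      using Cons.prems by (auto simp: filter_empty_conv filter_id_conv)
    then show ?thesis using False by simp
  qed simp
qed simp

lemma sorted_rejA: "sorted_wrt P l \<Longrightarrow> sorted_wrt P (rejA en S l)"
  by (induction l arbitrary: S) (use set_rejA in \<open>fastforce+\<close>)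

context
  fixes n :: nat and en :: "'e \<Rightarrow> nat set" and c :: "'e \<Rightarrow> real" and C :: real
  assumes n: "0 < n"
begin

text \<open>The edges of cost at most \<open>t\<close> form a prefix of the scan, and each
  acceptance lowers the number of components by one.\<close>

lemma acc_ctr:
  assumes "\<forall>e\<in>A. good n en e" "enum c C A l" "t \<le> C"
  shows "real (ctr c (set (acc en l)) t) = real n - rhoE n en {e \<in> A. c e \<le> t}"
proof -
  have st: "sorted_wrt (\<lambda>x y. c x < c y) l" and sl: "set l = {e \<in> A. c e \<le> C}"
    using assms by (auto simp: enum_def)
  define a b where "a = filter (\<lambda>e. c e \<le> t) l" and "b = filter (\<lambda>e. \<not> c e \<le> t) l"
  have l: "l = a @ b" unfolding a_def b_def by (rule sorted_split[OF st])
  have sa: "set a = {e \<in> A. c e \<le> t}" unfolding a_def set_filter sl using assms(3) by auto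
  have da: "distinct a" unfolding a_def using sorted_wrt_distinct[OF st] by simp
  have "{e \<in> set (acc en l). c e \<le> t} = set (accA en {} a)"
    unfolding acc_def l accA_append using set_accA[of a en "{}"] set_accA[of b en "{} \<union> set a"]
    by (auto simp: a_def b_def)
  then have "ctr c (set (acc en l)) t = length (accA en {} a)"
    unfolding ctr_def using distinct_accA[OF da] by (simp add: distinct_card)
  moreover have "\<forall>e\<in>set a. good n en e" using sa assms(1) by auto
  ultimately show ?thesis using length_accA[of a n en "{}"] by (simp add: rhoE_empty sa)
qed

text \<open>A forest of edges of cost at most \<open>t\<close> has at most n minus the number of
  components many edges, and the greedy tree attains this at every \<open>t\<close>, so
  \<open>ctr_sum_le\<close> applies. Uniqueness is what identifies the choice made in
  \<open>next_MST\<close>. The list already connects all vertices, so it does not matter how many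
  edges lie above \<open>C\<close> or whether they tie.\<close>

lemma MST_unique:
  assumes g: "\<forall>e\<in>A. good n en e" and l: "enum c C A l" and r: "rhoE n en (set l) = 1"
  shows "is_MST n en c A F \<longleftrightarrow> F = set (acc en l)"
proof -
  define T where "T = set (acc en l)"
  have st: "sorted_wrt (\<lambda>x y. c x < c y) l" and sl: "set l = {e \<in> A. c e \<le> C}"
    using l by (auto simp: enum_def)
  have TA: "T \<subseteq> set l" unfolding T_def acc_def using set_accA[of l en "{}"] by auto
  have gl: "\<forall>e\<in>set l. good n en e" using g sl by auto
  have conn1: "conn en S u v" if "rhoE n en S = 1" "u < n" "v < n" for S u v
    using that Phi_ginv_eq_1[OF equivp_conn n] unfolding rhoE_def by blast
  have ct: "card T = n - 1"
  proof -
    have "real (card T) = real n - 1"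
      unfolding T_def acc_def using length_accA[OF gl, of "{}"] r
        distinct_accA[OF sorted_wrt_distinct[OF st], of en "{}"]
      by (simp add: distinct_card rhoE_empty)
    then show ?thesis using n by linarith
  qed
  have ends: "en e \<subseteq> {..<n} \<and> card (en e) = 2" if "good n en e" for e
    using that by (auto simp: good_def)
  have "conn en T = conn en (set l)"
    unfolding T_def acc_def using conn_accA[OF gl, of "{}" "{}"] by simp
  then have spT: "spanning_tree n en T"
    unfolding spanning_tree_def using ct TA gl ends conn1[OF r]
    by (auto simp: conn_def T_def)
  have main: "sum c T \<le> sum c G \<and> (sum c G \<le> sum c T \<longrightarrow> G = T)"
    if G: "G \<subseteq> A" "spanning_tree n en G" for G
  proof -
    have fG: "finite G" "card G = n - 1" using G by (auto simp: spanning_tree_def)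
    have rG: "rhoE n en G = 1"
      using G(2) Phi_ginv_eq_1[OF equivp_conn n] unfolding rhoE_def spanning_tree_def conn_def by blast
    have sub: "real (card H) \<le> real n - rhoE n en H" if H: "H \<subseteq> G" for H
    proof -
      have "finite (G - H)" "\<forall>e\<in>G - H. good n en e" using fG G g by auto
      from rhoE_union[OF this, of H] have "rhoE n en H - real (card (G - H)) \<le> rhoE n en (H \<union> (G - H))" by simp
      moreover have "H \<union> (G - H) = G" using H by auto
      moreover have "real (card (G - H)) = real (card G) - real (card H)"
        using card_mono[OF fG(1) H] H fG(1) by (simp add: card_Diff_subset finite_subset of_nat_diff)
      ultimately show ?thesis using rG fG n by (simp add: of_nat_diff)
    qed
    \<comment> \<open>Up to \<open>C\<close> this is the rank bound; beyond \<open>C\<close> all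
      edges of \<open>T\<close> are already counted.\<close>
    have cle: "ctr c G t \<le> ctr c T t" for t
    proof (cases "t \<le> C")
      case True
      define H where "H = {e \<in> G. c e \<le> t}"
      define X where "X = {e \<in> A. c e \<le> t}"
      have HX: "H \<subseteq> X" using G by (auto simp: H_def X_def)
      have "X \<subseteq> set l" unfolding sl X_def using True by auto
      then have finX: "finite X" by (rule finite_subset) simp
      have "\<forall>e\<in>X. good n en e" using g by (simp add: X_def)
      from rhoE_union[OF finX this, of H] have "rhoE n en (H \<union> X) \<le> rhoE n en H" by simp
      moreover have "H \<union> X = X" using HX by auto
      ultimately have "real (card H) \<le> real n - rhoE n en X" using sub[of H] by (simp add: H_def)
      then have "real (card H) \<le> real (ctr c T t)"
        unfolding T_def using acc_ctr[OF g l True] by (simp add: X_def)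
      then show ?thesis unfolding ctr_def H_def[symmetric] by simp
    next
      case False
      have "ctr c G t \<le> n - 1" unfolding ctr_def fG(2)[symmetric] using fG by (intro card_mono) auto
      also have "n - 1 = ctr c T t" unfolding ctr_def ct[symmetric] using TA sl False
        by (intro arg_cong[where f = card]) auto
      finally show ?thesis .
    qed
    have fT: "finite T" by (simp add: T_def)
    have key: "sum c T \<le> sum c G \<and> (sum c G \<le> sum c T \<longrightarrow> (\<forall>t. ctr c G t = ctr c T t))"
      by (rule ctr_sum_le[OF fT fG(1) _ cle]) (simp add: ct fG)
    have "G = T" if eq: "\<forall>t. ctr c G t = ctr c T t"
    proof -
      have "ctr c T C = card T" unfolding ctr_def using TA sl by (intro arg_cong[where f = card]) auto
      then have "card G \<le> card {e \<in> G. c e \<le> C}" using eq ct fG by (simp add: ctr_def)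
      then have "{e \<in> G. c e \<le> C} = G" using fG by (intro card_seteq) auto
      then have GL: "G \<subseteq> set l" using G sl by auto
      have inj: "inj_on c (set l)" by (rule sorted_wrt_inj[OF st])
      have im: "card {x \<in> c ` H. x \<le> t} = ctr c H t" if "H \<subseteq> set l" for H t
      proof -
        have "{x \<in> c ` H. x \<le> t} = c ` {e \<in> H. c e \<le> t}" by auto
        moreover have "inj_on c {e \<in> H. c e \<le> t}" using inj that by (auto intro: inj_on_subset)
        ultimately show ?thesis by (simp add: card_image ctr_def)
      qed
      have "c ` G = c ` T"
        by (rule ctr_eq_imp_eq) (use fG fT im[OF GL] im[OF TA] eq in auto)
      then show ?thesis using inj_on_image_eq_iff[OF inj GL TA] by simp
    qed
    then show ?thesis using key by blast
  qed
  show ?thesis unfolding is_MST_def T_def[symmetric]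
  proof
    assume *: "F \<subseteq> A \<and> spanning_tree n en F \<and> (\<forall>G. G \<subseteq> A \<and> spanning_tree n en G \<longrightarrow> sum c F \<le> sum c G)"
    have "T \<subseteq> A" using TA sl by auto
    then show "F = T" using * main[of F] spT by blast
  next
    assume "F = T"
    moreover have "T \<subseteq> A" using TA sl by auto
    ultimately show "F \<subseteq> A \<and> spanning_tree n en F \<and> (\<forall>G. G \<subseteq> A \<and> spanning_tree n en G \<longrightarrow> sum c F \<le> sum c G)"
      using spT main by blast
  qed
qed

lemma next_MST_acc:
  assumes "\<forall>e\<in>A. good n en e" "enum c C A l" "rhoE n en (set l) = 1"
  shows "next_MST n en c A = Some (set (acc en l))"
  unfolding next_MST_def MST_unique[OF assms] by simp

lemma enum_rej:
  assumes "enum c C A l"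
  shows "enum c C (A - set (acc en l)) (rej en l)"
proof -
  have st: "sorted_wrt (\<lambda>x y. c x < c y) l" and sl: "set l = {e \<in> A. c e \<le> C}"
    using assms by (auto simp: enum_def)
  show ?thesis unfolding enum_def
  proof
    show "sorted_wrt (\<lambda>x y. c x < c y) (rej en l)" unfolding rej_def by (rule sorted_rejA[OF st])
    show "set (rej en l) = {e \<in> A - set (acc en l). c e \<le> C}"
      using set_accA[of l en "{}"] disjoint_accA[OF sorted_wrt_distinct[OF st], of en "{}"] sl
      unfolding rej_def acc_def by blast
  qed
qed

text \<open>Connectedness after k rejections guarantees that the trees before exist as well.\<close>

lemma rel_connected_mono:
  assumes "rhoE n en (set (lev en k l)) = 1" "i \<le> k"
  shows "rhoE n en (set (lev en i l)) = 1"
  using assms(2,1)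
proof (induction rule: inc_induct)
  case (step i)
  then have "\<forall>u<n. \<forall>v<n. rel en (Suc (Suc i)) l u v"
    using Phi_ginv_eq_1[OF equivp_conn n, of en "set (lev en (Suc i) l)"] by (simp add: rhoE_def)
  then have "\<forall>u<n. \<forall>v<n. rel en (Suc i) l u v" using rel_Suc_le by blast
  then show ?case using Phi_ginv_eq_1[OF equivp_conn n, of en "set (lev en i l)"] by (simp add: rhoE_def)
qed

text \<open>After removal of the first k trees the remaining cheap edges, in order of cost, are
  exactly the k-th rejected list.\<close>

lemma used_edges_lev:
  assumes "\<forall>e\<in>A. good n en e" "enum c C A l" "\<And>i. i < k \<Longrightarrow> rhoE n en (set (lev en i l)) = 1"
  shows "\<exists>U. used_edges n en c A k = Some U \<and> enum c C (A - U) (lev en k l)"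
  using assms(3)
proof (induction k)
  case 0
  then show ?case using assms(2) by simp
next
  case (Suc k)
  then obtain U where U: "used_edges n en c A k = Some U" "enum c C (A - U) (lev en k l)" by auto
  have "next_MST n en c (A - U) = Some (set (acc en (lev en k l)))"
    by (rule next_MST_acc[OF _ U(2)]) (use assms(1) Suc.prems in auto)
  moreover have "A - (U \<union> set (acc en (lev en k l))) = (A - U) - set (acc en (lev en k l))" by auto
  ultimately show ?case using U(1) enum_rej[OF U(2)] by (simp add: lev_Suc)
qed

text \<open>In a sorted list the edges of cost at most \<open>t\<close> form a prefix, and a scan of
  a prefix is a prefix of the scan.\<close>

lemma lev_filter:
  assumes "sorted_wrt (\<lambda>x y. c x < c y) l"
  shows "lev en j (filter (\<lambda>e. c e \<le> t) l) = filter (\<lambda>e. c e \<le> t) (lev en j l)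
     \<and> sorted_wrt (\<lambda>x y. c x < c y) (lev en j l)"
proof (induction j)
  case 0 show ?case using assms by simp
next
  case (Suc j)
  let ?l = "lev en j l"
  have st: "sorted_wrt (\<lambda>x y. c x < c y) ?l" using Suc by simp
  have r: "rej en ?l = rejA en {} (filter (\<lambda>e. c e \<le> t) ?l) @ rejA en ({} \<union> set (filter (\<lambda>e. c e \<le> t) ?l)) (filter (\<lambda>e. \<not> c e \<le> t) ?l)"
    unfolding rej_def by (subst sorted_split[OF st, of t]) (rule rejA_append)
  have "filter (\<lambda>e. c e \<le> t) (rej en ?l) = rejA en {} (filter (\<lambda>e. c e \<le> t) ?l)"
    unfolding r filter_append
    using set_rejA[of en "{}" "filter (\<lambda>e. c e \<le> t) ?l"]
      set_rejA[of en "{} \<union> set (filter (\<lambda>e. c e \<le> t) ?l)" "filter (\<lambda>e. \<not> c e \<le> t) ?l"]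
    by (subst filter_True, force, subst filter_False, force, simp)
  then show ?case using Suc sorted_rejA[OF st, of en "{}"] by (simp add: lev_Suc rej_def)
qed

lemma grid_count:
  assumes "0 < h" "0 < x" "x \<le> real I * h"
  shows "x \<le> h * real (card {i. i < I \<and> real i * h < x}) \<and> h * real (card {i. i < I \<and> real i * h < x}) \<le> x + h"
proof -
  define N where "N = nat \<lceil>x / h\<rceil>"
  have N: "x / h \<le> real N" "real N < x / h + 1" using assms by (simp_all add: N_def) linarith+
  have "x / h \<le> real I" using assms by (simp add: divide_le_eq)
  then have NI: "N \<le> I" unfolding N_def by (simp add: ceiling_le_iff nat_le_iff)
  have "{i. i < I \<and> real i * h < x} = {..<N}"
  proof (intro set_eqI)
    fix i
    have "real i * h < x \<longleftrightarrow> real i < x / h" using assms by (simp add: less_divide_eq)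
    also have "\<dots> \<longleftrightarrow> i < N" unfolding N_def by linarith
    finally show "i \<in> {i. i < I \<and> real i * h < x} \<longleftrightarrow> i \<in> {..<N}" using NI by auto
  qed
  moreover have "x \<le> h * real N" "h * real N \<le> x + h"
    using N assms by (simp_all add: field_simps)
  ultimately show ?thesis by simp
qed

text \<open>The cost of the tree is \<open>\<integral> (components - 1)\<close>; the integrand is decreasing, so a left Riemann sum
  is off by at most one step times the number of edges.\<close>

lemma wT_riemann:
  assumes g: "\<forall>e\<in>A. good n en e" and l: "enum c C A l" and k: "1 \<le> k"
    and r: "Phi n ginv (rel en k l) = 1"
    and pos: "\<And>e. e \<in> A \<Longrightarrow> 0 < c e" and h: "0 < h" and I: "C \<le> real I * h"
  defines "S \<equiv> h * (\<Sum>i<I. Phi n ginv (rel en k (filter (\<lambda>e. c e \<le> real i * h) l)) - 1)"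
  shows "\<exists>w. wT n en c A k = ereal w \<and> w \<le> S \<and> S \<le> w + h * real n"
proof -
  obtain j where j: "k = Suc j" using k by (cases k) auto
  have st: "sorted_wrt (\<lambda>x y. c x < c y) l" and sl: "set l = {e \<in> A. c e \<le> C}"
    using l by (auto simp: enum_def)
  have r1: "rhoE n en (set (lev en j l)) = 1" using r by (simp add: j rhoE_def)
  obtain U where U: "used_edges n en c A j = Some U" "enum c C (A - U) (lev en j l)"
    using used_edges_lev[OF g l, of j] rel_connected_mono[OF r1] by auto
  define T where "T = set (acc en (lev en j l))"
  have gU: "\<forall>e\<in>A - U. good n en e" using g by auto
  have "next_MST n en c (A - U) = Some T" unfolding T_def by (rule next_MST_acc[OF gU U(2) r1])
  then have w: "wT n en c A k = ereal (sum c T)" unfolding wT_def kth_tree_def using U(1) by (simp add: j)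
  have TA: "T \<subseteq> set (lev en j l)" unfolding T_def acc_def using set_accA[of "lev en j l" en "{}"] by auto
  have sU: "set (lev en j l) = {e \<in> A - U. c e \<le> C}" using U(2) unfolding enum_def by blast
  have finT: "finite T" by (simp add: T_def)
  have TC: "c e \<le> C" "0 < c e" if "e \<in> T" for e
  proof -
    have "e \<in> set l" using that TA set_lev[of en j l] by blast
    then show "c e \<le> C" "0 < c e" unfolding sl by (simp_all add: pos)
  qed
  \<comment> \<open>Components minus one at cost \<open>t\<close> are the merges still to come, that
    is, the tree edges of larger cost.\<close>
  have cnt: "Phi n ginv (rel en k (filter (\<lambda>e. c e \<le> t) l)) - 1 = real (card {e \<in> T. t < c e})" if t: "t \<le> C" for t
  proof -
    have X: "{e \<in> A - U. c e \<le> t} = set (filter (\<lambda>e. c e \<le> t) (lev en j l))"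
      unfolding set_filter sU using t by auto
    have "Phi n ginv (rel en k (filter (\<lambda>e. c e \<le> t) l)) = rhoE n en {e \<in> A - U. c e \<le> t}"
      unfolding j rel.simps rhoE_def X using lev_filter[OF st, of j t] by simp
    then have 1: "real (ctr c T t) = real n - Phi n ginv (rel en k (filter (\<lambda>e. c e \<le> t) l))"
      unfolding T_def using acc_ctr[OF gU U(2) t] by simp
    have 2: "real (ctr c T C) = real n - 1"
      unfolding T_def using acc_ctr[OF gU U(2) order_refl] r1 unfolding sU by simp
    have "ctr c T C = card ({e \<in> T. c e \<le> t} \<union> {e \<in> T. t < c e})"
      unfolding ctr_def using TC by (intro arg_cong[where f = card]) auto
    also have "\<dots> = ctr c T t + card {e \<in> T. t < c e}"
      unfolding ctr_def using finT by (intro card_Un_disjoint) auto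
    finally show ?thesis using 1 2 by linarith
  qed
  have cnt2: "Phi n ginv (rel en k (filter (\<lambda>e. c e \<le> t) l)) - 1 = real (card {e \<in> T. t < c e})" for t
  proof (cases "t \<le> C")
    case False
    then have "filter (\<lambda>e. c e \<le> t) l = l" using sl by (auto simp: filter_id_conv)
    moreover have E: "{e \<in> T. t < c e} = {}" using TC False by fastforce
    ultimately show ?thesis unfolding E using r by simp
  qed (rule cnt)
  \<comment> \<open>Exchanging the sums, each tree edge contributes h times the number of grid
    points below its cost, which \<open>grid_count\<close> compares with the cost itself.\<close>
  have "S = h * (\<Sum>i<I. \<Sum>e\<in>T. of_bool (real i * h < c e))"
  proof -
    have "(\<Sum>e\<in>T. of_bool (t < c e)) = real (card {e \<in> T. t < c e})" for t
      unfolding of_bool_def using sum.inter_filter[OF finT, of "\<lambda>_. 1::real" "\<lambda>e. t < c e"] by simp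
    then show ?thesis unfolding S_def cnt2 by simp
  qed
  also have "\<dots> = (\<Sum>e\<in>T. h * (\<Sum>i<I. of_bool (real i * h < c e)))"
    by (subst sum.swap) (simp add: sum_distrib_left)
  also have "\<dots> = (\<Sum>e\<in>T. h * real (card {i. i < I \<and> real i * h < c e}))"
  proof (intro sum.cong refl)
    fix e
    have "(\<Sum>i<I. of_bool (real i * h < c e)) = real (card {i \<in> {..<I}. real i * h < c e})"
      unfolding of_bool_def using sum.inter_filter[of "{..<I}" "\<lambda>_. 1::real" "\<lambda>i. real i * h < c e"] by simp
    then show "h * (\<Sum>i<I. of_bool (real i * h < c e)) = h * real (card {i. i < I \<and> real i * h < c e})" by simp
  qed
  finally have S: "S = (\<Sum>e\<in>T. h * real (card {i. i < I \<and> real i * h < c e}))" .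
  have gc: "c e \<le> h * real (card {i. i < I \<and> real i * h < c e}) \<and> h * real (card {i. i < I \<and> real i * h < c e}) \<le> c e + h"
    if "e \<in> T" for e
    using TC[OF that] I by (intro grid_count h) auto
  have "sum c T \<le> S" unfolding S by (intro sum_mono) (use gc in auto)
  moreover have "S \<le> sum c T + h * real n"
  proof -
    have "S \<le> (\<Sum>e\<in>T. c e + h)" unfolding S by (intro sum_mono) (use gc in auto)
    also have "\<dots> = sum c T + real (card T) * h" by (simp add: sum.distrib)
    also have "real (card T) * h \<le> real n * h"
    proof (intro mult_right_mono)
      have "real (card T) = real (ctr c T C)" unfolding ctr_def using TC by (intro arg_cong[where f = "\<lambda>x. real (card x)"]) auto
      also have "\<dots> = real n - 1"
        unfolding T_def using acc_ctr[OF gU U(2) order_refl] r1 unfolding sU by simp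
      finally show "real (card T) \<le> real n" by simp
    qed (use h in auto)
    finally show ?thesis by (simp add: mult.commute)
  qed
  ultimately show ?thesis using w by blast
qed

end

lemma rejA_map: "map f (rejA (\<lambda>e. en (f e)) S l) = rejA en (f ` S) (map f l)"
proof (induction l arbitrary: S)
  case (Cons e l)
  have "cyc (\<lambda>e. en (f e)) S e = cyc en (f ` S) (f e)" by (simp add: cyc_def conn_image)
  then show ?case using Cons by simp
qed simp

lemma lev_map: "map f (lev (\<lambda>e. en (f e)) j l) = lev en j (map f l)"
  by (induction j) (simp_all add: lev_Suc rej_def rejA_map)

text \<open>Parallel edges have the same ends, so the multigraph can be studied as a word of vertex
  pairs with repetitions.\<close>

lemma rel_map: "rel (\<lambda>e. en (f e)) j l = rel en j (map f l)"
proof (cases j)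
  case (Suc i)
  have "f ` set (lev (\<lambda>e. en (f e)) i l) = set (lev en i (map f l))"
    unfolding lev_map[symmetric] by simp
  then show ?thesis by (simp add: Suc conn_image)
qed simp

subsection \<open>Independent edge costs\<close>

text \<open>Convergence of the probability to 1 in the outer sense of \<open>conv_in_prob\<close>:
  the bad outcomes need only be covered by a measurable set of small measure.\<close>

definition whp :: "(nat \<Rightarrow> 'a measure) \<Rightarrow> (nat \<Rightarrow> 'a \<Rightarrow> bool) \<Rightarrow> bool" where
  "whp M P \<longleftrightarrow> (\<forall>\<delta>>0. \<forall>\<^sub>F n in sequentially. \<exists>A\<in>sets (M n).
     {\<omega>\<in>space (M n). \<not> P n \<omega>} \<subseteq> A \<and> measure (M n) A < \<delta>)"

lemma whp_mono:
  assumes "whp M P" "\<forall>\<^sub>F n in sequentially. \<forall>\<omega>\<in>space (M n). P n \<omega> \<longrightarrow> Q n \<omega>"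
  shows "whp M Q"
  unfolding whp_def
proof (intro allI impI)
  fix \<delta> :: real assume "0 < \<delta>"
  then have "\<forall>\<^sub>F n in sequentially. \<exists>A\<in>sets (M n). {\<omega>\<in>space (M n). \<not> P n \<omega>} \<subseteq> A \<and> measure (M n) A < \<delta>"
    using assms(1) unfolding whp_def by blast
  then show "\<forall>\<^sub>F n in sequentially. \<exists>A\<in>sets (M n). {\<omega>\<in>space (M n). \<not> Q n \<omega>} \<subseteq> A \<and> measure (M n) A < \<delta>"
    using assms(2)
  proof eventually_elim
    case (elim n)
    then obtain A where A: "A \<in> sets (M n)" "{\<omega>\<in>space (M n). \<not> P n \<omega>} \<subseteq> A" "measure (M n) A < \<delta>" by blast
    have "{\<omega>\<in>space (M n). \<not> Q n \<omega>} \<subseteq> A" using elim(2) A(2) by blast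
    then show ?case using A by blast
  qed
qed

lemma whp_conj:
  assumes "\<And>n. prob_space (M n)" "whp M P" "whp M Q"
  shows "whp M (\<lambda>n \<omega>. P n \<omega> \<and> Q n \<omega>)"
  unfolding whp_def
proof (intro allI impI)
  fix \<delta> :: real assume \<delta>: "0 < \<delta>"
  have h: "0 < \<delta> / 2" using \<delta> by simp
  have "\<forall>\<^sub>F n in sequentially. \<exists>A\<in>sets (M n). {\<omega>\<in>space (M n). \<not> P n \<omega>} \<subseteq> A \<and> measure (M n) A < \<delta> / 2"
    "\<forall>\<^sub>F n in sequentially. \<exists>A\<in>sets (M n). {\<omega>\<in>space (M n). \<not> Q n \<omega>} \<subseteq> A \<and> measure (M n) A < \<delta> / 2"
    using assms(2,3) h unfolding whp_def by blast+
  then show "\<forall>\<^sub>F n in sequentially. \<exists>A\<in>sets (M n). {\<omega>\<in>space (M n). \<not> (P n \<omega> \<and> Q n \<omega>)} \<subseteq> A \<and> measure (M n) A < \<delta>"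
  proof eventually_elim
    case (elim n)
    then obtain A B where A: "A \<in> sets (M n)" "{\<omega>\<in>space (M n). \<not> P n \<omega>} \<subseteq> A" "measure (M n) A < \<delta> / 2"
      and B: "B \<in> sets (M n)" "{\<omega>\<in>space (M n). \<not> Q n \<omega>} \<subseteq> B" "measure (M n) B < \<delta> / 2" by blast
    have "measure (M n) (A \<union> B) \<le> measure (M n) A + measure (M n) B"
      by (rule measure_Un_le[OF A(1) B(1)])
    moreover have "{\<omega>\<in>space (M n). \<not> (P n \<omega> \<and> Q n \<omega>)} \<subseteq> A \<union> B" using A(2) B(2) by blast
    ultimately show ?case using A B by (intro bexI[of _ "A \<union> B"]) auto
  qed
qed

lemma whp_True: "whp M (\<lambda>n \<omega>. True)"
  unfolding whp_def by (auto intro!: always_eventually bexI[of _ "{}"])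

lemma whp_ball:
  assumes "\<And>n. prob_space (M n)" "finite I" "\<And>i. i \<in> I \<Longrightarrow> whp M (P i)"
  shows "whp M (\<lambda>n \<omega>. \<forall>i\<in>I. P i n \<omega>)"
  using assms(2,3)
proof (induction I rule: finite_induct)
  case empty
  then show ?case using whp_True by simp
next
  case (insert i I)
  then show ?case using whp_conj[OF assms(1), where P = "P i" and Q = "\<lambda>n \<omega>. \<forall>i\<in>I. P i n \<omega>"] by simp
qed

lemma whpI:
  assumes "\<forall>\<^sub>F n in sequentially. A n \<in> sets (M n) \<and> {\<omega>\<in>space (M n). \<not> P n \<omega>} \<subseteq> A n \<and> measure (M n) (A n) \<le> b n"
    and "b \<longlonglongrightarrow> 0"
  shows "whp M P"
  unfolding whp_def
proof (intro allI impI)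
  fix \<delta> :: real assume "0 < \<delta>"
  then have "\<forall>\<^sub>F n in sequentially. b n < \<delta>" using assms(2) by (intro order_tendstoD) auto
  then show "\<forall>\<^sub>F n in sequentially. \<exists>A\<in>sets (M n). {\<omega>\<in>space (M n). \<not> P n \<omega>} \<subseteq> A \<and> measure (M n) A < \<delta>"
    using assms(1) by eventually_elim (auto intro: le_less_trans)
qed

lemma whp_transfer:
  assumes "whp N P" "\<And>n. T n \<in> measurable (M n) (N n)" "\<And>n. distr (M n) (N n) (T n) = N n"
  shows "whp M (\<lambda>n \<omega>. P n (T n \<omega>))"
  unfolding whp_def
proof (intro allI impI)
  fix \<delta> :: real assume "0 < \<delta>"
  then have "\<forall>\<^sub>F n in sequentially. \<exists>A\<in>sets (N n). {\<omega>\<in>space (N n). \<not> P n \<omega>} \<subseteq> A \<and> measure (N n) A < \<delta>"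
    using assms(1) unfolding whp_def by blast
  then show "\<forall>\<^sub>F n in sequentially. \<exists>A\<in>sets (M n). {\<omega>\<in>space (M n). \<not> P n (T n \<omega>)} \<subseteq> A \<and> measure (M n) A < \<delta>"
  proof eventually_elim
    case (elim n)
    then obtain A where A: "A \<in> sets (N n)" "{\<omega>\<in>space (N n). \<not> P n \<omega>} \<subseteq> A" "measure (N n) A < \<delta>" by blast
    let ?A = "T n -` A \<inter> space (M n)"
    have "?A \<in> sets (M n)" by (rule measurable_sets[OF assms(2) A(1)])
    moreover have "measure (M n) ?A = measure (N n) A"
      using measure_distr[OF assms(2) A(1)] unfolding assms(3) by simp
    moreover have "{\<omega>\<in>space (M n). \<not> P n (T n \<omega>)} \<subseteq> ?A"
      using A(2) measurable_space[OF assms(2)] by auto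
    ultimately show ?case using A(3) by (intro bexI[of _ ?A]) auto
  qed
qed

section \<open>Ordering edges by their costs\<close>

definition srt :: "('a \<Rightarrow> real) \<Rightarrow> 'a set \<Rightarrow> 'a list" where
  "srt c X = map (inv_into X c) (sorted_list_of_set (c ` X))"

lemma srt_sorted:
  assumes "finite X" "inj_on c X"
  shows "sorted_wrt (\<lambda>x y. c x < c y) (srt c X)" "set (srt c X) = X"
proof -
  have inv: "c (inv_into X c y) = y" if "y \<in> c ` X" for y using that by (rule f_inv_into_f)
  have "sorted_wrt (<) (sorted_list_of_set (c ` X))" by (rule strict_sorted_list_of_set)
  then have "sorted_wrt (\<lambda>x y. c (inv_into X c x) < c (inv_into X c y)) (sorted_list_of_set (c ` X))"
    by (rule sorted_wrt_mono_rel[rotated]) (use assms inv in auto)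
  then show "sorted_wrt (\<lambda>x y. c x < c y) (srt c X)" unfolding srt_def sorted_wrt_map .
  show "set (srt c X) = X" unfolding srt_def using assms by (simp add: image_image)
qed

lemma srt_unique:
  assumes "sorted_wrt (\<lambda>x y. c x < (c y :: real)) l"
  shows "l = srt c (set l)"
proof -
  have inj: "inj_on c (set l)" by (rule sorted_wrt_inj[OF assms])
  have "sorted_wrt (<) (map c l)" using assms by (simp add: sorted_wrt_map)
  then have "map c l = sorted_list_of_set (c ` set l)"
    by (metis finite_imageI finite_set list.set_map set_sorted_list_of_set strict_sorted_equal strict_sorted_list_of_set)
  then have "srt c (set l) = map (inv_into (set l) c) (map c l)" unfolding srt_def by simp
  also have "\<dots> = l" using inj by (auto intro!: map_idI)
  finally show ?thesis by simp
qed

lemma srt_filter: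
  assumes "finite X" "inj_on c X"
  shows "filter P (srt c X) = srt c {x \<in> X. P x}"
proof -
  have "sorted_wrt (\<lambda>x y. c x < c y) (filter P (srt c X))"
    using srt_sorted(1)[OF assms] by (rule sorted_wrt_filter)
  from srt_unique[OF this] show ?thesis by (simp add: srt_sorted(2)[OF assms])
qed

lemma distinct_srt: "finite X \<Longrightarrow> inj_on c X \<Longrightarrow> distinct (srt c X)"
  using srt_sorted(1) sorted_wrt_distinct by blast

lemma length_srt: "finite X \<Longrightarrow> inj_on c X \<Longrightarrow> length (srt c X) = card X"
  using distinct_card[OF distinct_srt] srt_sorted(2) by metis

section \<open>Laws of the edge costs\<close>

text \<open>What is used of the uniform law and of the exponential law alike: no atoms, positivity,
  density 1 at zero up to a quadratic error, and mass at least exp (-1) per unit length on [0, 1].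
  The constant exp (-1) is the least value of the exponential density there.\<close>

locale cost_law = prob_space \<mu> for \<mu> :: "real measure" +
  assumes sets_mu: "sets \<mu> = sets borel"
    and atomless: "\<And>x. measure \<mu> {x} = 0"
    and mu_pos: "measure \<mu> {..0} = 0"
    and mu_upper: "\<And>y. 0 \<le> y \<Longrightarrow> measure \<mu> {0<..y} \<le> y"
    and mu_lower: "\<And>y. 0 \<le> y \<Longrightarrow> y \<le> 1 \<Longrightarrow> y - y\<^sup>2 \<le> measure \<mu> {0<..y}"
    and mu_slot: "\<And>x y. 0 \<le> x \<Longrightarrow> x \<le> y \<Longrightarrow> y \<le> 1 \<Longrightarrow> exp (-1) * (y - x) \<le> measure \<mu> {x<..y}"
begin

abbreviation KM :: "'i set \<Rightarrow> ('i \<Rightarrow> real) measure" where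
  "KM I \<equiv> PiM I (\<lambda>_. \<mu>)"

lemma space_mu: "space \<mu> = UNIV"
  using sets_eq_imp_space_eq[OF sets_mu] by simp

lemma prob_KM: "prob_space (KM I)"
  by (rule prob_space_PiM) (rule prob_space_axioms)

lemma measurable_coord: "i \<in> I \<Longrightarrow> (\<lambda>\<omega>. \<omega> i) \<in> borel_measurable (KM I)"
  using measurable_component_singleton[of i I "\<lambda>_. \<mu>"] measurable_cong_sets[OF refl sets_mu] by blast

lemma KM_reindex:
  assumes "inj_on f I" "f ` I \<subseteq> J"
  shows "(\<lambda>\<omega>. \<lambda>i\<in>I. \<omega> (f i)) \<in> measurable (KM J) (KM I)"
    and "distr (KM J) (KM I) (\<lambda>\<omega>. \<lambda>i\<in>I. \<omega> (f i)) = KM I"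
proof -
  show "(\<lambda>\<omega>. \<lambda>i\<in>I. \<omega> (f i)) \<in> measurable (KM J) (KM I)"
    using assms(2) by (intro measurable_restrict measurable_component_singleton) auto
  show "distr (KM J) (KM I) (\<lambda>\<omega>. \<lambda>i\<in>I. \<omega> (f i)) = KM I"
    using distr_PiM_reindex[of J "\<lambda>_. \<mu>" f I] assms prob_space_axioms by auto
qed

lemma coord_indep: "prob_space.indep_vars (KM I) (\<lambda>_. borel) (\<lambda>i \<omega>. \<omega> i) I"
proof -
  interpret P: prob_space "KM I" by (rule prob_KM)
  show ?thesis
  proof (cases "I = {}")
    case True
    then show ?thesis unfolding P.indep_vars_def P.indep_sets_def by auto
  next
    case False
    have d: "distr (KM I) borel (\<lambda>\<omega>. \<omega> i) = \<mu>" if "i \<in> I" for i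
    proof -
      have "distr (KM I) borel (\<lambda>\<omega>. \<omega> i) = distr (KM I) \<mu> (\<lambda>\<omega>. \<omega> i)"
        by (rule distr_cong) (auto simp: sets_mu)
      also have "\<dots> = \<mu>" by (rule distr_PiM_component) (use that prob_space_axioms in auto)
      finally show ?thesis .
    qed
    have "sets (PiM I (\<lambda>_. borel)) = sets (KM I)" by (rule sets_PiM_cong) (auto simp: sets_mu)
    then have "distr (KM I) (PiM I (\<lambda>_. borel)) (\<lambda>x. \<lambda>i\<in>I. x i) = distr (KM I) (KM I) (\<lambda>x. x)"
      by (intro distr_cong) (auto simp: space_PiM restrict_PiE_iff)
    also have "\<dots> = PiM I (\<lambda>i. distr (KM I) borel (\<lambda>\<omega>. \<omega> i))"
      using d by (simp add: distr_id2 cong: PiM_cong)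
    finally show ?thesis using False by (subst P.indep_vars_iff_distr_eq_PiM') (auto intro: measurable_coord)
  qed
qed

lemma distr_coord: "i \<in> I \<Longrightarrow> distr (KM I) borel (\<lambda>\<omega>. \<omega> i) = \<mu>"
proof -
  assume "i \<in> I"
  have "distr (KM I) borel (\<lambda>\<omega>. \<omega> i) = distr (KM I) \<mu> (\<lambda>\<omega>. \<omega> i)"
    by (rule distr_cong) (auto simp: sets_mu)
  also have "\<dots> = \<mu>" by (rule distr_PiM_component) (use \<open>i \<in> I\<close> prob_space_axioms in auto)
  finally show ?thesis .
qed

lemma measure_coord:
  assumes "i \<in> I" "A \<in> sets borel"
  shows "measure (KM I) {\<omega>\<in>space (KM I). \<omega> i \<in> A} = measure \<mu> A"
proof -
  have "measure (distr (KM I) borel (\<lambda>\<omega>. \<omega> i)) A = measure (KM I) ((\<lambda>\<omega>. \<omega> i) -` A \<inter> space (KM I))"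
    by (rule measure_distr[OF measurable_coord[OF assms(1)] assms(2)])
  then show ?thesis unfolding distr_coord[OF assms(1)] by (simp add: vimage_def Int_def conj_commute)
qed

text \<open>The coordinate \<open>i\<close> is independent of \<open>g\<close> of the others, so by
  Fubini the probability is the mean of the mass of one point. A general \<open>g\<close> is allowed
  because the costs of the multigraph are partial sums.\<close>

lemma no_tie:
  assumes i: "i \<in> I" and g: "g \<in> borel_measurable (KM (I - {i}))"
  shows "measure (KM I) {\<omega>\<in>space (KM I). \<omega> i = g (restrict \<omega> (I - {i}))} = 0"
proof -
  interpret P: prob_space "KM I" by (rule prob_KM)
  have sb: "sets (PiM J (\<lambda>_. borel)) = sets (KM J)" for J by (rule sets_PiM_cong) (auto simp: sets_mu)
  have "P.indep_var (PiM {i} (\<lambda>_. borel)) (\<lambda>\<omega>. restrict (\<lambda>j. \<omega> j) {i}) (PiM (I - {i}) (\<lambda>_. borel)) (\<lambda>\<omega>. restrict (\<lambda>j. \<omega> j) (I - {i}))"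
    by (rule P.indep_var_restrict[OF coord_indep]) (use i in auto)
  then have "P.indep_var borel ((\<lambda>f. f i) \<circ> (\<lambda>\<omega>. restrict (\<lambda>j. \<omega> j) {i})) borel (g \<circ> (\<lambda>\<omega>. restrict (\<lambda>j. \<omega> j) (I - {i})))"
  proof (rule P.indep_var_compose)
    show "(\<lambda>f. f i) \<in> borel_measurable (PiM {i} (\<lambda>_. borel))" by (rule measurable_component_singleton) simp
    show "g \<in> borel_measurable (PiM (I - {i}) (\<lambda>_. borel))" using g measurable_cong_sets[OF sb refl] by blast
  qed
  then have ind: "P.indep_var borel (\<lambda>\<omega>. \<omega> i) borel (\<lambda>\<omega>. g (restrict \<omega> (I - {i})))"
    by (simp add: comp_def)
  define \<nu> where "\<nu> = distr (KM I) borel (\<lambda>\<omega>. g (restrict \<omega> (I - {i})))"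
  have rv: "(\<lambda>\<omega>. \<omega> i) \<in> borel_measurable (KM I)" "(\<lambda>\<omega>. g (restrict \<omega> (I - {i}))) \<in> borel_measurable (KM I)"
    using ind by (auto dest: P.indep_var_rv1 P.indep_var_rv2)
  interpret N: prob_space \<nu> unfolding \<nu>_def by (rule P.prob_space_distr[OF rv(2)])
  have joint: "distr (KM I) (borel \<Otimes>\<^sub>M borel) (\<lambda>\<omega>. (\<omega> i, g (restrict \<omega> (I - {i})))) = \<mu> \<Otimes>\<^sub>M \<nu>"
    using ind P.indep_var_distribution_eq[of borel "\<lambda>\<omega>. \<omega> i" borel "\<lambda>\<omega>. g (restrict \<omega> (I - {i}))"]
    unfolding distr_coord[OF i] \<nu>_def by simp
  have diag: "{(x, y). x = y} \<in> sets (borel \<Otimes>\<^sub>M borel :: (real \<times> real) measure)"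
  proof -
    have "{p \<in> space (borel \<Otimes>\<^sub>M borel). fst p = (snd p :: real)} \<in> sets (borel \<Otimes>\<^sub>M borel)" by measurable
    then show ?thesis by (simp add: space_pair_measure case_prod_unfold)
  qed
  have sn: "sets \<nu> = sets borel" by (simp add: \<nu>_def)
  have "emeasure (KM I) {\<omega>\<in>space (KM I). \<omega> i = g (restrict \<omega> (I - {i}))}
      = emeasure (distr (KM I) (borel \<Otimes>\<^sub>M borel) (\<lambda>\<omega>. (\<omega> i, g (restrict \<omega> (I - {i}))))) {(x, y). x = y}"
    by (subst emeasure_distr) (use rv diag in \<open>auto intro!: arg_cong[where f = "emeasure _"]\<close>)
  also have "\<dots> = (\<integral>\<^sup>+ y. emeasure \<mu> ((\<lambda>x. (x, y)) -` {(x, y). x = y}) \<partial>\<nu>)"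
    unfolding joint
  proof (rule pair_sigma_finite.emeasure_pair_measure_alt2)
    show "pair_sigma_finite \<mu> \<nu>" by unfold_locales
    show "{(x, y). x = y} \<in> sets (\<mu> \<Otimes>\<^sub>M \<nu>)" using diag sets_pair_measure_cong[OF sets_mu sn] by simp
  qed
  also have "\<dots> = (\<integral>\<^sup>+ y. 0 \<partial>\<nu>)"
  proof (rule nn_integral_cong)
    fix y :: real
    have "(\<lambda>x::real. (x, y)) -` {(x, y). x = y} = {y}" by auto
    then show "emeasure \<mu> ((\<lambda>x::real. (x, y)) -` {(x, y). x = y}) = 0"
      using atomless[of y] by (simp add: emeasure_eq_measure)
  qed
  finally show ?thesis by (simp add: measure_def)
qed

lemma null_pos:
  assumes "countable I"
  shows "{\<omega>\<in>space (KM I). \<not> (\<forall>i\<in>I. 0 < \<omega> i)} \<in> null_sets (KM I)"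
proof -
  have "{\<omega>\<in>space (KM I). \<not> (\<forall>i\<in>I. 0 < \<omega> i)} = (\<Union>i\<in>I. {\<omega>\<in>space (KM I). \<omega> i \<in> {..0}})"
    by (auto simp: not_less)
  also have "\<dots> \<in> null_sets (KM I)"
  proof (rule null_sets_UN'[OF assms])
    fix i assume i: "i \<in> I"
    interpret P: prob_space "KM I" by (rule prob_KM)
    have "{\<omega>\<in>space (KM I). \<omega> i \<in> {..0}} \<in> sets (KM I)"
      using measurable_sets[OF measurable_coord[OF i], of "{..0}"] by (simp add: vimage_def Int_def conj_commute)
    then show "{\<omega>\<in>space (KM I). \<omega> i \<in> {..0}} \<in> null_sets (KM I)"
      using measure_coord[OF i, of "{..0}"] mu_pos by (simp add: null_sets_def P.emeasure_eq_measure)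
  qed
  finally show ?thesis .
qed

lemma null_ties:
  assumes "countable I"
  shows "{\<omega>\<in>space (KM I). \<not> inj_on \<omega> I} \<in> null_sets (KM I)"
proof -
  have "{\<omega>\<in>space (KM I). \<not> inj_on \<omega> I} = (\<Union>(i, j)\<in>{(i, j). i \<in> I \<and> j \<in> I \<and> i \<noteq> j}. {\<omega>\<in>space (KM I). \<omega> i = \<omega> j})"
    by (auto simp: inj_on_def)
  also have "\<dots> \<in> null_sets (KM I)"
  proof (rule null_sets_UN')
    show "countable {(i, j). i \<in> I \<and> j \<in> I \<and> i \<noteq> j}"
      by (rule countable_subset[of _ "I \<times> I"]) (use assms in auto)
    fix p assume "p \<in> {(i, j). i \<in> I \<and> j \<in> I \<and> i \<noteq> j}"
    then obtain i j where p: "p = (i, j)" "i \<in> I" "j \<in> I" "i \<noteq> j" by auto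
    interpret P: prob_space "KM I" by (rule prob_KM)
    have "{\<omega>\<in>space (KM I). \<omega> i = \<omega> j} \<in> sets (KM I)"
      using p by (intro borel_measurable_eq measurable_coord) auto
    moreover have "measure (KM I) {\<omega>\<in>space (KM I). \<omega> i = \<omega> j} = 0"
      using no_tie[OF p(2), of "\<lambda>\<omega>. \<omega> j"] measurable_coord[of j "I - {i}"] p by simp
    ultimately show "(case p of (i, j) \<Rightarrow> {\<omega>\<in>space (KM I). \<omega> i = \<omega> j}) \<in> null_sets (KM I)"
      by (simp add: p null_sets_def P.emeasure_eq_measure)
  qed
  finally show ?thesis .
qed

subsection \<open>Exchangeability\<close>

text \<open>The event that the cheapest edges, in order, form the word \<open>l\<close>. For a fixed
  length these events are disjoint and equally likely.\<close>

definition pre :: "'i set \<Rightarrow> 'i list \<Rightarrow> ('i \<Rightarrow> real) set" where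
  "pre I l = {\<omega>\<in>space (KM I). sorted_wrt (\<lambda>x y. \<omega> x < \<omega> y) l \<and> (\<forall>x\<in>set l. \<forall>y\<in>I - set l. \<omega> x < \<omega> y)}"

lemma sets_sorted: "set l \<subseteq> I \<Longrightarrow> {\<omega>\<in>space (KM I). sorted_wrt (\<lambda>x y. \<omega> x < \<omega> y) l} \<in> sets (KM I)"
proof (induction l)
  case (Cons a l)
  have "{\<omega>\<in>space (KM I). \<forall>x\<in>set l. \<omega> a < \<omega> x} \<in> sets (KM I)"
  proof (intro sets.sets_Collect_finite_All)
    fix x assume "x \<in> set l"
    then show "{\<omega>\<in>space (KM I). \<omega> a < \<omega> x} \<in> sets (KM I)"
      using Cons.prems by (intro borel_measurable_less measurable_coord) auto
  qed simp
  moreover have "{\<omega>\<in>space (KM I). sorted_wrt (\<lambda>x y. \<omega> x < \<omega> y) (a # l)}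
     = {\<omega>\<in>space (KM I). \<forall>x\<in>set l. \<omega> a < \<omega> x} \<inter> {\<omega>\<in>space (KM I). sorted_wrt (\<lambda>x y. \<omega> x < \<omega> y) l}" by auto
  ultimately show ?case using Cons by auto
qed simp

lemma sets_pre:
  assumes "finite I" "set l \<subseteq> I"
  shows "pre I l \<in> sets (KM I)"
proof -
  have "{\<omega>\<in>space (KM I). \<forall>x\<in>set l. \<forall>y\<in>I - set l. \<omega> x < \<omega> y} \<in> sets (KM I)"
  proof (intro sets.sets_Collect_finite_All)
    fix x y assume "x \<in> set l" "y \<in> I - set l"
    then show "{\<omega>\<in>space (KM I). \<omega> x < \<omega> y} \<in> sets (KM I)"
      using assms by (intro borel_measurable_less measurable_coord) auto
  qed (use assms in auto)
  moreover have "pre I l = {\<omega>\<in>space (KM I). sorted_wrt (\<lambda>x y. \<omega> x < \<omega> y) l} \<inter> {\<omega>\<in>space (KM I). \<forall>x\<in>set l. \<forall>y\<in>I - set l. \<omega> x < \<omega> y}"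
    by (auto simp: pre_def)
  ultimately show ?thesis using sets_sorted[OF assms(2)] by auto
qed

text \<open>Permuting the coordinates preserves the product measure.\<close>

lemma pre_exchange:
  assumes I: "finite I" and \<pi>: "bij_betw \<pi> I I" and l: "set l \<subseteq> I"
  shows "measure (KM I) (pre I (map \<pi> l)) = measure (KM I) (pre I l)"
proof -
  define T where "T = (\<lambda>\<omega>. \<lambda>i\<in>I. \<omega> (\<pi> i) :: real)"
  have inj: "inj_on \<pi> I" "\<pi> ` I = I" using \<pi> by (auto simp: bij_betw_def)
  have T: "T \<in> measurable (KM I) (KM I)" "distr (KM I) (KM I) T = KM I"
    unfolding T_def using KM_reindex[of \<pi> I I] inj by auto
  have "T -` pre I l \<inter> space (KM I) = pre I (map \<pi> l)"
  proof (intro set_eqI)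
    fix \<omega>
    have d: "I - \<pi> ` set l = \<pi> ` (I - set l)"
      using inj_on_image_set_diff[OF inj(1), of I "set l"] l inj(2) by auto
    have 1: "sorted_wrt (\<lambda>x y. T \<omega> x < T \<omega> y) l \<longleftrightarrow> sorted_wrt (\<lambda>x y. \<omega> (\<pi> x) < \<omega> (\<pi> y)) l"
      using l by (induction l) (auto simp: T_def)
    have 2: "(\<forall>x\<in>set l. \<forall>y\<in>I - set l. T \<omega> x < T \<omega> y) \<longleftrightarrow> (\<forall>x\<in>set l. \<forall>y\<in>I - set l. \<omega> (\<pi> x) < \<omega> (\<pi> y))"
      using l by (auto simp: T_def)
    have 3: "\<omega> \<in> space (KM I) \<Longrightarrow> T \<omega> \<in> space (KM I)" using measurable_space[OF T(1)] .
    show "\<omega> \<in> T -` pre I l \<inter> space (KM I) \<longleftrightarrow> \<omega> \<in> pre I (map \<pi> l)"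
      unfolding pre_def using 1 2 3 by (auto simp: sorted_wrt_map d)
  qed
  then show ?thesis using measure_distr[OF T(1) sets_pre[OF I l]] unfolding T(2) by simp
qed

text \<open>Two injective words of the same length are related by a permutation of the index
  set.\<close>

lemma pre_equal:
  assumes I: "finite I" and l: "distinct l" "set l \<subseteq> I" and l': "distinct l'" "set l' \<subseteq> I" "length l' = length l"
  shows "measure (KM I) (pre I l') = measure (KM I) (pre I l)"
proof -
  have "card (I - set l) = card (I - set l')"
    using l l' I by (simp add: card_Diff_subset distinct_card)
  then obtain g where g: "bij_betw g (I - set l) (I - set l')"
    using I finite_same_card_bij by (metis finite_Diff)
  \<comment> \<open>The permutation sends \<open>l\<close> to \<open>l'\<close> position by position
    and is any bijection between the complements.\<close>
  define h where "h x = (case map_of (zip l l') x of Some y \<Rightarrow> y | None \<Rightarrow> g x)" for x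
  have hl: "map h l = l'"
  proof (rule nth_equalityI)
    fix i assume "i < length (map h l)"
    then have i: "i < length l" by simp
    have "map_of (zip l l') (l ! i) = Some (l' ! i)"
      using map_of_zip_nth[of l l' i] l l' i by simp
    then show "map h l ! i = l' ! i" using i by (simp add: h_def)
  qed (use l' in simp)
  have hg: "h x = g x" if "x \<notin> set l" for x
  proof -
    have "map_of (zip l l') x = None" using that l'(3) by (simp add: map_of_zip_is_None)
    then show ?thesis by (simp add: h_def)
  qed
  have b1: "bij_betw h (set l) (set l')"
  proof -
    have "h ` set l = set l'" using hl by (metis list.set_map)
    moreover have "card (set l) = card (set l')" using l l' by (simp add: distinct_card)
    ultimately show ?thesis by (simp add: bij_betw_def eq_card_imp_inj_on)
  qed
  have b2: "bij_betw h (I - set l) (I - set l')"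
    using g by (rule bij_betw_cong[THEN iffD1, rotated]) (simp add: hg)
  have "bij_betw h (set l \<union> (I - set l)) (set l' \<union> (I - set l'))"
    by (rule bij_betw_combine[OF b1 b2]) auto
  then have "bij_betw h I I" using l l' by (simp add: Un_absorb1)
  from pre_exchange[OF I this l(2)] show ?thesis unfolding hl .
qed

lemma pre_disjoint:
  assumes "\<omega> \<in> pre I l" "\<omega> \<in> pre I l'" "length l = length l'" "set l \<subseteq> I" "set l' \<subseteq> I"
  shows "l = l'"
proof -
  have s: "sorted_wrt (\<lambda>x y. \<omega> x < \<omega> y) l" "sorted_wrt (\<lambda>x y. \<omega> x < \<omega> y) l'"
    using assms by (auto simp: pre_def)
  have c: "card (set l) = card (set l')"
    using sorted_wrt_distinct[OF s(1)] sorted_wrt_distinct[OF s(2)] assms by (simp add: distinct_card)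
  have "set l = set l'"
  proof (rule ccontr)
    assume ne: "set l \<noteq> set l'"
    obtain x where x: "x \<in> set l" "x \<notin> set l'" using ne c card_subset_eq[of "set l'" "set l"] by auto
    obtain y where y: "y \<in> set l'" "y \<notin> set l" using ne c card_subset_eq[of "set l" "set l'"] by auto
    have "\<omega> x < \<omega> y" using assms x y by (auto simp: pre_def)
    moreover have "\<omega> y < \<omega> x" using assms x y by (auto simp: pre_def)
    ultimately show False by simp
  qed
  then show ?thesis using srt_unique[OF s(1)] srt_unique[OF s(2)] by simp
qed

definition injl :: "'i set \<Rightarrow> nat \<Rightarrow> 'i list set" where
  "injl I m = {l. set l \<subseteq> I \<and> length l = m \<and> distinct l}"

lemma finite_injl: "finite I \<Longrightarrow> finite (injl I m)"
  unfolding injl_def by (rule finite_subset[OF _ finite_lists_length_eq[of I m]]) auto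

text \<open>The events are disjoint with a common probability, so their number times this
  probability is at most 1.\<close>

lemma pre_measure_le:
  assumes I: "finite I" and B: "B \<subseteq> injl I m"
  shows "measure (KM I) (\<Union>l\<in>B. pre I l) * real (card (injl I m)) \<le> real (card B)"
proof (cases "B = {}")
  case False
  then obtain l0 where l0: "l0 \<in> B" by auto
  interpret P: prob_space "KM I" by (rule prob_KM)
  define q where "q = measure (KM I) (pre I l0)"
  have q: "measure (KM I) (pre I l) = q" if "l \<in> injl I m" for l
    unfolding q_def using that l0 B by (intro pre_equal[OF I]) (auto simp: injl_def)
  have fB: "finite B" using finite_injl[OF I] B by (rule finite_subset[rotated])
  have s: "pre I l \<in> sets (KM I)" if "l \<in> injl I m" for l using that by (intro sets_pre[OF I]) (auto simp: injl_def)
  have meas: "measure (KM I) (\<Union>l\<in>X. pre I l) = real (card X) * q" if X: "X \<subseteq> injl I m" for X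
  proof -
    have fX: "finite X" using finite_injl[OF I] X by (rule finite_subset[rotated])
    have "measure (KM I) (\<Union>l\<in>X. pre I l) = (\<Sum>l\<in>X. measure (KM I) (pre I l))"
    proof (rule P.finite_measure_finite_Union[OF fX])
      show "pre I ` X \<subseteq> sets (KM I)" using s X by auto
      show "disjoint_family_on (pre I) X"
        unfolding disjoint_family_on_def
      proof (intro ballI impI)
        fix l l' assume ll: "l \<in> X" "l' \<in> X" "l \<noteq> l'"
        then have *: "length l = length l'" "set l \<subseteq> I" "set l' \<subseteq> I" using X by (auto simp: injl_def)
        show "pre I l \<inter> pre I l' = {}" using pre_disjoint[OF _ _ *] ll(3) by blast
      qed
    qed
    also have "\<dots> = (\<Sum>l\<in>X. q)" by (intro sum.cong refl q) (use X in auto)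
    finally show ?thesis by simp
  qed
  have "real (card (injl I m)) * q \<le> 1" using meas[OF order_refl] P.prob_le_1 by metis
  then have "real (card B) * (real (card (injl I m)) * q) \<le> real (card B) * 1" by (intro mult_left_mono) auto
  then show ?thesis unfolding meas[OF B] by (simp add: algebra_simps)
qed simp

lemma take_srt_pre:
  assumes I: "finite I" and \<omega>: "\<omega> \<in> space (KM I)" "inj_on \<omega> I"
  shows "\<omega> \<in> pre I (take m (srt \<omega> I))"
proof -
  note s = srt_sorted[OF I \<omega>(2)]
  have split: "srt \<omega> I = take m (srt \<omega> I) @ drop m (srt \<omega> I)" by simp
  have "sorted_wrt (\<lambda>x y. \<omega> x < \<omega> y) (take m (srt \<omega> I) @ drop m (srt \<omega> I))" using s(1) by simp
  then have a: "sorted_wrt (\<lambda>x y. \<omega> x < \<omega> y) (take m (srt \<omega> I))"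
    "\<forall>x\<in>set (take m (srt \<omega> I)). \<forall>y\<in>set (drop m (srt \<omega> I)). \<omega> x < \<omega> y"
    unfolding sorted_wrt_append by auto
  have "I = set (take m (srt \<omega> I)) \<union> set (drop m (srt \<omega> I))" using s(2) split by (metis set_append)
  then show ?thesis unfolding pre_def using a \<omega> by blast
qed

lemma card_injl_ge:
  assumes "finite I" "m \<le> card I"
  shows "real (card I - m) ^ m \<le> real (card (injl I m))"
proof -
  have "injl I m = {xs. length xs = m \<and> distinct xs \<and> set xs \<subseteq> I}" by (auto simp: injl_def)
  then have "card (injl I m) = \<Prod>{card I - m + 1..card I}" using card_lists_distinct_length_eq[OF assms] by simp
  moreover have "(card I - m) ^ m \<le> \<Prod>{card I - m + 1..card I}"
  proof -
    have "(\<Prod>i\<in>{card I - m + 1..card I}. card I - m) \<le> \<Prod>{card I - m + 1..card I}"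
      by (intro prod_mono) auto
    then show ?thesis using assms(2) by simp
  qed
  ultimately have "(card I - m) ^ m \<le> card (injl I m)" by simp
  from of_nat_mono[OF this, where 'a = real] show ?thesis by simp
qed

end

section \<open>From uniform words to random costs\<close>

definition lst :: "nat \<Rightarrow> (nat \<times> nat \<Rightarrow> real) \<Rightarrow> real \<Rightarrow> (nat \<times> nat) list" where
  "lst n \<omega> s = filter (\<lambda>e. \<omega> e \<le> s) (srt \<omega> (Kn_edges n))"

lemma rho_take:
  assumes "set L \<subseteq> Kn_edges n"
  shows "\<bar>rho n k (take a L) - rho n k (take b L)\<bar> \<le> \<bar>real a - real b\<bar>"
proof -
  have half: "\<bar>rho n k (take b L) - rho n k (take a L)\<bar> \<le> real b - real a" if "a \<le> b" for a b
  proof -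
    have "take a L = take a (take b L)" using that by (simp add: min_def)
    then have "subseq (take a L) (take b L)" by (metis prefix_imp_subseq take_is_prefix)
    moreover have "\<forall>e\<in>set (take b L). good n Kn_ends e"
      using assms good_Kn set_take_subset[of b L] by blast
    ultimately have "\<bar>rho n k (take b L) - rho n k (take a L)\<bar> \<le> 1 * (real (length (take b L)) - real (length (take a L)))"
      unfolding rho_def rl_def by (rule Phi_subseq[OF mbound_ginv])
    then show ?thesis using that by (auto simp: min_def split: if_splits)
  qed
  show ?thesis using half[of a b] half[of b a] by (cases "a \<le> b") auto
qed

lemma lst_take:
  assumes "inj_on \<omega> (Kn_edges n)"
  shows "lst n \<omega> s = take (card {e \<in> Kn_edges n. \<omega> e \<le> s}) (srt \<omega> (Kn_edges n))"
proof -
  let ?E = "Kn_edges n"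
  have "length (lst n \<omega> s) = card {e \<in> ?E. \<omega> e \<le> s}"
    unfolding lst_def srt_filter[OF finite_Kn assms]
    by (rule length_srt) (use finite_Kn assms in \<open>auto intro: inj_on_subset\<close>)
  moreover have "srt \<omega> ?E = lst n \<omega> s @ filter (\<lambda>e. \<not> \<omega> e \<le> s) (srt \<omega> ?E)"
    unfolding lst_def by (rule sorted_split[OF srt_sorted(1)[OF finite_Kn assms]])
  ultimately show ?thesis by (metis append_eq_conv_conj)
qed

context cost_law
begin

lemma prob_coords:
  assumes "finite J" "J \<subseteq> I" "\<And>i. i \<in> J \<Longrightarrow> X i \<in> sets borel"
  shows "measure (KM I) {\<omega>\<in>space (KM I). \<forall>i\<in>J. \<omega> i \<in> X i} = (\<Prod>i\<in>J. measure \<mu> (X i))"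
proof -
  interpret P: prob_space "KM I" by (rule prob_KM)
  interpret PP: product_prob_space "\<lambda>_. \<mu>" I by unfold_locales
  have "emeasure (KM I) {\<omega>\<in>space (KM I). \<forall>i\<in>J. \<omega> i \<in> X i} = (\<Prod>i\<in>J. emeasure \<mu> (X i))"
    by (rule PP.emeasure_PiM_Collect) (use assms sets_mu in auto)
  also have "\<dots> = ennreal (\<Prod>i\<in>J. measure \<mu> (X i))"
    by (simp add: emeasure_eq_measure prod_ennreal)
  finally show ?thesis unfolding P.emeasure_eq_measure
    by (simp add: prod_nonneg)
qed

lemma sets_coords:
  assumes "finite J" "J \<subseteq> I" "\<And>i. i \<in> J \<Longrightarrow> X i \<in> sets borel"
  shows "{\<omega>\<in>space (KM I). \<forall>i\<in>J. \<omega> i \<in> X i} \<in> sets (KM I)"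
proof (intro sets.sets_Collect_finite_All assms(1))
  fix i assume i: "i \<in> J"
  then have "(\<lambda>\<omega>. \<omega> i) -` X i \<inter> space (KM I) \<in> sets (KM I)"
    using assms by (intro measurable_sets[OF measurable_coord]) auto
  then show "{\<omega>\<in>space (KM I). \<omega> i \<in> X i} \<in> sets (KM I)" by (simp add: vimage_def Int_def conj_commute)
qed

text \<open>Chebyshev for a sum of indicators whose second moments follow from pairwise
  independence.\<close>

lemma count_concentration:
  fixes s a :: real
  assumes I: "finite I" and a: "0 < a"
  defines "p \<equiv> measure \<mu> {..s}"
  shows "{\<omega>\<in>space (KM I). a \<le> \<bar>real (card {e \<in> I. \<omega> e \<le> s}) - real (card I) * p\<bar>} \<in> sets (KM I) \<and>
    measure (KM I) {\<omega>\<in>space (KM I). a \<le> \<bar>real (card {e \<in> I. \<omega> e \<le> s}) - real (card I) * p\<bar>} \<le> real (card I) * p / a\<^sup>2"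
proof -
  interpret P: prob_space "KM I" by (rule prob_KM)
  define A where "A e = {\<omega>\<in>space (KM I). \<omega> e \<in> {..s}}" for e
  define M where "M \<omega> = (\<Sum>e\<in>I. indicator (A e) \<omega> :: real)" for \<omega>
  have A: "A e \<in> sets (KM I)" if "e \<in> I" for e
    using sets_coords[of "{e}" I "\<lambda>_. {..s}"] that by (simp add: A_def)
  have pA: "measure (KM I) (A e) = p" if "e \<in> I" for e
    using prob_coords[of "{e}" I "\<lambda>_. {..s}"] that by (simp add: A_def p_def)
  have pAA: "measure (KM I) (A e \<inter> A f) = (if e = f then p else p * p)" if "e \<in> I" "f \<in> I" for e f
  proof (cases "e = f")
    case False
    have "A e \<inter> A f = {\<omega>\<in>space (KM I). \<forall>i\<in>{e, f}. \<omega> i \<in> {..s}}" by (auto simp: A_def)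
    then show ?thesis using prob_coords[of "{e, f}" I "\<lambda>_. {..s}"] that False by (simp add: p_def)
  qed (use pA that in simp)
  have Mcard: "M \<omega> = real (card {e \<in> I. \<omega> e \<le> s})" if "\<omega> \<in> space (KM I)" for \<omega>
  proof -
    have "M \<omega> = (\<Sum>e\<in>I. if \<omega> e \<le> s then 1 else 0)" unfolding M_def A_def using that
      by (intro sum.cong) (auto simp: indicator_def)
    then show ?thesis using sum.inter_filter[OF I, of "\<lambda>_. 1::real" "\<lambda>e. \<omega> e \<le> s"] by simp
  qed
  have Mm: "M \<in> borel_measurable (KM I)" unfolding M_def
    by (intro borel_measurable_sum borel_measurable_indicator A)
  have int1: "integrable (KM I) (\<lambda>\<omega>. indicator (A e) \<omega> :: real)" if "e \<in> I" for e
    using A[OF that] by (simp add: P.emeasure_eq_measure)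
  have M2: "(M \<omega>)\<^sup>2 = (\<Sum>e\<in>I. \<Sum>f\<in>I. indicator (A e \<inter> A f) \<omega>)" for \<omega>
    unfolding M_def power2_eq_square sum_product by (simp add: indicator_inter_arith)
  have int2: "integrable (KM I) (\<lambda>\<omega>. indicator (A e \<inter> A f) \<omega> :: real)" if "e \<in> I" "f \<in> I" for e f
    using A that by (simp add: P.emeasure_eq_measure sets.Int)
  have iM2: "integrable (KM I) (\<lambda>\<omega>. (M \<omega>)\<^sup>2)" unfolding M2 by (intro Bochner_Integration.integrable_sum int2)
  have iM: "integrable (KM I) M" unfolding M_def by (intro Bochner_Integration.integrable_sum int1)
  have EM: "P.expectation M = real (card I) * p"
  proof -
    have "P.expectation M = (\<Sum>e\<in>I. P.expectation (indicator (A e)))"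
      unfolding M_def by (intro Bochner_Integration.integral_sum int1)
    also have "\<dots> = (\<Sum>e\<in>I. p)"
    proof (intro sum.cong refl)
      fix e assume e: "e \<in> I"
      have "A e \<inter> space (KM I) = A e" by (auto simp: A_def)
      then show "P.expectation (indicator (A e)) = p" using pA[OF e] by simp
    qed
    finally show ?thesis by simp
  qed
  have EM2: "P.expectation (\<lambda>\<omega>. (M \<omega>)\<^sup>2) = real (card I) * p + (real (card I) * real (card I) - real (card I)) * (p * p)"
  proof -
    have "P.expectation (\<lambda>\<omega>. (M \<omega>)\<^sup>2) = (\<Sum>e\<in>I. \<Sum>f\<in>I. P.expectation (\<lambda>\<omega>. indicator (A e \<inter> A f) \<omega>))"
    proof -
      have "P.expectation (\<lambda>\<omega>. (M \<omega>)\<^sup>2) = (\<Sum>e\<in>I. P.expectation (\<lambda>\<omega>. \<Sum>f\<in>I. indicator (A e \<inter> A f) \<omega>))"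
        unfolding M2 by (rule Bochner_Integration.integral_sum) (intro Bochner_Integration.integrable_sum int2)
      also have "\<dots> = (\<Sum>e\<in>I. \<Sum>f\<in>I. P.expectation (\<lambda>\<omega>. indicator (A e \<inter> A f) \<omega>))"
        by (intro sum.cong refl Bochner_Integration.integral_sum int2)
      finally show ?thesis .
    qed
    also have "\<dots> = (\<Sum>e\<in>I. \<Sum>f\<in>I. if e = f then p else p * p)"
    proof (intro sum.cong refl)
      fix e f assume e: "e \<in> I" "f \<in> I"
      have "A e \<inter> A f \<inter> space (KM I) = A e \<inter> A f" by (auto simp: A_def)
      then show "P.expectation (\<lambda>\<omega>. indicator (A e \<inter> A f) \<omega>) = (if e = f then p else p * p)"
        using pAA[OF e] by simp
    qed
    also have "\<dots> = (\<Sum>e\<in>I. \<Sum>f\<in>I. (if e = f then p - p * p else 0) + p * p)"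
      by (intro sum.cong refl) auto
    also have "\<dots> = (\<Sum>e\<in>I. (p - p * p) + real (card I) * (p * p))"
      by (intro sum.cong refl) (simp add: sum.distrib I)
    also have "\<dots> = real (card I) * p + (real (card I) * real (card I) - real (card I)) * (p * p)"
      by (simp add: algebra_simps)
    finally show ?thesis .
  qed
  have var: "P.variance M \<le> real (card I) * p"
  proof -
    have "P.variance M = real (card I) * p - real (card I) * (p * p)"
      using P.variance_eq[OF iM iM2] unfolding EM EM2 by (simp add: power2_eq_square algebra_simps)
    then show ?thesis by simp
  qed
  have eq: "{\<omega>\<in>space (KM I). a \<le> \<bar>real (card {e \<in> I. \<omega> e \<le> s}) - real (card I) * p\<bar>}
     = {\<omega>\<in>space (KM I). a \<le> \<bar>M \<omega> - P.expectation M\<bar>}"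
    using Mcard unfolding EM by auto
  have "measure (KM I) {\<omega>\<in>space (KM I). a \<le> \<bar>M \<omega> - P.expectation M\<bar>} \<le> P.variance M / a\<^sup>2"
    by (rule P.Chebyshev_inequality[OF Mm iM2 a])
  also have "\<dots> \<le> real (card I) * p / a\<^sup>2" using var by (intro divide_right_mono) auto
  finally show ?thesis unfolding eq using Mm by (auto intro!: borel_measurable_le)
qed

lemma mu_le_pos: "0 \<le> s \<Longrightarrow> measure \<mu> {..s} = measure \<mu> {0<..s}"
proof -
  assume "0 \<le> s"
  then have "{..s} = {..0} \<union> {0<..s}" by auto
  moreover have "measure \<mu> ({..0} \<union> {0<..s}) = measure \<mu> {..0} + measure \<mu> {0<..s}"
    by (rule finite_measure_Union) (auto simp: sets_mu)
  ultimately show ?thesis using mu_pos by simp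
qed

lemma whp_inj: "whp (\<lambda>n. KM (Kn_edges n)) (\<lambda>n \<omega>. inj_on \<omega> (Kn_edges n))"
proof (rule whpI[where A = "\<lambda>n. {\<omega>\<in>space (KM (Kn_edges n)). \<not> inj_on \<omega> (Kn_edges n)}" and b = "\<lambda>_. 0"])
  show "\<forall>\<^sub>F n in sequentially. {\<omega>\<in>space (KM (Kn_edges n)). \<not> inj_on \<omega> (Kn_edges n)} \<in> sets (KM (Kn_edges n)) \<and>
    {\<omega>\<in>space (KM (Kn_edges n)). \<not> inj_on \<omega> (Kn_edges n)} \<subseteq> {\<omega>\<in>space (KM (Kn_edges n)). \<not> inj_on \<omega> (Kn_edges n)} \<and>
    measure (KM (Kn_edges n)) {\<omega>\<in>space (KM (Kn_edges n)). \<not> inj_on \<omega> (Kn_edges n)} \<le> 0"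
    using null_ties[OF countable_finite[OF finite_Kn]] by (auto simp: null_sets_def measure_def)
qed simp

text \<open>A uniformly random injective word of length \<open>m = O(n)\<close> has density at most
  \<open>exp (m\<^sup>2 / (N - m)) = O(1)\<close> with respect to an i.i.d. word, where \<open>N\<close> is the number of edges.\<close>

lemma whp_rho_prefix:
  assumes t: "0 \<le> t" and \<epsilon>: "0 < \<epsilon>"
  shows "whp (\<lambda>n. KM (Kn_edges n)) (\<lambda>n \<omega>. inj_on \<omega> (Kn_edges n) \<longrightarrow>
    \<bar>rho n k (take (nat \<lfloor>t * real n\<rfloor>) (srt \<omega> (Kn_edges n))) - real n * rhol k t\<bar> \<le> \<epsilon> * real n)"
proof -
  let ?E = "\<lambda>n. Kn_edges n"
  let ?m = "\<lambda>n. nat \<lfloor>t * real n\<rfloor>"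
  define B where "B n = {l \<in> injl (?E n) (?m n). \<epsilon> * real n \<le> \<bar>rho n k l - real n * rhol k t\<bar>}" for n
  define v where "v n = av (?E n) (?m n) (\<lambda>l. if \<epsilon> * real n \<le> \<bar>rho n k l - real n * rhol k t\<bar> then 1 else 0)" for n
  have v: "v \<longlonglongrightarrow> 0" unfolding v_def by (rule rho_concentrated[OF t \<epsilon>])
  have "filterlim (\<lambda>n. real n * (real n - 1) / 2 - t * real n - (real n)\<^sup>2 / 8) at_top sequentially" by real_asymp
  then have ev: "\<forall>\<^sub>F n in sequentially. 0 \<le> real n * (real n - 1) / 2 - t * real n - (real n)\<^sup>2 / 8"
    unfolding filterlim_at_top by blast
  show ?thesis
  proof (rule whpI[where A = "\<lambda>n. \<Union>l\<in>B n. pre (?E n) l" and b = "\<lambda>n. v n * exp (8 * t\<^sup>2)"])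
    show "(\<lambda>n. v n * exp (8 * t\<^sup>2)) \<longlonglongrightarrow> 0" using tendsto_mult_left_zero[OF v] by simp
    show "\<forall>\<^sub>F n in sequentially. (\<Union>l\<in>B n. pre (?E n) l) \<in> sets (KM (?E n)) \<and>
      {\<omega>\<in>space (KM (?E n)). \<not> (inj_on \<omega> (?E n) \<longrightarrow>
        \<bar>rho n k (take (?m n) (srt \<omega> (?E n))) - real n * rhol k t\<bar> \<le> \<epsilon> * real n)} \<subseteq> (\<Union>l\<in>B n. pre (?E n) l) \<and>
      measure (KM (?E n)) (\<Union>l\<in>B n. pre (?E n) l) \<le> v n * exp (8 * t\<^sup>2)"
      using ev eventually_ge_at_top[of 2]
    proof eventually_elim
      case (elim n)
      let ?N = "card (?E n)"
      note fin = finite_Kn[of n] and ne = Kn_ne[OF elim(2)]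
      have N: "real ?N = real n * (real n - 1) / 2" by (rule card_Kn)
      have m: "real (?m n) \<le> t * real n" using t by simp
      have d: "(real n)\<^sup>2 / 8 \<le> real ?N - real (?m n)" using elim(1) m N by linarith
      have n2: "0 < (real n)\<^sup>2" using elim(2) by simp
      have mN: "?m n \<le> ?N" using d n2 by linarith
      have BI: "B n \<subseteq> injl (?E n) (?m n)" by (auto simp: B_def)
      have fB: "finite (B n)" using finite_injl[OF fin] BI by (rule finite_subset[rotated])
      have "(\<Union>l\<in>B n. pre (?E n) l) \<in> sets (KM (?E n))"
        using fB BI by (intro sets.finite_UN sets_pre[OF fin]) (auto simp: injl_def)
      moreover have "{\<omega>\<in>space (KM (?E n)). \<not> (inj_on \<omega> (?E n) \<longrightarrow>
        \<bar>rho n k (take (?m n) (srt \<omega> (?E n))) - real n * rhol k t\<bar> \<le> \<epsilon> * real n)} \<subseteq> (\<Union>l\<in>B n. pre (?E n) l)"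
      proof
        fix \<omega> assume "\<omega> \<in> {\<omega>\<in>space (KM (?E n)). \<not> (inj_on \<omega> (?E n) \<longrightarrow>
          \<bar>rho n k (take (?m n) (srt \<omega> (?E n))) - real n * rhol k t\<bar> \<le> \<epsilon> * real n)}"
        then have \<omega>: "\<omega> \<in> space (KM (?E n))" "inj_on \<omega> (?E n)"
          and bad: "\<epsilon> * real n < \<bar>rho n k (take (?m n) (srt \<omega> (?E n))) - real n * rhol k t\<bar>" by auto
        have "take (?m n) (srt \<omega> (?E n)) \<in> B n"
          unfolding B_def injl_def using bad mN distinct_srt[OF fin \<omega>(2)] srt_sorted(2)[OF fin \<omega>(2)]
            length_srt[OF fin \<omega>(2)] set_take_subset[of "?m n" "srt \<omega> (?E n)"] by auto
        then show "\<omega> \<in> (\<Union>l\<in>B n. pre (?E n) l)" using take_srt_pre[OF fin \<omega>, of "?m n"] by blast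
      qed
      moreover have "measure (KM (?E n)) (\<Union>l\<in>B n. pre (?E n) l) \<le> v n * exp (8 * t\<^sup>2)"
      proof -
        let ?P = "measure (KM (?E n)) (\<Union>l\<in>B n. pre (?E n) l)"
        have "real (card (B n)) \<le> v n * real ?N ^ ?m n"
        proof -
          have "B n \<subseteq> {l. set l \<subseteq> ?E n \<and> length l = ?m n}" by (auto simp: B_def injl_def)
          then have "(\<Sum>l\<in>B n. 1) \<le> (\<Sum>l | set l \<subseteq> ?E n \<and> length l = ?m n. if \<epsilon> * real n \<le> \<bar>rho n k l - real n * rhol k t\<bar> then 1 else (0::real))"
            by (subst sum.mono_neutral_cong_left[of "{l. set l \<subseteq> ?E n \<and> length l = ?m n}" "B n" "\<lambda>l. if l \<in> B n then 1 else 0"])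
              (auto simp: finite_lists_length_eq[OF fin] B_def intro!: sum_mono)
          then show ?thesis unfolding v_def av_card[OF fin ne] using cardE[OF fin ne] by simp
        qed
        then have 1: "?P * real (card (injl (?E n) (?m n))) \<le> v n * real ?N ^ ?m n"
          using pre_measure_le[OF fin BI] by linarith
        have dpos: "0 < real (?N - ?m n)" using d n2 of_nat_diff[OF mN, where 'a = real] by linarith
        have "?P * real (?N - ?m n) ^ ?m n \<le> v n * real ?N ^ ?m n"
          using mult_left_mono[OF card_injl_ge[OF fin mN], of ?P] 1 by (simp add: measure_nonneg)
        then have "?P \<le> v n * (real ?N ^ ?m n / real (?N - ?m n) ^ ?m n)"
          using dpos by (simp add: field_simps)
        also have "real ?N ^ ?m n / real (?N - ?m n) ^ ?m n = (real ?N / real (?N - ?m n)) ^ ?m n"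
          by (simp add: power_divide)
        also have "v n * (real ?N / real (?N - ?m n)) ^ ?m n \<le> v n * exp (8 * t\<^sup>2)"
        proof (intro mult_left_mono)
          have "real ?N / real (?N - ?m n) = 1 + real (?m n) / real (?N - ?m n)"
            using dpos mN by (simp add: field_simps of_nat_diff)
          also have "\<dots> \<le> exp (real (?m n) / real (?N - ?m n))" by (rule exp_ge_add_one_self)
          finally have "(real ?N / real (?N - ?m n)) ^ ?m n \<le> exp (real (?m n) / real (?N - ?m n)) ^ ?m n"
            by (intro power_mono) auto
          also have "\<dots> = exp (real (?m n) * (real (?m n) / real (?N - ?m n)))" by (simp add: exp_of_nat_mult[symmetric])
          also have "\<dots> \<le> exp (8 * t\<^sup>2)"
          proof -
            have "real (?m n) * real (?m n) \<le> (t * real n) * (t * real n)" using m t by (intro mult_mono) auto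
            moreover have "(real n)\<^sup>2 / 8 \<le> real (?N - ?m n)" using d mN by (simp add: of_nat_diff)
            ultimately have "real (?m n) * real (?m n) / real (?N - ?m n) \<le> (t * real n) * (t * real n) / ((real n)\<^sup>2 / 8)"
              using n2 by (intro frac_le) auto
            also have "\<dots> = 8 * t\<^sup>2" using elim(2) by (simp add: power2_eq_square)
            finally show ?thesis by simp
          qed
          finally show "(real ?N / real (?N - ?m n)) ^ ?m n \<le> exp (8 * t\<^sup>2)" .
          show "0 \<le> v n" unfolding v_def by (intro av_nonneg[OF fin ne]) auto
        qed
        finally show ?thesis .
      qed
      ultimately show ?case by blast
    qed
  qed
qed

text \<open>About n n / 2 edges, each of cost at most t / n with probability t / n up to the
  quadratic error of \<open>mu_lower\<close>.\<close>

lemma mu_scaled: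
  assumes t: "0 \<le> t"
  shows "(\<lambda>n. (real (card (Kn_edges n)) * measure \<mu> {..t / real n} - t / 2 * real n) / real n) \<longlonglongrightarrow> 0"
proof -
  have lim1: "(\<lambda>n. ((real n * (real n - 1) / 2) * (t / real n) - t / 2 * real n) / real n) \<longlonglongrightarrow> 0" by real_asymp
  have lim2: "(\<lambda>n. ((real n * (real n - 1) / 2) * (t / real n - (t / real n)\<^sup>2) - t / 2 * real n) / real n) \<longlonglongrightarrow> 0"
  proof -
    have a: "(\<lambda>n. 1 / (2 * real n)) \<longlonglongrightarrow> 0" "(\<lambda>n. (real n - 1) / (2 * (real n)\<^sup>2)) \<longlonglongrightarrow> 0" by real_asymp+
    have "(\<lambda>n. - t * (1 / (2 * real n)) - t\<^sup>2 * ((real n - 1) / (2 * (real n)\<^sup>2))) \<longlonglongrightarrow> - t * 0 - t\<^sup>2 * 0"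
      by (intro tendsto_diff tendsto_mult tendsto_const a)
    then have "(\<lambda>n. - t * (1 / (2 * real n)) - t\<^sup>2 * ((real n - 1) / (2 * (real n)\<^sup>2))) \<longlonglongrightarrow> 0" by simp
    moreover have "\<forall>\<^sub>F n in sequentially. - t * (1 / (2 * real n)) - t\<^sup>2 * ((real n - 1) / (2 * (real n)\<^sup>2))
      = ((real n * (real n - 1) / 2) * (t / real n - (t / real n)\<^sup>2) - t / 2 * real n) / real n"
      using eventually_gt_at_top[of 0] by eventually_elim (simp add: field_simps power2_eq_square)
    ultimately show ?thesis by (rule Lim_transform_eventually)
  qed
  have "(\<lambda>n. t / real n) \<longlonglongrightarrow> 0" by real_asymp
  then have "\<forall>\<^sub>F n in sequentially. t / real n < 1" by (intro order_tendstoD) auto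
  then have b: "\<forall>\<^sub>F n in sequentially. t / real n - (t / real n)\<^sup>2 \<le> measure \<mu> {..t / real n} \<and> measure \<mu> {..t / real n} \<le> t / real n
      \<and> 0 \<le> real n * (real n - 1) / 2"
    using eventually_ge_at_top[of 1]
  proof eventually_elim
    case (elim n)
    have "0 \<le> t / real n" using t by simp
    then show ?case using mu_upper[of "t / real n"] mu_lower[of "t / real n"] elim by (simp add: mu_le_pos)
  qed
  show ?thesis
  proof (rule tendsto_sandwich[OF _ _ lim2 lim1])
    show "\<forall>\<^sub>F n in sequentially. ((real n * (real n - 1) / 2) * (t / real n - (t / real n)\<^sup>2) - t / 2 * real n) / real n
      \<le> (real (card (Kn_edges n)) * measure \<mu> {..t / real n} - t / 2 * real n) / real n"
      using b unfolding card_Kn by eventually_elim (intro divide_right_mono diff_right_mono mult_left_mono, auto)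
    show "\<forall>\<^sub>F n in sequentially. (real (card (Kn_edges n)) * measure \<mu> {..t / real n} - t / 2 * real n) / real n
      \<le> ((real n * (real n - 1) / 2) * (t / real n) - t / 2 * real n) / real n"
      using b unfolding card_Kn by eventually_elim (intro divide_right_mono diff_right_mono mult_left_mono, auto)
  qed
qed

lemma whp_count:
  assumes t: "0 \<le> t" and \<epsilon>: "0 < \<epsilon>"
  shows "whp (\<lambda>n. KM (Kn_edges n)) (\<lambda>n \<omega>. \<bar>real (card {e \<in> Kn_edges n. \<omega> e \<le> t / real n})
    - real (card (Kn_edges n)) * measure \<mu> {..t / real n}\<bar> \<le> \<epsilon> * real n)"
proof (rule whpI)
  let ?p = "\<lambda>n. measure \<mu> {..t / real n}"
  show "(\<lambda>n. (t / 2) / (\<epsilon>\<^sup>2 * real n)) \<longlonglongrightarrow> 0" using \<epsilon> by real_asymp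
  show "\<forall>\<^sub>F n in sequentially. {\<omega>\<in>space (KM (Kn_edges n)). \<epsilon> * real n \<le> \<bar>real (card {e \<in> Kn_edges n. \<omega> e \<le> t / real n}) - real (card (Kn_edges n)) * ?p n\<bar>} \<in> sets (KM (Kn_edges n)) \<and>
    {\<omega>\<in>space (KM (Kn_edges n)). \<not> \<bar>real (card {e \<in> Kn_edges n. \<omega> e \<le> t / real n}) - real (card (Kn_edges n)) * ?p n\<bar> \<le> \<epsilon> * real n}
     \<subseteq> {\<omega>\<in>space (KM (Kn_edges n)). \<epsilon> * real n \<le> \<bar>real (card {e \<in> Kn_edges n. \<omega> e \<le> t / real n}) - real (card (Kn_edges n)) * ?p n\<bar>} \<and>
    measure (KM (Kn_edges n)) {\<omega>\<in>space (KM (Kn_edges n)). \<epsilon> * real n \<le> \<bar>real (card {e \<in> Kn_edges n. \<omega> e \<le> t / real n}) - real (card (Kn_edges n)) * ?p n\<bar>} \<le> (t / 2) / (\<epsilon>\<^sup>2 * real n)"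
    using eventually_ge_at_top[of 2]
  proof eventually_elim
    case (elim n)
    have a: "0 < \<epsilon> * real n" using \<epsilon> elim by simp
    have "real (card (Kn_edges n)) * ?p n \<le> (real n * real n / 2) * (t / real n)"
      unfolding card_Kn using t mu_upper[of "t / real n"] elim
      by (intro mult_mono) (auto simp: mu_le_pos algebra_simps)
    then have "real (card (Kn_edges n)) * ?p n / (\<epsilon> * real n)\<^sup>2 \<le> (real n * real n / 2) * (t / real n) / (\<epsilon> * real n)\<^sup>2"
      by (intro divide_right_mono) auto
    also have "\<dots> = (t / 2) / (\<epsilon>\<^sup>2 * real n)" using elim \<epsilon> by (simp add: field_simps power2_eq_square)
    finally show ?case using count_concentration[OF finite_Kn a, of n "t / real n"] by auto
  qed
qed

text \<open>The edges of cost at most t / n are a prefix whose random length is close to t n / 2,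
  and the number of classes is 1-Lipschitz in the length of the prefix.\<close>

lemma whp_rho:
  assumes t: "0 \<le> t" and \<epsilon>: "0 < \<epsilon>"
  shows "whp (\<lambda>n. KM (Kn_edges n)) (\<lambda>n \<omega>. \<bar>rho n k (lst n \<omega> (t / real n)) - real n * rhol k (t / 2)\<bar> \<le> \<epsilon> * real n)"
proof -
  have \<epsilon>4: "0 < \<epsilon> / 4" and t2: "0 \<le> t / 2" using \<epsilon> t by auto
  have w: "whp (\<lambda>n. KM (Kn_edges n)) (\<lambda>n \<omega>. inj_on \<omega> (Kn_edges n) \<and>
    ((inj_on \<omega> (Kn_edges n) \<longrightarrow> \<bar>rho n k (take (nat \<lfloor>t / 2 * real n\<rfloor>) (srt \<omega> (Kn_edges n))) - real n * rhol k (t / 2)\<bar> \<le> \<epsilon> / 4 * real n) \<and>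
     \<bar>real (card {e \<in> Kn_edges n. \<omega> e \<le> t / real n}) - real (card (Kn_edges n)) * measure \<mu> {..t / real n}\<bar> \<le> \<epsilon> / 4 * real n))"
    by (rule whp_conj[OF prob_KM whp_inj whp_conj[OF prob_KM whp_rho_prefix[OF t2 \<epsilon>4] whp_count[OF t \<epsilon>4]]])
  have "\<forall>\<^sub>F n in sequentially. dist ((real (card (Kn_edges n)) * measure \<mu> {..t / real n} - t / 2 * real n) / real n) 0 < \<epsilon> / 4"
    using tendstoD[OF mu_scaled[OF t] \<epsilon>4] .
  moreover have "filterlim (\<lambda>n. \<epsilon> / 4 * real n) at_top sequentially" using \<epsilon> by real_asymp
  then have "\<forall>\<^sub>F n in sequentially. 1 \<le> \<epsilon> / 4 * real n" unfolding filterlim_at_top by blast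
  ultimately show ?thesis
    using eventually_ge_at_top[of 1]
  proof (intro whp_mono[OF w], eventually_elim, intro ballI impI)
    fix n \<omega>
    assume 1: "dist ((real (card (Kn_edges n)) * measure \<mu> {..t / real n} - t / 2 * real n) / real n) 0 < \<epsilon> / 4"
      and 2: "1 \<le> \<epsilon> / 4 * real n" and 3: "1 \<le> n"
      and 4: "inj_on \<omega> (Kn_edges n) \<and>
    ((inj_on \<omega> (Kn_edges n) \<longrightarrow> \<bar>rho n k (take (nat \<lfloor>t / 2 * real n\<rfloor>) (srt \<omega> (Kn_edges n))) - real n * rhol k (t / 2)\<bar> \<le> \<epsilon> / 4 * real n) \<and>
     \<bar>real (card {e \<in> Kn_edges n. \<omega> e \<le> t / real n}) - real (card (Kn_edges n)) * measure \<mu> {..t / real n}\<bar> \<le> \<epsilon> / 4 * real n)"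
    let ?M = "card {e \<in> Kn_edges n. \<omega> e \<le> t / real n}"
    let ?Np = "real (card (Kn_edges n)) * measure \<mu> {..t / real n}"
    let ?m = "nat \<lfloor>t / 2 * real n\<rfloor>"
    have inj: "inj_on \<omega> (Kn_edges n)" using 4 by simp
    have "\<bar>?Np - t / 2 * real n\<bar> / real n < \<epsilon> / 4" using 1 by (simp add: dist_real_def abs_divide)
    then have x1: "\<bar>?Np - t / 2 * real n\<bar> \<le> \<epsilon> / 4 * real n" using 3 by (simp add: divide_less_eq)
    have x2: "\<bar>real ?m - t / 2 * real n\<bar> \<le> 1"
    proof -
      have "0 \<le> t / 2 * real n" using t by simp
      then show ?thesis by linarith
    qed
    have x3: "\<bar>rho n k (take ?M (srt \<omega> (Kn_edges n))) - rho n k (take ?m (srt \<omega> (Kn_edges n)))\<bar> \<le> \<bar>real ?M - real ?m\<bar>"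
      by (rule rho_take) (simp add: srt_sorted(2)[OF finite_Kn inj])
    have x4: "\<bar>rho n k (take ?m (srt \<omega> (Kn_edges n))) - real n * rhol k (t / 2)\<bar> \<le> \<epsilon> / 4 * real n"
      "\<bar>real ?M - ?Np\<bar> \<le> \<epsilon> / 4 * real n" using 4 by auto
    show "\<bar>rho n k (lst n \<omega> (t / real n)) - real n * rhol k (t / 2)\<bar> \<le> \<epsilon> * real n"
    proof -
      have tri: "\<bar>a - c\<bar> \<le> \<bar>a - b\<bar> + \<bar>b - c\<bar>" for a b c :: real by linarith
      have "\<bar>real ?M - real ?m\<bar> \<le> \<bar>real ?M - ?Np\<bar> + (\<bar>?Np - t / 2 * real n\<bar> + \<bar>real ?m - t / 2 * real n\<bar>)"
        using tri[of "real ?M" "real ?m" ?Np] tri[of ?Np "real ?m" "t / 2 * real n"]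
        by (simp only: abs_minus_commute[of "real ?m"])
      also have "\<dots> \<le> \<epsilon> / 4 * real n + (\<epsilon> / 4 * real n + \<epsilon> / 4 * real n)"
        using x4(2) x1 order_trans[OF x2 2] by (intro add_mono)
      finally have y: "\<bar>real ?M - real ?m\<bar> \<le> \<epsilon> / 4 * real n + (\<epsilon> / 4 * real n + \<epsilon> / 4 * real n)" .
      have "\<bar>rho n k (take ?M (srt \<omega> (Kn_edges n))) - real n * rhol k (t / 2)\<bar>
        \<le> (\<epsilon> / 4 * real n + (\<epsilon> / 4 * real n + \<epsilon> / 4 * real n)) + \<epsilon> / 4 * real n"
        by (rule order_trans[OF tri add_mono[OF order_trans[OF x3 y] x4(1)]])
      then show ?thesis unfolding lst_take[OF inj] by (simp add: field_simps)
    qed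
  qed
qed

end

subsection \<open>Tail estimate\<close>

definition ed :: "nat \<Rightarrow> nat \<Rightarrow> nat \<times> nat" where
  "ed x y = (min x y, max x y)"

lemma ed_in: "x < n \<Longrightarrow> y < n \<Longrightarrow> x \<noteq> y \<Longrightarrow> ed x y \<in> Kn_edges n"
  by (auto simp: ed_def Kn_edges_def min_def max_def)

lemma ed_rel: "equivp R \<Longrightarrow> R (fst (ed x y)) (snd (ed x y)) \<Longrightarrow> R x y"
  by (auto simp: ed_def min_def max_def equivp_symp split: if_splits)

lemma ed_rel': "equivp R \<Longrightarrow> R x y \<Longrightarrow> R (fst (ed x y)) (snd (ed x y))"
  by (auto simp: ed_def min_def max_def equivp_symp split: if_splits)

lemma ed_inj: "ed x y = ed x' y' \<Longrightarrow> (x = x' \<and> y = y') \<or> (x = y' \<and> y = x')"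
  by (auto simp: ed_def min_def max_def split: if_splits)

text \<open>By \<open>ex\<close> every uncrossed cut of \<open>B\<close> has a side smaller than
  \<open>a\<close>, so \<open>cut_exists\<close> leaves at most 4 a n unrelated ordered pairs. A
  vertex with the fewest strangers has at most the average number, which is bounded by 8 a because
  \<open>B\<close> has at least n / 2 vertices.\<close>

lemma large_class:
  assumes R: "equivp R" and B: "B \<subseteq> {..<n}" and a: "0 < a" and n: "0 < n" and Bn: "real n / 2 \<le> real (card B)"
    and ex: "\<And>X Y. X \<subseteq> B \<Longrightarrow> Y \<subseteq> B \<Longrightarrow> X \<inter> Y = {} \<Longrightarrow> a \<le> real (card X) \<Longrightarrow> a \<le> real (card Y) \<Longrightarrow> \<exists>x\<in>X. \<exists>y\<in>Y. R x y"
  shows "\<exists>C\<subseteq>B. (\<forall>u\<in>C. \<forall>w\<in>C. R u w) \<and> real (card B) - 8 * a \<le> real (card C)"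
proof -
  have finB: "finite B" using B by (rule finite_subset) simp
  have cB: "card B \<le> n" using card_mono[OF _ B] by simp
  obtain W where W: "closed_in R B W" and p: "card {(u, v). u \<in> B \<and> v \<in> B \<and> \<not> R u v} \<le> 4 * (card W * card (B - W))"
    using cut_exists[OF R finB] by blast
  have WB: "W \<subseteq> B" using W by (simp add: closed_in_def)
  have cW: "card W \<le> n" "card (B - W) \<le> n"
    using card_mono[OF finB WB] card_mono[OF finB, of "B - W"] cB by auto
  have small: "real (card W) < a \<or> real (card (B - W)) < a"
  proof (rule ccontr)
    assume "\<not> ?thesis"
    then have "\<exists>x\<in>W. \<exists>y\<in>B - W. R x y" using WB by (intro ex) auto
    then show False using W by (auto simp: closed_in_def)
  qed
  have prod: "real (card W) * real (card (B - W)) \<le> a * real n"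
    using small
  proof
    assume "real (card W) < a"
    then show ?thesis using cW a by (intro mult_mono) auto
  next
    assume "real (card (B - W)) < a"
    then have "real (card (B - W)) * real (card W) \<le> a * real n" using cW a by (intro mult_mono) auto
    then show ?thesis by (simp add: mult.commute)
  qed
  have Bne: "B \<noteq> {}" using Bn n by auto
  obtain u where u: "u \<in> B" "\<And>w. w \<in> B \<Longrightarrow> real (card {v \<in> B. \<not> R u v}) \<le> real (card {v \<in> B. \<not> R w v})"
    using finite_maximizer[OF finB Bne, of "\<lambda>u. - real (card {v \<in> B. \<not> R u v})"] by (metis neg_le_iff_le)
  have "{(u, v). u \<in> B \<and> v \<in> B \<and> \<not> R u v} = (SIGMA u:B. {v \<in> B. \<not> R u v})" by auto
  then have "real (card {(u, v). u \<in> B \<and> v \<in> B \<and> \<not> R u v}) = (\<Sum>w\<in>B. real (card {v \<in> B. \<not> R w v}))"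
    using finB by simp
  also have "\<dots> \<ge> (\<Sum>w\<in>B. real (card {v \<in> B. \<not> R u v}))" by (intro sum_mono u(2))
  finally have "real (card B) * real (card {v \<in> B. \<not> R u v}) \<le> 4 * (real (card W) * real (card (B - W)))"
    using of_nat_mono[OF p, where 'a = real] by simp
  then have "real (card B) * real (card {v \<in> B. \<not> R u v}) \<le> 4 * (a * real n)" using prod by linarith
  moreover have "real n / 2 * real (card {v \<in> B. \<not> R u v}) \<le> real (card B) * real (card {v \<in> B. \<not> R u v})"
    using Bn by (intro mult_right_mono) auto
  moreover have "real n * (8 * a) = 2 * (4 * (a * real n))"
    "real n * real (card {v \<in> B. \<not> R u v}) = 2 * (real n / 2 * real (card {v \<in> B. \<not> R u v}))" by simp_all
  ultimately have "real n * real (card {v \<in> B. \<not> R u v}) \<le> real n * (8 * a)" by linarith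
  then have bad: "real (card {v \<in> B. \<not> R u v}) \<le> 8 * a" using n by simp
  have "card B = card ({v \<in> B. R u v} \<union> {v \<in> B. \<not> R u v})" by (intro arg_cong[where f = card]) auto
  also have "\<dots> = card {v \<in> B. R u v} + card {v \<in> B. \<not> R u v}" using finB by (intro card_Un_disjoint) auto
  finally have "real (card B) - 8 * a \<le> real (card {v \<in> B. R u v})" using bad by linarith
  moreover have "R x w" if "x \<in> {v \<in> B. R u v}" "w \<in> {v \<in> B. R u v}" for x w
  proof (rule equivp_transp[OF R])
    have "R u x" using that(1) by simp
    then show "R x u" by (rule equivp_symp[OF R])
    show "R u w" using that by simp
  qed
  moreover have "{v \<in> B. R u v} \<subseteq> B" by blast
  ultimately show ?thesis by meson
qed

lemma rl_level_mono: "i \<le> k \<Longrightarrow> rl k l u v \<Longrightarrow> rl i l u v"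
proof (induction rule: inc_induct)
  case (step i)
  then show ?case unfolding rl_def by (intro rel_Suc_le[of _ i]) simp
qed

lemma filter_advance:
  fixes c :: "'e \<Rightarrow> real"
  assumes "sorted_wrt (\<lambda>x y. c x < c y) L" "t \<le> t'"
  shows "filter (\<lambda>e. c e \<le> t') L = filter (\<lambda>e. c e \<le> t) L @ filter (\<lambda>e. t < c e \<and> c e \<le> t') L"
proof -
  have "sorted_wrt (\<lambda>x y. c x < c y) (filter (\<lambda>e. c e \<le> t') L)" by (rule sorted_wrt_filter[OF assms(1)])
  from sorted_split[OF this, of t]
  have "filter (\<lambda>e. c e \<le> t') L = filter (\<lambda>e. c e \<le> t \<and> c e \<le> t') L @ filter (\<lambda>e. \<not> c e \<le> t \<and> c e \<le> t') L"
    by (simp add: conj_commute)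
  also have "filter (\<lambda>e. c e \<le> t \<and> c e \<le> t') L = filter (\<lambda>e. c e \<le> t) L"
    using assms(2) by (intro filter_cong) auto
  finally show ?thesis by (simp add: not_le)
qed

text \<open>The edges of the graph without \<open>v\<close>. A core built from them is independent
  of the costs at \<open>v\<close>.\<close>

definition away :: "nat \<Rightarrow> nat \<Rightarrow> (nat \<times> nat) set" where
  "away n v = {e \<in> Kn_edges n. fst e \<noteq> v \<and> snd e \<noteq> v}"

text \<open>\<open>rel_join\<close> with costs as time: an edge from the window after
  \<open>t\<close> lifts a connection at level \<open>j\<close> to level
  \<open>j + 1\<close>.\<close>

lemma slot_join:
  assumes S: "S \<subseteq> Kn_edges n" and inj: "inj_on \<omega> S" and t: "t \<le> t'"
    and e: "e \<in> S" "t < \<omega> e" "\<omega> e \<le> t'"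
    and r: "rl j (filter (\<lambda>e. \<omega> e \<le> t) (srt \<omega> S)) (fst e) (snd e)"
  shows "rl (Suc j) (filter (\<lambda>e. \<omega> e \<le> t') (srt \<omega> S)) (fst e) (snd e)"
proof -
  have finS: "finite S" using S finite_Kn by (rule finite_subset)
  have adv: "filter (\<lambda>e. \<omega> e \<le> t') (srt \<omega> S) = filter (\<lambda>e. \<omega> e \<le> t) (srt \<omega> S) @ filter (\<lambda>e. t < \<omega> e \<and> \<omega> e \<le> t') (srt \<omega> S)"
    by (rule filter_advance[OF srt_sorted(1)[OF finS inj] t])
  show ?thesis unfolding adv rl_def
  proof (rule rel_join)
    show "\<forall>e\<in>set (filter (\<lambda>e. \<omega> e \<le> t) (srt \<omega> S) @ filter (\<lambda>e. t < \<omega> e \<and> \<omega> e \<le> t') (srt \<omega> S)). good n Kn_ends e"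
      using S good_Kn by (auto simp: srt_sorted(2)[OF finS inj])
    show "e \<in> set (filter (\<lambda>e. t < \<omega> e \<and> \<omega> e \<le> t') (srt \<omega> S))" using e by (simp add: srt_sorted(2)[OF finS inj])
    show "rel Kn_ends j (filter (\<lambda>e. \<omega> e \<le> t) (srt \<omega> S)) (fst e) (snd e)" using r by (simp add: rl_def)
  qed
qed

text \<open>One cost window per level: edges of the window i lift the core from level i to level i +
  1, at the expense of 8 a vertices by \<open>large_class\<close>. The bound on 8 k a keeps the core
  above n / 2 all along.\<close>

lemma core_chain:
  fixes a \<tau> :: real
  assumes n: "8 \<le> n" and a: "0 < a" "8 * real k * a \<le> real n / 8" and \<tau>: "0 < \<tau>" and v: "v < n"
    and inj: "inj_on \<omega> (away n v)"
    and ex: "\<And>i X Y. i < k \<Longrightarrow> X \<subseteq> {..<n} \<Longrightarrow> Y \<subseteq> {..<n} \<Longrightarrow> X \<inter> Y = {} \<Longrightarrow> a \<le> real (card X) \<Longrightarrow> a \<le> real (card Y) \<Longrightarrow>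
      \<exists>x\<in>X. \<exists>y\<in>Y. real i * \<tau> < \<omega> (ed x y) \<and> \<omega> (ed x y) \<le> real (Suc i) * \<tau>"
    and i: "i \<le> k"
  shows "\<exists>B\<subseteq>{..<n} - {v}. real n - 1 - 8 * real i * a \<le> real (card B) \<and>
    (\<forall>u\<in>B. \<forall>w\<in>B. rl i (filter (\<lambda>e. \<omega> e \<le> real i * \<tau>) (srt \<omega> (away n v))) u w)"
  using i
proof (induction i)
  case 0
  have "real (card ({..<n} - {v})) = real n - 1" using v by (simp add: of_nat_diff)
  then show ?case by (intro exI[of _ "{..<n} - {v}"]) (simp add: rl_def)
next
  case (Suc i)
  let ?F = "away n v"
  let ?L = "\<lambda>i. filter (\<lambda>e. \<omega> e \<le> real i * \<tau>) (srt \<omega> ?F)"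
  obtain B where B: "B \<subseteq> {..<n} - {v}" "real n - 1 - 8 * real i * a \<le> real (card B)"
    and BR: "\<forall>u\<in>B. \<forall>w\<in>B. rl i (?L i) u w" using Suc by auto
  have "8 * real i * a \<le> 8 * real k * a" using Suc.prems a by (intro mult_right_mono mult_left_mono) auto
  then have Bn: "real n / 2 \<le> real (card B)" using B(2) a(2) n by linarith
  have "\<exists>C\<subseteq>B. (\<forall>u\<in>C. \<forall>w\<in>C. rl (Suc i) (?L (Suc i)) u w) \<and> real (card B) - 8 * a \<le> real (card C)"
  proof (rule large_class[OF equivp_rl _ a(1) _ Bn])
    show "B \<subseteq> {..<n}" using B by auto
    show "0 < n" using n by simp
    fix X Y assume XY: "X \<subseteq> B" "Y \<subseteq> B" "X \<inter> Y = {}" "a \<le> real (card X)" "a \<le> real (card Y)"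
    then obtain x y where xy: "x \<in> X" "y \<in> Y" "real i * \<tau> < \<omega> (ed x y)" "\<omega> (ed x y) \<le> real (Suc i) * \<tau>"
      using ex[of i X Y] Suc.prems B by (meson Diff_subset Suc_le_lessD order_trans)
    have xyB: "x \<in> B" "y \<in> B" "x \<noteq> y" using xy XY by auto
    then have e: "ed x y \<in> ?F" using B ed_in[of x n y] by (auto simp: away_def ed_def min_def max_def)
    have "rl i (?L i) (fst (ed x y)) (snd (ed x y))"
      using BR xyB by (intro ed_rel'[OF equivp_rl]) auto
    then have "rl (Suc i) (?L (Suc i)) (fst (ed x y)) (snd (ed x y))"
      by (intro slot_join[OF _ inj _ e xy(3,4)]) (use \<tau> in \<open>auto simp: away_def intro: mult_right_mono\<close>)
    then show "\<exists>x\<in>X. \<exists>y\<in>Y. rl (Suc i) (?L (Suc i)) x y"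
      using xy ed_rel[OF equivp_rl] by blast
  qed
  then obtain C where C: "C \<subseteq> B" "\<forall>u\<in>C. \<forall>w\<in>C. rl (Suc i) (?L (Suc i)) u w" "real (card B) - 8 * a \<le> real (card C)" by blast
  have "real n - 1 - 8 * real (Suc i) * a \<le> real (card C)" using B(2) C(3) by (simp add: algebra_simps)
  then show ?case using B C by (intro exI[of _ C]) auto
qed

lemma rl_subseq:
  assumes "subseq l l'" "set l' \<subseteq> Kn_edges n" "rl j l u v"
  shows "rl j l' u v"
  using rel_mono_subseq[OF assms(1), of n Kn_ends j u v] assms(2,3) good_Kn unfolding rl_def by blast

lemma lst_core:
  assumes inj: "inj_on \<omega> (Kn_edges n)" and "s \<le> s'"
    and "rl k (filter (\<lambda>e. \<omega> e \<le> s) (srt \<omega> (away n v))) u w"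
  shows "rl k (lst n \<omega> s') u w"
proof -
  have "srt \<omega> (away n v) = filter (\<lambda>e. fst e \<noteq> v \<and> snd e \<noteq> v) (srt \<omega> (Kn_edges n))"
    unfolding away_def by (rule srt_filter[OF finite_Kn inj, symmetric])
  then have "filter (\<lambda>e. \<omega> e \<le> s) (srt \<omega> (away n v)) = filter (\<lambda>e. (fst e \<noteq> v \<and> snd e \<noteq> v) \<and> \<omega> e \<le> s) (lst n \<omega> s')"
    using assms(2) unfolding lst_def by (simp, intro filter_cong) auto
  then have "subseq (filter (\<lambda>e. \<omega> e \<le> s) (srt \<omega> (away n v))) (lst n \<omega> s')" by (simp add: subseq_filter_left)
  then show ?thesis
    by (rule rl_subseq[OF _ _ assms(3)]) (auto simp: lst_def srt_sorted(2)[OF finite_Kn inj])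
qed

text \<open>The core is joined at level k before \<open>v\<close> is considered. In each of k
  further windows an edge from \<open>v\<close> to the core lifts \<open>v\<close> by one level. The
  windows have to follow one another because an edge reaches level i + 1 only if its ends are
  already joined at level i.\<close>

lemma attach:
  fixes \<tau> :: real
  assumes inj: "inj_on \<omega> (Kn_edges n)" and \<tau>: "0 < \<tau>" and v: "v < n" and B: "B \<subseteq> {..<n} - {v}" and Bne: "B \<noteq> {}"
    and BR: "\<forall>u\<in>B. \<forall>w\<in>B. rl k (filter (\<lambda>e. \<omega> e \<le> real k * \<tau>) (srt \<omega> (away n v))) u w"
    and ex: "\<And>i. i < k \<Longrightarrow> \<exists>w\<in>B. real (k + i) * \<tau> < \<omega> (ed v w) \<and> \<omega> (ed v w) \<le> real (Suc (k + i)) * \<tau>"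
    and i: "i \<le> k"
  shows "\<forall>w\<in>B. rl i (lst n \<omega> (real (k + i) * \<tau>)) v w"
  using i
proof (induction i)
  case 0
  then show ?case by (simp add: rl_def)
next
  case (Suc i)
  let ?L = "\<lambda>i. lst n \<omega> (real (k + i) * \<tau>)"
  obtain w where w: "w \<in> B" "real (k + i) * \<tau> < \<omega> (ed v w)" "\<omega> (ed v w) \<le> real (Suc (k + i)) * \<tau>"
    using ex[of i] Suc.prems by auto
  have wn: "w < n" "w \<noteq> v" using w B by auto
  have "rl i (?L i) v w" using Suc w by simp
  then have "rl i (?L i) (fst (ed v w)) (snd (ed v w))" by (rule ed_rel'[OF equivp_rl])
  then have "rl (Suc i) (?L (Suc i)) (fst (ed v w)) (snd (ed v w))"
    unfolding lst_def add_Suc_right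
    by (intro slot_join[OF order_refl inj _ ed_in w(2,3)]) (use \<tau> wn v in \<open>auto intro: mult_right_mono\<close>)
  then have vw: "rl (Suc i) (?L (Suc i)) v w" by (rule ed_rel[OF equivp_rl])
  show ?case
  proof
    fix u assume u: "u \<in> B"
    have "rl k (?L (Suc i)) w u"
      by (rule lst_core[OF inj _ BR[rule_format, OF w(1) u]]) (use \<tau> in \<open>auto intro: mult_right_mono\<close>)
    then have "rl (Suc i) (?L (Suc i)) w u" using Suc.prems by (rule rl_level_mono[rotated])
    then show "rl (Suc i) (?L (Suc i)) v u" using vw equivp_transp[OF equivp_rl] by blast
  qed
qed

text \<open>All vertices outside \<open>U\<close> lie in one class and contribute at most 1
  together; each vertex of \<open>U\<close> contributes at most 1.\<close>

lemma Phi_ginv_le: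
  assumes R: "equivp R" and U: "U \<subseteq> {..<n}" and rel: "\<And>u v. u \<in> {..<n} - U \<Longrightarrow> v \<in> {..<n} - U \<Longrightarrow> R u v"
  shows "Phi n ginv R \<le> 1 + real (card U)"
proof -
  let ?A = "{..<n} - U"
  have "Phi n ginv R = (\<Sum>u\<in>?A. ginv (csz n R u)) + (\<Sum>u\<in>U. ginv (csz n R u))"
    unfolding Phi_def using U by (intro sum.subset_diff) auto
  also have "(\<Sum>u\<in>U. ginv (csz n R u)) \<le> (\<Sum>u\<in>U. 1)"
  proof (rule sum_mono)
    fix u show "ginv (csz n R u) \<le> 1" by (cases "csz n R u") (auto simp: ginv_def)
  qed
  also have "(\<Sum>u\<in>?A. ginv (csz n R u)) \<le> (\<Sum>u\<in>?A. 1 / real (card ?A))"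
  proof (rule sum_mono)
    fix u assume u: "u \<in> ?A"
    have "card ?A \<le> csz n R u" unfolding csz_def using rel[OF u] by (intro card_mono) auto
    moreover have "0 < card ?A" using u by (auto simp: card_gt_0_iff)
    ultimately show "ginv (csz n R u) \<le> 1 / real (card ?A)" unfolding ginv_def by (intro divide_left_mono) auto
  qed
  also have "\<dots> \<le> 1" by simp
  finally show ?thesis by simp
qed

section \<open>Probability that a vertex is not attached to the core\<close>

context cost_law
begin

lemma indep_restrict:
  assumes FS: "F \<inter> S = {}" "F \<subseteq> I" "S \<subseteq> I" and A: "A \<in> sets (KM F)" and B: "B \<in> sets (KM S)"
  shows "measure (KM I) {\<omega>\<in>space (KM I). restrict \<omega> F \<in> A \<and> restrict \<omega> S \<in> B}
    = measure (KM I) {\<omega>\<in>space (KM I). restrict \<omega> F \<in> A} * measure (KM I) {\<omega>\<in>space (KM I). restrict \<omega> S \<in> B}"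
proof -
  interpret P: prob_space "KM I" by (rule prob_KM)
  have sb: "sets (PiM J (\<lambda>_. borel)) = sets (KM J)" for J by (rule sets_PiM_cong) (auto simp: sets_mu)
  have "P.indep_var (PiM F (\<lambda>_. borel)) (\<lambda>\<omega>. restrict (\<lambda>j. \<omega> j) F) (PiM S (\<lambda>_. borel)) (\<lambda>\<omega>. restrict (\<lambda>j. \<omega> j) S)"
    by (rule P.indep_var_restrict[OF coord_indep FS])
  from P.indep_varD[OF this, of A B] A B
  have "measure (KM I) ((\<lambda>x. (restrict x F, restrict x S)) -` (A \<times> B) \<inter> space (KM I)) =
    measure (KM I) ((\<lambda>x. restrict x F) -` A \<inter> space (KM I)) * measure (KM I) ((\<lambda>x. restrict x S) -` B \<inter> space (KM I))"
    by (simp add: sb)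
  then show ?thesis by (simp add: vimage_def Int_def conj_commute)
qed

lemma prob_avoid:
  assumes "finite J" "J \<subseteq> I" and q: "0 \<le> q" "q \<le> measure \<mu> {x<..y}"
  shows "{\<omega>\<in>space (KM I). \<forall>e\<in>J. \<not> (x < \<omega> e \<and> \<omega> e \<le> y)} \<in> sets (KM I)"
    and "measure (KM I) {\<omega>\<in>space (KM I). \<forall>e\<in>J. \<not> (x < \<omega> e \<and> \<omega> e \<le> y)} \<le> exp (- q * real (card J))"
proof -
  have eq: "{\<omega>\<in>space (KM I). \<forall>e\<in>J. \<not> (x < \<omega> e \<and> \<omega> e \<le> y)} = {\<omega>\<in>space (KM I). \<forall>e\<in>J. \<omega> e \<in> - {x<..y}}" by auto
  show "{\<omega>\<in>space (KM I). \<forall>e\<in>J. \<not> (x < \<omega> e \<and> \<omega> e \<le> y)} \<in> sets (KM I)"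
    unfolding eq by (rule sets_coords) (use assms in auto)
  have "measure \<mu> (- {x<..y}) = 1 - measure \<mu> {x<..y}"
    using prob_compl[of "{x<..y}"] by (simp add: sets_mu space_mu Compl_eq_Diff_UNIV)
  also have "\<dots> \<le> 1 + (- q)" using q by simp
  also have "\<dots> \<le> exp (- q)" by (rule exp_ge_add_one_self)
  finally have m: "measure \<mu> (- {x<..y}) \<le> exp (- q)" .
  have "measure (KM I) {\<omega>\<in>space (KM I). \<forall>e\<in>J. \<omega> e \<in> - {x<..y}} = (\<Prod>e\<in>J. measure \<mu> (- {x<..y}))"
    by (rule prob_coords) (use assms in auto)
  also have "\<dots> \<le> (\<Prod>e\<in>J. exp (- q))" by (intro prod_mono) (auto simp: m)
  also have "\<dots> = exp (- q * real (card J))" by (simp add: exp_of_nat_mult[symmetric] mult.commute)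
  finally show "measure (KM I) {\<omega>\<in>space (KM I). \<forall>e\<in>J. \<not> (x < \<omega> e \<and> \<omega> e \<le> y)} \<le> exp (- q * real (card J))"
    unfolding eq .
qed

lemma measure_UN_le:
  assumes "finite J" "\<And>i. i \<in> J \<Longrightarrow> A i \<in> sets M" "\<And>i. i \<in> J \<Longrightarrow> measure M (A i) \<le> b"
  shows "measure M (\<Union>i\<in>J. A i) \<le> real (card J) * b"
proof -
  have "measure M (\<Union>i\<in>J. A i) \<le> (\<Sum>i\<in>J. measure M (A i))"
    using assms by (intro measure_UNION_le) auto
  also have "\<dots> \<le> (\<Sum>i\<in>J. b)" using assms by (intro sum_mono) auto
  finally show ?thesis by simp
qed

text \<open>Union bound over windows and at most 4 ^ n pairs of disjoint sets, each pair spanning at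
  least a a edges that would all have to miss the window.\<close>

lemma expander_event:
  fixes \<tau> a q :: real
  assumes q: "0 \<le> q" "\<And>i. i < k \<Longrightarrow> q \<le> measure \<mu> {real i * \<tau><..real (Suc i) * \<tau>}" and a: "0 < a"
  shows "\<exists>G\<in>sets (KM (Kn_edges n)). measure (KM (Kn_edges n)) G \<le> real k * (4 ^ n * exp (- q * a\<^sup>2)) \<and>
    (\<forall>\<omega>\<in>space (KM (Kn_edges n)) - G. \<forall>i<k. \<forall>X Y. X \<subseteq> {..<n} \<longrightarrow> Y \<subseteq> {..<n} \<longrightarrow> X \<inter> Y = {} \<longrightarrow>
      a \<le> real (card X) \<longrightarrow> a \<le> real (card Y) \<longrightarrow>
      (\<exists>x\<in>X. \<exists>y\<in>Y. real i * \<tau> < \<omega> (ed x y) \<and> \<omega> (ed x y) \<le> real (Suc i) * \<tau>))"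
proof -
  let ?E = "Kn_edges n"
  define J where "J = (\<lambda>(X, Y). {e. \<exists>x\<in>X. \<exists>y\<in>Y. e = ed x y})"
  define PP where "PP = {(X, Y). X \<subseteq> {..<n} \<and> Y \<subseteq> {..<n} \<and> X \<inter> Y = {} \<and> a \<le> real (card X) \<and> a \<le> real (card Y)}"
  define A where "A i p = {\<omega>\<in>space (KM ?E). \<forall>e\<in>J p. \<not> (real i * \<tau> < \<omega> e \<and> \<omega> e \<le> real (Suc i) * \<tau>)}" for i :: nat and p
  have PPsub: "PP \<subseteq> Pow {..<n} \<times> Pow {..<n}" by (auto simp: PP_def)
  then have fPP: "finite PP" by (rule finite_subset) simp
  have cPP: "real (card PP) \<le> 4 ^ n"
  proof -
    have "card PP \<le> card (Pow {..<n} \<times> Pow {..<n})" using PPsub by (intro card_mono) auto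
    also have "\<dots> = 4 ^ n" by (simp add: card_cartesian_product card_Pow flip: power_mult_distrib)
    finally have "card PP \<le> 4 ^ n" .
    from of_nat_mono[OF this, where 'a = real] show ?thesis by simp
  qed
  have JE: "J p \<subseteq> ?E" if "p \<in> PP" for p
    using that by (auto simp: J_def PP_def intro!: ed_in)
  have fJ: "finite (J p)" if "p \<in> PP" for p using JE[OF that] finite_Kn by (rule finite_subset)
  have cJ: "a\<^sup>2 \<le> real (card (J p))" if p: "p \<in> PP" for p
  proof -
    obtain X Y where XY: "p = (X, Y)" "X \<inter> Y = {}" "a \<le> real (card X)" "a \<le> real (card Y)" using p by (auto simp: PP_def)
    have "J p = (\<lambda>(x, y). ed x y) ` (X \<times> Y)" by (auto simp: J_def XY)
    moreover have "inj_on (\<lambda>(x, y). ed x y) (X \<times> Y)" using XY(2) ed_inj by (fastforce simp: inj_on_def)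
    ultimately have "card (J p) = card X * card Y" by (simp add: card_image card_cartesian_product)
    moreover have "a * a \<le> real (card X) * real (card Y)" using XY a by (intro mult_mono) auto
    ultimately show ?thesis by (simp add: power2_eq_square)
  qed
  have As: "A i p \<in> sets (KM ?E)" if "i < k" "p \<in> PP" for i p
    unfolding A_def by (rule prob_avoid(1)[OF fJ[OF that(2)] JE[OF that(2)] q(1) q(2)[OF that(1)]])
  have Am: "measure (KM ?E) (A i p) \<le> exp (- q * a\<^sup>2)" if "i < k" "p \<in> PP" for i p
  proof -
    have "measure (KM ?E) (A i p) \<le> exp (- q * real (card (J p)))"
      unfolding A_def by (rule prob_avoid(2)[OF fJ[OF that(2)] JE[OF that(2)] q(1) q(2)[OF that(1)]])
    also have "q * a\<^sup>2 \<le> q * real (card (J p))" by (rule mult_left_mono[OF cJ[OF that(2)] q(1)])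
    then have "exp (- q * real (card (J p))) \<le> exp (- q * a\<^sup>2)" by simp
    finally show ?thesis .
  qed
  define G where "G = (\<Union>i\<in>{..<k}. \<Union>p\<in>PP. A i p)"
  have inner: "(\<Union>p\<in>PP. A i p) \<in> sets (KM ?E)" if "i < k" for i using As[OF that] fPP by auto
  have "measure (KM ?E) (\<Union>p\<in>PP. A i p) \<le> 4 ^ n * exp (- q * a\<^sup>2)" if "i < k" for i
  proof -
    have "measure (KM ?E) (\<Union>p\<in>PP. A i p) \<le> real (card PP) * exp (- q * a\<^sup>2)"
      by (rule measure_UN_le[OF fPP]) (use As Am that in auto)
    also have "\<dots> \<le> 4 ^ n * exp (- q * a\<^sup>2)" using cPP by (intro mult_right_mono) auto
    finally show ?thesis .
  qed
  then have "measure (KM ?E) G \<le> real (card {..<k}) * (4 ^ n * exp (- q * a\<^sup>2))"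
    unfolding G_def using inner by (intro measure_UN_le) auto
  moreover have "G \<in> sets (KM ?E)" unfolding G_def using inner by auto
  moreover have "\<exists>x\<in>X. \<exists>y\<in>Y. real i * \<tau> < \<omega> (ed x y) \<and> \<omega> (ed x y) \<le> real (Suc i) * \<tau>"
    if "\<omega> \<in> space (KM ?E) - G" "i < k" "X \<subseteq> {..<n}" "Y \<subseteq> {..<n}" "X \<inter> Y = {}" "a \<le> real (card X)" "a \<le> real (card Y)" for \<omega> i X Y
  proof -
    have "(X, Y) \<in> PP" using that by (auto simp: PP_def)
    then have "\<omega> \<notin> A i (X, Y)" using that by (auto simp: G_def)
    then show ?thesis using that unfolding A_def J_def by blast
  qed
  ultimately show ?thesis by (intro bexI[of _ G]) auto
qed

lemma sets_state:
  assumes "finite F" "set l \<subseteq> F"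
  shows "{\<eta>\<in>space (KM F). sorted_wrt (\<lambda>x y. \<eta> x < \<eta> y) l \<and> (\<forall>e\<in>F. \<eta> e \<le> s \<longleftrightarrow> e \<in> set l)} \<in> sets (KM F)"
proof -
  have "{\<eta>\<in>space (KM F). \<forall>e\<in>F. \<eta> e \<in> (if e \<in> set l then {..s} else {s<..})} \<in> sets (KM F)"
    by (rule sets_coords[OF assms(1)]) auto
  moreover have "{\<eta>\<in>space (KM F). sorted_wrt (\<lambda>x y. \<eta> x < \<eta> y) l \<and> (\<forall>e\<in>F. \<eta> e \<le> s \<longleftrightarrow> e \<in> set l)}
     = {\<eta>\<in>space (KM F). sorted_wrt (\<lambda>x y. \<eta> x < \<eta> y) l} \<inter> {\<eta>\<in>space (KM F). \<forall>e\<in>F. \<eta> e \<in> (if e \<in> set l then {..s} else {s<..})}"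
  proof -
    have p: "x \<in> (if b then {..s} else {s<..}) \<longleftrightarrow> (x \<le> s \<longleftrightarrow> b)" for x b by auto
    show ?thesis unfolding p by blast
  qed
  ultimately show ?thesis using sets_sorted[OF assms(2)] by auto
qed

text \<open>The core \<open>\<beta> l\<close> seen by the edges away from \<open>v\<close> is independent of the costs of the edges at \<open>v\<close>.\<close>

lemma attach_event:
  fixes \<beta> :: "(nat \<times> nat) list \<Rightarrow> nat set" and \<tau> q b s :: real
  assumes v: "v < n" and q: "0 \<le> q" "\<And>i. i < k \<Longrightarrow> q \<le> measure \<mu> {real (k + i) * \<tau><..real (Suc (k + i)) * \<tau>}"
    and LL: "\<And>l. l \<in> LL \<Longrightarrow> distinct l \<and> set l \<subseteq> away n v \<and> \<beta> l \<subseteq> {..<n} - {v} \<and> b \<le> real (card (\<beta> l))"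
  shows "\<exists>D\<in>sets (KM (Kn_edges n)). measure (KM (Kn_edges n)) D \<le> real k * exp (- q * b) \<and>
    (\<forall>\<omega>\<in>space (KM (Kn_edges n)) - D. \<forall>l\<in>LL. sorted_wrt (\<lambda>x y. \<omega> x < \<omega> y) l \<longrightarrow> (\<forall>e\<in>away n v. \<omega> e \<le> s \<longleftrightarrow> e \<in> set l) \<longrightarrow>
      (\<forall>i<k. \<exists>w\<in>\<beta> l. real (k + i) * \<tau> < \<omega> (ed v w) \<and> \<omega> (ed v w) \<le> real (Suc (k + i)) * \<tau>))"
proof -
  let ?E = "Kn_edges n"
  let ?F = "away n v"
  interpret P: prob_space "KM ?E" by (rule prob_KM)
  define S where "S = ?E - ?F"
  have fE: "finite ?E" by (rule finite_Kn)
  have FE: "?F \<subseteq> ?E" by (auto simp: away_def)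
  have fF: "finite ?F" using FE fE by (rule finite_subset)
  have FS: "?F \<inter> S = {}" "S \<subseteq> ?E" by (auto simp: S_def)
  have fS: "finite S" using FS(2) fE by (rule finite_subset)
  have fLL: "finite LL"
  proof (rule finite_subset)
    show "LL \<subseteq> {l. set l \<subseteq> ?F \<and> length l \<le> card ?F}"
      using LL fF by (auto simp: card_mono dest!: LL) (metis LL card_mono distinct_card)
    show "finite {l. set l \<subseteq> ?F \<and> length l \<le> card ?F}" by (rule finite_lists_length_le[OF fF])
  qed
  define A' where "A' l = {\<eta>\<in>space (KM ?F). sorted_wrt (\<lambda>x y. \<eta> x < \<eta> y) l \<and> (\<forall>e\<in>?F. \<eta> e \<le> s \<longleftrightarrow> e \<in> set l)}" for l
  define J where "J l = ed v ` \<beta> l" for l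
  define N' where "N' l i = {\<eta>\<in>space (KM S). \<forall>e\<in>J l. \<not> (real (k + i) * \<tau> < \<eta> e \<and> \<eta> e \<le> real (Suc (k + i)) * \<tau>)}" for l i
  define A where "A l = {\<omega>\<in>space (KM ?E). restrict \<omega> ?F \<in> A' l}" for l
  define N where "N l i = {\<omega>\<in>space (KM ?E). restrict \<omega> S \<in> N' l i}" for l i
  have sp: "\<omega> \<in> space (KM ?E) \<Longrightarrow> restrict \<omega> X \<in> space (KM X)" if "X \<subseteq> ?E" for \<omega> X
    using that by (auto simp: space_PiM PiE_iff space_mu)
  have mr: "(\<lambda>\<omega>. restrict \<omega> X) \<in> measurable (KM ?E) (KM X)" if "X \<subseteq> ?E" for X
    by (rule measurable_restrict_subset[OF that])
  have A's: "A' l \<in> sets (KM ?F)" if "l \<in> LL" for l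
    unfolding A'_def using LL[OF that] by (intro sets_state[OF fF]) auto
  have JS: "J l \<subseteq> S" if "l \<in> LL" for l
    using LL[OF that] v ed_in[of v n] by (fastforce simp: J_def S_def away_def ed_def min_def max_def)
  have fJ: "finite (J l)" if "l \<in> LL" for l using JS[OF that] fS by (rule finite_subset)
  have cJ: "b \<le> real (card (J l))" if "l \<in> LL" for l
  proof -
    have "inj_on (ed v) (\<beta> l)" using ed_inj by (fastforce simp: inj_on_def)
    then show ?thesis using LL[OF that] by (simp add: J_def card_image)
  qed
  have N's: "N' l i \<in> sets (KM S)" if "l \<in> LL" "i < k" for l i
    unfolding N'_def by (rule prob_avoid(1)[OF fJ[OF that(1)] JS[OF that(1)] q(1) q(2)[OF that(2)]])
  have As: "A l \<in> sets (KM ?E)" if "l \<in> LL" for l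
    using measurable_sets[OF mr[OF FE] A's[OF that]] by (simp add: A_def vimage_def Int_def conj_commute)
  have Ns: "N l i \<in> sets (KM ?E)" if "l \<in> LL" "i < k" for l i
    using measurable_sets[OF mr[OF FS(2)] N's[OF that]] by (simp add: N_def vimage_def Int_def conj_commute)
  have N_eq: "N l i = {\<omega>\<in>space (KM ?E). \<forall>e\<in>J l. \<not> (real (k + i) * \<tau> < \<omega> e \<and> \<omega> e \<le> real (Suc (k + i)) * \<tau>)}" if "l \<in> LL" for l i
    unfolding N_def N'_def using sp[OF FS(2)] JS[OF that] by auto
  have Nm: "measure (KM ?E) (N l i) \<le> exp (- q * b)" if "l \<in> LL" "i < k" for l i
  proof -
    have "measure (KM ?E) (N l i) \<le> exp (- q * real (card (J l)))"
      unfolding N_eq[OF that(1)]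
      by (rule prob_avoid(2)[OF fJ[OF that(1)] _ q(1) q(2)[OF that(2)]]) (use JS[OF that(1)] FS in auto)
    also have "q * b \<le> q * real (card (J l))" by (rule mult_left_mono[OF cJ[OF that(1)] q(1)])
    then have "exp (- q * real (card (J l))) \<le> exp (- q * b)" by simp
    finally show ?thesis .
  qed
  \<comment> \<open>The state of the edges away from \<open>v\<close> and the costs of the edges at
    \<open>v\<close> are functions of disjoint sets of coordinates.\<close>
  have AN: "measure (KM ?E) (A l \<inter> N l i) = measure (KM ?E) (A l) * measure (KM ?E) (N l i)" if "l \<in> LL" "i < k" for l i
  proof -
    have "A l \<inter> N l i = {\<omega>\<in>space (KM ?E). restrict \<omega> ?F \<in> A' l \<and> restrict \<omega> S \<in> N' l i}" by (auto simp: A_def N_def)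
    then show ?thesis using indep_restrict[OF FS(1) FE FS(2) A's[OF that(1)] N's[OF that]] by (simp add: A_def N_def)
  qed
  have A_iff: "\<omega> \<in> A l \<longleftrightarrow> \<omega> \<in> space (KM ?E) \<and> sorted_wrt (\<lambda>x y. \<omega> x < \<omega> y) l \<and> (\<forall>e\<in>?F. \<omega> e \<le> s \<longleftrightarrow> e \<in> set l)"
    if "l \<in> LL" for l \<omega>
  proof -
    have "sorted_wrt (\<lambda>x y. restrict \<omega> ?F x < restrict \<omega> ?F y) l \<longleftrightarrow> sorted_wrt (\<lambda>x y. \<omega> x < \<omega> y) l"
    proof -
      have "set l \<subseteq> ?F" using LL[OF that] by simp
      then show ?thesis by (induction l) auto
    qed
    then show ?thesis unfolding A_def A'_def using sp[OF FE] by auto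
  qed
  have disj: "disjoint_family_on A LL"
    unfolding disjoint_family_on_def
  proof (intro ballI impI)
    fix l l' assume l: "l \<in> LL" "l' \<in> LL" "l \<noteq> l'"
    show "A l \<inter> A l' = {}"
    proof (rule ccontr)
      assume "A l \<inter> A l' \<noteq> {}"
      then obtain \<omega> where \<omega>: "\<omega> \<in> A l" "\<omega> \<in> A l'" by auto
      have st: "sorted_wrt (\<lambda>x y. \<omega> x < \<omega> y) l" "sorted_wrt (\<lambda>x y. \<omega> x < \<omega> y) l'"
        and mem: "\<forall>e\<in>?F. \<omega> e \<le> s \<longleftrightarrow> e \<in> set l" "\<forall>e\<in>?F. \<omega> e \<le> s \<longleftrightarrow> e \<in> set l'"
        using \<omega> A_iff[OF l(1)] A_iff[OF l(2)] by simp_all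
      have "set l \<subseteq> ?F" "set l' \<subseteq> ?F" using LL[OF l(1)] LL[OF l(2)] by simp_all
      with mem have eq: "set l = set l'" by blast
      have "l = srt \<omega> (set l')" unfolding eq[symmetric] by (rule srt_unique[OF st(1)])
      also have "\<dots> = l'" by (rule srt_unique[OF st(2), symmetric])
      finally have "l = l'" .
      then show False using l by simp
    qed
  qed
  \<comment> \<open>The states exclude one another, so summing over all of them costs no factor,
    however many there are.\<close>
  have sumA: "(\<Sum>l\<in>LL. measure (KM ?E) (A l)) \<le> 1"
  proof -
    have "(\<Sum>l\<in>LL. measure (KM ?E) (A l)) = measure (KM ?E) (\<Union>l\<in>LL. A l)"
      by (rule P.finite_measure_finite_Union[OF fLL _ disj, symmetric]) (use As in auto)
    then show ?thesis using P.prob_le_1 by metis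
  qed
  define D where "D = (\<Union>i\<in>{..<k}. \<Union>l\<in>LL. A l \<inter> N l i)"
  have Di: "(\<Union>l\<in>LL. A l \<inter> N l i) \<in> sets (KM ?E)" if "i < k" for i using As Ns[OF _ that] fLL by auto
  have "measure (KM ?E) (\<Union>l\<in>LL. A l \<inter> N l i) \<le> exp (- q * b)" if i: "i < k" for i
  proof -
    have "measure (KM ?E) (\<Union>l\<in>LL. A l \<inter> N l i) \<le> (\<Sum>l\<in>LL. measure (KM ?E) (A l \<inter> N l i))"
      using As Ns[OF _ i] by (intro measure_UNION_le[OF fLL]) auto
    also have "\<dots> \<le> (\<Sum>l\<in>LL. measure (KM ?E) (A l) * exp (- q * b))"
    proof (rule sum_mono)
      fix l assume l: "l \<in> LL"
      show "measure (KM ?E) (A l \<inter> N l i) \<le> measure (KM ?E) (A l) * exp (- q * b)"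
        unfolding AN[OF l i] by (rule mult_left_mono[OF Nm[OF l i]]) simp
    qed
    also have "\<dots> = (\<Sum>l\<in>LL. measure (KM ?E) (A l)) * exp (- q * b)" by (simp add: sum_distrib_right)
    also have "\<dots> \<le> 1 * exp (- q * b)" using sumA by (intro mult_right_mono) auto
    finally show ?thesis by simp
  qed
  then have "measure (KM ?E) D \<le> real (card {..<k}) * exp (- q * b)"
    unfolding D_def using Di by (intro measure_UN_le) auto
  moreover have "D \<in> sets (KM ?E)" unfolding D_def using Di by auto
  moreover have "\<exists>w\<in>\<beta> l. real (k + i) * \<tau> < \<omega> (ed v w) \<and> \<omega> (ed v w) \<le> real (Suc (k + i)) * \<tau>"
    if "\<omega> \<in> space (KM ?E) - D" "l \<in> LL" "sorted_wrt (\<lambda>x y. \<omega> x < \<omega> y) l" "\<forall>e\<in>?F. \<omega> e \<le> s \<longleftrightarrow> e \<in> set l" "i < k" for \<omega> l i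
  proof -
    have "\<omega> \<in> A l" using that A_iff by blast
    then have "\<omega> \<notin> N l i" using that by (auto simp: D_def)
    then show ?thesis using that N_eq[OF that(2)] by (auto simp: J_def)
  qed
  ultimately show ?thesis by (intro bexI[of _ D]) auto
qed

text \<open>The exceptional event \<open>G v\<close> is the failure of the expander property in the
  first k windows or of the attachment of \<open>v\<close> in the next k. Outside it
  \<open>v\<close> is joined at level k to more than half of the vertices, so any two such vertices
  are joined.\<close>

lemma unattached_bound:
  fixes \<tau> :: real
  assumes n: "8 \<le> n" and k: "1 \<le> k" and \<tau>: "0 < \<tau>" "2 * real k * \<tau> \<le> 1"
  defines "q \<equiv> exp (-1) * \<tau>"
  shows "\<exists>G. (\<forall>v<n. G v \<in> sets (KM (Kn_edges n)) \<and> measure (KM (Kn_edges n)) (G v)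
      \<le> real k * (4 ^ n * exp (- q * (real n / (64 * real k))\<^sup>2)) + real k * exp (- q * (real n / 2))) \<and>
    (\<forall>\<omega>\<in>space (KM (Kn_edges n)). inj_on \<omega> (Kn_edges n) \<longrightarrow>
      rho n k (lst n \<omega> (2 * real k * \<tau>)) \<le> 1 + real (card {v. v < n \<and> \<omega> \<in> G v}))"
proof -
  let ?E = "Kn_edges n"
  \<comment> \<open>Then 8 k a = n / 8, so the core keeps at least n - 1 - n / 8 vertices, which is
    at least 3 n / 4 for n at least 8.\<close>
  define a where "a = real n / (64 * real k)"
  have a: "0 < a" "8 * real k * a \<le> real n / 8" using n k by (auto simp: a_def)
  have q0: "0 \<le> q" using \<tau> by (simp add: q_def)
  have slot: "q \<le> measure \<mu> {real i * \<tau><..real (Suc i) * \<tau>}" if i: "i < 2 * k" for i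
  proof -
    have "real (Suc i) * \<tau> \<le> 2 * real k * \<tau>" using i \<tau> by (intro mult_right_mono) auto
    then have "real (Suc i) * \<tau> \<le> 1" using \<tau> by linarith
    moreover have "real i * \<tau> \<le> real (Suc i) * \<tau>" using \<tau> by (intro mult_right_mono) auto
    ultimately have "exp (-1) * (real (Suc i) * \<tau> - real i * \<tau>) \<le> measure \<mu> {real i * \<tau><..real (Suc i) * \<tau>}"
      using \<tau> by (intro mu_slot) auto
    then show ?thesis by (simp add: q_def algebra_simps)
  qed
  obtain X where X: "X \<in> sets (KM ?E)" "measure (KM ?E) X \<le> real k * (4 ^ n * exp (- q * a\<^sup>2))"
    and Xex: "\<And>\<omega> i A B. \<omega> \<in> space (KM ?E) - X \<Longrightarrow> i < k \<Longrightarrow> A \<subseteq> {..<n} \<Longrightarrow> B \<subseteq> {..<n} \<Longrightarrow> A \<inter> B = {} \<Longrightarrow>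
      a \<le> real (card A) \<Longrightarrow> a \<le> real (card B) \<Longrightarrow>
      \<exists>x\<in>A. \<exists>y\<in>B. real i * \<tau> < \<omega> (ed x y) \<and> \<omega> (ed x y) \<le> real (Suc i) * \<tau>"
    using expander_event[OF q0 slot a(1), of k n] by (auto simp: less_imp_le)
  define core where "core v l B \<longleftrightarrow> B \<subseteq> {..<n} - {v} \<and> 3 * real n / 4 \<le> real (card B) \<and> (\<forall>u\<in>B. \<forall>w\<in>B. rl k l u w)" for v l B
  \<comment> \<open>The core is chosen as a function of \<open>v\<close> and of the list
    \<open>l\<close> alone; otherwise it would not be independent of the costs at
    \<open>v\<close>.\<close>
  define \<beta> where "\<beta> v l = (SOME B. core v l B)" for v l
  define LL where "LL v = {l. distinct l \<and> set l \<subseteq> away n v \<and> (\<exists>B. core v l B)}" for v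
  have \<beta>: "core v l (\<beta> v l)" if "l \<in> LL v" for v l
    unfolding \<beta>_def by (rule someI_ex) (use that in \<open>simp add: LL_def\<close>)
  have "\<exists>D\<in>sets (KM ?E). measure (KM ?E) D \<le> real k * exp (- q * (real n / 2)) \<and>
    (\<forall>\<omega>\<in>space (KM ?E) - D. \<forall>l\<in>LL v. sorted_wrt (\<lambda>x y. \<omega> x < \<omega> y) l \<longrightarrow> (\<forall>e\<in>away n v. \<omega> e \<le> real k * \<tau> \<longleftrightarrow> e \<in> set l) \<longrightarrow>
      (\<forall>i<k. \<exists>w\<in>\<beta> v l. real (k + i) * \<tau> < \<omega> (ed v w) \<and> \<omega> (ed v w) \<le> real (Suc (k + i)) * \<tau>))" if v: "v < n" for v
  proof (rule attach_event[OF v q0])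
    show "q \<le> measure \<mu> {real (k + i) * \<tau><..real (Suc (k + i)) * \<tau>}" if "i < k" for i using slot[of "k + i"] that by simp
    fix l assume l: "l \<in> LL v"
    show "distinct l \<and> set l \<subseteq> away n v \<and> \<beta> v l \<subseteq> {..<n} - {v} \<and> real n / 2 \<le> real (card (\<beta> v l))"
      using l \<beta>[OF l] by (auto simp: LL_def core_def)
  qed
  then obtain D where D: "\<And>v. v < n \<Longrightarrow> D v \<in> sets (KM ?E)" "\<And>v. v < n \<Longrightarrow> measure (KM ?E) (D v) \<le> real k * exp (- q * (real n / 2))"
    and Dex: "\<And>v \<omega> l i. v < n \<Longrightarrow> \<omega> \<in> space (KM ?E) - D v \<Longrightarrow> l \<in> LL v \<Longrightarrow> sorted_wrt (\<lambda>x y. \<omega> x < \<omega> y) l \<Longrightarrow>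
      (\<forall>e\<in>away n v. \<omega> e \<le> real k * \<tau> \<longleftrightarrow> e \<in> set l) \<Longrightarrow> i < k \<Longrightarrow>
      \<exists>w\<in>\<beta> v l. real (k + i) * \<tau> < \<omega> (ed v w) \<and> \<omega> (ed v w) \<le> real (Suc (k + i)) * \<tau>"
    by metis
  define G where "G v = X \<union> D v" for v
  have Gm: "G v \<in> sets (KM ?E) \<and> measure (KM ?E) (G v) \<le> real k * (4 ^ n * exp (- q * a\<^sup>2)) + real k * exp (- q * (real n / 2))"
    if "v < n" for v
    unfolding G_def using X D[OF that] measure_Un_le[OF X(1) D(1)[OF that]] by auto
  have "rho n k (lst n \<omega> (2 * real k * \<tau>)) \<le> 1 + real (card {v. v < n \<and> \<omega> \<in> G v})"
    if \<omega>: "\<omega> \<in> space (KM ?E)" "inj_on \<omega> ?E" for \<omega>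
    unfolding rho_def
  proof (rule Phi_ginv_le[OF equivp_rl])
    show "{v. v < n \<and> \<omega> \<in> G v} \<subseteq> {..<n}" by auto
    let ?L = "lst n \<omega> (2 * real k * \<tau>)"
    have attached: "\<exists>B. B \<subseteq> {..<n} \<and> 3 * real n / 4 \<le> real (card B) \<and> (\<forall>w\<in>B. rl k ?L u w)"
      if u: "u \<in> {..<n} - {v. v < n \<and> \<omega> \<in> G v}" for u
    proof -
      have un: "u < n" "\<omega> \<notin> X" "\<omega> \<notin> D u" using u by (auto simp: G_def)
      let ?F = "away n u"
      have FE: "?F \<subseteq> ?E" by (auto simp: away_def)
      have inj: "inj_on \<omega> ?F" using \<omega>(2) FE by (rule inj_on_subset)
      have fF: "finite ?F" using FE finite_Kn by (rule finite_subset)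
      define l where "l = filter (\<lambda>e. \<omega> e \<le> real k * \<tau>) (srt \<omega> ?F)"
      have "\<exists>B\<subseteq>{..<n} - {u}. real n - 1 - 8 * real k * a \<le> real (card B) \<and> (\<forall>u\<in>B. \<forall>w\<in>B. rl k l u w)"
        unfolding l_def
        by (rule core_chain[OF n a \<tau>(1) un(1) inj Xex order_refl]) (use \<omega> un in auto)
      then obtain B where B: "B \<subseteq> {..<n} - {u}" "real n - 1 - 8 * real k * a \<le> real (card B)" "\<forall>u\<in>B. \<forall>w\<in>B. rl k l u w" by blast
      have "core u l B" unfolding core_def using B a(2) n by auto
      then have lL: "l \<in> LL u"
        unfolding LL_def l_def using distinct_srt[OF fF inj] by (auto simp: srt_sorted(2)[OF fF inj])
      have sl: "sorted_wrt (\<lambda>x y. \<omega> x < \<omega> y) l"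
        unfolding l_def by (rule sorted_wrt_filter[OF srt_sorted(1)[OF fF inj]])
      have ml: "\<forall>e\<in>?F. \<omega> e \<le> real k * \<tau> \<longleftrightarrow> e \<in> set l"
        unfolding l_def by (simp add: srt_sorted(2)[OF fF inj])
      have c: "core u l (\<beta> u l)" by (rule \<beta>[OF lL])
      have ne: "\<beta> u l \<noteq> {}" using c n by (auto simp: core_def)
      have "\<forall>w\<in>\<beta> u l. rl k (lst n \<omega> (real (k + k) * \<tau>)) u w"
      proof (rule attach[OF \<omega>(2) \<tau>(1) un(1) _ ne _ _ order_refl])
        show "\<beta> u l \<subseteq> {..<n} - {u}" using c by (simp add: core_def)
        show "\<forall>ua\<in>\<beta> u l. \<forall>w\<in>\<beta> u l. rl k (filter (\<lambda>e. \<omega> e \<le> real k * \<tau>) (srt \<omega> (away n u))) ua w"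
          using c by (simp add: core_def l_def)
        show "\<exists>w\<in>\<beta> u l. real (k + i) * \<tau> < \<omega> (ed u w) \<and> \<omega> (ed u w) \<le> real (Suc (k + i)) * \<tau>" if "i < k" for i
          by (rule Dex[OF un(1) _ lL sl ml that]) (use \<omega> un in auto)
      qed
      moreover have "real (k + k) * \<tau> = 2 * real k * \<tau>" by simp
      ultimately show ?thesis using c unfolding core_def by (intro exI[of _ "\<beta> u l"]) auto
    qed
    fix u v assume "u \<in> {..<n} - {v. v < n \<and> \<omega> \<in> G v}" "v \<in> {..<n} - {v. v < n \<and> \<omega> \<in> G v}"
    then obtain B C where B: "B \<subseteq> {..<n}" "3 * real n / 4 \<le> real (card B)" "\<forall>w\<in>B. rl k ?L u w"
      and C: "C \<subseteq> {..<n}" "3 * real n / 4 \<le> real (card C)" "\<forall>w\<in>C. rl k ?L v w" using attached by meson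
    \<comment> \<open>Different vertices may use different cores, but each holds more than half of
      all vertices.\<close>
    have "B \<inter> C \<noteq> {}"
    proof
      assume "B \<inter> C = {}"
      then have "card (B \<union> C) = card B + card C" using B C by (intro card_Un_disjoint) (auto intro: finite_subset)
      moreover have "card (B \<union> C) \<le> card {..<n}" using B C by (intro card_mono) auto
      ultimately show False using B(2) C(2) n by simp
    qed
    then obtain w where "w \<in> B" "w \<in> C" by auto
    then have "rl k ?L u w" "rl k ?L v w" using B(3) C(3) by auto
    then show "rl k ?L u v" using equivp_symp[OF equivp_rl] equivp_transp[OF equivp_rl] by blast
  qed
  then show ?thesis using Gm unfolding a_def by (intro exI[of _ G]) auto
qed

end

section \<open>Summing the tail\<close>

text \<open>A version of \<open>whp\<close> with fixed error, needed because the cutoff of the tail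
  sum depends on that error.\<close>

definition whpd :: "(nat \<Rightarrow> 'a measure) \<Rightarrow> real \<Rightarrow> (nat \<Rightarrow> 'a \<Rightarrow> bool) \<Rightarrow> bool" where
  "whpd M \<delta> P \<longleftrightarrow> (\<forall>\<^sub>F n in sequentially. \<exists>A\<in>sets (M n).
     {\<omega>\<in>space (M n). \<not> P n \<omega>} \<subseteq> A \<and> measure (M n) A < \<delta>)"

lemma whp_whpd: "whp M P \<longleftrightarrow> (\<forall>\<delta>>0. whpd M \<delta> P)"
  by (simp add: whp_def whpd_def)

lemma whpd_mono:
  assumes "whpd M \<delta> P" "\<forall>\<^sub>F n in sequentially. \<forall>\<omega>\<in>space (M n). P n \<omega> \<longrightarrow> Q n \<omega>"
  shows "whpd M \<delta> Q"
  using assms unfolding whpd_def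
proof eventually_elim
  case (elim n)
  then obtain A where A: "A \<in> sets (M n)" "{\<omega>\<in>space (M n). \<not> P n \<omega>} \<subseteq> A" "measure (M n) A < \<delta>" by blast
  have "{\<omega>\<in>space (M n). \<not> Q n \<omega>} \<subseteq> A" using elim(2) A(2) by blast
  then show ?case using A by blast
qed

lemma whpd_conj:
  assumes "whpd M \<delta> P" "whpd M \<delta>' Q"
  shows "whpd M (\<delta> + \<delta>') (\<lambda>n \<omega>. P n \<omega> \<and> Q n \<omega>)"
  using assms unfolding whpd_def
proof eventually_elim
  case (elim n)
  then obtain A B where A: "A \<in> sets (M n)" "{\<omega>\<in>space (M n). \<not> P n \<omega>} \<subseteq> A" "measure (M n) A < \<delta>"
    and B: "B \<in> sets (M n)" "{\<omega>\<in>space (M n). \<not> Q n \<omega>} \<subseteq> B" "measure (M n) B < \<delta>'" by blast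
  have "measure (M n) (A \<union> B) \<le> measure (M n) A + measure (M n) B"
    by (rule measure_Un_le[OF A(1) B(1)])
  moreover have "{\<omega>\<in>space (M n). \<not> (P n \<omega> \<and> Q n \<omega>)} \<subseteq> A \<union> B" using A(2) B(2) by blast
  ultimately show ?case using A B by (intro bexI[of _ "A \<union> B"]) auto
qed

lemma whpd_transfer:
  assumes "whpd N \<delta> P" "\<And>n. T n \<in> measurable (M n) (N n)" "\<And>n. distr (M n) (N n) (T n) = N n"
  shows "whpd M \<delta> (\<lambda>n \<omega>. P n (T n \<omega>))"
  using assms(1) unfolding whpd_def
proof eventually_elim
  case (elim n)
  then obtain A where A: "A \<in> sets (N n)" "{\<omega>\<in>space (N n). \<not> P n \<omega>} \<subseteq> A" "measure (N n) A < \<delta>" by blast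
  let ?A = "T n -` A \<inter> space (M n)"
  have "?A \<in> sets (M n)" by (rule measurable_sets[OF assms(2) A(1)])
  moreover have "measure (M n) ?A = measure (N n) A"
    using measure_distr[OF assms(2) A(1)] unfolding assms(3) by simp
  moreover have "{\<omega>\<in>space (M n). \<not> P n (T n \<omega>)} \<subseteq> ?A"
    using A(2) measurable_space[OF assms(2)] by auto
  ultimately show ?case using A(3) by (intro bexI[of _ ?A]) auto
qed

lemma (in prob_space) markov_count:
  assumes J: "finite J" and A: "\<And>j. j \<in> J \<Longrightarrow> A j \<in> sets M" and c: "0 < c"
  shows "{\<omega>\<in>space M. c \<le> real (card {j \<in> J. \<omega> \<in> A j})} \<in> sets M"
    and "prob {\<omega>\<in>space M. c \<le> real (card {j \<in> J. \<omega> \<in> A j})} \<le> (\<Sum>j\<in>J. prob (A j)) / c"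
proof -
  define Y where "Y \<omega> = (\<Sum>j\<in>J. indicator (A j) \<omega> :: real)" for \<omega>
  have Y: "Y \<omega> = real (card {j \<in> J. \<omega> \<in> A j})" for \<omega>
  proof -
    have "Y \<omega> = (\<Sum>j\<in>J. if \<omega> \<in> A j then 1 else 0)" unfolding Y_def by (intro sum.cong) (auto simp: indicator_def)
    then show ?thesis using sum.inter_filter[OF J, of "\<lambda>_. 1::real" "\<lambda>j. \<omega> \<in> A j"] by simp
  qed
  have int: "integrable M (\<lambda>\<omega>. indicator (A j) \<omega> :: real)" if "j \<in> J" for j
    using A[OF that] by (simp add: emeasure_eq_measure)
  have iY: "integrable M Y" unfolding Y_def by (intro Bochner_Integration.integrable_sum int)
  have EY: "expectation Y = (\<Sum>j\<in>J. prob (A j))"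
  proof -
    have "expectation Y = (\<Sum>j\<in>J. expectation (indicator (A j)))"
      unfolding Y_def by (rule Bochner_Integration.integral_sum) (rule int)
    also have "\<dots> = (\<Sum>j\<in>J. prob (A j))"
      using A sets.sets_into_space by (intro sum.cong refl) (simp add: Int_absorb2)
    finally show ?thesis .
  qed
  have eq: "{\<omega>\<in>space M. c \<le> real (card {j \<in> J. \<omega> \<in> A j})} = {\<omega>\<in>space M. c \<le> Y \<omega>}" by (simp add: Y)
  have "Y \<in> borel_measurable M" using iY by (rule borel_measurable_integrable)
  then show "{\<omega>\<in>space M. c \<le> real (card {j \<in> J. \<omega> \<in> A j})} \<in> sets M"
    unfolding eq by (auto intro!: borel_measurable_le)
  show "prob {\<omega>\<in>space M. c \<le> real (card {j \<in> J. \<omega> \<in> A j})} \<le> (\<Sum>j\<in>J. prob (A j)) / c"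
    unfolding eq EY[symmetric]
    by (rule integral_Markov_inequality_measure[OF iY sets.top _ c]) (simp add: Y)
qed

text \<open>Chosen so that with windows of length t / (2 k n) the expander exponent equals 2
  \<open>tailc k\<close> t n. Once \<open>tailc k\<close> t is at least 2, one half of it absorbs
  the factor 4 ^ n and the other half leaves exp (- \<open>tailc k\<close> t).\<close>

definition tailc :: "nat \<Rightarrow> real" where
  "tailc k = exp (-1) / (4 * real k * (64 * real k)\<^sup>2)"

lemma tailc_pos: "1 \<le> k \<Longrightarrow> 0 < tailc k"
  by (simp add: tailc_def)

context cost_law
begin

lemma tail_bound:
  assumes n: "8 \<le> n" and k: "1 \<le> k" and t: "2 / tailc k \<le> t" "t \<le> real n"
  shows "\<exists>G. (\<forall>v<n. G v \<in> sets (KM (Kn_edges n)) \<and> measure (KM (Kn_edges n)) (G v) \<le> 2 * real k * exp (- tailc k * t)) \<and>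
    (\<forall>\<omega>\<in>space (KM (Kn_edges n)). inj_on \<omega> (Kn_edges n) \<longrightarrow>
      rho n k (lst n \<omega> (t / real n)) \<le> 1 + real (card {v. v < n \<and> \<omega> \<in> G v}))"
proof -
  define b where "b = tailc k"
  have b: "0 < b" using tailc_pos[OF k] by (simp add: b_def)
  have t0: "0 < t" using t(1) b by (simp add: b_def[symmetric]) (meson divide_pos_pos less_le_trans zero_less_numeral)
  have bt: "2 \<le> b * t" using t(1) b by (simp add: b_def[symmetric] divide_le_eq mult.commute)
  define \<tau> where "\<tau> = t / (2 * real k * real n)"
  have \<tau>: "0 < \<tau>" "2 * real k * \<tau> = t / real n" using t0 n k by (simp_all add: \<tau>_def)
  have \<tau>1: "2 * real k * \<tau> \<le> 1" unfolding \<tau>(2) using t n by (simp add: divide_le_eq)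
  define q where "q = exp (-1) * \<tau>"
  have q1: "q * (real n / (64 * real k))\<^sup>2 = 2 * b * t * real n"
    unfolding q_def \<tau>_def b_def tailc_def using n k by (simp add: field_simps power2_eq_square)
  have q2: "b * t \<le> q * (real n / 2)"
  proof -
    have e: "q * (real n / 2) = exp (-1) * t / (4 * real k)" unfolding q_def \<tau>_def using n k by (simp add: field_simps)
    have "1 \<le> (64 * real k)\<^sup>2" using k by (intro one_le_power) auto
    then have "4 * real k * 1 \<le> 4 * real k * (64 * real k)\<^sup>2" using k by (intro mult_left_mono) auto
    then have "b \<le> exp (-1) / (4 * real k)" unfolding b_def tailc_def using k by (intro divide_left_mono) auto
    then have "b * t \<le> exp (-1) / (4 * real k) * t" using t0 by (intro mult_right_mono) auto
    then show ?thesis unfolding e by simp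
  qed
  have bound: "real k * (4 ^ n * exp (- q * (real n / (64 * real k))\<^sup>2)) + real k * exp (- q * (real n / 2)) \<le> 2 * real k * exp (- tailc k * t)"
  proof -
    have "(4::real) \<le> exp 2"
    proof -
      have "(2::real) * 2 \<le> exp 1 * exp 1" using exp_ge_add_one_self[of 1] by (intro mult_mono) auto
      then show ?thesis by (simp add: exp_add[symmetric])
    qed
    then have "(4::real) ^ n \<le> exp 2 ^ n" by (intro power_mono) auto
    also have "\<dots> = exp (2 * real n)" by (simp add: exp_of_nat_mult[symmetric] mult.commute)
    finally have "4 ^ n * exp (- q * (real n / (64 * real k))\<^sup>2) \<le> exp (2 * real n) * exp (- q * (real n / (64 * real k))\<^sup>2)"
      by (intro mult_right_mono) auto
    also have "\<dots> = exp (2 * real n - 2 * b * t * real n)" using q1 by (simp add: exp_add[symmetric] exp_diff exp_minus field_simps)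
    also have "\<dots> \<le> exp (- b * t)"
    proof -
      have "2 * real n \<le> b * t * real n" using bt by (intro mult_right_mono) auto
      moreover have "b * t * 1 \<le> b * t * real n" using b t0 n by (intro mult_left_mono) auto
      ultimately show ?thesis by simp
    qed
    finally have x: "4 ^ n * exp (- q * (real n / (64 * real k))\<^sup>2) \<le> exp (- b * t)" .
    have y: "exp (- q * (real n / 2)) \<le> exp (- b * t)" using q2 by simp
    have "real k * (4 ^ n * exp (- q * (real n / (64 * real k))\<^sup>2)) + real k * exp (- q * (real n / 2)) \<le> real k * exp (- b * t) + real k * exp (- b * t)"
      using x y by (intro add_mono mult_left_mono) auto
    then show ?thesis by (simp add: b_def)
  qed
  obtain G where G: "\<forall>v<n. G v \<in> sets (KM (Kn_edges n)) \<and> measure (KM (Kn_edges n)) (G v)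
      \<le> real k * (4 ^ n * exp (- q * (real n / (64 * real k))\<^sup>2)) + real k * exp (- q * (real n / 2))"
    "\<forall>\<omega>\<in>space (KM (Kn_edges n)). inj_on \<omega> (Kn_edges n) \<longrightarrow>
      rho n k (lst n \<omega> (2 * real k * \<tau>)) \<le> 1 + real (card {v. v < n \<and> \<omega> \<in> G v})"
    using unattached_bound[OF n k \<tau>(1) \<tau>1] unfolding q_def[symmetric] by blast
  have "\<forall>v<n. G v \<in> sets (KM (Kn_edges n)) \<and> measure (KM (Kn_edges n)) (G v) \<le> 2 * real k * exp (- tailc k * t)"
    using G(1) bound by (meson order_trans)
  then show ?thesis using G(2) unfolding \<tau>(2) by blast
qed

text \<open>The tail bound at t = n / 2, that is, at cost 1 / 2, is exponentially small in n, so a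
  union bound over the vertices leaves none unattached.\<close>

lemma whp_connected:
  assumes k: "1 \<le> k"
  shows "whp (\<lambda>n. KM (Kn_edges n)) (\<lambda>n \<omega>. inj_on \<omega> (Kn_edges n) \<longrightarrow> rho n k (lst n \<omega> (1 / 2)) \<le> 1)"
  unfolding whp_def
proof (intro allI impI)
  fix \<delta> :: real assume \<delta>: "0 < \<delta>"
  define b where "b = tailc k"
  have b: "0 < b" using tailc_pos[OF k] by (simp add: b_def)
  have "(\<lambda>n. real n * exp (- b * (real n / 2))) \<longlonglongrightarrow> 0" using b by real_asymp
  from tendsto_mult_right_zero[OF this, of "2 * real k"]
  have "\<forall>\<^sub>F n in sequentially. 2 * real k * (real n * exp (- b * (real n / 2))) < \<delta>" using \<delta> by (intro order_tendstoD) auto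
  moreover have "filterlim (\<lambda>n. real n / 2) at_top sequentially" by real_asymp
  then have "\<forall>\<^sub>F n in sequentially. 2 / b \<le> real n / 2" unfolding filterlim_at_top by blast
  ultimately show "\<forall>\<^sub>F n in sequentially. \<exists>A\<in>sets (KM (Kn_edges n)).
    {\<omega> \<in> space (KM (Kn_edges n)). \<not> (inj_on \<omega> (Kn_edges n) \<longrightarrow> rho n k (lst n \<omega> (1 / 2)) \<le> 1)} \<subseteq> A \<and> measure (KM (Kn_edges n)) A < \<delta>"
    using eventually_ge_at_top[of 8]
  proof eventually_elim
    case (elim n)
    have h: "(real n / 2) / real n = 1 / 2" using elim(3) by simp
    obtain G where G: "\<And>v. v < n \<Longrightarrow> G v \<in> sets (KM (Kn_edges n))"
      "\<And>v. v < n \<Longrightarrow> measure (KM (Kn_edges n)) (G v) \<le> 2 * real k * exp (- b * (real n / 2))"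
      "\<And>\<omega>. \<omega> \<in> space (KM (Kn_edges n)) \<Longrightarrow> inj_on \<omega> (Kn_edges n) \<Longrightarrow>
        rho n k (lst n \<omega> (1 / 2)) \<le> 1 + real (card {v. v < n \<and> \<omega> \<in> G v})"
      using tail_bound[OF elim(3) k, of "real n / 2"] elim(2) unfolding b_def h by auto
    have "measure (KM (Kn_edges n)) (\<Union>v\<in>{..<n}. G v) \<le> real (card {..<n}) * (2 * real k * exp (- b * (real n / 2)))"
      using G by (intro measure_UN_le) auto
    then have "measure (KM (Kn_edges n)) (\<Union>v\<in>{..<n}. G v) < \<delta>" using elim(1) by (simp add: mult.left_commute)
    moreover have "{\<omega> \<in> space (KM (Kn_edges n)). \<not> (inj_on \<omega> (Kn_edges n) \<longrightarrow> rho n k (lst n \<omega> (1 / 2)) \<le> 1)} \<subseteq> (\<Union>v\<in>{..<n}. G v)"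
    proof
      fix \<omega> assume "\<omega> \<in> {\<omega> \<in> space (KM (Kn_edges n)). \<not> (inj_on \<omega> (Kn_edges n) \<longrightarrow> rho n k (lst n \<omega> (1 / 2)) \<le> 1)}"
      then have "\<omega> \<in> space (KM (Kn_edges n))" "inj_on \<omega> (Kn_edges n)" "1 < rho n k (lst n \<omega> (1 / 2))" by auto
      with G(3) have "0 < card {v. v < n \<and> \<omega> \<in> G v}" by fastforce
      then show "\<omega> \<in> (\<Union>v\<in>{..<n}. G v)" by (auto simp: card_gt_0_iff)
    qed
    moreover have "(\<Union>v\<in>{..<n}. G v) \<in> sets (KM (Kn_edges n))" using G(1) by auto
    ultimately show ?case by blast
  qed
qed

end

text \<open>The number of steps of length \<eta> / n that cover the costs up to 1 / 2.\<close>

definition grd :: "real \<Rightarrow> nat \<Rightarrow> nat" where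
  "grd \<eta> n = nat \<lceil>real n / (2 * \<eta>)\<rceil>"

lemma grd_less: "0 < \<eta> \<Longrightarrow> i < grd \<eta> n \<Longrightarrow> real i * \<eta> < real n / 2"
proof -
  assume \<eta>: "0 < \<eta>" and i: "i < grd \<eta> n"
  have "real i < real n / (2 * \<eta>)" using i unfolding grd_def by linarith
  then show ?thesis using \<eta> by (simp add: field_simps)
qed

lemma grd_ge: "0 < \<eta> \<Longrightarrow> real n / 2 \<le> real (grd \<eta> n) * \<eta>"
proof -
  assume \<eta>: "0 < \<eta>"
  have "real n / (2 * \<eta>) \<le> real (grd \<eta> n)" unfolding grd_def by linarith
  then show ?thesis using \<eta> by (simp add: field_simps)
qed

text \<open>Riemann sum for the integral of components minus one with mesh \<eta> / n.\<close>

definition gsum :: "real \<Rightarrow> nat \<Rightarrow> nat set \<Rightarrow> (real \<Rightarrow> real) \<Rightarrow> real" where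
  "gsum \<eta> n I f = (\<eta> / real n) * (\<Sum>i\<in>I. f (real i * \<eta> / real n) - 1)"

context cost_law
begin

text \<open>The tail sum is at most \<eta> / n times the number of pairs of a grid point and a
  vertex unattached there. Its mean is bounded by n times a geometric series starting at J, and the
  Markov inequality concludes.\<close>

lemma tail_sum:
  assumes k: "1 \<le> k" and \<eta>: "0 < \<eta>" and \<zeta>: "0 < \<zeta>" and J: "2 / tailc k \<le> real J * \<eta>"
    and \<delta>: "2 * real k * (exp (- tailc k * \<eta>) ^ J / (1 - exp (- tailc k * \<eta>))) * \<eta> / \<zeta> < \<delta>"
  shows "whpd (\<lambda>n. KM (Kn_edges n)) \<delta> (\<lambda>n \<omega>. inj_on \<omega> (Kn_edges n) \<longrightarrow>
    gsum \<eta> n {J..<grd \<eta> n} (\<lambda>s. rho n k (lst n \<omega> s)) \<le> \<zeta>)"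
  unfolding whpd_def using eventually_ge_at_top[of 8]
proof eventually_elim
  case (elim n)
  let ?M = "KM (Kn_edges n)"
  interpret P: prob_space ?M by (rule prob_KM)
  define b where "b = tailc k"
  define x where "x = exp (- b * \<eta>)"
  have b: "0 < b" using tailc_pos[OF k] by (simp add: b_def)
  have x: "0 < x" "x < 1" using b \<eta> by (auto simp: x_def)
  define I where "I = {J..<grd \<eta> n}"
  have "\<forall>i\<in>I. \<exists>G. (\<forall>v<n. G v \<in> sets ?M \<and> measure ?M (G v) \<le> 2 * real k * exp (- b * (real i * \<eta>))) \<and>
    (\<forall>\<omega>\<in>space ?M. inj_on \<omega> (Kn_edges n) \<longrightarrow> rho n k (lst n \<omega> (real i * \<eta> / real n)) \<le> 1 + real (card {v. v < n \<and> \<omega> \<in> G v}))"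
    unfolding b_def
  proof (intro ballI tail_bound[OF elim k])
    fix i assume i: "i \<in> I"
    have "real J * \<eta> \<le> real i * \<eta>" using i \<eta> by (intro mult_right_mono) (auto simp: I_def)
    then show "2 / tailc k \<le> real i * \<eta>" using J by linarith
    show "real i * \<eta> \<le> real n" using grd_less[OF \<eta>, of i n] i by (simp add: I_def)
  qed
  from bchoice[OF this] obtain G where G0: "\<forall>i\<in>I. (\<forall>v<n. G i v \<in> sets ?M \<and> measure ?M (G i v) \<le> 2 * real k * exp (- b * (real i * \<eta>))) \<and>
    (\<forall>\<omega>\<in>space ?M. inj_on \<omega> (Kn_edges n) \<longrightarrow> rho n k (lst n \<omega> (real i * \<eta> / real n)) \<le> 1 + real (card {v. v < n \<and> \<omega> \<in> G i v}))" ..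
  have G: "\<And>i v. i \<in> I \<Longrightarrow> v < n \<Longrightarrow> G i v \<in> sets ?M"
    "\<And>i v. i \<in> I \<Longrightarrow> v < n \<Longrightarrow> measure ?M (G i v) \<le> 2 * real k * exp (- b * (real i * \<eta>))"
    "\<And>i \<omega>. i \<in> I \<Longrightarrow> \<omega> \<in> space ?M \<Longrightarrow> inj_on \<omega> (Kn_edges n) \<Longrightarrow> rho n k (lst n \<omega> (real i * \<eta> / real n)) \<le> 1 + real (card {v. v < n \<and> \<omega> \<in> G i v})"
    using G0 by blast+
  define c where "c = \<zeta> * real n / \<eta>"
  have c: "0 < c" using \<zeta> \<eta> elim by (simp add: c_def)
  define A where "A = {\<omega>\<in>space ?M. c \<le> real (card {j \<in> I \<times> {..<n}. \<omega> \<in> (case j of (i, v) \<Rightarrow> G i v)})}"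
  have fin: "finite (I \<times> {..<n})" by (simp add: I_def)
  have Gs: "(case j of (i, v) \<Rightarrow> G i v) \<in> sets ?M" if "j \<in> I \<times> {..<n}" for j using that G(1) by auto
  have As: "A \<in> sets ?M" unfolding A_def by (rule P.markov_count(1)[OF fin Gs c])
  have gs: "(\<Sum>i\<in>I. x ^ i) \<le> x ^ J / (1 - x)"
  proof -
    have "(\<Sum>i\<in>I. x ^ i) = (\<Sum>i<grd \<eta> n - J. x ^ (i + J))"
      unfolding I_def by (rule sum.reindex_bij_witness[of _ "\<lambda>i. i + J" "\<lambda>i. i - J"]) auto
    also have "\<dots> = x ^ J * (\<Sum>i<grd \<eta> n - J. x ^ i)" by (simp add: power_add sum_distrib_left mult.commute)
    also have "\<dots> \<le> x ^ J * (1 / (1 - x))"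
    proof (rule mult_left_mono)
      have "(\<Sum>i<grd \<eta> n - J. x ^ i) \<le> suminf (\<lambda>i. x ^ i)"
        using x by (intro sum_le_suminf summable_geometric) auto
      then show "(\<Sum>i<grd \<eta> n - J. x ^ i) \<le> 1 / (1 - x)" using x by (simp add: suminf_geometric)
      show "0 \<le> x ^ J" using x by simp
    qed
    finally show ?thesis by simp
  qed
  have "(\<Sum>j\<in>I \<times> {..<n}. measure ?M (case j of (i, v) \<Rightarrow> G i v)) \<le> (\<Sum>(i, v)\<in>I \<times> {..<n}. 2 * real k * x ^ i)"
  proof (rule sum_mono)
    fix j assume "j \<in> I \<times> {..<n}"
    then obtain i v where iv: "j = (i, v)" "i \<in> I" "v \<in> {..<n}" by auto
    have "exp (- b * (real i * \<eta>)) = x ^ i" unfolding x_def exp_of_nat_mult[symmetric] by (simp add: mult_ac)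
    then show "measure ?M (case j of (i, v) \<Rightarrow> G i v) \<le> (case j of (i, v) \<Rightarrow> 2 * real k * x ^ i)" using G(2)[of i v] iv by simp
  qed
  also have "\<dots> = real n * (2 * real k) * (\<Sum>i\<in>I. x ^ i)"
    by (simp add: sum.cartesian_product[symmetric] sum_distrib_left mult_ac)
  also have "\<dots> \<le> real n * (2 * real k) * (x ^ J / (1 - x))"
    using gs by (rule mult_left_mono) simp
  finally have "(\<Sum>j\<in>I \<times> {..<n}. measure ?M (case j of (i, v) \<Rightarrow> G i v)) / c \<le> real n * (2 * real k) * (x ^ J / (1 - x)) / c"
    using c by (intro divide_right_mono) auto
  then have "measure ?M A \<le> real n * (2 * real k) * (x ^ J / (1 - x)) / c"
    using P.markov_count(2)[of "I \<times> {..<n}" "\<lambda>j. case j of (i, v) \<Rightarrow> G i v", OF fin Gs c] unfolding A_def by linarith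
  also have "\<dots> = 2 * real k * (x ^ J / (1 - x)) * \<eta> / \<zeta>"
  proof -
    have "real n * (2 * real k) * y / c = 2 * real k * y * \<eta> / \<zeta>" for y
      unfolding c_def using elim \<eta> \<zeta> by (simp add: field_simps)
    then show ?thesis .
  qed
  also have "\<dots> < \<delta>" using \<delta> by (simp add: x_def b_def)
  finally have Am: "measure ?M A < \<delta>" .
  have "{\<omega> \<in> space ?M. \<not> (inj_on \<omega> (Kn_edges n) \<longrightarrow> gsum \<eta> n {J..<grd \<eta> n} (\<lambda>s. rho n k (lst n \<omega> s)) \<le> \<zeta>)} \<subseteq> A"
  proof
    fix \<omega> assume "\<omega> \<in> {\<omega> \<in> space ?M. \<not> (inj_on \<omega> (Kn_edges n) \<longrightarrow> gsum \<eta> n {J..<grd \<eta> n} (\<lambda>s. rho n k (lst n \<omega> s)) \<le> \<zeta>)}"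
    then have \<omega>: "\<omega> \<in> space ?M" "inj_on \<omega> (Kn_edges n)" "\<zeta> < gsum \<eta> n I (\<lambda>s. rho n k (lst n \<omega> s))" by (auto simp: I_def)
    have "gsum \<eta> n I (\<lambda>s. rho n k (lst n \<omega> s)) \<le> (\<eta> / real n) * (\<Sum>i\<in>I. real (card {v. v < n \<and> \<omega> \<in> G i v}))"
      unfolding gsum_def using \<eta> G(3)[OF _ \<omega>(1,2)] by (intro mult_left_mono sum_mono) (auto simp: algebra_simps)
    also have "(\<Sum>i\<in>I. real (card {v. v < n \<and> \<omega> \<in> G i v})) = real (card {j \<in> I \<times> {..<n}. \<omega> \<in> (case j of (i, v) \<Rightarrow> G i v)})"
    proof -
      have "{j \<in> I \<times> {..<n}. \<omega> \<in> (case j of (i, v) \<Rightarrow> G i v)} = (SIGMA i:I. {v. v < n \<and> \<omega> \<in> G i v})" by auto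
      then show ?thesis by (simp add: I_def)
    qed
    finally have "\<zeta> < (\<eta> / real n) * real (card {j \<in> I \<times> {..<n}. \<omega> \<in> (case j of (i, v) \<Rightarrow> G i v)})" using \<omega>(3) by linarith
    then have "c \<le> real (card {j \<in> I \<times> {..<n}. \<omega> \<in> (case j of (i, v) \<Rightarrow> G i v)})"
      unfolding c_def using \<eta> elim by (simp add: field_simps)
    then show "\<omega> \<in> A" using \<omega>(1) by (simp add: A_def)
  qed
  then show ?case using As Am by blast
qed

end

subsection \<open>Existence of a common limit\<close>

text \<open>The approximating constant \<open>\<eta> * (\<Sum>i<J. rhol k (i * \<eta> / 2))\<close> depends on \<open>k\<close>, \<open>\<epsilon>\<close> and \<open>\<delta>\<close> only, not on the model.\<close>

lemma near_constant:
  fixes M :: "nat \<Rightarrow> 'a measure" and Ls :: "nat \<Rightarrow> 'a \<Rightarrow> real \<Rightarrow> (nat \<times> nat) list" and X :: "nat \<Rightarrow> 'a \<Rightarrow> ereal"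
  assumes prob: "\<And>n. prob_space (M n)"
    and \<epsilon>: "0 < \<epsilon>" and \<delta>: "0 < \<delta>" and \<eta>: "\<eta> = \<epsilon> / 4"
    and rho: "\<And>t \<epsilon>. 0 \<le> t \<Longrightarrow> 0 < \<epsilon> \<Longrightarrow> whp M (\<lambda>n \<omega>. \<bar>rho n k (Ls n \<omega> (t / real n)) - real n * rhol k (t / 2)\<bar> \<le> \<epsilon> * real n)"
    and tail: "whpd M (\<delta> / 2) (\<lambda>n \<omega>. gsum \<eta> n {J..<grd \<eta> n} (\<lambda>s. rho n k (Ls n \<omega> s)) \<le> \<epsilon> / 4)"
    and w: "whp M (\<lambda>n \<omega>. \<exists>w. X n \<omega> = ereal w \<and> w \<le> gsum \<eta> n {..<grd \<eta> n} (\<lambda>s. rho n k (Ls n \<omega> s)) \<and>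
      gsum \<eta> n {..<grd \<eta> n} (\<lambda>s. rho n k (Ls n \<omega> s)) \<le> w + \<eta>)"
  shows "whpd M \<delta> (\<lambda>n \<omega>. \<exists>w. X n \<omega> = ereal w \<and> \<bar>w - \<eta> * (\<Sum>i<J. rhol k (real i * \<eta> / 2))\<bar> \<le> \<epsilon>)"
proof -
  have \<eta>0: "0 < \<eta>" using \<epsilon> \<eta> by simp
  \<comment> \<open>The J grid points together contribute at most \<eta> J \<epsilon>', which is at
    most \<epsilon> / 8; the summands -1 of \<open>gsum\<close> cost another \<epsilon> / 8 for
    large n.\<close>
  define \<epsilon>' where "\<epsilon>' = \<epsilon> / (8 * \<eta> * (real J + 1))"
  have \<epsilon>': "0 < \<epsilon>'" using \<epsilon> \<eta>0 by (simp add: \<epsilon>'_def)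
  have "whp M (\<lambda>n \<omega>. \<forall>i\<in>{..<J}. \<bar>rho n k (Ls n \<omega> (real i * \<eta> / real n)) - real n * rhol k (real i * \<eta> / 2)\<bar> \<le> \<epsilon>' * real n)"
    using \<eta>0 by (intro whp_ball[OF prob] rho \<epsilon>') auto
  then have "whp M (\<lambda>n \<omega>. (\<forall>i\<in>{..<J}. \<bar>rho n k (Ls n \<omega> (real i * \<eta> / real n)) - real n * rhol k (real i * \<eta> / 2)\<bar> \<le> \<epsilon>' * real n) \<and>
     (\<exists>w. X n \<omega> = ereal w \<and> w \<le> gsum \<eta> n {..<grd \<eta> n} (\<lambda>s. rho n k (Ls n \<omega> s)) \<and>
      gsum \<eta> n {..<grd \<eta> n} (\<lambda>s. rho n k (Ls n \<omega> s)) \<le> w + \<eta>))"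
    by (rule whp_conj[OF prob _ w])
  then have "whpd M (\<delta> / 2) (\<lambda>n \<omega>. (\<forall>i\<in>{..<J}. \<bar>rho n k (Ls n \<omega> (real i * \<eta> / real n)) - real n * rhol k (real i * \<eta> / 2)\<bar> \<le> \<epsilon>' * real n) \<and>
     (\<exists>w. X n \<omega> = ereal w \<and> w \<le> gsum \<eta> n {..<grd \<eta> n} (\<lambda>s. rho n k (Ls n \<omega> s)) \<and>
      gsum \<eta> n {..<grd \<eta> n} (\<lambda>s. rho n k (Ls n \<omega> s)) \<le> w + \<eta>))"
    unfolding whp_whpd using \<delta> by simp
  from whpd_conj[OF this tail]
  have all: "whpd M \<delta> (\<lambda>n \<omega>. ((\<forall>i\<in>{..<J}. \<bar>rho n k (Ls n \<omega> (real i * \<eta> / real n)) - real n * rhol k (real i * \<eta> / 2)\<bar> \<le> \<epsilon>' * real n) \<and>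
     (\<exists>w. X n \<omega> = ereal w \<and> w \<le> gsum \<eta> n {..<grd \<eta> n} (\<lambda>s. rho n k (Ls n \<omega> s)) \<and>
      gsum \<eta> n {..<grd \<eta> n} (\<lambda>s. rho n k (Ls n \<omega> s)) \<le> w + \<eta>)) \<and>
      gsum \<eta> n {J..<grd \<eta> n} (\<lambda>s. rho n k (Ls n \<omega> s)) \<le> \<epsilon> / 4)" by simp
  have "filterlim (\<lambda>n. real n / (2 * \<eta>)) at_top sequentially" using \<eta>0 by real_asymp
  then have ev1: "\<forall>\<^sub>F n in sequentially. real J \<le> real n / (2 * \<eta>)" unfolding filterlim_at_top by blast
  have "(\<lambda>n. \<eta> * real J / real n) \<longlonglongrightarrow> 0" by (rule lim_const_over_n)
  then have ev2: "\<forall>\<^sub>F n in sequentially. \<eta> * real J / real n < \<epsilon> / 8" using \<epsilon> by (intro order_tendstoD) auto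
  show ?thesis
  proof (rule whpd_mono[OF all], use ev1 ev2 eventually_ge_at_top[of 1] in eventually_elim, intro ballI impI)
    fix n \<omega>
    assume 1: "real J \<le> real n / (2 * \<eta>)" and 2: "\<eta> * real J / real n < \<epsilon> / 8" and n: "1 \<le> n"
      and H: "((\<forall>i\<in>{..<J}. \<bar>rho n k (Ls n \<omega> (real i * \<eta> / real n)) - real n * rhol k (real i * \<eta> / 2)\<bar> \<le> \<epsilon>' * real n) \<and>
     (\<exists>w. X n \<omega> = ereal w \<and> w \<le> gsum \<eta> n {..<grd \<eta> n} (\<lambda>s. rho n k (Ls n \<omega> s)) \<and>
      gsum \<eta> n {..<grd \<eta> n} (\<lambda>s. rho n k (Ls n \<omega> s)) \<le> w + \<eta>)) \<and>
      gsum \<eta> n {J..<grd \<eta> n} (\<lambda>s. rho n k (Ls n \<omega> s)) \<le> \<epsilon> / 4"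
    define f where "f s = rho n k (Ls n \<omega> s)" for s
    obtain w where w: "X n \<omega> = ereal w" "w \<le> gsum \<eta> n {..<grd \<eta> n} f" "gsum \<eta> n {..<grd \<eta> n} f \<le> w + \<eta>"
      using H unfolding f_def by blast
    have fc: "\<bar>f (real i * \<eta> / real n) - real n * rhol k (real i * \<eta> / 2)\<bar> \<le> \<epsilon>' * real n" if "i < J" for i
      using H that unfolding f_def by simp
    have t1: "gsum \<eta> n {J..<grd \<eta> n} f \<le> \<epsilon> / 4" using H unfolding f_def by blast
    have t0: "0 \<le> gsum \<eta> n {J..<grd \<eta> n} f"
      unfolding gsum_def f_def rho_def using \<eta>0 n Phi_ginv_ge_1[OF equivp_rl]
      by (intro mult_nonneg_nonneg sum_nonneg) auto
    have "real J \<le> real (grd \<eta> n)" using 1 unfolding grd_def by linarith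
    then have U: "{..<grd \<eta> n} = {..<J} \<union> {J..<grd \<eta> n}" by auto
    have split: "gsum \<eta> n {..<grd \<eta> n} f = gsum \<eta> n {..<J} f + gsum \<eta> n {J..<grd \<eta> n} f"
      unfolding gsum_def U by (subst sum.union_disjoint) (auto simp: distrib_left)
    have "\<bar>gsum \<eta> n {..<J} f - \<eta> * (\<Sum>i<J. rhol k (real i * \<eta> / 2))\<bar> \<le> \<epsilon> / 4"
    proof -
      have "gsum \<eta> n {..<J} f - \<eta> * (\<Sum>i<J. rhol k (real i * \<eta> / 2))
        = (\<eta> / real n) * (\<Sum>i<J. f (real i * \<eta> / real n) - real n * rhol k (real i * \<eta> / 2)) - \<eta> * real J / real n"
        unfolding gsum_def sum_subtractf sum_distrib_left[symmetric] using n by (simp add: field_simps)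
      also have "\<bar>\<dots>\<bar> \<le> (\<eta> / real n) * (\<Sum>i<J. \<epsilon>' * real n) + \<eta> * real J / real n"
      proof -
        have "\<bar>\<Sum>i<J. f (real i * \<eta> / real n) - real n * rhol k (real i * \<eta> / 2)\<bar> \<le> (\<Sum>i<J. \<epsilon>' * real n)"
          using fc by (intro order_trans[OF sum_abs] sum_mono) auto
        then have "\<bar>(\<eta> / real n) * (\<Sum>i<J. f (real i * \<eta> / real n) - real n * rhol k (real i * \<eta> / 2))\<bar> \<le> (\<eta> / real n) * (\<Sum>i<J. \<epsilon>' * real n)"
          unfolding abs_mult using \<eta>0 n by (intro mult_mono) auto
        moreover have "0 \<le> \<eta> * real J / real n" using \<eta>0 by simp
        ultimately show ?thesis by linarith
      qed
      also have "(\<eta> / real n) * (\<Sum>i<J. \<epsilon>' * real n) = \<epsilon> / 8 * (real J / (real J + 1))"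
      proof -
        have "(\<eta> / real n) * (x * (\<epsilon> / (8 * \<eta> * D) * real n)) = \<epsilon> / 8 * (x / D)" if "0 < D" for x D :: real
          using that n \<eta>0 by (simp add: field_simps)
        from this[of "real J + 1" "real J"] show ?thesis unfolding \<epsilon>'_def by simp
      qed
      also have "\<dots> \<le> \<epsilon> / 8 * 1" using \<epsilon> by (intro mult_left_mono) auto
      finally show ?thesis using 2 by linarith
    qed
    \<comment> \<open>Error budget: \<epsilon> / 4 each for the bulk of the sum, its tail, and the
      discretization error \<eta>.\<close>
    moreover have "\<bar>w - z\<bar> \<le> \<epsilon>" if "\<bar>a - z\<bar> \<le> \<epsilon> / 4" "w \<le> a + b" "a + b \<le> w + \<eta>" "0 \<le> b" "b \<le> \<epsilon> / 4" for a b z :: real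
      using that \<epsilon> \<eta> by linarith
    ultimately have "\<bar>w - \<eta> * (\<Sum>i<J. rhol k (real i * \<eta> / 2))\<bar> \<le> \<epsilon>"
      using w(2,3) t0 t1 unfolding split by blast
    then show "\<exists>w. X n \<omega> = ereal w \<and> \<bar>w - \<eta> * (\<Sum>i<J. rhol k (real i * \<eta> / 2))\<bar> \<le> \<epsilon>" using w(1) by blast
  qed
qed

text \<open>A covering set of measure below 1 misses some outcome; this turns probable statements
  about constants into true ones.\<close>

lemma whpd_satisfiable:
  assumes "\<And>n. prob_space (M n)" "whpd M \<delta> P" "\<delta> \<le> 1"
  shows "\<exists>n \<omega>. P n \<omega>"
proof -
  obtain n A where A: "A \<in> sets (M n)" "{\<omega>\<in>space (M n). \<not> P n \<omega>} \<subseteq> A" "measure (M n) A < \<delta>"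
    using assms(2) unfolding whpd_def eventually_sequentially by blast
  interpret prob_space "M n" by (rule assms)
  have "A \<noteq> space (M n)" using A(3) assms(3) prob_space by auto
  then obtain \<omega> where "\<omega> \<in> space (M n)" "\<omega> \<notin> A" using sets.sets_into_space[OF A(1)] by auto
  then show ?thesis using A(2) by blast
qed

text \<open>Two approximating constants are both close to the value of \<open>X\<close> at one
  common outcome, hence close to each other. This makes them Cauchy, and the limit serves
  \<open>N\<close> as well because both models use the same constants.\<close>

lemma common_limit:
  fixes X :: "nat \<Rightarrow> 'a \<Rightarrow> ereal" and Y :: "nat \<Rightarrow> 'b \<Rightarrow> ereal"
  assumes prob: "\<And>n. prob_space (M n)"
    and near: "\<And>\<epsilon> \<delta>. 0 < \<epsilon> \<Longrightarrow> 0 < \<delta> \<Longrightarrow> \<exists>G. whpd M \<delta> (\<lambda>n \<omega>. \<exists>w. X n \<omega> = ereal w \<and> \<bar>w - G\<bar> \<le> \<epsilon>)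
       \<and> whpd N \<delta> (\<lambda>n \<omega>. \<exists>w. Y n \<omega> = ereal w \<and> \<bar>w - G\<bar> \<le> \<epsilon>)"
  shows "\<exists>\<gamma>. conv_in_prob M X \<gamma> \<and> conv_in_prob N Y \<gamma>"
proof -
  have "\<forall>\<epsilon> \<delta>. \<exists>G. 0 < \<epsilon> \<longrightarrow> 0 < \<delta> \<longrightarrow> whpd M \<delta> (\<lambda>n \<omega>. \<exists>w. X n \<omega> = ereal w \<and> \<bar>w - G\<bar> \<le> \<epsilon>)
       \<and> whpd N \<delta> (\<lambda>n \<omega>. \<exists>w. Y n \<omega> = ereal w \<and> \<bar>w - G\<bar> \<le> \<epsilon>)" using near by blast
  then have "\<exists>G. \<forall>\<epsilon> \<delta>. 0 < \<epsilon> \<longrightarrow> 0 < \<delta> \<longrightarrow> whpd M \<delta> (\<lambda>n \<omega>. \<exists>w. X n \<omega> = ereal w \<and> \<bar>w - G \<epsilon> \<delta>\<bar> \<le> \<epsilon>)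
       \<and> whpd N \<delta> (\<lambda>n \<omega>. \<exists>w. Y n \<omega> = ereal w \<and> \<bar>w - G \<epsilon> \<delta>\<bar> \<le> \<epsilon>)" unfolding choice_iff .
  then obtain G where G0: "\<forall>\<epsilon> \<delta>. 0 < \<epsilon> \<longrightarrow> 0 < \<delta> \<longrightarrow> whpd M \<delta> (\<lambda>n \<omega>. \<exists>w. X n \<omega> = ereal w \<and> \<bar>w - G \<epsilon> \<delta>\<bar> \<le> \<epsilon>)
       \<and> whpd N \<delta> (\<lambda>n \<omega>. \<exists>w. Y n \<omega> = ereal w \<and> \<bar>w - G \<epsilon> \<delta>\<bar> \<le> \<epsilon>)" ..
  have G: "whpd M \<delta> (\<lambda>n \<omega>. \<exists>w. X n \<omega> = ereal w \<and> \<bar>w - G \<epsilon> \<delta>\<bar> \<le> \<epsilon>)"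
    "whpd N \<delta> (\<lambda>n \<omega>. \<exists>w. Y n \<omega> = ereal w \<and> \<bar>w - G \<epsilon> \<delta>\<bar> \<le> \<epsilon>)" if "0 < \<epsilon>" "0 < \<delta>" for \<epsilon> \<delta>
    using G0 that by auto
  have close: "\<bar>G \<epsilon> \<delta> - G \<epsilon>' \<delta>'\<bar> \<le> \<epsilon> + \<epsilon>'" if h: "0 < \<epsilon>" "0 < \<epsilon>'" "0 < \<delta>" "0 < \<delta>'" "\<delta> + \<delta>' \<le> 1" for \<epsilon> \<epsilon>' \<delta> \<delta>'
  proof -
    obtain n \<omega> where "(\<exists>w. X n \<omega> = ereal w \<and> \<bar>w - G \<epsilon> \<delta>\<bar> \<le> \<epsilon>) \<and> (\<exists>w. X n \<omega> = ereal w \<and> \<bar>w - G \<epsilon>' \<delta>'\<bar> \<le> \<epsilon>')"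
      using whpd_satisfiable[OF prob whpd_conj[OF G(1)[OF h(1,3)] G(1)[OF h(2,4)]] h(5)] by blast
    then obtain w where "\<bar>w - G \<epsilon> \<delta>\<bar> \<le> \<epsilon>" "\<bar>w - G \<epsilon>' \<delta>'\<bar> \<le> \<epsilon>'" by auto
    then show ?thesis by linarith
  qed
  \<comment> \<open>With the error fixed at 1 / 2, any two exceptional sets have total measure below
    1, as \<open>whpd_satisfiable\<close> requires.\<close>
  define g where "g r = G (1 / (real r + 1)) (1 / 2)" for r :: nat
  have inv0: "(\<lambda>r. 1 / (real r + 1)) \<longlonglongrightarrow> 0" by real_asymp
  have "Cauchy g"
  proof (rule metric_CauchyI)
    fix e :: real assume e: "0 < e"
    then obtain R where R: "\<And>r. r \<ge> R \<Longrightarrow> 1 / (real r + 1) < e / 2"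
      using order_tendstoD(2)[OF inv0, of "e / 2"] unfolding eventually_sequentially by auto
    show "\<exists>R. \<forall>m\<ge>R. \<forall>n\<ge>R. dist (g m) (g n) < e"
    proof (intro exI[of _ R] allI impI)
      fix m n assume "R \<le> m" "R \<le> n"
      then show "dist (g m) (g n) < e"
        using R[of m] R[of n] close[of "1 / (real m + 1)" "1 / (real n + 1)" "1 / 2" "1 / 2"]
        unfolding g_def dist_real_def by simp
    qed
  qed
  then obtain \<gamma> where \<gamma>: "g \<longlonglongrightarrow> \<gamma>" using Cauchy_convergent convergent_def by blast
  have G\<gamma>: "\<bar>G \<epsilon> \<delta> - \<gamma>\<bar> \<le> \<epsilon>" if "0 < \<epsilon>" "0 < \<delta>" "\<delta> \<le> 1 / 2" for \<epsilon> \<delta>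
  proof (rule tendsto_le[OF sequentially_bot])
    show "(\<lambda>r. \<epsilon> + 1 / (real r + 1)) \<longlonglongrightarrow> \<epsilon>" using tendsto_add[OF tendsto_const inv0, of \<epsilon>] by simp
    show "(\<lambda>r. \<bar>G \<epsilon> \<delta> - g r\<bar>) \<longlonglongrightarrow> \<bar>G \<epsilon> \<delta> - \<gamma>\<bar>" by (intro tendsto_intros \<gamma>)
    show "\<forall>\<^sub>F r in sequentially. \<bar>G \<epsilon> \<delta> - g r\<bar> \<le> \<epsilon> + 1 / (real r + 1)"
      unfolding g_def using that by (intro always_eventually allI close) auto
  qed
  have conv: "conv_in_prob M' Z \<gamma>"
    if "\<And>\<epsilon> \<delta>. 0 < \<epsilon> \<Longrightarrow> 0 < \<delta> \<Longrightarrow> whpd M' \<delta> (\<lambda>n \<omega>. \<exists>w. Z n \<omega> = ereal w \<and> \<bar>w - G \<epsilon> \<delta>\<bar> \<le> \<epsilon>)"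
    for M' :: "nat \<Rightarrow> 'c measure" and Z
    unfolding conv_in_prob_def
  proof (intro allI impI)
    fix \<epsilon> \<delta> :: real assume \<epsilon>: "0 < \<epsilon>" and \<delta>: "0 < \<delta>"
    \<comment> \<open>Capped at 1 / 2 so that the constant can be compared with the sequence
      \<open>g\<close>.\<close>
    define d where "d = min \<delta> (1 / 2)"
    have d: "0 < d" "d \<le> 1 / 2" "d \<le> \<delta>" using \<delta> by (auto simp: d_def)
    have "\<bar>G (\<epsilon> / 2) d - \<gamma>\<bar> \<le> \<epsilon> / 2" using \<epsilon> d by (intro G\<gamma>) auto
    then have "\<bar>w - \<gamma>\<bar> \<le> \<epsilon>" if "\<bar>w - G (\<epsilon> / 2) d\<bar> \<le> \<epsilon> / 2" for w using that by linarith
    then have near: "\<bar>ereal w - ereal \<gamma>\<bar> \<le> ereal \<epsilon>" if "\<bar>w - G (\<epsilon> / 2) d\<bar> \<le> \<epsilon> / 2" for w using that by simp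
    have "whpd M' d (\<lambda>n \<omega>. \<exists>w. Z n \<omega> = ereal w \<and> \<bar>w - G (\<epsilon> / 2) d\<bar> \<le> \<epsilon> / 2)"
      using \<epsilon> d(1) by (intro that) simp_all
    then have "whpd M' d (\<lambda>n \<omega>. \<bar>Z n \<omega> - ereal \<gamma>\<bar> \<le> ereal \<epsilon>)"
    proof (rule whpd_mono, intro always_eventually allI ballI impI)
      fix n \<omega> assume "\<exists>w. Z n \<omega> = ereal w \<and> \<bar>w - G (\<epsilon> / 2) d\<bar> \<le> \<epsilon> / 2"
      then obtain w where w: "Z n \<omega> = ereal w" "\<bar>w - G (\<epsilon> / 2) d\<bar> \<le> \<epsilon> / 2" by (elim exE conjE)
      show "\<bar>Z n \<omega> - ereal \<gamma>\<bar> \<le> ereal \<epsilon>" unfolding w(1) by (rule near[OF w(2)])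
    qed
    then show "\<forall>\<^sub>F n in sequentially. \<exists>A\<in>sets (M' n). {\<omega> \<in> space (M' n). \<not> \<bar>Z n \<omega> - ereal \<gamma>\<bar> \<le> ereal \<epsilon>} \<subseteq> A \<and> measure (M' n) A < \<delta>"
      unfolding whpd_def
    proof (rule eventually_mono, elim bexE)
      fix n A assume A: "A \<in> sets (M' n)" "{\<omega> \<in> space (M' n). \<not> \<bar>Z n \<omega> - ereal \<gamma>\<bar> \<le> ereal \<epsilon>} \<subseteq> A \<and> measure (M' n) A < d"
      then show "\<exists>A\<in>sets (M' n). {\<omega> \<in> space (M' n). \<not> \<bar>Z n \<omega> - ereal \<gamma>\<bar> \<le> ereal \<epsilon>} \<subseteq> A \<and> measure (M' n) A < \<delta>"
        by (intro bexI[OF _ A(1)]) (metis d(3) less_le_trans)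
    qed
  qed
  have "conv_in_prob M X \<gamma>" by (rule conv) (rule G(1))
  moreover have "conv_in_prob N Y \<gamma>" by (rule conv) (rule G(2))
  ultimately show ?thesis by blast
qed

subsection \<open>The complete graph\<close>

lemma cost_law_uniform: "cost_law (uniform_measure lborel {0<..<1::real})" (is "cost_law ?U")
proof -
  interpret prob_space ?U by (intro prob_space_uniform_measure) auto
  have m: "measure ?U B = measure lborel ({0<..<1} \<inter> B)" if "B \<in> sets borel" for B
    using that by (subst measure_uniform_measure) auto
  have iv: "measure ?U {x<..y} = y - x" if "0 \<le> x" "x \<le> y" "y \<le> 1" for x y
  proof (cases "y = 1")
    case True
    then have "{0<..<1} \<inter> {x<..y} = {x<..<1}" using that by auto
    then show ?thesis using that True by (simp add: m)
  next
    case False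
    then have "{0<..<1} \<inter> {x<..y} = {x<..y}" using that by auto
    then show ?thesis using that by (simp add: m)
  qed
  show ?thesis
  proof (unfold_locales)
    show "sets ?U = sets borel" by simp
    show "measure ?U {x} = 0" for x
    proof (cases "x \<in> {0<..<1}")
      case True
      then have "{0<..<1} \<inter> {x} = {x}" by auto
      then show ?thesis by (simp add: m measure_def)
    qed (simp add: m)
    have "{0<..<1} \<inter> {..0::real} = {}" by auto
    then show "measure ?U {..0} = 0" by (simp add: m)
    show "measure ?U {0<..y} \<le> y" if "0 \<le> y" for y
      using iv[of 0 y] that prob_le_1[of "{0<..y}"] by (cases "y \<le> 1") auto
    show "y - y\<^sup>2 \<le> measure ?U {0<..y}" if "0 \<le> y" "y \<le> 1" for y
      using iv[of 0 y] that by simp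
    show "exp (-1) * (y - x) \<le> measure ?U {x<..y}" if "0 \<le> x" "x \<le> y" "y \<le> 1" for x y
      using iv[OF that] that mult_right_mono[of "exp (-1)" 1 "y - x"] by simp
  qed
qed

lemma cost_law_exponential: "cost_law (density lborel (exponential_density 1))" (is "cost_law ?E")
proof -
  interpret prob_space ?E by (rule prob_space_exponential_density) simp
  have cdf: "measure ?E {..a} = 1 - exp (- a)" if "0 \<le> a" for a
    using emeasure_erlang_density[of 1 0 a] that
    by (simp add: measure_def erlang_CDF_0)
  have iv: "measure ?E {x<..y} = exp (- x) - exp (- y)" if "0 \<le> x" "x \<le> y" for x y
  proof -
    have "{x<..y} = {..y} - {..x}" by auto
    then have "measure ?E {x<..y} = measure ?E {..y} - measure ?E {..x}"
      using that by (simp add: finite_measure_Diff)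
    then show ?thesis using cdf that by simp
  qed
  show ?thesis
  proof (unfold_locales)
    show "sets ?E = sets borel" by simp
    have "null_sets lborel \<subseteq> null_sets ?E"
      using absolutely_continuousI_density[of "\<lambda>x. ennreal (exponential_density 1 x)" lborel]
      unfolding absolutely_continuous_def by simp
    moreover have "{x} \<in> null_sets lborel" for x :: real by (simp add: null_sets_def)
    ultimately show "measure ?E {x} = 0" for x
      by (intro measure_eq_0_null_sets) blast
    show "measure ?E {..0} = 0" using cdf[of 0] by simp
    show "measure ?E {0<..y} \<le> y" if "0 \<le> y" for y
      using iv[of 0 y] that exp_ge_add_one_self[of "- y"] by simp
    show "y - y\<^sup>2 \<le> measure ?E {0<..y}" if y: "0 \<le> y" "y \<le> 1" for y
    proof -
      have "exp (- y) * (1 + y) \<le> exp (- y) * exp y"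
        using exp_ge_add_one_self[of y] by (intro mult_left_mono) auto
      also have "\<dots> = 1" by (simp add: exp_add[symmetric])
      \<comment> \<open>Since 1 + y ^ 3 is divisible by 1 + y, this yields the quadratic upper bound
        for exp (- y).\<close>
      also have "\<dots> \<le> 1 + y ^ 3" using y by simp
      also have "\<dots> = (1 - y + y\<^sup>2) * (1 + y)" by (simp add: algebra_simps power2_eq_square power3_eq_cube)
      finally have "exp (- y) \<le> 1 - y + y\<^sup>2" by (rule mult_right_le_imp_le) (use y in linarith)
      then show ?thesis using iv[of 0 y] y by simp
    qed
    show "exp (-1) * (y - x) \<le> measure ?E {x<..y}" if y: "0 \<le> x" "x \<le> y" "y \<le> 1" for x y
    proof -
      have "y - x \<le> exp (y - x) - 1" using exp_ge_add_one_self[of "y - x"] by linarith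
      \<comment> \<open>Here y at most 1 gives exp (-1) at most exp (- y).\<close>
      then have "exp (-1) * (y - x) \<le> exp (- y) * (exp (y - x) - 1)"
        using y by (intro mult_mono) simp_all
      also have "\<dots> = exp (- x) - exp (- y)" by (simp add: algebra_simps exp_add[symmetric])
      finally show ?thesis using iv y by simp
    qed
  qed
qed

lemma ex_cutoff:
  assumes k: "1 \<le> k" and \<eta>: "0 < \<eta>" and \<zeta>: "0 < \<zeta>" and \<delta>: "0 < \<delta>"
  shows "\<exists>J. 2 / tailc k \<le> real J * \<eta> \<and>
    2 * real k * (exp (- tailc k * \<eta>) ^ J / (1 - exp (- tailc k * \<eta>))) * \<eta> / \<zeta> < \<delta>"
proof -
  define x where "x = exp (- tailc k * \<eta>)"
  have x: "0 < x" "x < 1" using tailc_pos[OF k] \<eta> by (auto simp: x_def)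
  have "(\<lambda>J. x ^ J) \<longlonglongrightarrow> 0" using x by (intro LIMSEQ_realpow_zero) auto
  from tendsto_mult_right_zero[OF this, of "2 * real k / (1 - x) * \<eta> / \<zeta>"]
  have "\<forall>\<^sub>F J in sequentially. 2 * real k / (1 - x) * \<eta> / \<zeta> * x ^ J < \<delta>" using \<delta> by (intro order_tendstoD) auto
  moreover have "filterlim (\<lambda>J. real J * \<eta>) at_top sequentially" using \<eta> by real_asymp
  then have "\<forall>\<^sub>F J in sequentially. 2 / tailc k \<le> real J * \<eta>" unfolding filterlim_at_top by blast
  ultimately have "\<forall>\<^sub>F J in sequentially. 2 / tailc k \<le> real J * \<eta> \<and> 2 * real k * (x ^ J / (1 - x)) * \<eta> / \<zeta> < \<delta>"
    by eventually_elim (simp add: mult_ac)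
  then show ?thesis unfolding x_def by (rule eventually_happens'[OF sequentially_bot])
qed

lemma gsum_mono: "0 < \<eta> \<Longrightarrow> (\<And>i. i \<in> I \<Longrightarrow> f (real i * \<eta> / real n) \<le> g (real i * \<eta> / real n)) \<Longrightarrow> gsum \<eta> n I f \<le> gsum \<eta> n I g"
  unfolding gsum_def by (intro mult_left_mono sum_mono) auto

lemma grd_half:
  assumes "0 < \<eta>" "0 < n" "i < grd \<eta> n"
  shows "real i * \<eta> / real n \<le> 1 / 2"
  using grd_less[OF assms(1,3)] assms(2) by (simp add: field_simps)

text \<open>With mesh \<eta> / n the discretization error \<open>h * real n\<close> of
  \<open>wT_riemann\<close> becomes \<eta>. Costs up to 1 / 2 suffice because the graph of level k
  is connected by then.\<close>

lemma wT_gsum: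
  assumes n: "0 < n" and k: "1 \<le> k" and \<eta>: "0 < \<eta>"
    and g: "\<forall>e\<in>A. good n en e" and l: "enum c (1 / 2) A l" and pos: "\<And>e. e \<in> A \<Longrightarrow> 0 < c e"
    and r: "Phi n ginv (rel en k l) \<le> 1"
    and f: "\<And>s. s \<le> 1 / 2 \<Longrightarrow> f s = Phi n ginv (rel en k (filter (\<lambda>e. c e \<le> s) l))"
  shows "\<exists>w. wT n en c A k = ereal w \<and> w \<le> gsum \<eta> n {..<grd \<eta> n} f \<and> gsum \<eta> n {..<grd \<eta> n} f \<le> w + \<eta>"
proof -
  have r1: "Phi n ginv (rel en k l) = 1" using r Phi_ginv_ge_1[OF equivp_rel n, of en k l] by linarith
  have h: "0 < \<eta> / real n" using n \<eta> by simp
  have I: "1 / 2 \<le> real (grd \<eta> n) * (\<eta> / real n)" using grd_ge[OF \<eta>, of n] n by (simp add: field_simps)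
  have S: "(\<eta> / real n) * (\<Sum>i<grd \<eta> n. Phi n ginv (rel en k (filter (\<lambda>e. c e \<le> real i * (\<eta> / real n)) l)) - 1) = gsum \<eta> n {..<grd \<eta> n} f"
    unfolding gsum_def using f grd_half[OF \<eta> n] by (intro arg_cong2[where f = "(*)"] sum.cong refl) simp
  show ?thesis using wT_riemann[OF n g l k r1 pos h I] n unfolding S by simp
qed

lemma whp_null:
  assumes "\<And>n. {\<omega>\<in>space (M n). \<not> P n \<omega>} \<in> null_sets (M n)"
  shows "whp M P"
proof (rule whpI[where A = "\<lambda>n. {\<omega>\<in>space (M n). \<not> P n \<omega>}" and b = "\<lambda>_. 0"])
  show "\<forall>\<^sub>F n in sequentially. {\<omega>\<in>space (M n). \<not> P n \<omega>} \<in> sets (M n) \<and>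
    {\<omega>\<in>space (M n). \<not> P n \<omega>} \<subseteq> {\<omega>\<in>space (M n). \<not> P n \<omega>} \<and> measure (M n) {\<omega>\<in>space (M n). \<not> P n \<omega>} \<le> 0"
    using assms by (intro always_eventually allI) (simp add: null_sets_def measure_def)
qed simp

lemma Phi_ginv_antimono:
  assumes "equivp R" "\<And>u v. R u v \<Longrightarrow> R' u v"
  shows "Phi n ginv R' \<le> Phi n ginv R"
  unfolding Phi_def
proof (rule sum_mono)
  fix u assume "u \<in> {..<n}"
  then have "0 < csz n R u" unfolding csz_def using equivp_reflp[OF assms(1)] by (auto simp: card_gt_0_iff)
  moreover have "csz n R u \<le> csz n R' u" by (rule csz_mono) (rule assms(2))
  ultimately show "ginv (csz n R' u) \<le> ginv (csz n R u)" unfolding ginv_def by (intro divide_left_mono) auto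
qed

lemma rho_subseq:
  assumes "subseq l l'" "set l' \<subseteq> Kn_edges n"
  shows "rho n k l' \<le> rho n k l" "rho n k l - rho n k l' \<le> real (length l') - real (length l)"
proof -
  show "rho n k l' \<le> rho n k l" unfolding rho_def
    by (rule Phi_ginv_antimono[OF equivp_rl]) (rule rl_subseq[OF assms])
  have "\<forall>e\<in>set l'. good n Kn_ends e" using assms(2) good_Kn by blast
  from Phi_subseq[OF mbound_ginv assms(1) this, of k]
  show "rho n k l - rho n k l' \<le> real (length l') - real (length l)"
    unfolding rho_def rl_def by (metis abs_le_D2 minus_diff_eq mult_1)
qed

lemma lst_filter: "s \<le> s' \<Longrightarrow> lst n \<omega> s = filter (\<lambda>e. \<omega> e \<le> s) (lst n \<omega> s')"
  unfolding lst_def by (auto simp: conj_commute intro!: filter_cong)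

lemma enum_lst: "inj_on \<omega> (Kn_edges n) \<Longrightarrow> enum \<omega> s (Kn_edges n) (lst n \<omega> s)"
  unfolding enum_def lst_def
  using srt_sorted[OF finite_Kn, of \<omega> n] sorted_wrt_filter by fastforce

context cost_law
begin

lemma whpd_tail:
  assumes k: "1 \<le> k" and \<eta>: "0 < \<eta>" and \<zeta>: "0 < \<zeta>" and \<delta>: "0 < \<delta>" and J: "2 / tailc k \<le> real J * \<eta>"
    "2 * real k * (exp (- tailc k * \<eta>) ^ J / (1 - exp (- tailc k * \<eta>))) * \<eta> / \<zeta> < \<delta> / 2"
  shows "whpd (\<lambda>n. KM (Kn_edges n)) \<delta> (\<lambda>n \<omega>. gsum \<eta> n {J..<grd \<eta> n} (\<lambda>s. rho n k (lst n \<omega> s)) \<le> \<zeta>)"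
proof -
  have "whpd (\<lambda>n. KM (Kn_edges n)) (\<delta> / 2) (\<lambda>n \<omega>. inj_on \<omega> (Kn_edges n))"
    using whp_inj \<delta> unfolding whp_whpd by simp
  from whpd_conj[OF this tail_sum[OF k \<eta> \<zeta> J]]
  have "whpd (\<lambda>n. KM (Kn_edges n)) \<delta> (\<lambda>n \<omega>. inj_on \<omega> (Kn_edges n) \<and> (inj_on \<omega> (Kn_edges n) \<longrightarrow>
    gsum \<eta> n {J..<grd \<eta> n} (\<lambda>s. rho n k (lst n \<omega> s)) \<le> \<zeta>))" by simp
  then show ?thesis by (rule whpd_mono) simp
qed

lemma near_Kn:
  assumes k: "1 \<le> k" and \<epsilon>: "0 < \<epsilon>" and \<delta>: "0 < \<delta>" and \<eta>: "\<eta> = \<epsilon> / 4" and J: "2 / tailc k \<le> real J * \<eta>"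
    "2 * real k * (exp (- tailc k * \<eta>) ^ J / (1 - exp (- tailc k * \<eta>))) * \<eta> / (\<epsilon> / 4) < \<delta> / 2 / 2"
  shows "whpd (\<lambda>n. KM (Kn_edges n)) \<delta> (\<lambda>n \<omega>. \<exists>w. wT n Kn_ends \<omega> (Kn_edges n) k = ereal w \<and>
    \<bar>w - \<eta> * (\<Sum>i<J. rhol k (real i * \<eta> / 2))\<bar> \<le> \<epsilon>)"
proof (rule near_constant[where Ls = lst, OF prob_KM \<epsilon> \<delta> \<eta>])
  have \<eta>0: "0 < \<eta>" using \<epsilon> \<eta> by simp
  show "whp (\<lambda>n. KM (Kn_edges n)) (\<lambda>n \<omega>. \<bar>rho n k (lst n \<omega> (t / real n)) - real n * rhol k (t / 2)\<bar> \<le> \<epsilon>' * real n)"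
    if "0 \<le> t" "0 < \<epsilon>'" for t \<epsilon>' using whp_rho[OF that] .
  show "whpd (\<lambda>n. KM (Kn_edges n)) (\<delta> / 2) (\<lambda>n \<omega>. gsum \<eta> n {J..<grd \<eta> n} (\<lambda>s. rho n k (lst n \<omega> s)) \<le> \<epsilon> / 4)"
    by (rule whpd_tail[OF k \<eta>0 _ _ J]) (use \<epsilon> \<delta> in auto)
  have pos: "whp (\<lambda>n. KM (Kn_edges n)) (\<lambda>n \<omega>. \<forall>e\<in>Kn_edges n. 0 < \<omega> e)"
    by (rule whp_null[OF null_pos[OF countable_finite[OF finite_Kn]]])
  show "whp (\<lambda>n. KM (Kn_edges n)) (\<lambda>n \<omega>. \<exists>w. wT n Kn_ends \<omega> (Kn_edges n) k = ereal w \<and>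
    w \<le> gsum \<eta> n {..<grd \<eta> n} (\<lambda>s. rho n k (lst n \<omega> s)) \<and> gsum \<eta> n {..<grd \<eta> n} (\<lambda>s. rho n k (lst n \<omega> s)) \<le> w + \<eta>)"
  proof (rule whp_mono[OF whp_conj[OF prob_KM whp_inj whp_conj[OF prob_KM pos whp_connected[OF k]]]],
      use eventually_gt_at_top[of 0] in eventually_elim, intro ballI impI)
    fix n \<omega> assume n: "0 < n" and H: "inj_on \<omega> (Kn_edges n) \<and> (\<forall>e\<in>Kn_edges n. 0 < \<omega> e) \<and>
      (inj_on \<omega> (Kn_edges n) \<longrightarrow> rho n k (lst n \<omega> (1 / 2)) \<le> 1)"
    show "\<exists>w. wT n Kn_ends \<omega> (Kn_edges n) k = ereal w \<and>
      w \<le> gsum \<eta> n {..<grd \<eta> n} (\<lambda>s. rho n k (lst n \<omega> s)) \<and> gsum \<eta> n {..<grd \<eta> n} (\<lambda>s. rho n k (lst n \<omega> s)) \<le> w + \<eta>"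
    proof (rule wT_gsum[OF n k \<eta>0])
      show "\<forall>e\<in>Kn_edges n. good n Kn_ends e" using good_Kn by blast
      show "enum \<omega> (1 / 2) (Kn_edges n) (lst n \<omega> (1 / 2))" using H by (intro enum_lst) blast
      show "0 < \<omega> e" if "e \<in> Kn_edges n" for e using H that by blast
      show "Phi n ginv (rel Kn_ends k (lst n \<omega> (1 / 2))) \<le> 1" using H unfolding rho_def rl_def by blast
      show "rho n k (lst n \<omega> s) = Phi n ginv (rel Kn_ends k (filter (\<lambda>e. \<omega> e \<le> s) (lst n \<omega> (1 / 2))))" if "s \<le> 1 / 2" for s
        unfolding rho_def rl_def using lst_filter[OF that] by metis
    qed
  qed
qed

end

subsection \<open>The Poisson multigraph\<close>

text \<open>Each cheap parallel edge contributes one letter, so a pair of vertices may be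
  repeated.\<close>

definition plst :: "nat \<Rightarrow> ((nat \<times> nat) \<times> nat \<Rightarrow> real) \<Rightarrow> real \<Rightarrow> (nat \<times> nat) list" where
  "plst n \<omega> s = map fst (srt (PM_cost \<omega>) {e \<in> PM_edges n. PM_cost \<omega> e \<le> s})"

text \<open>The first points of the processes: a copy of the complete graph with exponential costs
  inside the multigraph.\<close>

definition base :: "nat \<Rightarrow> ((nat \<times> nat) \<times> nat \<Rightarrow> real) \<Rightarrow> nat \<times> nat \<Rightarrow> real" where
  "base n \<omega> = (\<lambda>p\<in>Kn_edges n. \<omega> (p, 0))"

text \<open>The third clause makes the set of edges of cost at most \<open>1 / 2\<close> finite.\<close>

definition tame :: "nat \<Rightarrow> ((nat \<times> nat) \<times> nat \<Rightarrow> real) \<Rightarrow> bool" where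
  "tame n \<omega> \<longleftrightarrow> (\<forall>e\<in>PM_edges n. 0 < \<omega> e) \<and> inj_on (PM_cost \<omega>) (PM_edges n) \<and>
     (\<forall>p\<in>Kn_edges n. \<exists>i\<le>n. 1 / 2 < \<omega> (p, i))"

lemma PM_cost_0: "PM_cost \<omega> (p, 0) = \<omega> (p, 0)"
  by (simp add: PM_cost_def)

lemma coord_le_PM_cost:
  assumes "\<forall>e\<in>PM_edges n. 0 < \<omega> e" "p \<in> Kn_edges n" "i \<le> m"
  shows "\<omega> (p, i) \<le> PM_cost \<omega> (p, m)"
proof -
  have "sum (\<lambda>l. \<omega> (p, l)) {i} \<le> (\<Sum>l\<le>m. \<omega> (p, l))"
    using assms by (intro sum_mono2) (auto simp: PM_edges_def less_imp_le)
  then show ?thesis by (simp add: PM_cost_def)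
qed

lemma PM_cost_pos:
  assumes "\<forall>e\<in>PM_edges n. 0 < \<omega> e" "e \<in> PM_edges n"
  shows "0 < PM_cost \<omega> e"
proof -
  have "fst e \<in> Kn_edges n" using assms(2) by (auto simp: PM_edges_def)
  then have "\<omega> (fst e, 0) \<le> PM_cost \<omega> (fst e, snd e)" by (intro coord_le_PM_cost[OF assms(1)]) simp_all
  moreover have "0 < \<omega> (fst e, 0)" using assms by (auto simp: PM_edges_def)
  ultimately show ?thesis by simp
qed

text \<open>An increment above 1 / 2 pushes all later points of its pair beyond 1 / 2, and by
  \<open>tame\<close> one occurs among the first n + 1.\<close>

lemma finite_cheap:
  assumes "tame n \<omega>" "s \<le> 1 / 2"
  shows "finite {e \<in> PM_edges n. PM_cost \<omega> e \<le> s}"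
proof (rule finite_subset)
  show "{e \<in> PM_edges n. PM_cost \<omega> e \<le> s} \<subseteq> Kn_edges n \<times> {..n}"
  proof
    fix e assume "e \<in> {e \<in> PM_edges n. PM_cost \<omega> e \<le> s}"
    then obtain p m where e: "e = (p, m)" "p \<in> Kn_edges n" "PM_cost \<omega> (p, m) \<le> s"
      by (cases e) (auto simp: PM_edges_def)
    obtain i where i: "i \<le> n" "1 / 2 < \<omega> (p, i)" using assms(1) e(2) unfolding tame_def by blast
    have "m < i"
    proof (rule ccontr)
      assume "\<not> m < i"
      then have "\<omega> (p, i) \<le> PM_cost \<omega> (p, m)"
        using assms(1) e(2) unfolding tame_def by (intro coord_le_PM_cost[of n]) auto
      then show False using i(2) e(3) assms(2) by linarith
    qed
    then show "e \<in> Kn_edges n \<times> {..n}" using e i(1) by simp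
  qed
qed (simp add: finite_Kn)

lemma tame_inj: "tame n \<omega> \<Longrightarrow> inj_on (PM_cost \<omega>) {e \<in> PM_edges n. PM_cost \<omega> e \<le> s}"
  unfolding tame_def by (elim conjE, erule inj_on_subset) blast

lemma base_inj:
  assumes "tame n \<omega>"
  shows "inj_on (base n \<omega>) (Kn_edges n)"
proof (rule inj_onI)
  fix p q assume p: "p \<in> Kn_edges n" "q \<in> Kn_edges n" "base n \<omega> p = base n \<omega> q"
  have "inj_on (PM_cost \<omega>) (PM_edges n)" using assms unfolding tame_def by blast
  moreover have "PM_cost \<omega> (p, 0) = PM_cost \<omega> (q, 0)" using p by (simp add: base_def PM_cost_0)
  moreover have "(p, 0) \<in> PM_edges n" "(q, 0) \<in> PM_edges n" using p by (auto simp: PM_edges_def)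
  ultimately show "p = q" by (auto dest: inj_onD)
qed

lemma set_plst:
  assumes "tame n \<omega>" "s \<le> 1 / 2"
  shows "set (plst n \<omega> s) \<subseteq> Kn_edges n"
  unfolding plst_def set_map srt_sorted(2)[OF finite_cheap[OF assms] tame_inj[OF assms(1)]]
  by (auto simp: PM_edges_def)

lemma lst_plst:
  assumes "tame n \<omega>" "s \<le> 1 / 2"
  shows "lst n (base n \<omega>) s = map fst (filter (\<lambda>e. snd e = 0) (srt (PM_cost \<omega>) {e \<in> PM_edges n. PM_cost \<omega> e \<le> s}))"
    (is "_ = map fst ?l")
proof -
  note S = srt_sorted[OF finite_cheap[OF assms] tame_inj[OF assms(1)]]
  have sl: "set ?l = (\<lambda>p. (p, 0)) ` {p \<in> Kn_edges n. \<omega> (p, 0) \<le> s}"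
    unfolding set_filter S(2) by (auto simp: PM_edges_def PM_cost_0)
  have "sorted_wrt (\<lambda>x y. PM_cost \<omega> x < PM_cost \<omega> y) ?l" using S(1) by (rule sorted_wrt_filter)
  then have "sorted_wrt (\<lambda>x y. base n \<omega> (fst x) < base n \<omega> (fst y)) ?l"
    by (rule sorted_wrt_mono_rel[rotated]) (unfold sl, auto simp: base_def PM_cost_0)
  then have "sorted_wrt (\<lambda>x y. base n \<omega> x < base n \<omega> y) (map fst ?l)" by (simp add: sorted_wrt_map)
  from srt_unique[OF this] have "map fst ?l = srt (base n \<omega>) (fst ` set ?l)" by simp
  also have "fst ` set ?l = {p \<in> Kn_edges n. base n \<omega> p \<le> s}" unfolding sl by (force simp: base_def)
  finally show ?thesis unfolding lst_def srt_filter[OF finite_Kn base_inj[OF assms(1)]] by simp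
qed

lemma subseq_plst:
  assumes "tame n \<omega>" "s \<le> 1 / 2"
  shows "subseq (lst n (base n \<omega>) s) (plst n \<omega> s)"
  unfolding lst_plst[OF assms] plst_def by (intro subseq_map subseq_filter_left)

text \<open>By \<open>no3\<close> a pair has at most two points up to \<open>s\<close>, so the
  surplus over the first points is at most one per pair, and only for pairs whose first two
  increments are both at most \<open>s\<close>.\<close>

lemma length_plst:
  assumes "tame n \<omega>" "s \<le> 1 / 2" and no3: "\<forall>p\<in>Kn_edges n. \<exists>i\<le>2. s < \<omega> (p, i)"
  shows "length (plst n \<omega> s) \<le> length (lst n (base n \<omega>) s) + card {p \<in> Kn_edges n. \<forall>i\<le>1. \<omega> (p, i) \<le> s}"
proof -
  let ?A = "{e \<in> PM_edges n. PM_cost \<omega> e \<le> s}"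
  let ?l = "srt (PM_cost \<omega>) ?A"
  note fin = finite_cheap[OF assms(1,2)] and inj = tame_inj[OF assms(1), of s]
  have pos: "\<forall>e\<in>PM_edges n. 0 < \<omega> e" using assms(1) unfolding tame_def by blast
  have "length (filter (\<lambda>e. snd e \<noteq> 0) ?l) = card {e \<in> ?A. snd e \<noteq> 0}"
    using distinct_card[OF distinct_filter[OF distinct_srt[OF fin inj]], of "\<lambda>e. snd e \<noteq> 0"]
    unfolding set_filter srt_sorted(2)[OF fin inj] by simp
  also have "\<dots> \<le> card {p \<in> Kn_edges n. \<forall>i\<le>1. \<omega> (p, i) \<le> s}"
  proof (rule card_inj_on_le)
    have e: "fst e \<in> Kn_edges n" "snd e = 1" "\<forall>i\<le>1. \<omega> (fst e, i) \<le> s" if "e \<in> {e \<in> ?A. snd e \<noteq> 0}" for e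
    proof -
      show p: "fst e \<in> Kn_edges n" using that by (auto simp: PM_edges_def)
      have le: "\<omega> (fst e, i) \<le> s" if i: "i \<le> snd e" for i
      proof -
        have "PM_cost \<omega> (fst e, snd e) \<le> s" using \<open>e \<in> {e \<in> ?A. snd e \<noteq> 0}\<close> by simp
        then show ?thesis using coord_le_PM_cost[OF pos p i] by linarith
      qed
      obtain i where i: "i \<le> 2" "s < \<omega> (fst e, i)" using no3 p by blast
      have "snd e < i" using le[of i] i(2) by (meson not_less)
      then show m: "snd e = 1" using that i(1) by auto
      show "\<forall>i\<le>1. \<omega> (fst e, i) \<le> s"
      proof (intro allI impI)
        fix i :: nat assume "i \<le> 1"
        then show "\<omega> (fst e, i) \<le> s" unfolding m[symmetric] by (rule le)
      qed
    qed
    show "inj_on fst {e \<in> ?A. snd e \<noteq> 0}"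
    proof (rule inj_onI)
      fix x y assume x: "x \<in> {e \<in> ?A. snd e \<noteq> 0}" and y: "y \<in> {e \<in> ?A. snd e \<noteq> 0}" and "fst x = fst y"
      then show "x = y" using e(2)[OF x] e(2)[OF y] by (simp add: prod_eq_iff)
    qed
    show "fst ` {e \<in> ?A. snd e \<noteq> 0} \<subseteq> {p \<in> Kn_edges n. \<forall>i\<le>1. \<omega> (p, i) \<le> s}"
    proof
      fix p assume "p \<in> fst ` {e \<in> ?A. snd e \<noteq> 0}"
      then obtain x where x: "x \<in> {e \<in> ?A. snd e \<noteq> 0}" and p: "p = fst x" by (rule imageE)
      show "p \<in> {p \<in> Kn_edges n. \<forall>i\<le>1. \<omega> (p, i) \<le> s}" unfolding p using e(1)[OF x] e(3)[OF x] by (intro CollectI conjI)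
    qed
  qed (simp add: finite_Kn)
  finally show ?thesis
    using sum_length_filter_compl[of "\<lambda>e. snd e = 0" ?l] unfolding lst_plst[OF assms(1,2)] plst_def by simp
qed

context cost_law
begin

lemma base_measurable: "base n \<in> measurable (KM (PM_edges n)) (KM (Kn_edges n))"
  and base_distr: "distr (KM (PM_edges n)) (KM (Kn_edges n)) (base n) = KM (Kn_edges n)"
proof -
  have "inj_on (\<lambda>p. (p, 0::nat)) (Kn_edges n)" "(\<lambda>p. (p, 0)) ` Kn_edges n \<subseteq> PM_edges n"
    by (auto simp: inj_on_def PM_edges_def)
  from KM_reindex[OF this] show "base n \<in> measurable (KM (PM_edges n)) (KM (Kn_edges n))"
    "distr (KM (PM_edges n)) (KM (Kn_edges n)) (base n) = KM (Kn_edges n)" unfolding base_def[abs_def] by auto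
qed

text \<open>The event that the first m + 1 increments of a pair are short.\<close>

definition run :: "nat \<Rightarrow> nat \<Rightarrow> real \<Rightarrow> nat \<times> nat \<Rightarrow> ((nat \<times> nat) \<times> nat \<Rightarrow> real) set" where
  "run n m s p = {\<omega>\<in>space (KM (PM_edges n)). \<forall>j\<in>{p} \<times> {..m}. \<omega> j \<in> {..s}}"

lemma sets_run: "p \<in> Kn_edges n \<Longrightarrow> run n m s p \<in> sets (KM (PM_edges n))"
  unfolding run_def by (rule sets_coords) (auto simp: PM_edges_def)

lemma measure_run:
  assumes "p \<in> Kn_edges n" "0 \<le> s"
  shows "measure (KM (PM_edges n)) (run n m s p) \<le> s ^ Suc m"
proof -
  have "measure (KM (PM_edges n)) (run n m s p) = (\<Prod>j\<in>{p} \<times> {..m}. measure \<mu> {..s})"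
    unfolding run_def using assms by (intro prob_coords) (auto simp: PM_edges_def)
  also have "\<dots> = measure \<mu> {..s} ^ Suc m" by simp
  also have "\<dots> \<le> s ^ Suc m" using mu_upper[OF assms(2)] mu_le_pos[OF assms(2)] by (intro power_mono) auto
  finally show ?thesis .
qed

lemma card_Kn_le: "real (card (Kn_edges n)) \<le> (real n)\<^sup>2"
  unfolding card_Kn by (simp add: power2_eq_square algebra_simps)

text \<open>Union bound over the pairs. It is used with n + 1 increments at cost 1 / 2, for
  \<open>tame\<close>, and with three increments at cost t / n.\<close>

lemma whp_no_run:
  assumes s: "\<And>n. 0 \<le> s n" and lim: "(\<lambda>n. (real n)\<^sup>2 * s n ^ Suc (m n)) \<longlonglongrightarrow> 0"
  shows "whp (\<lambda>n. KM (PM_edges n)) (\<lambda>n \<omega>. \<forall>p\<in>Kn_edges n. \<exists>i\<le>m n. s n < \<omega> (p, i))"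
proof (rule whpI[OF _ lim])
  show "\<forall>\<^sub>F n in sequentially. (\<Union>p\<in>Kn_edges n. run n (m n) (s n) p) \<in> sets (KM (PM_edges n)) \<and>
    {\<omega>\<in>space (KM (PM_edges n)). \<not> (\<forall>p\<in>Kn_edges n. \<exists>i\<le>m n. s n < \<omega> (p, i))} \<subseteq> (\<Union>p\<in>Kn_edges n. run n (m n) (s n) p) \<and>
    measure (KM (PM_edges n)) (\<Union>p\<in>Kn_edges n. run n (m n) (s n) p) \<le> (real n)\<^sup>2 * s n ^ Suc (m n)"
  proof (intro always_eventually allI conjI)
    fix n
    show "(\<Union>p\<in>Kn_edges n. run n (m n) (s n) p) \<in> sets (KM (PM_edges n))"
      using finite_Kn sets_run by (intro sets.finite_UN) auto
    show "{\<omega>\<in>space (KM (PM_edges n)). \<not> (\<forall>p\<in>Kn_edges n. \<exists>i\<le>m n. s n < \<omega> (p, i))} \<subseteq> (\<Union>p\<in>Kn_edges n. run n (m n) (s n) p)"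
      by (auto simp: run_def not_less)
    have "measure (KM (PM_edges n)) (\<Union>p\<in>Kn_edges n. run n (m n) (s n) p) \<le> real (card (Kn_edges n)) * s n ^ Suc (m n)"
      using finite_Kn sets_run measure_run[OF _ s] by (intro measure_UN_le) auto
    also have "\<dots> \<le> (real n)\<^sup>2 * s n ^ Suc (m n)" using card_Kn_le s by (intro mult_right_mono) auto
    finally show "measure (KM (PM_edges n)) (\<Union>p\<in>Kn_edges n. run n (m n) (s n) p) \<le> (real n)\<^sup>2 * s n ^ Suc (m n)" .
  qed
qed

text \<open>For different pairs the first increment of one pair does not occur in the other cost, so
  a tie fixes it as a function of the other coordinates.\<close>

lemma PM_tie_null:
  assumes e: "e \<in> PM_edges n" "e' \<in> PM_edges n" "fst e \<noteq> fst e'"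
  shows "{\<omega>\<in>space (KM (PM_edges n)). PM_cost \<omega> e = PM_cost \<omega> e'} \<in> null_sets (KM (PM_edges n))"
proof -
  let ?I = "PM_edges n" and ?i = "(fst e, 0::nat)"
  interpret P: prob_space "KM ?I" by (rule prob_KM)
  define g where "g \<omega> = (\<Sum>l\<le>snd e'. \<omega> (fst e', l)) - (\<Sum>l\<in>{1..snd e}. \<omega> (fst e, l))" for \<omega> :: "(nat \<times> nat) \<times> nat \<Rightarrow> real"
  have J: "(fst e', l) \<in> ?I - {?i}" "l \<noteq> 0 \<Longrightarrow> (fst e, l) \<in> ?I - {?i}" for l using e by (auto simp: PM_edges_def)
  have i: "?i \<in> ?I" using e by (auto simp: PM_edges_def)
  have gm: "g \<in> borel_measurable (KM (?I - {?i}))" unfolding g_def[abs_def]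
    using J by (intro borel_measurable_diff borel_measurable_sum measurable_coord) auto
  have split: "PM_cost \<omega> e = \<omega> ?i + (\<Sum>l\<in>{1..snd e}. \<omega> (fst e, l))" for \<omega> :: "(nat \<times> nat) \<times> nat \<Rightarrow> real"
  proof -
    have "{..snd e} = insert 0 {1..snd e}" by auto
    then show ?thesis unfolding PM_cost_def by simp
  qed
  have gr: "g (restrict \<omega> (?I - {?i})) = g \<omega>" for \<omega> :: "(nat \<times> nat) \<times> nat \<Rightarrow> real"
    unfolding g_def using J by (intro arg_cong2[where f = "(-)"] sum.cong refl) (auto simp: restrict_def)
  have eq: "{\<omega>\<in>space (KM ?I). PM_cost \<omega> e = PM_cost \<omega> e'} = {\<omega>\<in>space (KM ?I). \<omega> ?i = g (restrict \<omega> (?I - {?i}))}"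
    unfolding gr unfolding split g_def by (auto simp: PM_cost_def algebra_simps)
  have "{\<omega>\<in>space (KM ?I). PM_cost \<omega> e = PM_cost \<omega> e'} \<in> sets (KM ?I)"
  proof (rule borel_measurable_eq)
    have "(\<lambda>\<omega>. PM_cost \<omega> f) \<in> borel_measurable (KM ?I)" if "f \<in> ?I" for f
      unfolding PM_cost_def using that by (intro borel_measurable_sum measurable_coord) (auto simp: PM_edges_def)
    then show "(\<lambda>\<omega>. PM_cost \<omega> e) \<in> borel_measurable (KM ?I)" "(\<lambda>\<omega>. PM_cost \<omega> e') \<in> borel_measurable (KM ?I)"
      using e by auto
  qed
  moreover have "measure (KM ?I) {\<omega>\<in>space (KM ?I). PM_cost \<omega> e = PM_cost \<omega> e'} = 0"
    unfolding eq by (rule no_tie[OF i gm])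
  ultimately show ?thesis by (simp add: null_sets_def P.emeasure_eq_measure)
qed

lemma countable_PM: "countable (PM_edges n)"
  unfolding PM_edges_def by (rule countable_SIGMA[OF countable_finite[OF finite_Kn]]) simp

text \<open>Within one pair positive increments make the costs strictly increasing; between pairs
  \<open>PM_tie_null\<close> applies to countably many cases.\<close>

lemma PM_inj_null: "{\<omega>\<in>space (KM (PM_edges n)). \<not> ((\<forall>e\<in>PM_edges n. 0 < \<omega> e) \<and> inj_on (PM_cost \<omega>) (PM_edges n))} \<in> null_sets (KM (PM_edges n))"
proof -
  let ?I = "PM_edges n" and ?D = "{(e, e'). e \<in> PM_edges n \<and> e' \<in> PM_edges n \<and> fst e \<noteq> fst e'}"
  let ?Z = "{\<omega>\<in>space (KM ?I). \<not> (\<forall>e\<in>?I. 0 < \<omega> e)}"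
  let ?T = "\<Union>d\<in>?D. {\<omega>\<in>space (KM ?I). PM_cost \<omega> (fst d) = PM_cost \<omega> (snd d)}"
  have "countable ?D" by (rule countable_subset[of _ "?I \<times> ?I"]) (auto intro: countable_PM)
  then have "?T \<in> null_sets (KM ?I)" using PM_tie_null by (intro null_sets_UN') auto
  then have N: "?Z \<union> ?T \<in> null_sets (KM ?I)" using null_pos[OF countable_PM] by blast
  have "{\<omega>\<in>space (KM ?I). \<not> ((\<forall>e\<in>?I. 0 < \<omega> e) \<and> inj_on (PM_cost \<omega>) ?I)} = ?Z \<union> ?T"
  proof (intro set_eqI iffI)
    fix \<omega> assume "\<omega> \<in> {\<omega>\<in>space (KM ?I). \<not> ((\<forall>e\<in>?I. 0 < \<omega> e) \<and> inj_on (PM_cost \<omega>) ?I)}"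
    then have \<omega>: "\<omega> \<in> space (KM ?I)" "\<not> ((\<forall>e\<in>?I. 0 < \<omega> e) \<and> inj_on (PM_cost \<omega>) ?I)" by auto
    show "\<omega> \<in> ?Z \<union> ?T"
    proof (cases "\<forall>e\<in>?I. 0 < \<omega> e")
      case True
      have less: "PM_cost \<omega> (p, m) < PM_cost \<omega> (p, m')" if "p \<in> Kn_edges n" "m < m'" for p m m'
        using True that unfolding PM_cost_def fst_conv snd_conv
        by (intro sum_strict_mono2[where b = m']) (auto simp: PM_edges_def less_imp_le)
      have "\<not> inj_on (PM_cost \<omega>) ?I" using True \<omega>(2) by blast
      then obtain e e' where e: "e \<in> ?I" "e' \<in> ?I" "PM_cost \<omega> e = PM_cost \<omega> e'" "e \<noteq> e'" unfolding inj_on_def by blast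
      have "fst e \<noteq> fst e'"
      proof
        assume f: "fst e = fst e'"
        then have "snd e \<noteq> snd e'" using e(4) by (simp add: prod_eq_iff)
        moreover have "fst e \<in> Kn_edges n" using e(1) by (auto simp: PM_edges_def)
        ultimately show False using less[of "fst e" "snd e" "snd e'"] less[of "fst e" "snd e'" "snd e"] e(3) f
          by (metis less_irrefl nat_neq_iff prod.collapse)
      qed
      then have "(e, e') \<in> ?D" using e by simp
      then show ?thesis using \<omega>(1) e(3) by (intro UnI2 UN_I[of "(e, e')"]) auto
    qed (use \<omega>(1) in blast)
  next
    fix \<omega> assume "\<omega> \<in> ?Z \<union> ?T"
    then show "\<omega> \<in> {\<omega>\<in>space (KM ?I). \<not> ((\<forall>e\<in>?I. 0 < \<omega> e) \<and> inj_on (PM_cost \<omega>) ?I)}"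
      by (auto dest: inj_onD)
  qed
  then show ?thesis using N by simp
qed

lemma whp_tame: "whp (\<lambda>n. KM (PM_edges n)) (\<lambda>n \<omega>. tame n \<omega>)"
proof -
  have "(\<lambda>n. (real n)\<^sup>2 * (1 / 2) ^ Suc n) \<longlonglongrightarrow> 0" by real_asymp
  from whp_no_run[OF _ this]
  have "whp (\<lambda>n. KM (PM_edges n)) (\<lambda>n \<omega>. \<forall>p\<in>Kn_edges n. \<exists>i\<le>n. 1 / 2 < \<omega> (p, i))" by simp
  from whp_conj[OF prob_KM whp_null[OF PM_inj_null] this] show ?thesis
    by (rule whp_mono) (simp add: tame_def)
qed

lemma rho_plst_le:
  assumes "tame n \<omega>" "s \<le> 1 / 2"
  shows "rho n k (plst n \<omega> s) \<le> rho n k (lst n (base n \<omega>) s)"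
  by (rule rho_subseq(1)[OF subseq_plst[OF assms] set_plst[OF assms]])

text \<open>Two short increments have probability at most (t / n)(t / n), so the mean number of such
  pairs is at most t t, bounded in n.\<close>

lemma whp_few_doubles:
  assumes t: "0 \<le> t" and \<epsilon>: "0 < \<epsilon>"
  shows "whp (\<lambda>n. KM (PM_edges n)) (\<lambda>n \<omega>. real (card {p \<in> Kn_edges n. \<forall>i\<le>1. \<omega> (p, i) \<le> t / real n}) \<le> \<epsilon> * real n)"
proof (rule whpI[where A = "\<lambda>n. {\<omega>\<in>space (KM (PM_edges n)). \<epsilon> * real n \<le> real (card {p \<in> Kn_edges n. \<omega> \<in> run n 1 (t / real n) p})}"
      and b = "\<lambda>n. t\<^sup>2 / \<epsilon> / real n"])
  show "(\<lambda>n. t\<^sup>2 / \<epsilon> / real n) \<longlonglongrightarrow> 0" by (rule lim_const_over_n)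
  show "\<forall>\<^sub>F n in sequentially. {\<omega>\<in>space (KM (PM_edges n)). \<epsilon> * real n \<le> real (card {p \<in> Kn_edges n. \<omega> \<in> run n 1 (t / real n) p})} \<in> sets (KM (PM_edges n)) \<and>
    {\<omega>\<in>space (KM (PM_edges n)). \<not> real (card {p \<in> Kn_edges n. \<forall>i\<le>1. \<omega> (p, i) \<le> t / real n}) \<le> \<epsilon> * real n}
      \<subseteq> {\<omega>\<in>space (KM (PM_edges n)). \<epsilon> * real n \<le> real (card {p \<in> Kn_edges n. \<omega> \<in> run n 1 (t / real n) p})} \<and>
    measure (KM (PM_edges n)) {\<omega>\<in>space (KM (PM_edges n)). \<epsilon> * real n \<le> real (card {p \<in> Kn_edges n. \<omega> \<in> run n 1 (t / real n) p})} \<le> t\<^sup>2 / \<epsilon> / real n"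
    using eventually_gt_at_top[of 0]
  proof (eventually_elim, intro conjI)
    fix n :: nat assume n: "0 < n"
    interpret P: prob_space "KM (PM_edges n)" by (rule prob_KM)
    have c: "0 < \<epsilon> * real n" using \<epsilon> n by simp
    note mc = P.markov_count[where J = "Kn_edges n" and A = "run n 1 (t / real n)" and c = "\<epsilon> * real n", OF finite_Kn sets_run c]
    show "{\<omega>\<in>space (KM (PM_edges n)). \<epsilon> * real n \<le> real (card {p \<in> Kn_edges n. \<omega> \<in> run n 1 (t / real n) p})} \<in> sets (KM (PM_edges n))"
      by (rule mc(1))
    have "{p \<in> Kn_edges n. \<omega> \<in> run n 1 (t / real n) p} = {p \<in> Kn_edges n. \<forall>i\<le>1. \<omega> (p, i) \<le> t / real n}"
      if "\<omega> \<in> space (KM (PM_edges n))" for \<omega> using that unfolding run_def by auto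
    then show "{\<omega>\<in>space (KM (PM_edges n)). \<not> real (card {p \<in> Kn_edges n. \<forall>i\<le>1. \<omega> (p, i) \<le> t / real n}) \<le> \<epsilon> * real n}
      \<subseteq> {\<omega>\<in>space (KM (PM_edges n)). \<epsilon> * real n \<le> real (card {p \<in> Kn_edges n. \<omega> \<in> run n 1 (t / real n) p})}" by force
    have "(\<Sum>p\<in>Kn_edges n. P.prob (run n 1 (t / real n) p)) \<le> (\<Sum>p\<in>Kn_edges n. (t / real n) ^ Suc 1)"
      using t by (intro sum_mono measure_run) auto
    also have "\<dots> \<le> (real n)\<^sup>2 * (t / real n)\<^sup>2"
      using mult_right_mono[OF card_Kn_le[of n], of "(t / real n)\<^sup>2"] by (simp add: power2_eq_square)
    also have "\<dots> = t\<^sup>2" using n by (simp add: power_divide)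
    finally have "(\<Sum>p\<in>Kn_edges n. P.prob (run n 1 (t / real n) p)) / (\<epsilon> * real n) \<le> t\<^sup>2 / (\<epsilon> * real n)"
      using c by (intro divide_right_mono) auto
    then show "P.prob {\<omega>\<in>space (KM (PM_edges n)). \<epsilon> * real n \<le> real (card {p \<in> Kn_edges n. \<omega> \<in> run n 1 (t / real n) p})} \<le> t\<^sup>2 / \<epsilon> / real n"
      using mc(2) by simp
  qed
qed

text \<open>The word of the multigraph contains that of the first points and exceeds it by o(n)
  letters, so the numbers of classes differ by o(n).\<close>

lemma whp_rho_plst:
  assumes t: "0 \<le> t" and \<epsilon>: "0 < \<epsilon>"
  shows "whp (\<lambda>n. KM (PM_edges n)) (\<lambda>n \<omega>. \<bar>rho n k (plst n \<omega> (t / real n)) - real n * rhol k (t / 2)\<bar> \<le> \<epsilon> * real n)"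
proof -
  have \<epsilon>2: "0 < \<epsilon> / 2" using \<epsilon> by simp
  have A: "whp (\<lambda>n. KM (PM_edges n)) (\<lambda>n \<omega>. \<bar>rho n k (lst n (base n \<omega>) (t / real n)) - real n * rhol k (t / 2)\<bar> \<le> \<epsilon> / 2 * real n)"
    by (rule whp_transfer[OF whp_rho[OF t \<epsilon>2] base_measurable base_distr])
  have "\<forall>\<^sub>F n in sequentially. t ^ 3 / real n = (real n)\<^sup>2 * (t / real n) ^ Suc 2"
    using eventually_gt_at_top[of 0] by eventually_elim (simp add: field_simps power2_eq_square power3_eq_cube)
  then have "(\<lambda>n. (real n)\<^sup>2 * (t / real n) ^ Suc 2) \<longlonglongrightarrow> 0"
    by (rule Lim_transform_eventually[OF lim_const_over_n])
  from whp_no_run[OF _ this] t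
  have B: "whp (\<lambda>n. KM (PM_edges n)) (\<lambda>n \<omega>. \<forall>p\<in>Kn_edges n. \<exists>i\<le>2. t / real n < \<omega> (p, i))" by simp
  have "(\<lambda>n. t / real n) \<longlonglongrightarrow> 0" by (rule lim_const_over_n)
  then have ev: "\<forall>\<^sub>F n in sequentially. t / real n < 1 / 2" by (intro order_tendstoD) auto
  show ?thesis
  proof (rule whp_mono[OF whp_conj[OF prob_KM whp_conj[OF prob_KM A B] whp_conj[OF prob_KM whp_tame whp_few_doubles[OF t \<epsilon>2]]]],
      use ev in eventually_elim, intro ballI impI)
    fix n \<omega> assume s: "t / real n < 1 / 2"
      and H: "(\<bar>rho n k (lst n (base n \<omega>) (t / real n)) - real n * rhol k (t / 2)\<bar> \<le> \<epsilon> / 2 * real n \<and>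
        (\<forall>p\<in>Kn_edges n. \<exists>i\<le>2. t / real n < \<omega> (p, i))) \<and>
        tame n \<omega> \<and> real (card {p \<in> Kn_edges n. \<forall>i\<le>1. \<omega> (p, i) \<le> t / real n}) \<le> \<epsilon> / 2 * real n"
    have tame: "tame n \<omega>" and s': "t / real n \<le> 1 / 2" using H s by auto
    note sub = rho_subseq[OF subseq_plst[OF tame s'] set_plst[OF tame s'], of k]
    have "real (length (plst n \<omega> (t / real n))) \<le> real (length (lst n (base n \<omega>) (t / real n))) + \<epsilon> / 2 * real n"
      using length_plst[OF tame s'] H by force
    then have "rho n k (lst n (base n \<omega>) (t / real n)) - rho n k (plst n \<omega> (t / real n)) \<le> \<epsilon> / 2 * real n"
      using sub(2) by linarith
    then show "\<bar>rho n k (plst n \<omega> (t / real n)) - real n * rhol k (t / 2)\<bar> \<le> \<epsilon> * real n"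
      using sub(1) conjunct1[OF conjunct1[OF H]] unfolding abs_le_iff by (elim conjE, intro conjI) linarith+
  qed
qed

text \<open>Additional edges only lower the number of classes, so the tail bound and the
  connectedness carry over from the first points. The error \<delta> / 2 for the tail is split
  evenly between that bound and \<open>tame\<close>.\<close>

lemma near_PM:
  assumes k: "1 \<le> k" and \<epsilon>: "0 < \<epsilon>" and \<delta>: "0 < \<delta>" and \<eta>: "\<eta> = \<epsilon> / 4" and J: "2 / tailc k \<le> real J * \<eta>"
    "2 * real k * (exp (- tailc k * \<eta>) ^ J / (1 - exp (- tailc k * \<eta>))) * \<eta> / (\<epsilon> / 4) < \<delta> / 4 / 2"
  shows "whpd (\<lambda>n. KM (PM_edges n)) \<delta> (\<lambda>n \<omega>. \<exists>w. wT n PM_ends (PM_cost \<omega>) (PM_edges n) k = ereal w \<and>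
    \<bar>w - \<eta> * (\<Sum>i<J. rhol k (real i * \<eta> / 2))\<bar> \<le> \<epsilon>)"
proof (rule near_constant[where Ls = plst, OF prob_KM \<epsilon> \<delta> \<eta>])
  have \<eta>0: "0 < \<eta>" using \<epsilon> \<eta> by simp
  show "whp (\<lambda>n. KM (PM_edges n)) (\<lambda>n \<omega>. \<bar>rho n k (plst n \<omega> (t / real n)) - real n * rhol k (t / 2)\<bar> \<le> \<epsilon>' * real n)"
    if "0 \<le> t" "0 < \<epsilon>'" for t \<epsilon>' using whp_rho_plst[OF that] .
  have "whpd (\<lambda>n. KM (Kn_edges n)) (\<delta> / 4) (\<lambda>n \<omega>. gsum \<eta> n {J..<grd \<eta> n} (\<lambda>s. rho n k (lst n \<omega> s)) \<le> \<epsilon> / 4)"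
    by (rule whpd_tail[OF k \<eta>0 _ _ J]) (use \<epsilon> \<delta> in auto)
  then have T: "whpd (\<lambda>n. KM (PM_edges n)) (\<delta> / 4) (\<lambda>n \<omega>. gsum \<eta> n {J..<grd \<eta> n} (\<lambda>s. rho n k (lst n (base n \<omega>) s)) \<le> \<epsilon> / 4)"
    by (rule whpd_transfer[OF _ base_measurable base_distr])
  have "whpd (\<lambda>n. KM (PM_edges n)) (\<delta> / 4) (\<lambda>n \<omega>. tame n \<omega>)" using whp_tame \<delta> unfolding whp_whpd by simp
  from whpd_conj[OF T this]
  have "whpd (\<lambda>n. KM (PM_edges n)) (\<delta> / 2) (\<lambda>n \<omega>. gsum \<eta> n {J..<grd \<eta> n} (\<lambda>s. rho n k (lst n (base n \<omega>) s)) \<le> \<epsilon> / 4 \<and> tame n \<omega>)" by simp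
  then show "whpd (\<lambda>n. KM (PM_edges n)) (\<delta> / 2) (\<lambda>n \<omega>. gsum \<eta> n {J..<grd \<eta> n} (\<lambda>s. rho n k (plst n \<omega> s)) \<le> \<epsilon> / 4)"
  proof (rule whpd_mono, use eventually_gt_at_top[of 0] in eventually_elim, intro ballI impI, elim conjE)
    fix n \<omega> assume n: "0 < n" and le: "gsum \<eta> n {J..<grd \<eta> n} (\<lambda>s. rho n k (lst n (base n \<omega>) s)) \<le> \<epsilon> / 4" and tame: "tame n \<omega>"
    have "gsum \<eta> n {J..<grd \<eta> n} (\<lambda>s. rho n k (plst n \<omega> s)) \<le> gsum \<eta> n {J..<grd \<eta> n} (\<lambda>s. rho n k (lst n (base n \<omega>) s))"
      using grd_half[OF \<eta>0 n] by (intro gsum_mono \<eta>0 rho_plst_le tame) auto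
    then show "gsum \<eta> n {J..<grd \<eta> n} (\<lambda>s. rho n k (plst n \<omega> s)) \<le> \<epsilon> / 4" using le by linarith
  qed
  have C: "whp (\<lambda>n. KM (PM_edges n)) (\<lambda>n \<omega>. inj_on (base n \<omega>) (Kn_edges n) \<longrightarrow> rho n k (lst n (base n \<omega>) (1 / 2)) \<le> 1)"
    by (rule whp_transfer[OF whp_connected[OF k] base_measurable base_distr])
  show "whp (\<lambda>n. KM (PM_edges n)) (\<lambda>n \<omega>. \<exists>w. wT n PM_ends (PM_cost \<omega>) (PM_edges n) k = ereal w \<and>
    w \<le> gsum \<eta> n {..<grd \<eta> n} (\<lambda>s. rho n k (plst n \<omega> s)) \<and> gsum \<eta> n {..<grd \<eta> n} (\<lambda>s. rho n k (plst n \<omega> s)) \<le> w + \<eta>)"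
  proof (rule whp_mono[OF whp_conj[OF prob_KM whp_tame C]],
      use eventually_gt_at_top[of 0] in eventually_elim, intro ballI impI, elim conjE)
    fix n \<omega> assume n: "0 < n" and tame: "tame n \<omega>"
      and con: "inj_on (base n \<omega>) (Kn_edges n) \<longrightarrow> rho n k (lst n (base n \<omega>) (1 / 2)) \<le> 1"
    let ?A = "\<lambda>s. {e \<in> PM_edges n. PM_cost \<omega> e \<le> s}"
    let ?l = "\<lambda>s. srt (PM_cost \<omega>) (?A s)"
    have ends: "PM_ends = (\<lambda>e. Kn_ends (fst e))" by (simp add: fun_eq_iff PM_ends_def)
    have rel: "Phi n ginv (rel PM_ends k l) = rho n k (map fst l)" for l
      unfolding rho_def rl_def ends rel_map ..
    note S = srt_sorted[OF finite_cheap[OF tame] tame_inj[OF tame]]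
    show "\<exists>w. wT n PM_ends (PM_cost \<omega>) (PM_edges n) k = ereal w \<and>
      w \<le> gsum \<eta> n {..<grd \<eta> n} (\<lambda>s. rho n k (plst n \<omega> s)) \<and> gsum \<eta> n {..<grd \<eta> n} (\<lambda>s. rho n k (plst n \<omega> s)) \<le> w + \<eta>"
    proof (rule wT_gsum[OF n k \<eta>0, where l = "?l (1 / 2)"])
      show "\<forall>e\<in>PM_edges n. good n PM_ends e" using good_Kn by (auto simp: PM_edges_def good_def PM_ends_def)
      show "enum (PM_cost \<omega>) (1 / 2) (PM_edges n) (?l (1 / 2))" unfolding enum_def by (intro conjI S[OF order_refl])
      show "0 < PM_cost \<omega> e" if "e \<in> PM_edges n" for e using PM_cost_pos that tame unfolding tame_def by blast
      show "Phi n ginv (rel PM_ends k (?l (1 / 2))) \<le> 1"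
        unfolding rel using rho_plst_le[OF tame, of "1 / 2" k] con base_inj[OF tame] unfolding plst_def by simp
      show "rho n k (plst n \<omega> s) = Phi n ginv (rel PM_ends k (filter (\<lambda>e. PM_cost \<omega> e \<le> s) (?l (1 / 2))))" if "s \<le> 1 / 2" for s
      proof -
        have "{e \<in> ?A (1 / 2). PM_cost \<omega> e \<le> s} = ?A s" using that by auto
        then show ?thesis unfolding rel plst_def srt_filter[OF finite_cheap[OF tame order_refl] tame_inj[OF tame]] by simp
      qed
    qed
  qed
qed

end

theorem theorem1p2:
  fixes k :: nat
  assumes "k \<ge> 1"
  shows "\<exists>\<gamma>::real.
    conv_in_prob Kn_uniform_space (\<lambda>n \<omega>. wT n Kn_ends \<omega> (Kn_edges n) k) \<gamma> \<and>
    conv_in_prob PM_space (\<lambda>n \<omega>. wT n PM_ends (PM_cost \<omega>) (PM_edges n) k) \<gamma>"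
proof (rule common_limit)
  interpret U: cost_law "uniform_measure lborel {0<..<1::real}" by (rule cost_law_uniform)
  interpret E: cost_law "density lborel (exponential_density 1)" by (rule cost_law_exponential)
  have MU: "Kn_uniform_space = (\<lambda>n. PiM (Kn_edges n) (\<lambda>_. uniform_measure lborel {0<..<1::real}))"
    by (simp add: fun_eq_iff Kn_uniform_space_def)
  have ME: "PM_space = (\<lambda>n. PiM (PM_edges n) (\<lambda>_. density lborel (exponential_density 1)))"
    by (simp add: fun_eq_iff PM_space_def)
  show "prob_space (Kn_uniform_space n)" for n unfolding MU by (rule U.prob_KM)
  fix \<epsilon> \<delta> :: real assume \<epsilon>: "0 < \<epsilon>" and \<delta>: "0 < \<delta>"
  have "0 < \<epsilon> / 4" "0 < \<delta> / 4 / 2" using \<epsilon> \<delta> by auto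
  from ex_cutoff[OF assms this(1) this]
  obtain J where J: "2 / tailc k \<le> real J * (\<epsilon> / 4)"
    "2 * real k * (exp (- tailc k * (\<epsilon> / 4)) ^ J / (1 - exp (- tailc k * (\<epsilon> / 4)))) * (\<epsilon> / 4) / (\<epsilon> / 4) < \<delta> / 4 / 2" by blast
  \<comment> \<open>The cutoff J is chosen for the stricter demand of the multigraph and then serves
    both models, so that both get the same constant.\<close>
  have "\<delta> / 4 / 2 < \<delta> / 2 / 2" using \<delta> by simp
  with J(2) have J': "2 * real k * (exp (- tailc k * (\<epsilon> / 4)) ^ J / (1 - exp (- tailc k * (\<epsilon> / 4)))) * (\<epsilon> / 4) / (\<epsilon> / 4) < \<delta> / 2 / 2"
    by (rule less_trans)
  show "\<exists>G. whpd Kn_uniform_space \<delta> (\<lambda>n \<omega>. \<exists>w. wT n Kn_ends \<omega> (Kn_edges n) k = ereal w \<and> \<bar>w - G\<bar> \<le> \<epsilon>) \<and>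
    whpd PM_space \<delta> (\<lambda>n \<omega>. \<exists>w. wT n PM_ends (PM_cost \<omega>) (PM_edges n) k = ereal w \<and> \<bar>w - G\<bar> \<le> \<epsilon>)"
    unfolding MU ME
    by (intro exI conjI) (rule U.near_Kn[OF assms \<epsilon> \<delta> refl J(1) J'] E.near_PM[OF assms \<epsilon> \<delta> refl J])+
qed

end
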